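(* Let $n\ge 3$ and let $M=[0,1]\times T^{n-1}$, where $T^{n-1}$ is the $(n-1)$-dimensional torus, and let $\Gamma_1=\{1\}\times T^{n-1}\subset\partial M$. For every $\rho\in(0,1)$ there exists a Riemannian metric $g$ on $M$ whose coefficients are smooth in $[0,1)\times T^{n-1}$ and Hölder continuous of order $\rho$ up to the end $\Gamma_1$, and there exist infinitely many smooth positive functions $c$ on $M$, each not identically equal to $1$ on $M$, such that the partial Dirichlet-to-Neumann maps on $\Gamma_1$ of the metrics $c^4g$ and $g$ are identical: $$\Lambda_{c^4 g,\Gamma_1}=\Lambda_{g,\Gamma_1}.$$
   Context: The manifold $M=[0,1]\times T^{n-1}$ is a smooth compact connected manifold whose boundary is the disjoint union $\Gamma_0\cup\Gamma_1$, where $\Gamma_0=\{0\}\times T^{n-1}$ and $\Gamma_1=\{1\}\times T^{n-1}$ are called the ends. Metrics. A Riemannian metric $g=(g_{ij})$ on $M$ is allowed to have merely measurable bounded coefficients and is required to be uniformly elliptic: in local coordinates there is a constant $\kappa>0$ with $\sum_{i,j}g^{ij}(x)\xi_i\xi_j\ge \kappa|\xi|^2$ for a.e. $x\in M$ and all $\xi\in\mathbb{R}^n$, where $(g^{ij})$ is the inverse of $(g_{ij})$. Write $\langle du,dw\rangle_g=g^{ij}\partial_i u\,\partial_j w$ and let $dVol_g$ be the Riemannian volume element. Dirichlet problem. Let $\Delta_g=\frac{1}{\sqrt{|g|}}\partial_i\left(\sqrt{|g|}\,g^{ij}\partial_j\right)$, with $|g|=\det(g_{ij})$. For $\psi\in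 H^{1/2}(\partial M)$ there is a unique weak solution $u\in H^1(M)$ of $-\Delta_g u=0$ on $M$, $u=\psi$ on $\partial M$; that is, $\int_M\langle du,dw\rangle_g\,dVol_g=0$ for all $w\in H^1_0(M)$ and the trace of $u$ on $\partial M$ is $\psi$. Partial Dirichlet-to-Neumann map. For an open subset $\Gamma\subset\partial M$ let $H^{1/2}_{co}(\Gamma)=\{f\in H^{1/2}(\partial M) : \operatorname{supp} f\subset\Gamma\}$. The partial Dirichlet-to-Neumann map $\Lambda_{g,\Gamma}$ is defined by $$\langle\Lambda_{g,\Gamma}(\psi)\,|\,\phi\rangle=\int_M\langle du,dv\rangle_g\,dVol_g\quad\text{for all }\psi,\phi\in H^{1/2}_{co}(\Gamma),$$ where $u$ is the unique weak solution in $H^1(M)$ of the Dirichlet problem $-\Delta_g u=0$ on $M$, $u=\psi$ on $\partial M$, $v$ is any element of $H^1(M)$ with $v|_{\partial M}=\phi$, and $\langle\cdot|\cdot\rangle$ is the $L^2$ duality pairing between $H^{1/2}(\partial M)$ and its dual. *)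

theory Defs
  imports "HOL-Analysis.Analysis"
begin

subsection \<open>The cylinder\<close>

text \<open>
  The torus is \<open>T^(n-1) = R^(n-1) / Z^(n-1)\<close>. A point of \<open>[0,1] \<times> T^(n-1)\<close> is represented by any
  of its lifts \<open>(t, y)\<close> to \<open>R \<times> R^(n-1)\<close>, a function on the cylinder by a function of \<open>(t, y)\<close> that
  is \<open>Z^(n-1)\<close>-periodic in \<open>y\<close>, and a subset by its full preimage. With \<open>'m\<close> as index type of the
  torus variables, the global coordinates on the cylinder are indexed by \<open>'m option\<close>: \<open>None\<close> is the
  variable \<open>t\<close> and \<open>Some j\<close> is the variable \<open>y $ j\<close>. Thus \<open>n = CARD('m option)\<close>.
\<close>

type_synonym 'm pt = "real \<times> (real ^ 'm)"
type_synonym 'm covec = "real ^ ('m option)"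
type_synonym 'm metric = "'m pt \<Rightarrow> real ^ ('m option) ^ ('m option)"

definition M :: "'m::finite pt set" where
  "M = {0..1} \<times> UNIV"

definition boundary_M :: "'m::finite pt set" where
  "boundary_M = {0, 1} \<times> UNIV"

definition Gamma1 :: "'m::finite pt set" where
  "Gamma1 = {1} \<times> UNIV"

definition lattice_pts :: "(real ^ 'm::finite) set" where
  "lattice_pts = {k. \<forall>j. k $ j \<in> \<int>}"

definition periodic :: "('m::finite pt \<Rightarrow> 'b) \<Rightarrow> bool" where
  "periodic f \<longleftrightarrow> (\<forall>t\<in>{0..1}. \<forall>y. \<forall>k\<in>lattice_pts. f (t, y + k) = f (t, y))"

text \<open>The distance on the cylinder, i.e. between the classes of two points.\<close>

definition mdist :: "'m::finite pt \<Rightarrow> 'm pt \<Rightarrow> real" where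
  "mdist x z = (INF k\<in>lattice_pts. dist x (fst z, snd z + k))"

definition torus_cell :: "(real ^ 'm::finite) set" where
  "torus_cell = cbox 0 (\<chi> j. 1)"

definition cell :: "'m::finite pt set" where
  "cell = {0..1} \<times> torus_cell"

definition coord :: "'m::finite option \<Rightarrow> 'm pt" where
  "coord i = (case i of None \<Rightarrow> (1, 0) | Some j \<Rightarrow> (0, axis j 1))"

definition gradient :: "('m::finite pt \<Rightarrow> real) \<Rightarrow> 'm pt \<Rightarrow> 'm covec" where
  "gradient f x = (\<chi> i. frechet_derivative f (at x) (coord i))"

subsection \<open>Smooth and Hoelder continuous functions\<close>

primrec Ck_on :: "nat \<Rightarrow> 'a::euclidean_space set \<Rightarrow> ('a \<Rightarrow> real) \<Rightarrow> bool" where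
  "Ck_on 0 = (\<lambda>U f. continuous_on U f)"
| "Ck_on (Suc k) = (\<lambda>U f. (\<forall>x\<in>U. f differentiable (at x)) \<and>
      (\<forall>v. Ck_on k U (\<lambda>x. frechet_derivative f (at x) v)))"

text \<open>
  Smoothness on a set that need not be open (such as \<open>M\<close> or \<open>[0,1) \<times> T^(n-1)\<close>): near every point of
  the set the function extends to a smooth function on an open neighbourhood.
\<close>

definition smooth_on :: "'a::euclidean_space set \<Rightarrow> ('a \<Rightarrow> real) \<Rightarrow> bool" where
  "smooth_on S f \<longleftrightarrow> (\<forall>x\<in>S. \<exists>U F. open U \<and> x \<in> U \<and> (\<forall>k. Ck_on k U F) \<and>
      (\<forall>y\<in>U \<inter> S. F y = f y))"

definition holder_on_M :: "real \<Rightarrow> ('m::finite pt \<Rightarrow> real) \<Rightarrow> bool" where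
  "holder_on_M \<rho> f \<longleftrightarrow> (\<exists>C. \<forall>x\<in>M. \<forall>z\<in>M. \<bar>f x - f z\<bar> \<le> C * mdist x z powr \<rho>)"

subsection \<open>Riemannian metrics\<close>

text \<open>
  \<open>g x $ i $ j\<close> is the coefficient \<open>g_ij(x)\<close> in the global coordinates; these are defined up to
  lattice translations, so the coefficients are periodic and the ellipticity constant is global.
\<close>

definition riemannian_metric :: "'m::finite metric \<Rightarrow> bool" where
  "riemannian_metric g \<longleftrightarrow>
     periodic g \<and>
     (\<forall>x\<in>M. transpose (g x) = g x) \<and>
     (\<forall>x\<in>M. \<forall>\<xi>. \<xi> \<noteq> 0 \<longrightarrow> 0 < \<xi> \<bullet> (g x *v \<xi>)) \<and>
     (\<forall>i j. (\<lambda>x. g x $ i $ j) \<in> borel_measurable (lebesgue_on M)) \<and>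
     (\<exists>C. \<forall>x\<in>M. \<forall>i j. \<bar>g x $ i $ j\<bar> \<le> C) \<and>
     (\<exists>\<kappa>>0. AE x in lebesgue_on M. \<forall>\<xi>. \<kappa> * (norm \<xi>)\<^sup>2 \<le> \<xi> \<bullet> (matrix_inv (g x) *v \<xi>))"

text \<open>The integral over \<open>M\<close> of \<open>\<langle>du, dw\<rangle>_g dVol_g\<close>.\<close>

definition energy ::
  "'m::finite metric \<Rightarrow> ('m pt \<Rightarrow> 'm covec) \<Rightarrow> ('m pt \<Rightarrow> 'm covec) \<Rightarrow> real" where
  "energy g du dw =
     (LINT x|lebesgue_on cell. (du x \<bullet> (matrix_inv (g x) *v dw x)) * sqrt (det (g x)))"

subsection \<open>Sobolev spaces on the cylinder\<close>

text \<open>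
  On the compact \<open>M\<close>, the Sobolev spaces do not depend on the (bounded, elliptic) metric; the flat
  one is used as reference. Elements are represented by functions, not by classes modulo null sets.
\<close>

definition L2 :: "('m::finite pt \<Rightarrow> 'b::euclidean_space) \<Rightarrow> bool" where
  "L2 f \<longleftrightarrow> periodic f \<and> f \<in> borel_measurable (lebesgue_on cell) \<and>
     integrable (lebesgue_on cell) (\<lambda>x. (norm (f x))\<^sup>2)"

text \<open>Smooth functions with compact support in the interior of \<open>M\<close>.\<close>

definition test_fun :: "('m::finite pt \<Rightarrow> real) \<Rightarrow> bool" where
  "test_fun \<phi> \<longleftrightarrow> periodic \<phi> \<and> smooth_on UNIV \<phi> \<and>
     (\<exists>\<epsilon>>0. \<forall>t y. \<phi> (t, y) \<noteq> 0 \<longrightarrow> \<epsilon> \<le> t \<and> t \<le> 1 - \<epsilon>)"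

text \<open>\<open>H1 u du\<close>: the function \<open>u\<close> is in \<open>H^1(M)\<close> and \<open>du\<close> is (a representative of) its weak
  differential.\<close>

definition H1 :: "('m::finite pt \<Rightarrow> real) \<Rightarrow> ('m pt \<Rightarrow> 'm covec) \<Rightarrow> bool" where
  "H1 u du \<longleftrightarrow> L2 u \<and> L2 du \<and>
     (\<forall>\<phi>. test_fun \<phi> \<longrightarrow> (\<forall>i.
        (LINT x|lebesgue_on cell. u x * gradient \<phi> x $ i) =
        - (LINT x|lebesgue_on cell. du x $ i * \<phi> x)))"

text \<open>Convergence in \<open>H^1(M)\<close> of a sequence of smooth functions.\<close>

definition H1_converges ::
  "(nat \<Rightarrow> 'm::finite pt \<Rightarrow> real) \<Rightarrow> ('m pt \<Rightarrow> real) \<Rightarrow> ('m pt \<Rightarrow> 'm covec) \<Rightarrow> bool" where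
  "H1_converges X u du \<longleftrightarrow>
     (\<lambda>k. LINT x|lebesgue_on cell. (X k x - u x)\<^sup>2 + (norm (gradient (X k) x - du x))\<^sup>2)
       \<longlonglongrightarrow> 0"

text \<open>\<open>H^1_0(M)\<close> is the closure of the test functions in \<open>H^1(M)\<close>.\<close>

definition H10 :: "('m::finite pt \<Rightarrow> real) \<Rightarrow> ('m pt \<Rightarrow> 'm covec) \<Rightarrow> bool" where
  "H10 w dw \<longleftrightarrow> H1 w dw \<and> (\<exists>X. (\<forall>k. test_fun (X k)) \<and> H1_converges X w dw)"

subsection \<open>The boundary\<close>

text \<open>Surface measure on the two faces, restricted to the part with torus variable in \<open>S\<close>.\<close>

definition face_measure :: "(real ^ 'm::finite) set \<Rightarrow> 'm pt measure" where
  "face_measure S = count_space {0, 1} \<Otimes>\<^sub>M lebesgue_on S"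

definition L2_boundary :: "('m::finite pt \<Rightarrow> real) \<Rightarrow> bool" where
  "L2_boundary \<psi> \<longleftrightarrow> periodic \<psi> \<and> \<psi> \<in> borel_measurable (face_measure torus_cell) \<and>
     integrable (face_measure torus_cell) (\<lambda>z. (\<psi> z)\<^sup>2)"

text \<open>\<open>H^(1/2)\<close> of the boundary, by finiteness of the Gagliardo (Slobodeckij) seminorm. The boundary
  has dimension \<open>n - 1\<close>, so the exponent of the distance is \<open>(n - 1) + 2 * (1/2) = n\<close>.\<close>

definition H_half :: "('m::finite pt \<Rightarrow> real) set" where
  "H_half = {\<psi>. L2_boundary \<psi> \<and>
     (\<integral>\<^sup>+ x. (\<integral>\<^sup>+ z. ennreal ((\<psi> x - \<psi> z)\<^sup>2 / mdist x z ^ CARD('m option))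
        \<partial>face_measure torus_cell) \<partial>face_measure torus_cell) < \<infinity>}"

text \<open>Support of the almost-everywhere class of a boundary function.\<close>

definition boundary_supp :: "('m::finite pt \<Rightarrow> real) \<Rightarrow> 'm pt set" where
  "boundary_supp \<psi> = {x \<in> boundary_M. \<forall>U. open U \<and> x \<in> U \<longrightarrow>
     \<not> (AE z in face_measure UNIV. z \<in> U \<longrightarrow> \<psi> z = 0)}"

definition H_half_co :: "'m::finite pt set \<Rightarrow> ('m pt \<Rightarrow> real) set" where
  "H_half_co \<Gamma> = {\<psi> \<in> H_half. boundary_supp \<psi> \<subseteq> \<Gamma>}"

text \<open>The trace is the extension by continuity, from smooth functions on \<open>M\<close> to \<open>H^1(M)\<close>, of the
  restriction to the boundary.\<close>

definition has_trace ::
  "('m::finite pt \<Rightarrow> real) \<Rightarrow> ('m pt \<Rightarrow> 'm covec) \<Rightarrow> ('m pt \<Rightarrow> real) \<Rightarrow> bool" where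
  "has_trace u du \<psi> \<longleftrightarrow> H1 u du \<and> L2_boundary \<psi> \<and>
     (\<exists>X. (\<forall>k. periodic (X k) \<and> smooth_on M (X k)) \<and> H1_converges X u du \<and>
        (\<lambda>k. LINT z|face_measure torus_cell. (X k z - \<psi> z)\<^sup>2) \<longlonglongrightarrow> 0)"

subsection \<open>The Dirichlet problem and the partial Dirichlet-to-Neumann map\<close>

text \<open>\<open>u\<close>, with weak differential \<open>du\<close>, is a weak solution of \<open>- \<Delta>_g u = 0\<close> with \<open>u = \<psi>\<close> on the
  boundary.\<close>

definition weak_solution :: "'m::finite metric \<Rightarrow> ('m pt \<Rightarrow> real) \<Rightarrow>
    ('m pt \<Rightarrow> real) \<Rightarrow> ('m pt \<Rightarrow> 'm covec) \<Rightarrow> bool" where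
  "weak_solution g \<psi> u du \<longleftrightarrow> H1 u du \<and> has_trace u du \<psi> \<and>
     (\<forall>w dw. H10 w dw \<longrightarrow> energy g du dw = 0)"

text \<open>\<open>DN_map g \<Gamma> \<psi> \<phi>\<close> is the pairing \<open>\<langle>\<Lambda>_{g,\<Gamma>} \<psi> | \<phi>\<rangle>\<close>: the element \<open>\<Lambda>_{g,\<Gamma>} \<psi>\<close> of the dual is
  identified with the functional it induces on \<open>H^(1/2)_co(\<Gamma>)\<close>. When \<open>g\<close> and its inverse are bounded
  (as for continuous \<open>g\<close>), the described number exists and is unique, by unique solvability of the
  Dirichlet problem and surjectivity of the trace.\<close>

definition DN_map :: "'m::finite metric \<Rightarrow> 'm pt set \<Rightarrow>
    ('m pt \<Rightarrow> real) \<Rightarrow> ('m pt \<Rightarrow> real) \<Rightarrow> real" where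
  "DN_map g \<Gamma> = (\<lambda>\<psi>\<in>H_half_co \<Gamma>. \<lambda>\<phi>\<in>H_half_co \<Gamma>.
     THE a. \<exists>u du v dv. weak_solution g \<psi> u du \<and> has_trace v dv \<phi> \<and> a = energy g du dv)"

definition conformal :: "('m::finite pt \<Rightarrow> real) \<Rightarrow> 'm metric \<Rightarrow> 'm metric" where
  "conformal c g = (\<lambda>x. (c x) ^ 4 *\<^sub>R g x)"

end

theory Submission
  imports Defs
begin

text \<open>
  Let \<open>A = sqrt |g| g^-1\<close> be the conductivity of \<open>g\<close>, and let \<open>w > 0\<close> satisfy \<open>div V = 0\<close> for
  \<open>V = A \<nabla>w\<close>, with \<open>w = 1\<close> and \<open>V = 0\<close> on \<open>\<Gamma>\<^sub>1\<close>. For \<open>c^(n-2) = w\<close> the conductivity of \<open>c^4 g\<close> is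
  \<open>w^2 A\<close>, and \<open>u \<mapsto> u / w\<close> maps solutions for \<open>g\<close> to solutions for \<open>c^4 g\<close> with the same data on
  \<open>\<Gamma>\<^sub>1\<close>: the two energies of a pair \<open>u, v\<close> differ by the integral of \<open>V \<bullet> \<nabla>(u v / w)\<close>, which vanishes
  because \<open>V\<close> is divergence free, \<open>V = 0\<close> on \<open>\<Gamma>\<^sub>1\<close>, and the data are zero on \<open>\<Gamma>\<^sub>0\<close>. So the maps agree.

  A nonconstant such \<open>w\<close> violates unique continuation at \<open>\<Gamma>\<^sub>1\<close>. This is possible for coefficients
  that are only Hoelder continuous, by the construction of Plis and Miller: \<open>w = 1 + \<epsilon> u\<close>, where \<open>u\<close>
  is a sum of modes \<open>U_n(t) cos(\<lambda>_n y_i)\<close> with \<open>\<lambda>_n \<rightarrow> \<infinity>\<close>, with \<open>i\<close> alternating between two torus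
  variables, and with all modes shrinking rapidly as \<open>t \<rightarrow> 1\<close>. On the \<open>n\<close>-th of a sequence of strips
  that accumulate at \<open>t = 1\<close> one mode is replaced by the next, and the resulting error in the equation
  is absorbed in the entries of \<open>A\<close>. Small \<open>\<epsilon>\<close> give infinitely many \<open>c\<close>.
\<close>

subsection \<open>Smooth functions\<close>

text \<open>Higher frequencies decay faster, so a new mode can overtake its predecessor only if the
  coefficients slow its decay for a while. In each strip the entry of A that belongs to the new mode
  therefore dips by a relative amount of order c_n, and c_n has to exceed the relative step of the
  frequencies. Polynomially growing \<lambda>_n give c_n of order 1/n. A variation c_n over a width
  L_n is Hoelder of order \<rho> if c_n is at most a multiple of L_n^\<rho>, and widths of order
  n^(-1/\<rho>) are summable because \<rho> < 1. The dip is the only term that limits the regularity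
  of A: switching takes place where one of the two modes is smaller than the other by a factor
  exp(-n), and the correction entries inherit this factor in all derivatives, up to powers of n.
  Having two torus variables puts the modes that meet in a strip into different directions, so that
  an off-diagonal entry can couple them. The gauge argument has its own obstacle: it concerns
  products of weak solutions, known only as limits of smooth functions whose gradients make sense
  only in the interior of the cylinder.\<close>

lemma fd_eq: "(f has_derivative f') (at x) \<Longrightarrow> frechet_derivative f (at x) = f'"
  using frechet_derivative_at by metis

text \<open>The set of derivatives at \<open>x\<close> depends only on the germ of the function, and
  \<open>frechet_derivative\<close> is a choice from that set, so the two choices coincide even
  where the set is empty.\<close>

lemma fd_cong_open:
  assumes "open U" "x \<in> U" "\<And>y. y \<in> U \<Longrightarrow> f y = g y"
  shows "frechet_derivative f (at x) = frechet_derivative g (at x)"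
proof -
  have "(f has_derivative D) (at x) \<longleftrightarrow> (g has_derivative D) (at x)" for D
    using has_derivative_transform_within_open[OF _ assms(1,2), of f D UNIV g]
      has_derivative_transform_within_open[OF _ assms(1,2), of g D UNIV f] assms(3) by force
  thus ?thesis unfolding frechet_derivative_def by simp
qed

lemma differentiable_cong_open:
  assumes "open U" "x \<in> U" "\<And>y. y \<in> U \<Longrightarrow> f y = g y" "f differentiable (at x)"
  shows "g differentiable (at x)"
  using has_derivative_transform_within_open[OF _ assms(1,2), of f _ UNIV g] assms(3,4)
  unfolding differentiable_def by force

lemma fd_add:
  assumes "f differentiable (at x)" "g differentiable (at x)"
  shows "frechet_derivative (\<lambda>x. f x + g x) (at x) v =
    frechet_derivative f (at x) v + frechet_derivative g (at x) v"
  using fd_eq[OF has_derivative_add[OF assms[THEN frechet_derivative_works[THEN iffD1]]]] by simp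

lemma fd_mult:
  fixes f g :: "'a::real_normed_vector \<Rightarrow> real"
  assumes "f differentiable (at x)" "g differentiable (at x)"
  shows "frechet_derivative (\<lambda>x. f x * g x) (at x) v =
    f x * frechet_derivative g (at x) v + frechet_derivative f (at x) v * g x"
  using fd_eq[OF has_derivative_mult[OF assms[THEN frechet_derivative_works[THEN iffD1]]]] by simp

lemma fd_comp_real:
  fixes f :: "'a::real_normed_vector \<Rightarrow> real"
  assumes "(\<phi> has_real_derivative d) (at (f x))" "f differentiable (at x)"
  shows "((\<lambda>x. \<phi> (f x)) has_derivative (\<lambda>v. frechet_derivative f (at x) v * d)) (at x)"
proof -
  have "(\<phi> \<circ> f has_derivative (*) d \<circ> frechet_derivative f (at x)) (at x)"
    by (intro diff_chain_at) (use assms in \<open>auto simp: frechet_derivative_works has_field_derivative_def\<close>)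
  moreover have "(*) d \<circ> frechet_derivative f (at x) = (\<lambda>v. frechet_derivative f (at x) v * d)"
    by (auto simp: mult.commute)
  ultimately show ?thesis by (simp add: o_def)
qed

section \<open>Functions with k continuous derivatives\<close>

lemma Ck_on_Suc_D: "Ck_on (Suc k) U f \<Longrightarrow> Ck_on k U f"
proof (induction k arbitrary: f)
  case 0
  then show ?case
    by (auto intro!: differentiable_imp_continuous_on simp: differentiable_on_def differentiable_at_withinI)
next
  case (Suc k)
  from Suc.prems have "\<forall>v. Ck_on (Suc k) U (\<lambda>x. frechet_derivative f (at x) v)"
    by (subst (asm) Ck_on.simps) blast
  hence "\<forall>v. Ck_on k U (\<lambda>x. frechet_derivative f (at x) v)" using Suc.IH by blast
  thus ?case using Suc.prems by simp
qed

lemma Ck_on_subset: "Ck_on k U f \<Longrightarrow> V \<subseteq> U \<Longrightarrow> Ck_on k V f"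
  by (induction k arbitrary: f) (auto intro: continuous_on_subset)

lemma Ck_on_cong:
  assumes "open U" "\<And>x. x \<in> U \<Longrightarrow> f x = g x" "Ck_on k U f"
  shows "Ck_on k U g"
  using assms(2,3)
proof (induction k arbitrary: f g)
  case 0
  then show ?case using continuous_on_cong[of U U f g] by auto
next
  case (Suc k)
  have d: "\<forall>x\<in>U. g differentiable (at x)"
    using differentiable_cong_open[OF assms(1) _ Suc.prems(1)] Suc.prems(2) by auto
  have "Ck_on k U (\<lambda>x. frechet_derivative g (at x) v)" for v
  proof (rule Suc.IH)
    show "Ck_on k U (\<lambda>x. frechet_derivative f (at x) v)" using Suc.prems by simp
    show "\<And>x. x \<in> U \<Longrightarrow> frechet_derivative f (at x) v = frechet_derivative g (at x) v"
      using fd_cong_open[OF assms(1) _ Suc.prems(1)] by simp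
  qed
  thus ?case using d by simp
qed

lemma Ck_on_const [simp]: "Ck_on k U (\<lambda>x. c)"
  by (induction k arbitrary: c) simp_all

lemma Ck_on_add:
  assumes "open U" "Ck_on k U f" "Ck_on k U g"
  shows "Ck_on k U (\<lambda>x. f x + g x)"
  using assms(2,3)
proof (induction k arbitrary: f g)
  case 0 thus ?case by (auto intro: continuous_intros)
next
  case (Suc k)
  have "Ck_on k U (\<lambda>x. frechet_derivative (\<lambda>x. f x + g x) (at x) v)" for v
    by (rule Ck_on_cong[OF assms(1) _ Suc.IH[of "\<lambda>x. frechet_derivative f (at x) v" "\<lambda>x. frechet_derivative g (at x) v"]])
       (use Suc.prems fd_add in force)+
  thus ?case using Suc.prems by simp
qed

lemma Ck_on_mult:
  assumes "open U" "Ck_on k U f" "Ck_on k U g"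
  shows "Ck_on k U (\<lambda>x. f x * g x)"
  using assms(2,3)
proof (induction k arbitrary: f g)
  case 0 thus ?case by (auto intro: continuous_intros)
next
  case (Suc k)
  have "Ck_on k U (\<lambda>x. frechet_derivative (\<lambda>x. f x * g x) (at x) v)" for v
  proof (rule Ck_on_cong[OF assms(1)])
    show "Ck_on k U (\<lambda>x. f x * frechet_derivative g (at x) v + frechet_derivative f (at x) v * g x)"
      by (rule Ck_on_add[OF assms(1)]; rule Suc.IH) (use Suc.prems in \<open>simp_all only: Ck_on.simps Ck_on_Suc_D[OF Suc.prems(1)] Ck_on_Suc_D[OF Suc.prems(2)]\<close>)
    fix x assume "x \<in> U"
    thus "f x * frechet_derivative g (at x) v + frechet_derivative f (at x) v * g x =
        frechet_derivative (\<lambda>x. f x * g x) (at x) v"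
      using Suc.prems by (subst fd_mult) simp_all
  qed
  thus ?case using Suc.prems by simp
qed

lemma Ck_on_powr:
  assumes "open U" "\<And>x. x \<in> U \<Longrightarrow> 0 < f x" "Ck_on k U f"
  shows "Ck_on k U (\<lambda>x. f x powr r)"
  using assms(3)
\<comment> \<open>The exponent falls by one with every derivative, so it has to vary in the
  induction.\<close>
proof (induction k arbitrary: r)
  case 0
  have "continuous_on U (\<lambda>x. f x powr r)"
    by (rule continuous_on_powr) (use 0 assms(2) in \<open>auto simp: less_imp_neq[symmetric]\<close>)
  thus ?case by simp
next
  case (Suc k)
  have d: "((\<lambda>x. f x powr r) has_derivative
      (\<lambda>v. frechet_derivative f (at x) v * (r * f x powr (r - 1)))) (at x)" if "x \<in> U" for x
    by (rule fd_comp_real[OF has_real_derivative_powr]) (use that assms(2) Suc.prems in simp_all)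
  have "Ck_on k U (\<lambda>x. frechet_derivative (\<lambda>x. f x powr r) (at x) v)" for v
  proof (rule Ck_on_cong[OF assms(1)])
    show "Ck_on k U (\<lambda>x. frechet_derivative f (at x) v * (r * f x powr (r - 1)))"
    proof (rule Ck_on_mult[OF assms(1)])
      show "Ck_on k U (\<lambda>x. frechet_derivative f (at x) v)" using Suc.prems by simp
      show "Ck_on k U (\<lambda>x. r * f x powr (r - 1))"
        by (rule Ck_on_mult[OF assms(1) Ck_on_const Suc.IH[OF Ck_on_Suc_D[OF Suc.prems]]])
    qed
  qed (use fd_eq[OF d] in simp)
  thus ?case using d by (auto simp: differentiable_def)
qed

section \<open>Smooth functions on sets that need not be open\<close>

lemma smooth_on_cong_subset:
  assumes "smooth_on S f" "T \<subseteq> S" "\<And>x. x \<in> T \<Longrightarrow> f x = g x"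
  shows "smooth_on T g"
  unfolding smooth_on_def
proof
  fix x assume "x \<in> T"
  hence "x \<in> S" using assms(2) by blast
  then obtain U F where h: "open U" "x \<in> U" "\<forall>k. Ck_on k U F" "\<forall>y\<in>U \<inter> S. F y = f y"
    using assms(1) unfolding smooth_on_def by blast
  have "\<forall>y\<in>U \<inter> T. F y = g y" using h(4) assms(2,3) by auto
  thus "\<exists>U F. open U \<and> x \<in> U \<and> (\<forall>k. Ck_on k U F) \<and> (\<forall>y\<in>U \<inter> T. F y = g y)"
    using h(1-3) by (intro exI conjI)
qed

lemmas smooth_on_subset = smooth_on_cong_subset[OF _ _ refl]

lemma smooth_onI: "open U \<Longrightarrow> S \<subseteq> U \<Longrightarrow> (\<And>k. Ck_on k U f) \<Longrightarrow> smooth_on S f"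
  unfolding smooth_on_def by blast

text \<open>\<open>Ck_on\<close> is a local property, and on the whole space a local extension is
  the function itself, so the two notions of smoothness agree.\<close>

lemma smooth_on_UNIV_iff: "smooth_on UNIV f \<longleftrightarrow> (\<forall>k. Ck_on k UNIV f)"
proof
  assume s: "smooth_on UNIV f"
  have loc: "(\<And>x. x\<in>W \<Longrightarrow> \<exists>U. open U \<and> x \<in> U \<and> Ck_on k U h) \<Longrightarrow> Ck_on k W h" for k h and W :: "'a set"
  proof (induction k arbitrary: h)
    case 0
    show ?case unfolding Ck_on.simps continuous_on_eq_continuous_within
    proof
      fix x assume "x \<in> W"
      then obtain U where "open U" "x \<in> U" "continuous_on U h" using 0 by (auto)
      thus "continuous (at x within W) h"
        using continuous_at_imp_continuous_at_within continuous_on_eq_continuous_at by blast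
    qed
  next
    case (Suc k)
    have "\<forall>x\<in>W. h differentiable at x" using Suc.prems by fastforce
    moreover have "Ck_on k W (\<lambda>x. frechet_derivative h (at x) v)" for v
      by (rule Suc.IH) (use Suc.prems in fastforce)
    ultimately show ?case by simp
  qed
  show "\<forall>k. Ck_on k UNIV f"
  proof
    fix k show "Ck_on k UNIV f"
    proof (rule loc)
      fix x :: 'a
      obtain U F where "open U" "x \<in> U" "\<forall>k. Ck_on k U F" "\<forall>y\<in>U \<inter> UNIV. F y = f y"
        using s unfolding smooth_on_def by blast
      thus "\<exists>U. open U \<and> x \<in> U \<and> Ck_on k U f" using Ck_on_cong[of U F f k] by auto
    qed
  qed
qed (auto intro: smooth_onI[OF open_UNIV])

lemma smooth_on_binop:
  fixes f g :: "'a::euclidean_space \<Rightarrow> real"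
  assumes "\<And>(U::'a set) F G k. open U \<Longrightarrow> (\<And>k. Ck_on k U F) \<Longrightarrow> (\<And>k. Ck_on k U G) \<Longrightarrow> Ck_on k U (\<lambda>x. op2 (F x) (G x))"
    and "smooth_on S f" "smooth_on S g"
  shows "smooth_on S (\<lambda>x. op2 (f x) (g x))"
  unfolding smooth_on_def
proof
  fix x assume "x \<in> S"
  obtain U F where h: "open U" "x \<in> U" "\<forall>k. Ck_on k U F" "\<forall>y\<in>U \<inter> S. F y = f y"
    using assms(2) \<open>x \<in> S\<close> unfolding smooth_on_def by blast
  obtain V G where h': "open V" "x \<in> V" "\<forall>k. Ck_on k V G" "\<forall>y\<in>V \<inter> S. G y = g y"
    using assms(3) \<open>x \<in> S\<close> unfolding smooth_on_def by blast
  have o: "open (U \<inter> V)" using h h' by auto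
  have "Ck_on k (U \<inter> V) (\<lambda>x. op2 (F x) (G x))" for k
    by (rule assms(1)[OF o]) (use h(3) h'(3) Ck_on_subset in blast)+
  hence c: "\<forall>k. Ck_on k (U \<inter> V) (\<lambda>x. op2 (F x) (G x))" by blast
  have m: "x \<in> U \<inter> V" "\<forall>y\<in>(U \<inter> V) \<inter> S. op2 (F y) (G y) = op2 (f y) (g y)" using h(2,4) h'(2,4) by auto
  show "\<exists>U Fa. open U \<and> x \<in> U \<and> (\<forall>k. Ck_on k U Fa) \<and> (\<forall>y\<in>U \<inter> S. Fa y = op2 (f y) (g y))"
    by (rule exI[of _ "U \<inter> V"], rule exI[of _ "\<lambda>x. op2 (F x) (G x)"], rule conjI[OF o conjI[OF m(1) conjI[OF c m(2)]]])
qed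

lemma smooth_on_const [simp]: "smooth_on S (\<lambda>x. c)"
  by (rule smooth_onI[of UNIV]) auto

lemma smooth_on_add: "smooth_on S f \<Longrightarrow> smooth_on S g \<Longrightarrow> smooth_on S (\<lambda>x. f x + g x)"
  by (rule smooth_on_binop[of "(+)"], rule Ck_on_add)

lemma smooth_on_mult: "smooth_on S f \<Longrightarrow> smooth_on S g \<Longrightarrow> smooth_on S (\<lambda>x. f x * g x)"
  by (rule smooth_on_binop[of "(*)"], rule Ck_on_mult)

lemma smooth_on_sum: "(\<And>i. i \<in> I \<Longrightarrow> smooth_on S (f i)) \<Longrightarrow> smooth_on S (\<lambda>x. \<Sum>i\<in>I. f i x)"
  by (induction I rule: infinite_finite_induct) (simp_all add: smooth_on_add)

lemma smooth_on_powr: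
  assumes "smooth_on S f" "\<And>x. x \<in> S \<Longrightarrow> 0 < f x"
  shows "smooth_on S (\<lambda>x. f x powr r)"
  unfolding smooth_on_def
proof
  fix x assume x: "x \<in> S"
  then obtain U F where h: "open U" "x \<in> U" "\<forall>k. Ck_on k U F" "\<forall>y\<in>U \<inter> S. F y = f y"
    using assms(1) unfolding smooth_on_def by blast
  \<comment> \<open>The extension \<open>F\<close> is known to be positive only on \<open>S\<close>;
    the neighbourhood is cut down to the open set where it is positive.\<close>
  have "continuous_on U F" using h(3)[rule_format, of 0] by simp
  from continuous_open_preimage[OF this h(1) open_greaterThan[of 0]]
  have o: "open (U \<inter> F -` {0<..})" .
  show "\<exists>U F. open U \<and> x \<in> U \<and> (\<forall>k. Ck_on k U F) \<and> (\<forall>y\<in>U \<inter> S. F y = f y powr r)"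
  proof (intro exI[of _ "U \<inter> F -` {0<..}"] exI[of _ "\<lambda>x. F x powr r"] conjI allI)
    show "x \<in> U \<inter> F -` {0<..}" using h(2,4) x assms(2) by auto
    show "Ck_on k (U \<inter> F -` {0<..}) (\<lambda>x. F x powr r)" for k
      by (rule Ck_on_powr[OF o]) (simp_all add: Ck_on_subset[OF h(3)[rule_format]])
    show "\<forall>y\<in>U \<inter> F -` {0<..} \<inter> S. F y powr r = f y powr r" using h(4) by auto
  qed (rule o)
qed

lemma smooth_on_imp_continuous_on: "smooth_on S f \<Longrightarrow> continuous_on S f"
  unfolding continuous_on_eq_continuous_within
proof
  fix x assume "smooth_on S f" "x \<in> S"
  then obtain U F where h: "open U" "x \<in> U" "\<forall>k. Ck_on k U F" "\<forall>y\<in>U \<inter> S. F y = f y"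
    unfolding smooth_on_def by blast
  have "continuous_on (U \<inter> S) F" using h(3)[rule_format, of 0] by (auto intro: continuous_on_subset)
  hence "continuous_on (U \<inter> S) f" using continuous_on_cong[of "U \<inter> S" "U \<inter> S" F f] h(4) by auto
  hence "continuous (at x within U \<inter> S) f"
    using h(2) \<open>x \<in> S\<close> by (simp add: continuous_on_eq_continuous_within)
  moreover have "at x within U \<inter> S = at x within S" using at_within_nhd[OF h(2,1), of "U \<inter> S" S] by auto
  ultimately show "continuous (at x within S) f" by simp
qed

lemma smooth_on_UNIV_D:
  assumes "smooth_on UNIV f"
  shows "f differentiable (at x)" "smooth_on UNIV (\<lambda>x. frechet_derivative f (at x) v)"
    "continuous_on T f" "continuous_on T (\<lambda>x. frechet_derivative f (at x) v)"
proof -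
  have a: "Ck_on (Suc k) UNIV f" for k using assms unfolding smooth_on_UNIV_iff by (rule spec)
  show "f differentiable (at x)" using a[of 0] by simp
  have "Ck_on k UNIV (\<lambda>x. frechet_derivative f (at x) v)" for k
    using a[of k] unfolding Ck_on.simps by (rule conjunct2[THEN spec])
  thus s: "smooth_on UNIV (\<lambda>x. frechet_derivative f (at x) v)" unfolding smooth_on_UNIV_iff by (rule allI)
  show "continuous_on T f" by (rule continuous_on_subset[OF smooth_on_imp_continuous_on[OF assms] subset_UNIV])
  show "continuous_on T (\<lambda>x. frechet_derivative f (at x) v)"
    by (rule continuous_on_subset[OF smooth_on_imp_continuous_on[OF s] subset_UNIV])
qed

subsection \<open>Tempered sequences of functions\<close>

text \<open>The point of this notion: for exponentially decaying weights \<open>W\<close>, the series over \<open>k\<close> of a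
  tempered sequence is smooth.\<close>

definition poly_bounded :: "(nat \<Rightarrow> 'a set) \<Rightarrow> (nat \<Rightarrow> real) \<Rightarrow> (nat \<Rightarrow> 'a \<Rightarrow> real) \<Rightarrow> bool" where
  "poly_bounded S W F \<longleftrightarrow> (\<exists>C\<ge>0. \<exists>N. \<forall>k. \<forall>x\<in>S k. \<bar>F k x\<bar> \<le> C * (real k + 1) ^ N * W k)"

text \<open>All derivatives share the weight \<open>W\<close>, while the polynomial factor may grow
  with their order: each derivative of a mode costs a power of its frequency. Bounds are asked for
  on \<open>S k\<close> only, since an exponential mode is small only near its own strip, but
  differentiability everywhere, so that cutoffs can be applied later.\<close>

primrec bdC :: "nat \<Rightarrow> (nat \<Rightarrow> 'a::real_normed_vector set) \<Rightarrow> (nat \<Rightarrow> real) \<Rightarrow> (nat \<Rightarrow> 'a \<Rightarrow> real) \<Rightarrow> bool" where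
  "bdC 0 = poly_bounded"
| "bdC (Suc n) = (\<lambda>S W F. poly_bounded S W F \<and> (\<forall>k x. F k differentiable (at x)) \<and>
     (\<forall>v. bdC n S W (\<lambda>k x. frechet_derivative (F k) (at x) v)))"

definition tempered :: "(nat \<Rightarrow> 'a::real_normed_vector set) \<Rightarrow> (nat \<Rightarrow> real) \<Rightarrow> (nat \<Rightarrow> 'a \<Rightarrow> real) \<Rightarrow> bool" where
  "tempered S W F \<longleftrightarrow> (\<forall>n. bdC n S W F)"

lemma poly_boundedI: "0 \<le> C \<Longrightarrow> (\<And>k x. x \<in> S k \<Longrightarrow> \<bar>F k x\<bar> \<le> C * (real k + 1) ^ N * W k) \<Longrightarrow> poly_bounded S W F"
  unfolding poly_bounded_def by blast

section \<open>Closure properties of tempered sequences\<close>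

lemma poly_bounded_add:
  assumes "\<And>k. W k \<ge> 0" "poly_bounded S W F" "poly_bounded S W G"
  shows "poly_bounded S W (\<lambda>k x. F k x + G k x)"
proof -
  obtain C N where 1: "0 \<le> C" "\<And>k x. x \<in> S k \<Longrightarrow> \<bar>F k x\<bar> \<le> C * (real k + 1) ^ N * W k"
    using assms(2) unfolding poly_bounded_def by auto
  obtain C' N' where 2: "0 \<le> C'" "\<And>k x. x \<in> S k \<Longrightarrow> \<bar>G k x\<bar> \<le> C' * (real k + 1) ^ N' * W k"
    using assms(3) unfolding poly_bounded_def by auto
  show ?thesis
  proof (rule poly_boundedI[of "C + C'" _ _ "N + N'"])
    fix k x assume x: "x \<in> S k"
    have p: "(real k + 1) ^ N \<le> (real k + 1) ^ (N + N')" "(real k + 1) ^ N' \<le> (real k + 1) ^ (N + N')"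
      by (auto intro: power_increasing)
    have "\<bar>F k x\<bar> \<le> C * (real k + 1) ^ (N + N') * W k"
      by (rule order_trans[OF 1(2)[OF x] mult_right_mono[OF mult_left_mono[OF p(1) 1(1)] assms(1)]])
    moreover have "\<bar>G k x\<bar> \<le> C' * (real k + 1) ^ (N + N') * W k"
      by (rule order_trans[OF 2(2)[OF x] mult_right_mono[OF mult_left_mono[OF p(2) 2(1)] assms(1)]])
    ultimately show "\<bar>F k x + G k x\<bar> \<le> (C + C') * (real k + 1) ^ (N + N') * W k"
      by (simp add: algebra_simps)
  qed (use 1(1) 2(1) in simp)
qed

lemma poly_bounded_mult:
  assumes "poly_bounded S W F" "poly_bounded S W' G"
  shows "poly_bounded S (\<lambda>k. W k * W' k) (\<lambda>k x. F k x * G k x)"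
proof -
  obtain C N where 1: "0 \<le> C" "\<And>k x. x \<in> S k \<Longrightarrow> \<bar>F k x\<bar> \<le> C * (real k + 1) ^ N * W k"
    using assms(1) unfolding poly_bounded_def by auto
  obtain C' N' where 2: "0 \<le> C'" "\<And>k x. x \<in> S k \<Longrightarrow> \<bar>G k x\<bar> \<le> C' * (real k + 1) ^ N' * W' k"
    using assms(2) unfolding poly_bounded_def by auto
  show ?thesis
  proof (rule poly_boundedI[of "C * C'" _ _ "N + N'"])
    fix k x assume x: "x \<in> S k"
    have "\<bar>F k x * G k x\<bar> = \<bar>F k x\<bar> * \<bar>G k x\<bar>" by (rule abs_mult)
    also have "\<dots> \<le> (C * (real k + 1) ^ N * W k) * (C' * (real k + 1) ^ N' * W' k)"
      using 1(2)[OF x] 2(2)[OF x] abs_ge_zero[of "F k x"] abs_ge_zero[of "G k x"]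
      by (intro mult_mono) linarith+
    also have "\<dots> = C * C' * (real k + 1) ^ (N + N') * (W k * W' k)" by (simp add: power_add)
    finally show "\<bar>F k x * G k x\<bar> \<le> C * C' * (real k + 1) ^ (N + N') * (W k * W' k)" .
  qed (use 1(1) 2(1) in simp)
qed

lemma bdC_Suc_D: "bdC (Suc n) S W F \<Longrightarrow> bdC n S W F"
proof (induction n arbitrary: F)
  case (Suc n)
  have "bdC n S W (\<lambda>k x. frechet_derivative (F k) (at x) v)" for v
    by (rule Suc.IH) (use Suc.prems in \<open>subst (asm) bdC.simps, blast\<close>)
  thus ?case using Suc.prems by simp
qed simp

lemma bdC_add:
  assumes "\<And>k. W k \<ge> 0" "bdC n S W F" "bdC n S W G"
  shows "bdC n S W (\<lambda>k x. F k x + G k x)"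
  using assms(2,3)
proof (induction n arbitrary: F G)
  case (Suc n)
  have d: "F k differentiable (at x)" "G k differentiable (at x)" for k x using Suc.prems by simp_all
  have "bdC n S W (\<lambda>k x. frechet_derivative (\<lambda>x. F k x + G k x) (at x) v)" for v
    unfolding fd_add[OF d] by (rule Suc.IH) (use Suc.prems in simp_all)
  thus ?case using d Suc.prems by (simp add: poly_bounded_add[OF assms(1)])
qed (simp add: poly_bounded_add[OF assms(1)])

lemma bdC_mult:
  assumes "\<And>k. W k \<ge> 0" "\<And>k. W' k \<ge> 0" "bdC n S W F" "bdC n S W' G"
  shows "bdC n S (\<lambda>k. W k * W' k) (\<lambda>k x. F k x * G k x)"
  using assms(3,4)
proof (induction n arbitrary: F G)
  case (Suc n)
  have d: "F k differentiable (at x)" "G k differentiable (at x)" for k x using Suc.prems by simp_all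
  have "bdC n S (\<lambda>k. W k * W' k) (\<lambda>k x. frechet_derivative (\<lambda>x. F k x * G k x) (at x) v)" for v
    unfolding fd_mult[OF d]
  proof (rule bdC_add)
    show "bdC n S (\<lambda>k. W k * W' k) (\<lambda>k x. F k x * frechet_derivative (G k) (at x) v)"
      by (rule Suc.IH) (use Suc.prems(2) in \<open>simp_all add: bdC_Suc_D[OF Suc.prems(1)]\<close>)
    show "bdC n S (\<lambda>k. W k * W' k) (\<lambda>k x. frechet_derivative (F k) (at x) v * G k x)"
      by (rule Suc.IH) (use Suc.prems(1) in \<open>simp_all add: bdC_Suc_D[OF Suc.prems(2)]\<close>)
  qed (simp add: assms)
  thus ?case using d Suc.prems by (simp add: poly_bounded_mult)
qed (simp add: poly_bounded_mult)

lemma temperedD: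
  assumes "tempered S W F"
  shows "F k differentiable (at x)" "tempered S W (\<lambda>k x. frechet_derivative (F k) (at x) v)"
    "poly_bounded S W F"
proof -
  have a: "bdC (Suc n) S W F" for n using assms unfolding tempered_def by (rule spec)
  show "F k differentiable (at x)" "poly_bounded S W F" using a[of 0] by simp_all
  show "tempered S W (\<lambda>k x. frechet_derivative (F k) (at x) v)"
    unfolding tempered_def using a by simp
qed

lemma tempered_add:
  assumes "\<And>k. W k \<ge> 0" "tempered S W F" "tempered S W G"
  shows "tempered S W (\<lambda>k x. F k x + G k x)"
  using assms(2,3) unfolding tempered_def by (simp add: bdC_add[OF assms(1)])

lemma tempered_mult_weights:
  assumes "\<And>k. W k \<ge> 0" "\<And>k. W' k \<ge> 0" "tempered S W F" "tempered S W' G"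
  shows "tempered S (\<lambda>k. W k * W' k) (\<lambda>k x. F k x * G k x)"
  using assms(3,4) unfolding tempered_def by (simp add: bdC_mult[OF assms(1,2)])

lemma tempered_mult:
  assumes "\<And>k. W k \<ge> 0" "tempered S (\<lambda>_. 1) F" "tempered S W G"
  shows "tempered S W (\<lambda>k x. F k x * G k x)"
  using tempered_mult_weights[of "\<lambda>_. 1" W S F G] assms by simp

lemma tempered_const:
  assumes "poly_bounded S W (\<lambda>k x. c k)" "\<And>k. W k \<ge> 0"
  shows "tempered S W (\<lambda>k x. c k)"
proof -
  have z: "bdC n S W (\<lambda>k x. 0)" for n
    by (induction n) (use assms(2) in \<open>auto intro!: poly_boundedI[of 0]\<close>)
  have "bdC n S W (\<lambda>k x. c k)" for n using z assms by (cases n) auto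
  thus ?thesis by (simp add: tempered_def)
qed

lemma tempered_cmult:
  assumes "\<And>k. W k \<ge> 0" "tempered S W G"
  shows "tempered S W (\<lambda>k x. c * G k x)"
  by (rule tempered_mult[OF assms(1) tempered_const assms(2)]) (auto intro!: poly_boundedI[of "\<bar>c\<bar>" _ _ 0])

lemma tempered_mono:
  assumes "tempered S W F" "\<And>k. S' k \<subseteq> S k" "\<And>k. W k \<le> W' k"
  shows "tempered S' W' F"
proof -
  have p: "poly_bounded S' W' G" if g: "poly_bounded S W G" for G
  proof -
    obtain C N where 1: "0 \<le> C" "\<And>k x. x \<in> S k \<Longrightarrow> \<bar>G k x\<bar> \<le> C * (real k + 1) ^ N * W k"
      using g unfolding poly_bounded_def by auto
    show ?thesis
    proof (rule poly_boundedI[OF 1(1)])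
      fix k x assume "x \<in> S' k"
      hence "\<bar>G k x\<bar> \<le> C * (real k + 1) ^ N * W k" using 1(2) assms(2) by blast
      also have "\<dots> \<le> C * (real k + 1) ^ N * W' k" using 1(1) assms(3) by (intro mult_left_mono) auto
      finally show "\<bar>G k x\<bar> \<le> C * (real k + 1) ^ N * W' k" .
    qed
  qed
  have "bdC n S W G \<Longrightarrow> bdC n S' W' G" for n G
    by (induction n arbitrary: G) (simp_all add: p)
  thus ?thesis using assms(1) by (simp add: tempered_def)
qed

text \<open>Used for the profiles of strip n + 1, which also act on mode n. As k + 2 is at most 2 (k
  + 1), a shift of the index costs only a constant factor.\<close>

lemma tempered_shift:
  assumes "tempered S W F" "\<And>k. W k \<ge> 0"
  shows "tempered (\<lambda>k. S (Suc k)) (\<lambda>k. W (Suc k)) (\<lambda>k. F (Suc k))"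
proof -
  have p: "poly_bounded (\<lambda>k. S (Suc k)) (\<lambda>k. W (Suc k)) (\<lambda>k. G (Suc k))" if g: "poly_bounded S W G" for G
  proof -
    obtain C N where 1: "0 \<le> C" "\<And>k x. x \<in> S k \<Longrightarrow> \<bar>G k x\<bar> \<le> C * (real k + 1) ^ N * W k"
      using g unfolding poly_bounded_def by auto
    show ?thesis
    proof (rule poly_boundedI[of "C * 2 ^ N" _ _ N])
      fix k x assume x: "x \<in> S (Suc k)"
      have "(real (Suc k) + 1) ^ N \<le> (2 * (real k + 1)) ^ N" by (intro power_mono) auto
      also have "\<dots> = 2 ^ N * (real k + 1) ^ N" by (rule power_mult_distrib)
      finally have "C * (real (Suc k) + 1) ^ N * W (Suc k) \<le> C * (2 ^ N * (real k + 1) ^ N) * W (Suc k)"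
        using 1(1) assms(2) by (intro mult_right_mono mult_left_mono)
      thus "\<bar>G (Suc k) x\<bar> \<le> C * 2 ^ N * (real k + 1) ^ N * W (Suc k)"
        using 1(2)[OF x] by (simp add: mult.assoc)
    qed (use 1(1) in simp)
  qed
  have "bdC n S W G \<Longrightarrow> bdC n (\<lambda>k. S (Suc k)) (\<lambda>k. W (Suc k)) (\<lambda>k. G (Suc k))" for n G
  proof (induction n arbitrary: G)
    case (Suc n)
    have "bdC n (\<lambda>k. S (Suc k)) (\<lambda>k. W (Suc k)) (\<lambda>k x. frechet_derivative (G (Suc k)) (at x) v)" for v
      using Suc.IH[of "\<lambda>k x. frechet_derivative (G k) (at x) v"] Suc.prems by simp
    thus ?case using Suc.prems by (simp add: p)
  qed (simp add: p)
  thus ?thesis using assms(1) by (simp add: tempered_def)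
qed

text \<open>Every derivative of exp G is exp G times a polynomial in derivatives of G, so the weight
  is a matter of exp G alone; G itself may be unbounded.\<close>

lemma tempered_exp:
  assumes "\<And>k. W k \<ge> 0" "\<And>k x. G k differentiable (at x)"
    "\<And>v. tempered S (\<lambda>_. 1) (\<lambda>k x. frechet_derivative (G k) (at x) v)"
    "poly_bounded S W (\<lambda>k x. exp (G k x))"
  shows "tempered S W (\<lambda>k x. exp (G k x))"
proof -
  have "bdC n S W (\<lambda>k x. exp (G k x))" for n
  proof (induction n)
    case (Suc n)
    have d: "((\<lambda>x. exp (G k x)) has_derivative (\<lambda>v. frechet_derivative (G k) (at x) v * exp (G k x))) (at x)" for k x
      by (rule fd_comp_real[OF _ assms(2)]) (auto intro!: derivative_eq_intros)
    have "bdC n S (\<lambda>k. 1 * W k) (\<lambda>k x. frechet_derivative (G k) (at x) v * exp (G k x))" for v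
      by (rule bdC_mult) (use assms Suc in \<open>simp_all add: tempered_def\<close>)
    thus ?case using assms(4) d by (auto simp: fd_eq[OF d] differentiable_def)
  qed (simp add: assms)
  thus ?thesis by (simp add: tempered_def)
qed

text \<open>The chain rule costs a factor \<open>c k\<close> per derivative, which is polynomially
  bounded; the offsets \<open>d k\<close> are arbitrary because the bounds on the fixed function
  \<phi> hold on the whole line.\<close>

lemma tempered_comp_real:
  fixes \<phi> :: "real \<Rightarrow> real" and b :: "'a::euclidean_space"
  assumes "tempered (\<lambda>_. UNIV) (\<lambda>_. 1) (\<lambda>_. \<phi>)" "poly_bounded S (\<lambda>_. 1) (\<lambda>k x. c k)"
  shows "tempered S (\<lambda>_. 1) (\<lambda>k x. \<phi> (c k * (x \<bullet> b) + d k))"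
proof -
  have p: "poly_bounded S (\<lambda>_. 1) (\<lambda>k x. \<phi> (c k * (x \<bullet> b) + d k))"
    if f: "poly_bounded (\<lambda>_. UNIV) (\<lambda>_. 1) (\<lambda>_. \<phi>)" for \<phi> :: "real \<Rightarrow> real"
  proof -
    obtain C N where 1: "0 \<le> C" "\<And>k x. \<bar>\<phi> x\<bar> \<le> C * (real k + 1) ^ N * 1"
      using f unfolding poly_bounded_def by auto
    \<comment> \<open>The sequence is constant, so its bound at index 0, where the polynomial factor
      is 1, holds for all indices.\<close>
    show ?thesis
      by (rule poly_boundedI[of C _ _ 0]) (use 1(1) 1(2)[where k=0] in auto)
  qed
  have "bdC n (\<lambda>_. UNIV) (\<lambda>_. 1) (\<lambda>_. \<phi>) \<Longrightarrow> bdC n S (\<lambda>_. 1) (\<lambda>k x. \<phi> (c k * (x \<bullet> b) + d k))" for n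
  proof (induction n arbitrary: \<phi>)
    case (Suc n)
    let ?\<phi>' = "\<lambda>s. frechet_derivative \<phi> (at s) 1"
    have dp: "(\<phi> has_real_derivative ?\<phi>' s) (at s)" for s
    proof -
      have "(\<phi> has_derivative frechet_derivative \<phi> (at s)) (at s)"
        using Suc.prems by (simp add: frechet_derivative_works[symmetric])
      moreover have "frechet_derivative \<phi> (at s) = (*) (?\<phi>' s)"
      proof
        fix h
        have "linear (frechet_derivative \<phi> (at s))" using Suc.prems by (simp add: linear_frechet_derivative)
        from linear_scale[OF this, of h 1] show "frechet_derivative \<phi> (at s) h = ?\<phi>' s * h" by simp
      qed
      ultimately show ?thesis by (simp add: has_field_derivative_def)
    qed
    have d: "((\<lambda>x. \<phi> (c k * (x \<bullet> b) + d k)) has_derivative (\<lambda>v. (c k * (v \<bullet> b)) * ?\<phi>' (c k * (x \<bullet> b) + d k))) (at x)" for k x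
    proof -
      have l: "((\<lambda>x. c k * (x \<bullet> b) + d k) has_derivative (\<lambda>v. c k * (v \<bullet> b))) (at x)"
        by (auto intro!: derivative_eq_intros)
      show ?thesis
        using fd_comp_real[OF dp differentiableI[OF l]] unfolding fd_eq[OF l] .
    qed
    have "bdC n S (\<lambda>_. 1 * 1) (\<lambda>k x. (c k * (v \<bullet> b)) * ?\<phi>' (c k * (x \<bullet> b) + d k))" for v
    proof (rule bdC_mult)
      have "poly_bounded S (\<lambda>_. 1 * 1) (\<lambda>k x. c k * (v \<bullet> b))"
        by (rule poly_bounded_mult[OF assms(2)]) (auto intro!: poly_boundedI[of "\<bar>v \<bullet> b\<bar>" _ _ 0])
      hence "tempered S (\<lambda>_. 1) (\<lambda>k x. c k * (v \<bullet> b))" by (intro tempered_const) simp_all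
      thus "bdC n S (\<lambda>_. 1) (\<lambda>k x. c k * (v \<bullet> b))" by (simp add: tempered_def)
      show "bdC n S (\<lambda>_. 1) (\<lambda>k x. ?\<phi>' (c k * (x \<bullet> b) + d k))"
        by (rule Suc.IH) (use Suc.prems in simp)
    qed simp_all
    thus ?case using Suc.prems d by (auto simp: fd_eq[OF d] p differentiable_def)
  qed (simp add: p)
  thus ?thesis using assms(1) by (simp add: tempered_def)
qed

text \<open>The complement of \<open>S k\<close> is open and the function vanishes on it, so all its
  derivatives vanish there as well.\<close>

lemma tempered_support:
  assumes "tempered S W F" "\<And>k. closed (S k)" "\<And>k x. x \<notin> S k \<Longrightarrow> F k x = 0" "\<And>k. W k \<ge> 0"
  shows "tempered (\<lambda>_. UNIV) W F"
proof -
  have p: "poly_bounded (\<lambda>_. UNIV) W G" if g: "poly_bounded S W G" "\<And>k x. x \<notin> S k \<Longrightarrow> G k x = 0" for G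
  proof -
    obtain C N where 1: "0 \<le> C" "\<And>k x. x \<in> S k \<Longrightarrow> \<bar>G k x\<bar> \<le> C * (real k + 1) ^ N * W k"
      using g(1) unfolding poly_bounded_def by auto
    show ?thesis
    proof (rule poly_boundedI[OF 1(1)])
      fix k x show "\<bar>G k x\<bar> \<le> C * (real k + 1) ^ N * W k"
        using 1 g(2)[of x k] assms(4)[of k] by (cases "x \<in> S k") auto
    qed
  qed
  have "bdC n S W G \<Longrightarrow> (\<And>k x. x \<notin> S k \<Longrightarrow> G k x = 0) \<Longrightarrow> bdC n (\<lambda>_. UNIV) W G" for n G
  proof (induction n arbitrary: G)
    case (Suc n)
    have "frechet_derivative (G k) (at x) v = 0" if "x \<notin> S k" for k x v
      using fd_cong_open[of "- S k" x "G k" "\<lambda>_. 0"] that assms(2)[of k] Suc.prems(2)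
      by (auto simp: open_Compl)
    thus ?case using Suc by (simp add: p)
  qed (simp add: p)
  thus ?thesis using assms by (simp add: tempered_def)
qed

lemma tempered_sin_cos:
  "tempered (\<lambda>_. UNIV) (\<lambda>_. 1) (\<lambda>_. sin :: real \<Rightarrow> real)" "tempered (\<lambda>_. UNIV) (\<lambda>_. 1) (\<lambda>_. cos :: real \<Rightarrow> real)"
proof -
  have ps: "poly_bounded (\<lambda>_. UNIV) (\<lambda>_. 1) (\<lambda>_. sin :: real \<Rightarrow> real)" "poly_bounded (\<lambda>_. UNIV) (\<lambda>_. 1) (\<lambda>_. cos :: real \<Rightarrow> real)"
    by (auto intro!: poly_boundedI[of 1 _ _ 0])
  have ds: "(sin has_derivative (\<lambda>v. v * cos s)) (at s)" "(cos has_derivative (\<lambda>v. (- v) * sin s)) (at s)" for s :: real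
    by (auto intro!: derivative_eq_intros)
  have c: "bdC n (\<lambda>_. UNIV :: real set) (\<lambda>_. 1) (\<lambda>_ _. v)" for n v
    by (rule tempered_const[unfolded tempered_def, rule_format]) (auto intro!: poly_boundedI[of "\<bar>v\<bar>" _ _ 0])
  have "bdC n (\<lambda>_. UNIV) (\<lambda>_. 1) (\<lambda>_. sin :: real \<Rightarrow> real) \<and> bdC n (\<lambda>_. UNIV) (\<lambda>_. 1) (\<lambda>_. cos :: real \<Rightarrow> real)" for n
  proof (induction n)
    case (Suc n)
    have "bdC n (\<lambda>_. UNIV) (\<lambda>_. 1 * 1) (\<lambda>_ s. v * cos s)" "bdC n (\<lambda>_. UNIV) (\<lambda>_. 1 * 1) (\<lambda>_ s. (- v) * sin s)" for v :: real
      by (rule bdC_mult; use Suc c in simp)+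
    thus ?case using ps differentiableI[OF ds(1)] differentiableI[OF ds(2)]
      by (simp add: fd_eq[OF ds(1)] fd_eq[OF ds(2)])
  qed (use ps in simp)
  thus "tempered (\<lambda>_. UNIV) (\<lambda>_. 1) (\<lambda>_. sin :: real \<Rightarrow> real)" "tempered (\<lambda>_. UNIV) (\<lambda>_. 1) (\<lambda>_. cos :: real \<Rightarrow> real)"
    by (simp_all add: tempered_def)
qed

section \<open>Series of tempered sequences\<close>

lemma tempered_imp_smooth:
  fixes F :: "nat \<Rightarrow> 'a::euclidean_space \<Rightarrow> real"
  assumes "tempered S W F"
  shows "smooth_on UNIV (F k)"
proof -
  have "bdC (Suc n) S W G \<Longrightarrow> Ck_on n UNIV (G k)" for n G
  proof (induction n arbitrary: G)
    case 0
    thus ?case by (simp add: continuous_on_eq_continuous_within differentiable_imp_continuous_within)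
  next
    case (Suc n)
    from Suc.prems have "bdC (Suc n) S W (\<lambda>k x. frechet_derivative (G k) (at x) v)" for v
      by (subst (asm) bdC.simps) blast
    hence "Ck_on n UNIV (\<lambda>x. frechet_derivative (G k) (at x) v)" for v by (rule Suc.IH)
    thus ?case using Suc.prems by simp
  qed
  thus ?thesis using assms unfolding tempered_def smooth_on_UNIV_iff by blast
qed

lemma tempered_series:
  fixes F :: "nat \<Rightarrow> 'a::euclidean_space \<Rightarrow> real"
  assumes "tempered (\<lambda>_. UNIV) W F" "\<And>N. summable (\<lambda>k. (real k + 1) ^ N * W k)"
  shows "summable (\<lambda>k. F k x)"
    and "((\<lambda>x. \<Sum>k. F k x) has_derivative (\<lambda>v. \<Sum>k. frechet_derivative (F k) (at x) v)) (at x)"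
proof -
  have maj: "\<exists>B. (\<forall>k x. \<bar>G k x\<bar> \<le> B k) \<and> summable B" if g: "tempered (\<lambda>_. UNIV) W G" for G :: "nat \<Rightarrow> 'a \<Rightarrow> real"
  proof -
    obtain C N where "0 \<le> C" "\<And>k x. \<bar>G k x\<bar> \<le> C * (real k + 1) ^ N * W k"
      using temperedD(3)[OF g] unfolding poly_bounded_def by auto
    thus ?thesis using summable_mult[OF assms(2)[of N], of C]
      by (intro exI[of _ "\<lambda>k. C * ((real k + 1) ^ N * W k)"]) (simp add: mult.assoc)
  qed
  show s: "summable (\<lambda>k. F k x)" for x
    using maj[OF assms(1)] by (auto intro: summable_comparison_test')
  note D = temperedD(1)[OF assms(1)] note D2 = temperedD(2)[OF assms(1)]
  have hd: "(F k has_derivative frechet_derivative (F k) (at x)) (at x)" for k x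
    using D by (simp add: frechet_derivative_works[symmetric])
  have "\<forall>b. \<exists>B. (\<forall>k x. \<bar>frechet_derivative (F k) (at x) b\<bar> \<le> B k) \<and> summable B"
    using maj[OF D2] by blast
  then obtain B where B: "\<And>b k x. \<bar>frechet_derivative (F k) (at x) b\<bar> \<le> B b k" "\<And>b. summable (B b)" by metis
  define C where "C k = (\<Sum>b\<in>Basis. B b k)" for k
  have C: "summable C" unfolding C_def by (intro summable_sum B)
  \<comment> \<open>The bounds come direction by direction; expanding in the basis turns them into
    one bound of the differentials in operator norm, as termwise differentiation requires.\<close>
  have Cb: "\<bar>frechet_derivative (F k) (at x) h\<bar> \<le> C k * norm h" for k x h
  proof -
    interpret linear "frechet_derivative (F k) (at x)" using D linear_frechet_derivative by blast
    have "frechet_derivative (F k) (at x) h = (\<Sum>b\<in>Basis. (h \<bullet> b) * frechet_derivative (F k) (at x) b)"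
      by (subst (1) euclidean_representation[of h, symmetric]) (simp only: sum scale real_scaleR_def)
    also have "\<bar>\<dots>\<bar> \<le> (\<Sum>b\<in>Basis. norm h * B b k)"
      by (rule order_trans[OF sum_abs sum_mono]) (auto simp: abs_mult intro!: mult_mono B(1) Basis_le_norm)
    finally show ?thesis by (simp add: C_def sum_distrib_left mult.commute)
  qed
  have Cs: "summable (\<lambda>k. frechet_derivative (F k) (at x) h)" for x h
    by (rule summable_comparison_test'[OF summable_mult2[OF C, of "norm h"], of 0]) (use Cb in simp)
  have "\<exists>g. \<forall>x\<in>UNIV. (\<lambda>n. F n x) sums g x \<and>
      (g has_derivative (\<lambda>v. \<Sum>k. frechet_derivative (F k) (at x) v)) (at x within UNIV)"
  proof (rule has_derivative_series)
    show "(F k has_derivative frechet_derivative (F k) (at x)) (at x within UNIV)" for k x using hd by simp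
    show "(\<lambda>n. F n x) sums (\<Sum>n. F n x)" for x using s by (rule summable_sums)
    fix e :: real assume "e > 0"
    then obtain N where N: "\<And>n. n \<ge> N \<Longrightarrow> norm (\<Sum>i. C (i + n)) < e" using suminf_exist_split[OF _ C] by blast
    have "norm ((\<Sum>i<n. frechet_derivative (F i) (at x) h) - (\<Sum>k. frechet_derivative (F k) (at x) h)) \<le> e * norm h"
      if "n \<ge> N" for n x h
    proof -
      have "(\<Sum>i<n. frechet_derivative (F i) (at x) h) - (\<Sum>k. frechet_derivative (F k) (at x) h)
          = - (\<Sum>k. frechet_derivative (F (k + n)) (at x) h)"
        using suminf_split_initial_segment[OF Cs, of x h n] by simp
      also have "norm \<dots> \<le> (\<Sum>k. C (k + n) * norm h)"
      proof -
        have sC: "summable (\<lambda>k. C (k + n) * norm h)"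
          by (intro summable_mult2) (use C in \<open>simp add: summable_iff_shift\<close>)
        have sa: "summable (\<lambda>k. \<bar>frechet_derivative (F (k + n)) (at x) h\<bar>)"
          by (rule summable_comparison_test'[OF sC, of 0]) (use Cb in simp)
        have "\<bar>\<Sum>k. frechet_derivative (F (k + n)) (at x) h\<bar> \<le> (\<Sum>k. \<bar>frechet_derivative (F (k + n)) (at x) h\<bar>)"
          by (rule summable_rabs[OF sa])
        also have "\<dots> \<le> (\<Sum>k. C (k + n) * norm h)" by (rule suminf_le[OF Cb sa sC])
        finally show ?thesis by simp
      qed
      also have "\<dots> = (\<Sum>k. C (k + n)) * norm h"
        by (rule suminf_mult2[symmetric]) (use C in \<open>simp add: summable_iff_shift\<close>)
      also have "\<dots> \<le> e * norm h" using N[OF that] by (intro mult_right_mono) auto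
      finally show ?thesis .
    qed
    thus "\<forall>\<^sub>F n in sequentially. \<forall>x\<in>UNIV. \<forall>h. norm ((\<Sum>i<n. frechet_derivative (F i) (at x) h) -
        (\<Sum>k. frechet_derivative (F k) (at x) h)) \<le> e * norm h"
      unfolding eventually_sequentially by blast
  qed simp_all
  then obtain g where g: "\<And>x. (\<lambda>n. F n x) sums g x"
      "\<And>x. (g has_derivative (\<lambda>v. \<Sum>k. frechet_derivative (F k) (at x) v)) (at x)" by auto
  have "g = (\<lambda>x. \<Sum>k. F k x)" using sums_unique[OF g(1)] by auto
  thus "((\<lambda>x. \<Sum>k. F k x) has_derivative (\<lambda>v. \<Sum>k. frechet_derivative (F k) (at x) v)) (at x)"
    using g(2) by simp
qed

lemma tempered_series_smooth:
  fixes F :: "nat \<Rightarrow> 'a::euclidean_space \<Rightarrow> real"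
  assumes "tempered (\<lambda>_. UNIV) W F" "\<And>N. summable (\<lambda>k. (real k + 1) ^ N * W k)"
  shows "smooth_on UNIV (\<lambda>x. \<Sum>k. F k x)"
proof -
  have "tempered (\<lambda>_. UNIV) W G \<Longrightarrow> Ck_on n UNIV (\<lambda>x. \<Sum>k. G k x)" for n and G :: "nat \<Rightarrow> 'a \<Rightarrow> real"
  proof (induction n arbitrary: G)
    case 0
    show ?case using differentiableI[OF tempered_series(2)[OF 0 assms(2)]]
      by (simp add: continuous_on_eq_continuous_within differentiable_imp_continuous_within)
  next
    case (Suc n)
    note d = tempered_series(2)[OF Suc.prems assms(2)]
    have "Ck_on n UNIV (\<lambda>x. \<Sum>k. frechet_derivative (G k) (at x) v)" for v
      by (rule Suc.IH[OF temperedD(2)[OF Suc.prems]])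
    thus ?case using differentiableI[OF d] by (simp add: fd_eq[OF d])
  qed
  thus ?thesis using assms(1) unfolding smooth_on_UNIV_iff by blast
qed

lemma tempered_intro:
  assumes "poly_bounded S W F" "\<And>k x. F k differentiable (at x)"
    "\<And>v. tempered S W (\<lambda>k x. frechet_derivative (F k) (at x) v)"
  shows "tempered S W F"
  unfolding tempered_def
proof
  fix n show "bdC n S W F" using assms by (cases n) (simp_all add: tempered_def)
qed

lemma fd_real:
  assumes "(f has_real_derivative d) (at x)"
  shows "frechet_derivative f (at x) v = d * v" "f differentiable (at x)"
  using assms fd_eq[of f "(*) d"] by (auto simp: has_field_derivative_def differentiable_def)

subsection \<open>Smooth steps\<close>

text \<open>The functions p(1/x) exp(-1/x), extended by 0, form a family closed under
  differentiation: smoothness at 0 becomes an induction in which only the polynomial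
  changes.\<close>

definition flat_fun :: "real poly \<Rightarrow> real \<Rightarrow> real" where
  "flat_fun p x = (if 0 < x then poly p (1 / x) * exp (- (1 / x)) else 0)"

lemma poly_exp_decay: "((\<lambda>y::real. poly p y * exp (- y)) \<longlongrightarrow> 0) at_top"
proof -
  have "((\<lambda>y. \<Sum>i\<le>degree p. coeff p i * (y ^ i / exp y)) \<longlongrightarrow> (\<Sum>i\<le>degree p. coeff p i * 0)) at_top"
    by (intro tendsto_intros tendsto_power_div_exp_0)
  thus ?thesis by (simp add: poly_altdef sum_distrib_right exp_minus divide_inverse mult.assoc)
qed

lemma flat_fun_tendsto_0: "(flat_fun p \<longlongrightarrow> 0) (at 0)"
proof -
  have "(flat_fun p \<longlongrightarrow> 0) (at_right 0)"
  proof -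
    have "((\<lambda>x. poly p (inverse x) * exp (- (inverse x))) \<longlongrightarrow> 0) (at_right 0)"
      by (rule filterlim_compose[OF poly_exp_decay filterlim_inverse_at_top_right])
    thus ?thesis
      by (rule Lim_transform_eventually)
         (auto simp: flat_fun_def eventually_at_right_field divide_inverse intro!: exI[of _ 1])
  qed
  moreover have "(flat_fun p \<longlongrightarrow> 0) (at_left 0)"
    by (rule Lim_transform_eventually[OF tendsto_const])
       (auto simp: flat_fun_def eventually_at_left_field intro!: exI[of _ "-1"])
  ultimately show ?thesis by (intro filterlim_split_at)
qed

lemma flat_fun_DERIV:
  "(flat_fun p has_real_derivative flat_fun ([:0, 0, 1:] * (p - pderiv p)) x) (at x)"
proof -
  consider "x > 0" | "x < 0" | "x = 0" by linarith
  thus ?thesis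
  proof cases
    case 1
    have "((\<lambda>x. poly p (1 / x) * exp (- (1 / x))) has_real_derivative
        flat_fun ([:0, 0, 1:] * (p - pderiv p)) x) (at x)"
      using 1 by (auto intro!: derivative_eq_intros DERIV_chain2[where f="poly p"] poly_DERIV
          simp: flat_fun_def field_simps power2_eq_square)
    thus ?thesis
      by (rule has_field_derivative_transform_within_open[of _ _ _ "{0<..}"]) (use 1 in \<open>auto simp: flat_fun_def\<close>)
  next
    case 2
    have "((\<lambda>x. 0) has_real_derivative flat_fun ([:0, 0, 1:] * (p - pderiv p)) x) (at x)"
      using 2 by (simp add: flat_fun_def)
    thus ?thesis
      by (rule has_field_derivative_transform_within_open[of _ _ _ "{..<0}"]) (use 2 in \<open>auto simp: flat_fun_def\<close>)
  next
    case 3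
    have "(flat_fun p has_real_derivative 0) (at 0)"
      unfolding has_field_derivative_iff
    \<comment> \<open>The difference quotient at 0 is again a member of the family, with
      \<open>p\<close> multiplied by the variable.\<close>
    proof (rule Lim_transform_eventually[OF flat_fun_tendsto_0[of "[:0, 1:] * p"]])
      show "\<forall>\<^sub>F y in at 0. flat_fun ([:0, 1:] * p) y = (flat_fun p y - flat_fun p 0) / (y - 0)"
        by (rule always_eventually) (auto simp: flat_fun_def field_simps)
    qed
    thus ?thesis using 3 by (simp add: flat_fun_def)
  qed
qed

lemma ex_smooth_bump:
  "\<exists>\<phi>::real \<Rightarrow> real. tempered (\<lambda>_. UNIV) (\<lambda>_. 1) (\<lambda>_. \<phi>) \<and> (\<forall>x. 0 \<le> \<phi> x) \<and>
     (\<forall>x. x \<notin> {0<..<1} \<longrightarrow> \<phi> x = 0) \<and> (\<forall>x\<in>{0<..<1}. 0 < \<phi> x)"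
proof -
  have cont: "isCont (flat_fun p) x" for p x using flat_fun_DERIV by (rule DERIV_isCont)
  \<comment> \<open>Bounds are taken on [0, 1], by compactness; the bump vanishes outside, and
    \<open>tempered_support\<close> extends them to the line.\<close>
  have bd: "poly_bounded (\<lambda>_. {0..1}) (\<lambda>_. 1) (\<lambda>_. f)" if "\<And>x. isCont f x" for f :: "real \<Rightarrow> real"
  proof -
    have "compact (f ` {0..1})" by (intro compact_continuous_image continuous_at_imp_continuous_on) (use that in auto)
    from compact_imp_bounded[OF this] obtain B where "\<forall>y\<in>f ` {0..1}. \<bar>y\<bar> \<le> B" unfolding bounded_real by blast
    thus ?thesis by (intro poly_boundedI[of "\<bar>B\<bar>" _ _ 0]) force+
  qed
  have cm: "bdC n (\<lambda>_. {0..1::real}) (\<lambda>_. 1) (\<lambda>_ _. v)" for n and v :: real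
    by (rule tempered_const[unfolded tempered_def, rule_format]) (auto intro!: poly_boundedI[of "\<bar>v\<bar>" _ _ 0])
  have 1: "bdC n (\<lambda>_. {0..1}) (\<lambda>_. 1) (\<lambda>_. flat_fun p)" for n p
  proof (induction n arbitrary: p)
    case (Suc n)
    have "bdC n (\<lambda>_. {0..1}) (\<lambda>_. 1 * 1) (\<lambda>_ x. flat_fun ([:0, 0, 1:] * (p - pderiv p)) x * v)" for v
      by (rule bdC_mult[OF _ _ Suc cm]) auto
    thus ?case using fd_real[OF flat_fun_DERIV] bd[OF cont] by (simp del: mult_pCons_left)
  qed (simp add: bd cont)
  have D': "((\<lambda>x. flat_fun p (1 - x)) has_real_derivative - flat_fun ([:0, 0, 1:] * (p - pderiv p)) (1 - x)) (at x)" for p x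
    by (rule DERIV_cong[OF DERIV_chain2[OF flat_fun_DERIV]]) (auto intro!: derivative_eq_intros)
  have 2: "bdC n (\<lambda>_. {0..1}) (\<lambda>_. 1) (\<lambda>_ x. flat_fun p (1 - x))" for n p
  proof (induction n arbitrary: p)
    case 0 show ?case using bd[OF DERIV_isCont[OF D']] by simp
  next
    case (Suc n)
    have "bdC n (\<lambda>_. {0..1}) (\<lambda>_. 1 * 1) (\<lambda>_ x. flat_fun ([:0, 0, 1:] * (p - pderiv p)) (1 - x) * (-v))" for v
      by (rule bdC_mult[OF _ _ Suc cm]) auto
    thus ?case using fd_real[OF D'] bd[OF DERIV_isCont[OF D']] by (simp del: mult_pCons_left)
  qed
  let ?\<phi> = "\<lambda>x. flat_fun 1 x * flat_fun 1 (1 - x)"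
  have "tempered (\<lambda>_. {0..1}) (\<lambda>_. 1) (\<lambda>_. ?\<phi>)"
    by (rule tempered_mult) (use 1 2 in \<open>auto simp: tempered_def\<close>)
  hence "tempered (\<lambda>_. UNIV) (\<lambda>_. 1) (\<lambda>_. ?\<phi>)"
    by (rule tempered_support) (auto simp: flat_fun_def)
  thus ?thesis by (intro exI[of _ ?\<phi>]) (auto simp: flat_fun_def)
qed

lemma ex_antiderivative:
  fixes \<phi> :: "real \<Rightarrow> real"
  assumes "\<And>x. isCont \<phi> x" "\<And>x. x \<le> 0 \<Longrightarrow> \<phi> x = 0"
  obtains F where "\<And>x. (F has_real_derivative \<phi> x) (at x)" "\<And>x. x \<le> 0 \<Longrightarrow> F x = 0"
proof
  \<comment> \<open>Integrating from -1 instead of 0 keeps the point 0 in the interior, where the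
    derivative is two-sided; the additional piece of the integral is 0.\<close>
  let ?F = "\<lambda>x. integral {-1..x} \<phi>"
  show z: "?F x = 0" if "x \<le> 0" for x
    using integral_cong[of "{-1..x}" \<phi> "\<lambda>_. 0"] assms(2) that by auto
  show "(?F has_real_derivative \<phi> x) (at x)" for x
  proof (cases "x < 0")
    case True
    have "((\<lambda>x. 0) has_real_derivative \<phi> x) (at x)" using True assms(2) by simp
    thus ?thesis
      by (rule has_field_derivative_transform_within_open[of _ _ _ "{..<0}"]) (use True z in auto)
  next
    case False
    have "(?F has_real_derivative \<phi> x) (at x within {-1..x+1})"
      by (rule integral_has_real_derivative) (use False assms in \<open>auto intro!: continuous_at_imp_continuous_on\<close>)
    moreover have "at x within {-1..x+1} = at x"
      by (rule at_within_interior) (use False in auto)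
    ultimately show ?thesis by simp
  qed
qed

lemma tempered_antiderivative:
  fixes F :: "real \<Rightarrow> real"
  assumes "\<And>x. (F has_real_derivative \<phi> x) (at x)" "tempered (\<lambda>_. UNIV) (\<lambda>_. 1) (\<lambda>_. \<phi>)" "\<And>x. \<bar>F x\<bar> \<le> B"
  shows "tempered (\<lambda>_. UNIV) (\<lambda>_. 1) (\<lambda>_. F)"
proof (rule tempered_intro)
  show "poly_bounded (\<lambda>_. UNIV) (\<lambda>_. 1) (\<lambda>_. F)"
    by (rule poly_boundedI[of B _ _ 0]) (use assms(3) order_trans[OF abs_ge_zero assms(3)[of 0]] in simp_all)
  show "tempered (\<lambda>_. UNIV) (\<lambda>_. 1) (\<lambda>k x. frechet_derivative F (at x) v)" for v
    using tempered_cmult[OF _ assms(2), of v] by (simp add: fd_real[OF assms(1)] mult.commute)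
qed (use fd_real[OF assms(1)] in simp)

lemma ex_smooth_step:
  "\<exists>S::real \<Rightarrow> real. tempered (\<lambda>_. UNIV) (\<lambda>_. 1) (\<lambda>_. S) \<and> (\<forall>x\<le>0. S x = 0) \<and> (\<forall>x\<ge>1. S x = 1) \<and>
     (\<forall>x. 0 \<le> S x) \<and> (\<forall>x. S x \<le> 1)"
proof -
  obtain \<phi> :: "real \<Rightarrow> real" where p: "tempered (\<lambda>_. UNIV) (\<lambda>_. 1) (\<lambda>_. \<phi>)" "\<And>x. 0 \<le> \<phi> x"
     "\<And>x. x \<notin> {0<..<1} \<Longrightarrow> \<phi> x = 0" "\<And>x. x\<in>{0<..<1} \<Longrightarrow> 0 < \<phi> x" using ex_smooth_bump by blast
  have c: "isCont \<phi> x" for x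
    using temperedD(1)[OF p(1)] by (simp add: differentiable_imp_continuous_within)
  obtain F where F: "\<And>x. (F has_real_derivative \<phi> x) (at x)" "\<And>x. x \<le> 0 \<Longrightarrow> F x = 0"
    using ex_antiderivative[OF c] p(3) by (metis greaterThanLessThan_iff not_le)
  have mono: "F x \<le> F y" if "x \<le> y" for x y
    by (rule DERIV_nonneg_imp_nondecreasing[OF that]) (use F(1) p(2) in blast)
  have "F 0 < F 1"
  proof (rule DERIV_pos_imp_increasing_open[of 0 1 F])
    fix x :: real assume "0 < x" "x < 1"
    thus "\<exists>y. (F has_real_derivative y) (at x) \<and> 0 < y" using F(1)[of x] p(4)[of x] by auto
  next
    show "continuous_on {0..1} F"
      by (rule continuous_at_imp_continuous_on) (use F(1) DERIV_isCont in blast)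
  qed simp
  hence pos: "0 < F 1" using F(2)[of 0] by simp
  have one: "F x = F 1" if "x \<ge> 1" for x
  proof -
    have "F x \<le> F 1" by (rule DERIV_nonpos_imp_nonincreasing[OF that]) (use F(1) p(3) in force)
    thus ?thesis using mono[OF that] by simp
  qed
  let ?S = "\<lambda>x. F x / F 1"
  have b: "0 \<le> ?S x" "?S x \<le> 1" for x
    using mono[of "min 0 x" x] F(2)[of "min 0 x"] mono[of x "max 1 x"] one[of "max 1 x"] pos by (auto simp: field_simps)
  have "tempered (\<lambda>_. UNIV) (\<lambda>_. 1) (\<lambda>_. ?S)"
  proof (rule tempered_antiderivative)
    show "(?S has_real_derivative (1 / F 1) * \<phi> x) (at x)" for x
      using DERIV_cdivide[OF F(1)] by simp
    show "tempered (\<lambda>_. UNIV) (\<lambda>_. 1) (\<lambda>_ x. (1 / F 1) * \<phi> x)" by (rule tempered_cmult[OF _ p(1)]) simp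
    show "\<bar>?S x\<bar> \<le> 1" for x using b[of x] by simp
  qed
  moreover have "?S x = 0" if "x \<le> 0" for x using F(2)[OF that] by simp
  moreover have "?S x = 1" if "x \<ge> 1" for x unfolding one[OF that] using pos by simp
  ultimately show ?thesis using b by blast
qed

subsection \<open>Divergence-free fields on the cylinder\<close>

lemma cell_eq_cbox: "cell = cbox (0, 0) (1, \<chi> j. 1)"
  by (simp add: cell_def torus_cell_def cbox_Pair_eq)

lemma cell_subset_M: "cell \<subseteq> M" by (auto simp: cell_def M_def)

lemma compact_cell: "compact cell" by (simp add: cell_eq_cbox compact_cbox)

lemma cell_lebesgue: "cell \<in> sets lebesgue" by (simp add: cell_eq_cbox)

lemma finite_measure_cell: "finite_measure (lebesgue_on cell)"
  by (rule finite_measure_lebesgue_on) (simp add: cell_eq_cbox)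

lemma periodicD: "periodic f \<Longrightarrow> t \<in> {0..1} \<Longrightarrow> k \<in> lattice_pts \<Longrightarrow> f (t, y + k) = f (t, y)"
  by (simp add: periodic_def)

lemma lattice_axis: "axis j 1 \<in> lattice_pts"
  by (auto simp: lattice_pts_def axis_def)

text \<open>For gradients near the ends of the cylinder: there only the local smooth extensions give
  bounds, and compactness of the cell reduces them to finitely many.\<close>

lemma bounded_of_locally_bounded:
  fixes f :: "'a::metric_space \<Rightarrow> 'b::real_normed_vector"
  assumes "compact K" "\<And>x. x \<in> K \<Longrightarrow> \<exists>U B. open U \<and> x \<in> U \<and> (\<forall>y\<in>U \<inter> S. norm (f y) \<le> B)"
  shows "\<exists>B. \<forall>y\<in>K \<inter> S. norm (f y) \<le> B"
proof -
  obtain U B where UB: "\<And>x. x \<in> K \<Longrightarrow> open (U x) \<and> x \<in> U x \<and> (\<forall>y\<in>U x \<inter> S. norm (f y) \<le> B x)"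
    using assms(2) by metis
  obtain D where D: "D \<subseteq> K" "finite D" "K \<subseteq> (\<Union>x\<in>D. U x)"
    using compactE_image[OF assms(1), of K U] UB by (metis UN_iff subsetI)
  have "norm (f y) \<le> (\<Sum>x\<in>D. \<bar>B x\<bar>)" if "y \<in> K \<inter> S" for y
  proof -
    obtain x where x: "x \<in> D" "y \<in> U x" using D(3) \<open>y \<in> K \<inter> S\<close> by blast
    have "norm (f y) \<le> B x" using UB[of x] x D(1) that by blast
    also have "\<dots> \<le> \<bar>B x\<bar>" by simp
    also have "\<dots> \<le> (\<Sum>x\<in>D. \<bar>B x\<bar>)" by (rule member_le_sum) (use x D(2) in auto)
    finally show ?thesis .
  qed
  thus ?thesis by blast
qed

lemma gradient_cong_open:
  assumes "open U" "x \<in> U" "\<And>y. y \<in> U \<Longrightarrow> f y = g y"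
  shows "gradient f x = gradient g x"
  unfolding gradient_def by (simp add: fd_cong_open[OF assms])

lemma continuous_on_gradient:
  assumes "Ck_on 1 U F" shows "continuous_on U (gradient F)"
  unfolding gradient_def by (rule continuous_on_vec_lambda) (use assms in \<open>simp del: split_paired_All\<close>)

abbreviation (input) open_cyl :: "'m::finite pt set" where "open_cyl \<equiv> {0<..<1} \<times> UNIV"

lemma open_open_cyl: "open (open_cyl :: 'm::finite pt set)"
  by (rule open_Times) auto

text \<open>The value of \<open>gradient Z\<close> at an end depends on how \<open>Z\<close> is
  continued outside \<open>M\<close>, which smoothness on \<open>M\<close> leaves open. In the
  interior it agrees with the gradient of a local extension, and the latter is continuous up to the
  ends.\<close>

lemma smooth_on_M_local:
  assumes "smooth_on M Z" "x \<in> M"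
  obtains U F where "open U" "x \<in> U" "\<And>k. Ck_on k U F" "\<And>y. y \<in> U \<inter> M \<Longrightarrow> F y = Z y"
    "\<And>y. y \<in> U \<inter> open_cyl \<Longrightarrow> gradient Z y = gradient F y"
    "\<And>y. y \<in> U \<inter> open_cyl \<Longrightarrow> Z differentiable (at y)"
proof -
  obtain U F where h: "open U" "x \<in> U" "\<forall>k. Ck_on k U F" "\<forall>y\<in>U \<inter> M. F y = Z y"
    using assms unfolding smooth_on_def by blast
  have o: "open (U \<inter> open_cyl)" using h(1) open_open_cyl by blast
  have e: "F y = Z y" if "y \<in> U \<inter> open_cyl" for y using h(4) that by (auto simp: M_def)
  show ?thesis
  proof (rule that[OF h(1,2)])
    show "Ck_on k U F" for k using h(3) by blast
    show "F y = Z y" if "y \<in> U \<inter> M" for y using h(4) that by blast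
    fix y assume y: "y \<in> U \<inter> open_cyl"
    show "gradient Z y = gradient F y" by (rule gradient_cong_open[OF o y e[symmetric]])
    have "Ck_on 1 U F" using h(3) by blast
    hence "F differentiable (at y)" using y by auto
    thus "Z differentiable (at y)" using differentiable_cong_open[of "U \<inter> open_cyl" y F Z] o y e by blast
  qed
qed

lemma smooth_on_M_gradient:
  assumes "smooth_on M Z"
  shows "continuous_on open_cyl (gradient Z)" "\<And>x. x \<in> open_cyl \<Longrightarrow> Z differentiable (at x)"
    "\<exists>B\<ge>0. \<forall>x\<in>cell \<inter> open_cyl. norm (gradient Z x) \<le> B"
proof -
  have loc: "isCont (gradient Z) x \<and> Z differentiable (at x)" if x: "x \<in> open_cyl" for x
  proof -
    have xM: "x \<in> M" using x by (auto simp: M_def)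
    obtain U F where h: "open U" "x \<in> U" "\<And>k. Ck_on k U F" "\<And>y. y \<in> U \<inter> M \<Longrightarrow> F y = Z y"
      "\<And>y. y \<in> U \<inter> open_cyl \<Longrightarrow> gradient Z y = gradient F y"
      "\<And>y. y \<in> U \<inter> open_cyl \<Longrightarrow> Z differentiable (at y)"
      using smooth_on_M_local[OF assms xM] by metis
    have o: "open (U \<inter> open_cyl)" using h(1) open_open_cyl by blast
    have "continuous_on (U \<inter> open_cyl) (gradient F)"
      using continuous_on_gradient[OF h(3)] by (rule continuous_on_subset) blast
    hence "continuous_on (U \<inter> open_cyl) (gradient Z)"
      by (rule continuous_on_eq) (simp add: h(5))
    hence "isCont (gradient Z) x" using h(2) x by (auto simp: continuous_on_eq_continuous_at[OF o])
    thus ?thesis using h(2) h(6)[of x] x by blast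
  qed
  show "continuous_on open_cyl (gradient Z)" using loc by (intro continuous_at_imp_continuous_on) blast
  show "\<And>x. x \<in> open_cyl \<Longrightarrow> Z differentiable (at x)" using loc by blast
  have "\<exists>B. \<forall>y\<in>cell \<inter> open_cyl. norm (gradient Z y) \<le> B"
  proof (rule bounded_of_locally_bounded[OF compact_cell])
    fix x :: "'a pt" assume "x \<in> cell"
    hence xM: "x \<in> M" using cell_subset_M by blast
    obtain U F where h: "open U" "x \<in> U" "\<And>k. Ck_on k U F" "\<And>y. y \<in> U \<inter> M \<Longrightarrow> F y = Z y"
      "\<And>y. y \<in> U \<inter> open_cyl \<Longrightarrow> gradient Z y = gradient F y"
      "\<And>y. y \<in> U \<inter> open_cyl \<Longrightarrow> Z differentiable (at y)"
      using smooth_on_M_local[OF assms xM] by metis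
    have c: "continuous_on U (gradient F)" by (rule continuous_on_gradient[OF h(3)])
    hence "continuous_on U (\<lambda>y. norm (gradient F y))" by (rule continuous_on_norm)
    from continuous_open_preimage[OF this h(1) open_lessThan[of "norm (gradient F x) + 1"]]
    have o: "open (U \<inter> (\<lambda>y. norm (gradient F y)) -` {..<norm (gradient F x) + 1})" .
    show "\<exists>U B. open U \<and> x \<in> U \<and> (\<forall>y\<in>U \<inter> open_cyl. norm (gradient Z y) \<le> B)"
    proof (intro exI conjI)
      show "\<forall>y\<in>(U \<inter> (\<lambda>y. norm (gradient F y)) -` {..<norm (gradient F x) + 1}) \<inter> open_cyl.
          norm (gradient Z y) \<le> norm (gradient F x) + 1"
        using h(5) by (auto simp: less_imp_le)
    qed (use o h(2) in auto)
  qed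
  then obtain B where "\<forall>y\<in>cell \<inter> open_cyl. norm (gradient Z y) \<le> B" by blast
  thus "\<exists>B\<ge>0. \<forall>x\<in>cell \<inter> open_cyl. norm (gradient Z x) \<le> B" by (intro exI[of _ "\<bar>B\<bar>"]) force
qed

text \<open>Integrals over the cell therefore do not see the arbitrary values of
  \<open>gradient\<close> at the ends.\<close>

lemma negligible_cell_ends: "negligible (cell - open_cyl :: 'm::finite pt set)"
proof -
  have "(1, 0) \<in> (Basis :: 'm pt set)" by (simp add: Basis_prod_def)
  hence "negligible {x :: 'm pt. x \<bullet> (1, 0) = c}" for c by (rule negligible_standard_hyperplane)
  hence "negligible ({x :: 'm pt. x \<bullet> (1, 0) = 0} \<union> {x. x \<bullet> (1, 0) = 1})" by (simp add: negligible_Un)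
  thus ?thesis by (rule negligible_subset) (auto simp: cell_def inner_prod_def)
qed

lemma AE_cell_open_cyl: "AE x in lebesgue_on (cell :: 'm::finite pt set). x \<in> open_cyl"
proof -
  have "cell - open_cyl \<in> null_sets (lebesgue :: 'm pt measure)"
    using negligible_cell_ends by (simp add: negligible_iff_null_sets)
  hence "AE x in (lebesgue :: 'm pt measure). x \<notin> cell - open_cyl" by (rule AE_not_in)
  hence "AE x in (lebesgue :: 'm pt measure). x \<in> cell \<longrightarrow> x \<in> open_cyl" by (rule eventually_mono) auto
  thus ?thesis using cell_lebesgue by (subst AE_restrict_space_iff) auto
qed

lemma borel_measurable_cellI:
  fixes f :: "'m::finite pt \<Rightarrow> 'b::euclidean_space"
  assumes "continuous_on open_cyl f"
  shows "f \<in> borel_measurable (lebesgue_on cell)"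
proof -
  let ?S = "cell \<inter> open_cyl :: 'm pt set"
  have S: "?S \<in> sets lebesgue" 
    by (rule sets.Int[OF cell_lebesgue sets_completionI_sets]) (simp add: borel_open open_open_cyl)
  have "f \<in> borel_measurable (lebesgue_on ?S)"
    by (rule continuous_imp_measurable_on_sets_lebesgue[OF _ S]) (rule continuous_on_subset[OF assms Int_lower2])
  hence "(\<lambda>x. if x \<in> ?S then f x else 0) \<in> borel_measurable lebesgue" by (subst borel_measurable_if[OF S])
  moreover have "AE x in lebesgue. (if x \<in> ?S then f x else 0) = (if x \<in> cell then f x else 0)"
  proof -
    have "cell - open_cyl \<in> null_sets (lebesgue :: 'm pt measure)"
      using negligible_cell_ends by (simp add: negligible_iff_null_sets)
    hence "AE x in (lebesgue :: 'm pt measure). x \<notin> cell - open_cyl" by (rule AE_not_in)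
    thus ?thesis by (rule eventually_mono) auto
  qed
  ultimately have "(\<lambda>x. if x \<in> cell then f x else 0) \<in> borel_measurable lebesgue"
    by (rule borel_measurable_AE)
  thus ?thesis by (subst (asm) borel_measurable_if[OF cell_lebesgue])
qed

lemma integrable_cellI:
  fixes f :: "'m::finite pt \<Rightarrow> 'b::euclidean_space"
  assumes "f \<in> borel_measurable (lebesgue_on cell)" "\<And>x. x \<in> cell \<inter> open_cyl \<Longrightarrow> norm (f x) \<le> B"
  shows "integrable (lebesgue_on cell) f"
proof -
  interpret finite_measure "lebesgue_on (cell :: 'm pt set)" by (rule finite_measure_cell)
  have "AE x in lebesgue_on cell. norm (f x) \<le> B"
    using AE_cell_open_cyl AE_space by eventually_elim (use assms(2) in auto)
  thus ?thesis using assms(1) by (rule integrable_const_bound)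
qed

text \<open>The shifted cube is cut along x_j = 1, and the overhanging slab is moved back by one
  period; it fills the gap left at the bottom.\<close>

lemma integral_torus_shift:
  fixes f :: "real ^ 'm::finite \<Rightarrow> real"
  assumes c: "continuous_on UNIV f" and p: "\<And>y. f (y + axis j 1) = f y" and s: "0 \<le> s" "s \<le> 1"
  shows "integral torus_cell (\<lambda>y. f (y + s *\<^sub>R axis j 1)) = integral torus_cell f"
proof -
  define e :: "real ^ 'm" where "e = axis j 1"
  define one :: "real ^ 'm" where "one = (\<chi> j. 1)"
  have eB: "e \<in> Basis" by (auto simp: e_def Basis_vec_def)
  have int: "f integrable_on cbox a b" for a b
    by (rule integrable_continuous) (use c continuous_on_subset in blast)
  have k: "x \<bullet> e = x $ j" for x by (simp add: e_def inner_axis)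
  have mb: "x \<in> cbox a b \<longleftrightarrow> (a $ j \<le> x $ j \<and> x $ j \<le> b $ j) \<and> (\<forall>i. i \<noteq> j \<longrightarrow> a $ i \<le> x $ i \<and> x $ i \<le> b $ i)"
    for x a b :: "real ^ 'm" unfolding mem_box_cart by metis
  have ec: "e $ i = (if i = j then 1 else 0)" for i by (simp add: e_def axis_def)
  have "integral torus_cell (\<lambda>y. f (y + s *\<^sub>R e)) = integral (cbox (s *\<^sub>R e) (one + s *\<^sub>R e)) f"
    using integral_shift_cbox[of "s *\<^sub>R e" "s *\<^sub>R e" "one + s *\<^sub>R e" f] by (simp add: torus_cell_def one_def)
  also have "\<dots> = integral (cbox (s *\<^sub>R e) (one + s *\<^sub>R e) \<inter> {x. x \<bullet> e \<le> 1}) f +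
      integral (cbox (s *\<^sub>R e) (one + s *\<^sub>R e) \<inter> {x. x \<bullet> e \<ge> 1}) f" by (rule integral_split[OF int eB])
  also have "cbox (s *\<^sub>R e) (one + s *\<^sub>R e) \<inter> {x. x \<bullet> e \<le> 1} = cbox 0 one \<inter> {x. x \<bullet> e \<ge> s}"
    using s by (intro set_eqI) (auto simp: mb k one_def ec)
  also have "integral (cbox (s *\<^sub>R e) (one + s *\<^sub>R e) \<inter> {x. x \<bullet> e \<ge> 1}) f = integral (cbox 0 one \<inter> {x. x \<bullet> e \<le> s}) f"
  proof -
    have 1: "cbox (s *\<^sub>R e) (one + s *\<^sub>R e) \<inter> {x. x \<bullet> e \<ge> 1} = cbox e (one + s *\<^sub>R e)"
      using s by (intro set_eqI) (auto simp: mb k one_def ec)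
    have 2: "cbox 0 one \<inter> {x. x \<bullet> e \<le> s} = cbox (e - e) (one + s *\<^sub>R e - e)"
      using s by (intro set_eqI) (auto simp: mb k one_def ec)
    show ?thesis unfolding 1 2 integral_shift_cbox[of e e "one + s *\<^sub>R e" f, symmetric]
      using p by (simp add: e_def)
  qed
  also have "integral (cbox 0 one \<inter> {x. x \<bullet> e \<ge> s}) f + integral (cbox 0 one \<inter> {x. x \<bullet> e \<le> s}) f = integral (cbox 0 one) f"
    using integral_split[OF int eB, of 0 one s] by simp
  finally show ?thesis by (simp add: torus_cell_def one_def e_def)
qed

text \<open>The integral is averaged over the shifts by s in [0, 1], none of which changes it. After
  exchanging the integrals the inner one runs over a full period of \<open>f\<close> and vanishes by
  the fundamental theorem.\<close>

lemma integral_torus_derivative: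
  fixes f f' :: "real ^ 'm::finite \<Rightarrow> real"
  assumes c: "continuous_on UNIV f'"
    and d: "\<And>y s. ((\<lambda>s. f (y + s *\<^sub>R axis j 1)) has_real_derivative f' (y + s *\<^sub>R axis j 1)) (at s)"
    and p: "\<And>y. f (y + axis j 1) = f y" "\<And>y. f' (y + axis j 1) = f' y"
  shows "integral torus_cell f' = 0"
proof -
  have z: "integral {0..1} (\<lambda>s. f' (y + s *\<^sub>R axis j 1)) = 0" for y
  proof -
    have "((\<lambda>s. f' (y + s *\<^sub>R axis j 1)) has_integral (f (y + 1 *\<^sub>R axis j 1) - f (y + 0 *\<^sub>R axis j 1))) {0..1}"
      by (rule fundamental_theorem_of_calculus)
         (use d in \<open>auto simp: has_real_derivative_iff_has_vector_derivative[symmetric] has_field_derivative_at_within\<close>)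
    thus ?thesis using p(1) by (simp add: integral_unique)
  qed
  have "integral torus_cell f' = integral {0..1} (\<lambda>s. integral torus_cell (\<lambda>y. f' (y + s *\<^sub>R axis j 1)))"
    using integral_torus_shift[OF c p(2)] by (subst integral_cong[where g="\<lambda>_. integral torus_cell f'"]) auto
  also have "\<dots> = integral torus_cell (\<lambda>y. integral {0..1} (\<lambda>s. f' (y + s *\<^sub>R axis j 1)))"
  proof -
    have "continuous_on (cbox (0, 0) (1, \<chi> j. 1)) (\<lambda>(s, y). f' (y + s *\<^sub>R axis j 1))"
      unfolding split_beta by (rule continuous_on_compose2[OF c]) (auto intro!: continuous_intros)
    from integral_swap_continuous[OF this] show ?thesis by (simp add: torus_cell_def)
  qed
  also have "\<dots> = 0" by (simp add: z)
  finally show ?thesis by simp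
qed

section \<open>Integration by parts against a divergence-free field\<close>

lemma fd_shift:
  assumes "f differentiable (at (x + c))"
  shows "frechet_derivative (\<lambda>x. f (x + c)) (at x) = frechet_derivative f (at (x + c))"
proof -
  have "((\<lambda>x. x + c) has_derivative (\<lambda>h. h)) (at x)" by (auto intro!: derivative_eq_intros)
  from diff_chain_at[OF this, of f "frechet_derivative f (at (x + c))"]
  have "((\<lambda>x. f (x + c)) has_derivative frechet_derivative f (at (x + c))) (at x)"
    using assms by (simp add: frechet_derivative_works o_def)
  thus ?thesis by (rule fd_eq)
qed

lemma fd_periodic:
  fixes f :: "'m::finite pt \<Rightarrow> real"
  assumes "periodic f" "\<And>x. x \<in> open_cyl \<Longrightarrow> f differentiable (at x)" "t \<in> {0<..<1}" "k \<in> lattice_pts"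
  shows "frechet_derivative f (at (t, y + k)) = frechet_derivative f (at (t, y))"
proof -
  have e: "f x = f (x + (0, k))" if "x \<in> open_cyl" for x
    using periodicD[OF assms(1) _ assms(4), of "fst x" "snd x"] that by (cases x) auto
  have "frechet_derivative f (at (t, y)) = frechet_derivative (\<lambda>x. f (x + (0, k))) (at (t, y))"
    by (rule fd_cong_open[OF open_open_cyl _ e]) (use assms(3) in auto)
  also have "\<dots> = frechet_derivative f (at ((t, y) + (0, k)))"
    by (rule fd_shift) (use assms(2)[of "(t, y + k)"] assms(3) in simp)
  finally show ?thesis by simp
qed

lemma has_real_derivative_line:
  fixes F :: "'m::finite pt \<Rightarrow> real"
  assumes "F differentiable (at (p + s *\<^sub>R c))"
  shows "((\<lambda>s. F (p + s *\<^sub>R c)) has_real_derivative frechet_derivative F (at (p + s *\<^sub>R c)) c) (at s)"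
proof -
  let ?D = "frechet_derivative F (at (p + s *\<^sub>R c))"
  have l: "((\<lambda>s. p + s *\<^sub>R c) has_derivative (\<lambda>h. h *\<^sub>R c)) (at s)" by (auto intro!: derivative_eq_intros)
  have "(F has_derivative ?D) (at (p + s *\<^sub>R c))" using assms by (simp add: frechet_derivative_works)
  from diff_chain_at[OF l this] have "((\<lambda>s. F (p + s *\<^sub>R c)) has_derivative (\<lambda>h. ?D (h *\<^sub>R c))) (at s)"
    by (simp add: o_def)
  moreover have "?D (h *\<^sub>R c) = ?D c * h" for h
    using linear_scale[OF linear_frechet_derivative[OF assms]] by simp
  ultimately show ?thesis by (simp add: has_field_derivative_def mult_commute_abs)
qed

text \<open>The field vanishes at t = 1 only. The boundary term at t = 0 survives integration by
  parts and is removed later by the data, which are zero there.\<close>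

locale flux_field =
  fixes V :: "'m::finite pt \<Rightarrow> 'm covec"
  assumes V_smooth: "\<And>i. smooth_on UNIV (\<lambda>x. V x $ i)" and V_periodic: "periodic V"
    and V_end: "\<And>y. V (1, y) = 0"
    and V_div: "\<And>x. (\<Sum>i\<in>UNIV. frechet_derivative (\<lambda>x. V x $ i) (at x) (coord i)) = 0"
begin

lemma V_continuous: "continuous_on S V"
proof -
  have "continuous_on S (\<lambda>x. \<chi> i. V x $ i)"
    by (intro continuous_on_vec_lambda smooth_on_UNIV_D(3)[OF V_smooth])
  thus ?thesis by simp
qed

lemma V_bounded: obtains B where "0 \<le> B" "\<And>x. x \<in> cell \<Longrightarrow> norm (V x) \<le> B"
proof -
  have "bounded (V ` cell)"
    by (intro compact_imp_bounded compact_continuous_image V_continuous compact_cell)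
  then obtain B where "\<forall>x\<in>cell. norm (V x) \<le> B" unfolding bounded_iff by auto
  thus ?thesis using that[of "\<bar>B\<bar>"] by force
qed

context
  fixes Z :: "'m pt \<Rightarrow> real"
  assumes Z: "smooth_on M Z" "periodic Z"
begin

lemma flux_integrable: "integrable (lebesgue_on cell) (\<lambda>x. V x \<bullet> gradient Z x)"
proof -
  obtain B where B: "0 \<le> B" "\<And>x. x \<in> cell \<Longrightarrow> norm (V x) \<le> B" using V_bounded by blast
  obtain C where C: "C \<ge> 0" "\<forall>x\<in>cell \<inter> open_cyl. norm (gradient Z x) \<le> C"
    using smooth_on_M_gradient(3)[OF Z(1)] by auto
  show ?thesis
  proof (rule integrable_cellI[of _ "B * C"])
    show "(\<lambda>x. V x \<bullet> gradient Z x) \<in> borel_measurable (lebesgue_on cell)"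
      by (intro borel_measurable_cellI continuous_on_inner V_continuous smooth_on_M_gradient(1)[OF Z(1)])
    fix x :: "'m pt" assume x: "x \<in> cell \<inter> open_cyl"
    have "norm (V x \<bullet> gradient Z x) \<le> norm (V x) * norm (gradient Z x)" by (simp add: Cauchy_Schwarz_ineq2)
    also have "\<dots> \<le> B * C" using x B C by (intro mult_mono) auto
    finally show "norm (V x \<bullet> gradient Z x) \<le> B * C" .
  qed
qed

definition "flux_int t = integral torus_cell (\<lambda>y. Z (t, y) * V (t, y) $ None)"

text \<open>As div V = 0, the integrand is div (Z V). The box stays away from the ends, where
  \<open>Z\<close> might have no derivative.\<close>

lemma flux_box:
  assumes ab: "0 < a" "a \<le> b" "b < 1"
  shows "integral (cbox (a, 0) (b, \<chi> j. 1)) (\<lambda>x. V x \<bullet> gradient Z x) = flux_int b - flux_int a"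
proof -
  let ?F = "\<lambda>i x. Z x * V x $ i"
  let ?D = "\<lambda>i x. frechet_derivative (?F i) (at x) (coord i)"
  let ?Q = "cbox (a, 0) (b, \<chi> j. 1) :: 'm pt set"
  have dZ: "Z differentiable (at x)" if "x \<in> open_cyl" for x by (rule smooth_on_M_gradient(2)[OF Z(1) that])
  have dV: "(\<lambda>x. V x $ i) differentiable (at x)" for i x by (rule smooth_on_UNIV_D(1)[OF V_smooth])
  have dF: "?F i differentiable (at x)" if "x \<in> open_cyl" for i x
    by (intro differentiable_mult dZ[OF that] dV)
  have Dx: "?D i x = Z x * frechet_derivative (\<lambda>x. V x $ i) (at x) (coord i) + gradient Z x $ i * V x $ i"
    if "x \<in> open_cyl" for i x
    using fd_mult[OF dZ[OF that] dV] by (simp add: gradient_def)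
  have Zc: "continuous_on open_cyl Z"
    by (rule continuous_on_subset[OF smooth_on_imp_continuous_on[OF Z(1)]]) (auto simp: M_def)
  have Dc: "continuous_on open_cyl (?D i)" for i
  proof -
    have "continuous_on open_cyl (\<lambda>x. Z x * frechet_derivative (\<lambda>x. V x $ i) (at x) (coord i) + gradient Z x $ i * V x $ i)"
      by (intro continuous_intros Zc smooth_on_UNIV_D(4)[OF V_smooth] smooth_on_UNIV_D(3)[OF V_smooth]
          smooth_on_M_gradient(1)[OF Z(1)])
    thus ?thesis by (rule continuous_on_eq) (simp add: Dx)
  qed
  have sub: "?Q \<subseteq> open_cyl" using ab by (auto simp: cbox_Pair_eq)
  have DcQ: "continuous_on ?Q (?D i)" for i by (rule continuous_on_subset[OF Dc sub])
  have Fper: "periodic (?F i)" for i using Z(2) V_periodic by (simp add: periodic_def)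
  have sumD: "V x \<bullet> gradient Z x = (\<Sum>i\<in>UNIV. ?D i x)" if "x \<in> ?Q" for x
  proof -
    have x: "x \<in> open_cyl" using that sub by blast
    have "(\<Sum>i\<in>UNIV. ?D i x) = Z x * (\<Sum>i\<in>UNIV. frechet_derivative (\<lambda>x. V x $ i) (at x) (coord i))
        + (\<Sum>i\<in>UNIV. gradient Z x $ i * V x $ i)"
      by (simp add: Dx[OF x] sum.distrib sum_distrib_left)
    thus ?thesis using V_div[of x] by (simp add: inner_vec_def mult.commute)
  qed
  \<comment> \<open>Periodicity removes the contributions of the torus directions, slice by
    slice.\<close>
  have torus0: "integral ?Q (?D (Some j)) = 0" for j
  proof -
    have "integral (cbox 0 (\<chi> j. 1)) (\<lambda>y. ?D (Some j) (t, y)) = 0" if t: "t \<in> {a..b}" for t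
    proof -
      have t1: "(t, y) \<in> open_cyl" for y :: "real ^ 'm" using t ab by auto
      have "integral torus_cell (\<lambda>y. ?D (Some j) (t, y)) = 0"
      proof (rule integral_torus_derivative[of _ "\<lambda>y. ?F (Some j) (t, y)" j])
        show "continuous_on UNIV (\<lambda>y. ?D (Some j) (t, y))"
          by (rule continuous_on_compose2[OF Dc]) (use t ab in \<open>auto intro!: continuous_intros\<close>)
        show "?F (Some j) (t, y + axis j 1) = ?F (Some j) (t, y)" for y
          using periodicD[OF Fper[of "Some j"] _ lattice_axis, of t y j] t ab by auto
        show "?D (Some j) (t, y + axis j 1) = ?D (Some j) (t, y)" for y
          using fd_periodic[OF Fper dF _ lattice_axis, where t=t and y=y] t ab by auto
        show "((\<lambda>s. ?F (Some j) (t, y + s *\<^sub>R axis j 1)) has_real_derivative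
            ?D (Some j) (t, y + s *\<^sub>R axis j 1)) (at s)" for y s
          using has_real_derivative_line[of "?F (Some j)" "(t, y)" s "coord (Some j)"] dF[OF t1]
          by (simp add: coord_def)
      qed
      thus ?thesis by (simp add: torus_cell_def)
    qed
    hence z: "integral (cbox a b) (\<lambda>t. integral (cbox 0 (\<chi> j. 1)) (\<lambda>y. ?D (Some j) (t, y))) = integral (cbox a b) (\<lambda>t. 0)"
      by (intro integral_cong) simp
    show ?thesis unfolding integral_prod_continuous[OF DcQ] z by simp
  qed
  have "integral ?Q (\<lambda>x. V x \<bullet> gradient Z x) = integral ?Q (\<lambda>x. \<Sum>i\<in>UNIV. ?D i x)"
    by (rule integral_cong[OF sumD])
  also have "\<dots> = (\<Sum>i\<in>UNIV. integral ?Q (?D i))"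
    by (intro integral_sum integrable_continuous DcQ) simp
  also have "\<dots> = integral ?Q (?D None) + (\<Sum>j\<in>UNIV. integral ?Q (?D (Some j)))"
    by (simp add: UNIV_option_conv sum.reindex)
  also have "integral ?Q (?D None) = flux_int b - flux_int a"
  proof -
    have "integral ?Q (?D None) = integral (cbox a b) (\<lambda>t. integral (cbox 0 (\<chi> j. 1)) (\<lambda>y. ?D None (t, y)))"
      by (rule integral_prod_continuous[OF DcQ])
    also have "\<dots> = integral (cbox 0 (\<chi> j. 1)) (\<lambda>y. integral (cbox a b) (\<lambda>t. ?D None (t, y)))"
      by (rule integral_swap_continuous) (use DcQ in simp)
    also have "\<dots> = integral (cbox 0 (\<chi> j. 1)) (\<lambda>y. ?F None (b, y) - ?F None (a, y))"
    proof (rule integral_cong)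
      fix y :: "real ^ 'm"
      have "((\<lambda>t. ?D None (t, y)) has_integral ?F None (b, y) - ?F None (a, y)) {a..b}"
      proof (rule fundamental_theorem_of_calculus[OF ab(2)])
        fix t assume t: "t \<in> {a..b}"
        have t1: "(t, y) \<in> open_cyl" using t ab by auto
        have "((\<lambda>t. ?F None (t, y)) has_real_derivative ?D None (t, y)) (at t)"
          using has_real_derivative_line[of "?F None" "(0, y)" t "coord None"] dF[OF t1]
          by (simp add: coord_def)
        thus "((\<lambda>t. ?F None (t, y)) has_vector_derivative ?D None (t, y)) (at t within {a..b})"
          by (simp add: has_real_derivative_iff_has_vector_derivative[symmetric] has_field_derivative_at_within)
      qed
      thus "integral (cbox a b) (\<lambda>t. ?D None (t, y)) = ?F None (b, y) - ?F None (a, y)"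
        by (simp add: integral_unique)
    qed
    also have "\<dots> = flux_int b - flux_int a"
    proof -
      have "(\<lambda>y. ?F None (t, y)) integrable_on cbox 0 (\<chi> j. 1)" if "t \<in> {a..b}" for t
      proof (rule integrable_continuous)
        have "continuous_on open_cyl (?F None)"
          by (intro continuous_on_mult Zc smooth_on_UNIV_D(3)[OF V_smooth])
        thus "continuous_on (cbox 0 (\<chi> j. 1)) (\<lambda>y. ?F None (t, y))"
          by (rule continuous_on_compose2) (use that ab in \<open>auto intro!: continuous_intros\<close>)
      qed
      thus ?thesis unfolding flux_int_def torus_cell_def using ab by (simp add: integral_diff)
    qed
    finally show ?thesis .
  qed
  finally show ?thesis by (simp add: torus0)
qed

text \<open>Inner boxes exhaust the cell: dominated convergence handles the volume integral,
  continuity of \<open>flux_int\<close> up to the ends the boundary terms, of which the one at t = 1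
  is zero by \<open>V_end\<close>.\<close>

lemma flux_identity:
  "(LINT x|lebesgue_on cell. V x \<bullet> gradient Z x) = - integral torus_cell (\<lambda>y. Z (0, y) * V (0, y) $ None)"
proof -
  let ?G = "\<lambda>x. V x \<bullet> gradient Z x"
  \<comment> \<open>The 3 keeps \<open>a n\<close> below 1/2, so that no box is empty.\<close>
  define a :: "nat \<Rightarrow> real" where "a n = 1 / (real n + 3)" for n
  define b :: "nat \<Rightarrow> real" where "b n = 1 - a n" for n
  have a: "0 < a n" "a n \<le> 1 / 3" for n by (auto simp: a_def field_simps)
  have ab: "0 < a n" "a n \<le> b n" "b n < 1" for n using a[of n] by (auto simp: b_def)
  have al: "a \<longlonglongrightarrow> 0" unfolding a_def
    by (rule tendsto_divide_0[OF tendsto_const filterlim_at_top_imp_at_infinity])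
       (rule filterlim_tendsto_add_at_top[OF tendsto_const filterlim_real_sequentially, of 3, simplified add.commute])
  have bl: "b \<longlonglongrightarrow> 1" using tendsto_diff[OF tendsto_const[of 1] al] by (simp add: b_def[abs_def])
  let ?Q = "\<lambda>n. cbox (a n, 0) (b n, \<chi> j. 1) :: 'm pt set"
  have sub: "?Q n \<subseteq> cell" for n using ab[of n] by (auto simp: cell_eq_cbox cbox_Pair_eq)
  have meas: "?G \<in> borel_measurable (lebesgue_on cell)" using flux_integrable by auto
  have Qs: "?Q n \<in> sets (lebesgue_on cell)" for n
    using sub[of n] cell_lebesgue by (subst sets_restrict_space_iff) auto
  have i1: "(\<lambda>n. LINT x|lebesgue_on cell. indicator (?Q n) x * ?G x) \<longlonglongrightarrow> (LINT x|lebesgue_on cell. ?G x)"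
  proof (rule integral_dominated_convergence[of _ _ _ "\<lambda>x. \<bar>?G x\<bar>"])
    show "(\<lambda>x. indicator (?Q n) x * ?G x) \<in> borel_measurable (lebesgue_on cell)" for n
      by (intro borel_measurable_times borel_measurable_indicator Qs meas)
    show "integrable (lebesgue_on cell) (\<lambda>x. \<bar>?G x\<bar>)" using flux_integrable by (rule integrable_abs)
    show "AE x in lebesgue_on cell. (\<lambda>n. indicator (?Q n) x * ?G x) \<longlonglongrightarrow> ?G x"
      using AE_cell_open_cyl AE_space
    proof eventually_elim
      fix x :: "'m pt" assume x: "x \<in> open_cyl" "x \<in> space (lebesgue_on cell)"
      obtain t y where ty: "x = (t, y)" by (cases x)
      have 1: "\<forall>\<^sub>F n in sequentially. a n < t" using x ty by (intro order_tendstoD(2)[OF al]) auto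
      have 2: "\<forall>\<^sub>F n in sequentially. t < b n" using x ty by (intro order_tendstoD(1)[OF bl]) auto
      have "\<forall>\<^sub>F n in sequentially. indicator (?Q n) x * ?G x = ?G x"
        using 1 2 by eventually_elim (use x ty in \<open>auto simp: indicator_def cbox_Pair_eq cell_def torus_cell_def\<close>)
      thus "(\<lambda>n. indicator (?Q n) x * ?G x) \<longlonglongrightarrow> ?G x" by (rule tendsto_eventually)
    qed
    show "AE x in lebesgue_on cell. norm (indicator (?Q n) x * ?G x) \<le> \<bar>?G x\<bar>" for n
      by (rule AE_I2) (auto simp: indicator_def)
  qed (rule meas)
  have i2: "(LINT x|lebesgue_on cell. indicator (?Q n) x * ?G x) = flux_int (b n) - flux_int (a n)" for n
  proof -
    have "integrable (lebesgue_on cell) (\<lambda>x. indicator (?Q n) x * ?G x)"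
    proof (rule Bochner_Integration.integrable_bound[OF flux_integrable])
      show "(\<lambda>x. indicator (?Q n) x * ?G x) \<in> borel_measurable (lebesgue_on cell)"
        by (intro borel_measurable_times borel_measurable_indicator Qs meas)
    qed (auto simp: indicator_def)
    hence "(LINT x|lebesgue_on cell. indicator (?Q n) x * ?G x) = integral cell (\<lambda>x. indicator (?Q n) x * ?G x)"
      by (rule lebesgue_integral_eq_integral[OF _ cell_lebesgue])
    also have "\<dots> = integral cell (\<lambda>x. if x \<in> ?Q n then ?G x else 0)"
      by (rule integral_cong) (simp add: indicator_def)
    also have "\<dots> = integral (?Q n) ?G" using sub[of n] by (simp add: integral_restrict_Int Int_absorb1 Int_absorb2)
    finally show ?thesis using flux_box[OF ab] by simp
  qed
  have cont: "continuous_on {0..1} flux_int"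
    unfolding flux_int_def torus_cell_def
  proof (rule integral_continuous_on_param)
    have "continuous_on M (\<lambda>x. Z x * V x $ None)"
      by (intro continuous_on_mult smooth_on_imp_continuous_on Z(1) smooth_on_UNIV_D(3)[OF V_smooth])
    hence "continuous_on ({0..1} \<times> cbox 0 (\<chi> j. 1)) (\<lambda>x. Z x * V x $ None)"
      by (rule continuous_on_subset) (auto simp: M_def)
    thus "continuous_on ({0..1} \<times> cbox 0 (\<chi> j. 1)) (\<lambda>(t, y). Z (t, y) * V (t, y) $ None)"
      by (simp add: split_beta)
  qed
  have 01: "a n \<in> {0..1}" "b n \<in> {0..1}" for n using ab[of n] by auto
  have "(\<lambda>n. flux_int (b n)) \<longlonglongrightarrow> flux_int 1"
    by (rule continuous_on_tendsto_compose[OF cont bl]) (simp_all add: 01 del: atLeastAtMost_iff, simp)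
  moreover have "(\<lambda>n. flux_int (a n)) \<longlonglongrightarrow> flux_int 0"
    by (rule continuous_on_tendsto_compose[OF cont al]) (simp_all add: 01 del: atLeastAtMost_iff, simp)
  ultimately have "(\<lambda>n. flux_int (b n) - flux_int (a n)) \<longlonglongrightarrow> flux_int 1 - flux_int 0" by (rule tendsto_diff)
  with i1 have "(LINT x|lebesgue_on cell. ?G x) = flux_int 1 - flux_int 0"
    unfolding i2 by (rule LIMSEQ_unique)
  thus ?thesis by (simp add: flux_int_def V_end)
qed

end

end

subsection \<open>Multiplication by smooth functions in Sobolev spaces\<close>

text \<open>Periodicity is asked for at all t, unlike in \<open>periodic\<close>: then the gradient
  is periodic at the ends too, where it depends on values outside \<open>M\<close>.\<close>

definition multiplier :: "('m::finite pt \<Rightarrow> real) \<Rightarrow> bool" where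
  "multiplier \<kappa> \<longleftrightarrow> smooth_on UNIV \<kappa> \<and> (\<forall>t y. \<forall>k\<in>lattice_pts. \<kappa> (t, y + k) = \<kappa> (t, y))"

lemma multiplier_smooth: "multiplier \<kappa> \<Longrightarrow> smooth_on UNIV \<kappa>"
  and multiplier_periodic: "multiplier \<kappa> \<Longrightarrow> periodic \<kappa>"
  by (auto simp: multiplier_def periodic_def)

lemma multiplier_gradient_continuous:
  assumes "multiplier \<kappa>" shows "continuous_on S (gradient \<kappa>)"
  unfolding gradient_def
  by (intro continuous_on_vec_lambda smooth_on_UNIV_D(4) multiplier_smooth[OF assms])

lemma multiplier_gradient_periodic:
  assumes "multiplier \<kappa>" shows "periodic (gradient \<kappa>)"
  unfolding periodic_def
proof (intro ballI allI)
  fix t and y k :: "real ^ 'a" assume k: "k \<in> lattice_pts"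
  have e: "\<kappa> x = \<kappa> (x + (0, k))" for x using assms k by (cases x) (simp add: multiplier_def)
  have "frechet_derivative \<kappa> (at (t, y)) = frechet_derivative (\<lambda>x. \<kappa> (x + (0, k))) (at (t, y))"
    using e by presburger
  also have "\<dots> = frechet_derivative \<kappa> (at ((t, y) + (0, k)))"
    by (rule fd_shift[OF smooth_on_UNIV_D(1)[OF multiplier_smooth[OF assms]]])
  finally show "gradient \<kappa> (t, y + k) = gradient \<kappa> (t, y)" by (simp add: gradient_def)
qed

lemma continuous_bounded_cell:
  fixes f :: "'m::finite pt \<Rightarrow> 'b::real_normed_vector"
  assumes "continuous_on cell f"
  obtains B where "0 \<le> B" "\<And>x. x \<in> cell \<Longrightarrow> norm (f x) \<le> B"
proof -
  have "bounded (f ` cell)" by (intro compact_imp_bounded compact_continuous_image assms compact_cell)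
  then obtain B where "\<forall>x\<in>cell. norm (f x) \<le> B" unfolding bounded_iff by auto
  thus ?thesis using that[of "\<bar>B\<bar>"] by force
qed

lemma multiplier_bound:
  assumes "multiplier \<kappa>"
  obtains B where "1 \<le> B" "\<And>x. x \<in> cell \<Longrightarrow> \<bar>\<kappa> x\<bar> \<le> B" "\<And>x. x \<in> cell \<Longrightarrow> norm (gradient \<kappa> x) \<le> B"
proof -
  obtain B where B: "0 \<le> B" "\<And>x. x \<in> cell \<Longrightarrow> norm (\<kappa> x) \<le> B"
    using continuous_bounded_cell[OF smooth_on_UNIV_D(3)[OF multiplier_smooth[OF assms]]] by blast
  obtain C where C: "0 \<le> C" "\<And>x. x \<in> cell \<Longrightarrow> norm (gradient \<kappa> x) \<le> C"
    using continuous_bounded_cell[OF multiplier_gradient_continuous[OF assms]] by blast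
  show ?thesis
  proof (rule that[of "B + C + 1"])
    show "\<bar>\<kappa> x\<bar> \<le> B + C + 1" if "x \<in> cell" for x using B(2)[OF that] C(1) by simp
    show "norm (gradient \<kappa> x) \<le> B + C + 1" if "x \<in> cell" for x using C(2)[OF that] B(1) by simp
  qed (use B C in simp)
qed

lemma gradient_mult:
  assumes "f differentiable (at x)" "g differentiable (at x)"
  shows "gradient (\<lambda>x. f x * g x) x = f x *\<^sub>R gradient g x + g x *\<^sub>R gradient f x"
  unfolding gradient_def by (simp add: vec_eq_iff fd_mult[OF assms] mult.commute)

lemma borel_measurable_cell_continuous:
  fixes f :: "'m::finite pt \<Rightarrow> 'b::euclidean_space"
  assumes "continuous_on UNIV f" shows "f \<in> borel_measurable (lebesgue_on cell)"
  by (rule borel_measurable_cellI) (rule continuous_on_subset[OF assms subset_UNIV])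

lemma L2_bound:
  fixes f :: "'m::finite pt \<Rightarrow> 'b::euclidean_space" and g :: "'m::finite pt \<Rightarrow> 'c::euclidean_space"
  assumes "periodic f" "f \<in> borel_measurable (lebesgue_on cell)" "L2 g"
    "\<And>x. x \<in> cell \<Longrightarrow> norm (f x) \<le> B * norm (g x)"
  shows "L2 f"
  unfolding L2_def
proof (intro conjI assms(1,2))
  have "integrable (lebesgue_on cell) (\<lambda>x. B\<^sup>2 * (norm (g x))\<^sup>2)" using assms(3) by (simp add: L2_def)
  thus "integrable (lebesgue_on cell) (\<lambda>x. (norm (f x))\<^sup>2)"
  proof (rule Bochner_Integration.integrable_bound)
    show "(\<lambda>x. (norm (f x))\<^sup>2) \<in> borel_measurable (lebesgue_on cell)" using assms(2) by simp
    have "(norm (f x))\<^sup>2 \<le> B\<^sup>2 * (norm (g x))\<^sup>2" if "x \<in> cell" for x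
      using power_mono[OF assms(4)[OF that], of 2] by (simp add: power_mult_distrib)
    thus "AE x in lebesgue_on cell. norm ((norm (f x))\<^sup>2) \<le> norm (B\<^sup>2 * (norm (g x))\<^sup>2)" by (intro AE_I2) simp
  qed
qed

lemma norm_add_sq: "(norm (a + b))\<^sup>2 \<le> 2 * (norm a)\<^sup>2 + 2 * (norm (b :: 'b::real_normed_vector))\<^sup>2"
proof -
  have "(norm (a + b))\<^sup>2 \<le> (norm a + norm b)\<^sup>2" by (intro power_mono norm_triangle_ineq) simp
  also have "\<dots> \<le> 2 * (norm a)\<^sup>2 + 2 * (norm b)\<^sup>2"
    using zero_le_power2[of "norm a - norm b"] by (simp add: power2_eq_square algebra_simps)
  finally show ?thesis .
qed

lemma L2_add:
  fixes f g :: "'m::finite pt \<Rightarrow> 'b::euclidean_space"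
  assumes "L2 f" "L2 g" shows "L2 (\<lambda>x. f x + g x)"
  unfolding L2_def
proof (intro conjI)
  show "periodic (\<lambda>x. f x + g x)" using assms by (simp add: L2_def periodic_def)
  show m: "(\<lambda>x. f x + g x) \<in> borel_measurable (lebesgue_on cell)"
    by (rule borel_measurable_add) (use assms in \<open>simp_all add: L2_def\<close>)
  have "integrable (lebesgue_on cell) (\<lambda>x. 2 * (norm (f x))\<^sup>2 + 2 * (norm (g x))\<^sup>2)"
    using assms by (simp add: L2_def)
  thus "integrable (lebesgue_on cell) (\<lambda>x. (norm (f x + g x))\<^sup>2)"
    by (rule Bochner_Integration.integrable_bound) (use m norm_add_sq in \<open>auto intro!: AE_I2\<close>)
qed

lemma integrable_mult_L2:
  fixes f g :: "'m::finite pt \<Rightarrow> real"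
  assumes "f \<in> borel_measurable (lebesgue_on cell)" "integrable (lebesgue_on cell) (\<lambda>x. (f x)\<^sup>2)"
    "g \<in> borel_measurable (lebesgue_on cell)" "integrable (lebesgue_on cell) (\<lambda>x. (g x)\<^sup>2)"
  shows "integrable (lebesgue_on cell) (\<lambda>x. f x * g x)"
proof -
  have "integrable (lebesgue_on cell) (\<lambda>x. (f x)\<^sup>2 + (g x)\<^sup>2)" using assms by simp
  thus ?thesis
  proof (rule Bochner_Integration.integrable_bound)
    have "\<bar>a * b\<bar> \<le> a\<^sup>2 + b\<^sup>2" for a b :: real
      using zero_le_power2[of "\<bar>a\<bar> - \<bar>b\<bar>"] mult_nonneg_nonneg[OF abs_ge_zero[of a] abs_ge_zero[of b]]
      by (simp only: power2_diff abs_mult power2_abs)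
    thus "AE x in lebesgue_on cell. norm (f x * g x) \<le> norm ((f x)\<^sup>2 + (g x)\<^sup>2)" by (intro AE_I2) simp
  qed (use assms in simp)
qed

lemma L2_component:
  fixes f :: "'m::finite pt \<Rightarrow> 'm covec"
  assumes "L2 f"
  shows "(\<lambda>x. f x $ i) \<in> borel_measurable (lebesgue_on cell)" "integrable (lebesgue_on cell) (\<lambda>x. (f x $ i)\<^sup>2)"
proof -
  have m: "f \<in> borel_measurable (lebesgue_on cell)" and n: "integrable (lebesgue_on cell) (\<lambda>x. (norm (f x))\<^sup>2)"
    using assms by (auto simp: L2_def)
  show m': "(\<lambda>x. f x $ i) \<in> borel_measurable (lebesgue_on cell)"
    by (rule measurable_compose[OF m borel_measurable_continuous_onI]) (intro continuous_intros)
  have "(v $ i)\<^sup>2 \<le> (norm v)\<^sup>2" for v :: "'m covec"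
    using power_mono[OF component_le_norm_cart[of v i] abs_ge_zero, of 2] by simp
  thus "integrable (lebesgue_on cell) (\<lambda>x. (f x $ i)\<^sup>2)"
    by (intro Bochner_Integration.integrable_bound[OF n]) (use m' in \<open>auto intro!: AE_I2\<close>)
qed

lemma integrable_sq_continuous:
  fixes f :: "'m::finite pt \<Rightarrow> real"
  assumes "continuous_on UNIV f"
  shows "integrable (lebesgue_on cell) (\<lambda>x. (f x)\<^sup>2)"
proof -
  have c: "continuous_on UNIV (\<lambda>x. (f x)\<^sup>2)" using assms by (intro continuous_intros)
  obtain B where "0 \<le> B" "\<And>x. x \<in> cell \<Longrightarrow> norm ((f x)\<^sup>2) \<le> B"
    using continuous_bounded_cell[OF continuous_on_subset[OF c subset_UNIV]] by blast
  thus ?thesis by (intro integrable_cellI[where B=B] borel_measurable_cell_continuous c) auto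
qed

lemma test_fun_mult:
  assumes "multiplier \<kappa>" "test_fun \<phi>" shows "test_fun (\<lambda>x. \<kappa> x * \<phi> x)"
proof -
  have "periodic (\<lambda>x. \<kappa> x * \<phi> x)" using multiplier_periodic[OF assms(1)] assms(2) by (simp add: periodic_def test_fun_def)
  moreover have "smooth_on UNIV (\<lambda>x. \<kappa> x * \<phi> x)"
    using assms(2) by (intro smooth_on_mult multiplier_smooth[OF assms(1)]) (simp add: test_fun_def)
  moreover obtain \<epsilon> where "\<epsilon> > 0" "\<forall>t y. \<phi> (t, y) \<noteq> 0 \<longrightarrow> \<epsilon> \<le> t \<and> t \<le> 1 - \<epsilon>"
    using assms(2) by (auto simp: test_fun_def)
  hence "\<exists>\<epsilon>>0. \<forall>t y. \<kappa> (t, y) * \<phi> (t, y) \<noteq> 0 \<longrightarrow> \<epsilon> \<le> t \<and> t \<le> 1 - \<epsilon>" by (intro exI[of _ \<epsilon>]) auto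
  ultimately show ?thesis by (simp add: test_fun_def)
qed

text \<open>The multiplier is moved to the test function: the weak derivative of \<open>u\<close> is
  tested with \<kappa>\<phi>, and the term u \<phi> \<nabla>\<kappa> of the product rule changes
  sides.\<close>

lemma H1_mult:
  fixes u :: "'m::finite pt \<Rightarrow> real"
  assumes k: "multiplier \<kappa>" and H: "H1 u du"
  shows "H1 (\<lambda>x. \<kappa> x * u x) (\<lambda>x. \<kappa> x *\<^sub>R du x + u x *\<^sub>R gradient \<kappa> x)"
proof -
  note ks = multiplier_smooth[OF k]
  have kc: "continuous_on UNIV \<kappa>" by (rule smooth_on_UNIV_D(3)[OF ks])
  have km: "\<kappa> \<in> borel_measurable (lebesgue_on cell)" by (rule borel_measurable_cell_continuous[OF kc])
  have gm: "gradient \<kappa> \<in> borel_measurable (lebesgue_on cell)"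
    by (rule borel_measurable_cell_continuous[OF multiplier_gradient_continuous[OF k]])
  obtain B where B: "1 \<le> B" "\<And>x. x \<in> cell \<Longrightarrow> \<bar>\<kappa> x\<bar> \<le> B" "\<And>x. x \<in> cell \<Longrightarrow> norm (gradient \<kappa> x) \<le> B"
    using multiplier_bound[OF k] by blast
  have u: "L2 u" and du: "L2 du" using H by (auto simp: H1_def)
  have um: "u \<in> borel_measurable (lebesgue_on cell)" and dum: "du \<in> borel_measurable (lebesgue_on cell)"
    and uI: "integrable (lebesgue_on cell) (\<lambda>x. (u x)\<^sup>2)"
    using u du by (auto simp: L2_def)
  have per: "periodic u" "periodic du" "periodic \<kappa>" "periodic (gradient \<kappa>)"
    using u du k by (auto simp: L2_def multiplier_periodic multiplier_gradient_periodic)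
  have 1: "L2 (\<lambda>x. \<kappa> x * u x)"
    by (rule L2_bound[OF _ _ u, of _ B])
       (use per km um B in \<open>auto simp: periodic_def abs_mult intro!: mult_right_mono\<close>)
  have "L2 (\<lambda>x. \<kappa> x *\<^sub>R du x)"
    by (rule L2_bound[OF _ _ du, of _ B])
       (use per km dum B in \<open>auto simp: periodic_def intro!: mult_right_mono\<close>)
  moreover have "L2 (\<lambda>x. u x *\<^sub>R gradient \<kappa> x)"
    by (rule L2_bound[OF _ _ u, of _ B])
       (use per um gm B in \<open>auto simp: periodic_def mult.commute[of B] intro!: mult_left_mono\<close>)
  ultimately have 2: "L2 (\<lambda>x. \<kappa> x *\<^sub>R du x + u x *\<^sub>R gradient \<kappa> x)" by (rule L2_add)
  have "(LINT x|lebesgue_on cell. (\<kappa> x * u x) * gradient \<phi> x $ i) =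
        - (LINT x|lebesgue_on cell. (\<kappa> x *\<^sub>R du x + u x *\<^sub>R gradient \<kappa> x) $ i * \<phi> x)" if \<phi>: "test_fun \<phi>" for \<phi> i
  proof -
    have ps: "smooth_on UNIV \<phi>" using \<phi> by (simp add: test_fun_def)
    have gc: "continuous_on UNIV (\<lambda>x. gradient f x $ i)" if "smooth_on UNIV f" for f :: "'m pt \<Rightarrow> real"
      unfolding gradient_def using smooth_on_UNIV_D(4)[OF that] by simp
    have "(LINT x|lebesgue_on cell. u x * gradient (\<lambda>x. \<kappa> x * \<phi> x) x $ i) =
        - (LINT x|lebesgue_on cell. du x $ i * (\<kappa> x * \<phi> x))"
      using H test_fun_mult[OF k \<phi>] by (simp add: H1_def)
    moreover have "gradient (\<lambda>x. \<kappa> x * \<phi> x) x = \<kappa> x *\<^sub>R gradient \<phi> x + \<phi> x *\<^sub>R gradient \<kappa> x" for x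
      by (rule gradient_mult[OF smooth_on_UNIV_D(1)[OF ks] smooth_on_UNIV_D(1)[OF ps]])
    moreover have "(LINT x|lebesgue_on cell. u x * (\<kappa> x *\<^sub>R gradient \<phi> x + \<phi> x *\<^sub>R gradient \<kappa> x) $ i) =
        (LINT x|lebesgue_on cell. (\<kappa> x * u x) * gradient \<phi> x $ i) + (LINT x|lebesgue_on cell. u x * (\<phi> x * gradient \<kappa> x $ i))"
    proof -
      have c1: "continuous_on UNIV (\<lambda>x. \<kappa> x * gradient \<phi> x $ i)" "continuous_on UNIV (\<lambda>x. \<phi> x * gradient \<kappa> x $ i)"
        by (intro continuous_on_mult kc gc ps ks smooth_on_UNIV_D(3)[OF ps])+
      have "integrable (lebesgue_on cell) (\<lambda>x. u x * (\<kappa> x * gradient \<phi> x $ i))"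
        "integrable (lebesgue_on cell) (\<lambda>x. u x * (\<phi> x * gradient \<kappa> x $ i))"
        by (intro integrable_mult_L2 um uI borel_measurable_cell_continuous c1 integrable_sq_continuous)+
      from Bochner_Integration.integral_add[OF this] show ?thesis by (simp add: algebra_simps)
    qed
    moreover have "(LINT x|lebesgue_on cell. (\<kappa> x *\<^sub>R du x + u x *\<^sub>R gradient \<kappa> x) $ i * \<phi> x) =
        (LINT x|lebesgue_on cell. du x $ i * (\<kappa> x * \<phi> x)) + (LINT x|lebesgue_on cell. u x * (\<phi> x * gradient \<kappa> x $ i))"
    proof -
      have c1: "continuous_on UNIV (\<lambda>x. \<kappa> x * \<phi> x)" "continuous_on UNIV (\<lambda>x. \<phi> x * gradient \<kappa> x $ i)"
        by (intro continuous_on_mult kc gc ps ks smooth_on_UNIV_D(3)[OF ps])+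
      have "integrable (lebesgue_on cell) (\<lambda>x. du x $ i * (\<kappa> x * \<phi> x))"
        "integrable (lebesgue_on cell) (\<lambda>x. u x * (\<phi> x * gradient \<kappa> x $ i))"
        by (intro integrable_mult_L2 um uI borel_measurable_cell_continuous c1 integrable_sq_continuous L2_component[OF du])+
      from Bochner_Integration.integral_add[OF this] show ?thesis by (simp add: algebra_simps)
    qed
    ultimately show ?thesis by simp
  qed
  thus ?thesis using 1 2 by (simp add: H1_def)
qed

text \<open>The integral of a non-integrable function is 0 by default, so comparing the integrals
  that measure convergence in H^1 presupposes integrability.\<close>

lemma H1_diff_integrable:
  fixes u :: "'m::finite pt \<Rightarrow> real"
  assumes X: "smooth_on M X" and u: "L2 u" "L2 du"
  shows "(\<lambda>x. (X x - u x)\<^sup>2 + (norm (gradient X x - du x))\<^sup>2) \<in> borel_measurable (lebesgue_on cell)"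
    and "integrable (lebesgue_on cell) (\<lambda>x. (X x - u x)\<^sup>2 + (norm (gradient X x - du x))\<^sup>2)"
proof -
  have Xc: "continuous_on M X" by (rule smooth_on_imp_continuous_on[OF X])
  have Xm: "X \<in> borel_measurable (lebesgue_on cell)"
    by (rule borel_measurable_cellI[OF continuous_on_subset[OF Xc]]) (auto simp: M_def)
  have gm: "gradient X \<in> borel_measurable (lebesgue_on cell)"
    by (rule borel_measurable_cellI[OF smooth_on_M_gradient(1)[OF X]])
  have um: "u \<in> borel_measurable (lebesgue_on cell)" "du \<in> borel_measurable (lebesgue_on cell)"
    using u by (auto simp: L2_def)
  show m: "(\<lambda>x. (X x - u x)\<^sup>2 + (norm (gradient X x - du x))\<^sup>2) \<in> borel_measurable (lebesgue_on cell)"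
    using Xm gm um by measurable
  obtain B where B: "0 \<le> B" "\<And>x. x \<in> cell \<Longrightarrow> norm (X x) \<le> B"
    using continuous_bounded_cell[OF continuous_on_subset[OF Xc cell_subset_M]] by blast
  obtain C where C: "0 \<le> C" "\<And>x. x \<in> cell \<inter> open_cyl \<Longrightarrow> norm (gradient X x) \<le> C"
    using smooth_on_M_gradient(3)[OF X] by blast
  have i: "integrable (lebesgue_on cell) (\<lambda>x. (2 * B\<^sup>2 + 2 * (u x)\<^sup>2) + (2 * C\<^sup>2 + 2 * (norm (du x))\<^sup>2))"
    using u finite_measure.integrable_const[OF finite_measure_cell]
    by (intro Bochner_Integration.integrable_add integrable_mult_right) (auto simp: L2_def)
  show "integrable (lebesgue_on cell) (\<lambda>x. (X x - u x)\<^sup>2 + (norm (gradient X x - du x))\<^sup>2)"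
  proof (rule Bochner_Integration.integrable_bound[OF i m])
    show "AE x in lebesgue_on cell. norm ((X x - u x)\<^sup>2 + (norm (gradient X x - du x))\<^sup>2)
        \<le> norm ((2 * B\<^sup>2 + 2 * (u x)\<^sup>2) + (2 * C\<^sup>2 + 2 * (norm (du x))\<^sup>2))"
      using AE_cell_open_cyl AE_space
    proof eventually_elim
      fix x :: "'m pt" assume "x \<in> open_cyl" "x \<in> space (lebesgue_on cell)"
      hence x: "x \<in> cell \<inter> open_cyl" by simp
      have "(X x - u x)\<^sup>2 \<le> 2 * (X x)\<^sup>2 + 2 * (u x)\<^sup>2" using norm_add_sq[of "X x" "- u x"] by simp
      moreover have "(X x)\<^sup>2 \<le> B\<^sup>2" using B(2)[of x] x power_mono[of "\<bar>X x\<bar>" B 2] by simp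
      moreover have "(norm (gradient X x - du x))\<^sup>2 \<le> 2 * (norm (gradient X x))\<^sup>2 + 2 * (norm (du x))\<^sup>2"
        using norm_add_sq[of "gradient X x" "- du x"] by simp
      moreover have "(norm (gradient X x))\<^sup>2 \<le> C\<^sup>2" using power_mono[OF C(2)[OF x] norm_ge_zero] .
      ultimately show "norm ((X x - u x)\<^sup>2 + (norm (gradient X x - du x))\<^sup>2)
        \<le> norm ((2 * B\<^sup>2 + 2 * (u x)\<^sup>2) + (2 * C\<^sup>2 + 2 * (norm (du x))\<^sup>2))" by simp
    qed
  qed
qed

lemma H1_converges_mult:
  fixes u :: "'m::finite pt \<Rightarrow> real"
  assumes k: "multiplier \<kappa>" and H: "H1 u du" and X: "\<And>n. smooth_on M (X n)" and c: "H1_converges X u du"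
  shows "H1_converges (\<lambda>n x. \<kappa> x * X n x) (\<lambda>x. \<kappa> x * u x) (\<lambda>x. \<kappa> x *\<^sub>R du x + u x *\<^sub>R gradient \<kappa> x)"
proof -
  obtain B where B: "1 \<le> B" "\<And>x. x \<in> cell \<Longrightarrow> \<bar>\<kappa> x\<bar> \<le> B" "\<And>x. x \<in> cell \<Longrightarrow> norm (gradient \<kappa> x) \<le> B"
    using multiplier_bound[OF k] by blast
  note ks = multiplier_smooth[OF k]
  have u: "L2 u" "L2 du" using H by (auto simp: H1_def)
  have u': "L2 (\<lambda>x. \<kappa> x * u x)" "L2 (\<lambda>x. \<kappa> x *\<^sub>R du x + u x *\<^sub>R gradient \<kappa> x)"
    using H1_mult[OF k H] by (auto simp: H1_def)
  have kX: "smooth_on M (\<lambda>x. \<kappa> x * X n x)" for n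
    by (intro smooth_on_mult X smooth_on_subset[OF ks]) simp
  let ?f = "\<lambda>n x. (X n x - u x)\<^sup>2 + (norm (gradient (X n) x - du x))\<^sup>2"
  let ?g = "\<lambda>n x. (\<kappa> x * X n x - \<kappa> x * u x)\<^sup>2 +
      (norm (gradient (\<lambda>x. \<kappa> x * X n x) x - (\<kappa> x *\<^sub>R du x + u x *\<^sub>R gradient \<kappa> x)))\<^sup>2"
  \<comment> \<open>One B^2 comes from the functions themselves and two from the part (X - u)
    \<nabla>\<kappa> of the gradients, hence 3 B^2.\<close>
  have le: "(LINT x|lebesgue_on cell. ?g n x) \<le> 3 * B\<^sup>2 * (LINT x|lebesgue_on cell. ?f n x)" for n
  proof -
    have "(LINT x|lebesgue_on cell. ?g n x) \<le> (LINT x|lebesgue_on cell. 3 * B\<^sup>2 * ?f n x)"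
    proof (rule integral_mono_AE)
      show "integrable (lebesgue_on cell) (?g n)" by (rule H1_diff_integrable(2)[OF kX u'])
      show "integrable (lebesgue_on cell) (\<lambda>x. 3 * B\<^sup>2 * ?f n x)"
        using H1_diff_integrable(2)[OF X u] by (rule integrable_mult_right)
      show "AE x in lebesgue_on cell. ?g n x \<le> 3 * B\<^sup>2 * ?f n x"
        using AE_cell_open_cyl AE_space
      proof eventually_elim
        fix x :: "'m pt" assume x0: "x \<in> open_cyl" "x \<in> space (lebesgue_on cell)"
        hence x: "x \<in> cell" by simp
        have g: "gradient (\<lambda>x. \<kappa> x * X n x) x = \<kappa> x *\<^sub>R gradient (X n) x + X n x *\<^sub>R gradient \<kappa> x"
          by (rule gradient_mult[OF smooth_on_UNIV_D(1)[OF ks] smooth_on_M_gradient(2)[OF X x0(1)]])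
        have k2: "(\<kappa> x)\<^sup>2 \<le> B\<^sup>2" using power_mono[OF B(2)[OF x], of 2] by simp
        have g2: "(norm (gradient \<kappa> x))\<^sup>2 \<le> B\<^sup>2" using power_mono[OF B(3)[OF x], of 2] by simp
        have "gradient (\<lambda>x. \<kappa> x * X n x) x - (\<kappa> x *\<^sub>R du x + u x *\<^sub>R gradient \<kappa> x) =
            \<kappa> x *\<^sub>R (gradient (X n) x - du x) + (X n x - u x) *\<^sub>R gradient \<kappa> x" unfolding g by (simp add: algebra_simps)
        hence "(norm (gradient (\<lambda>x. \<kappa> x * X n x) x - (\<kappa> x *\<^sub>R du x + u x *\<^sub>R gradient \<kappa> x)))\<^sup>2
            \<le> 2 * ((\<kappa> x)\<^sup>2 * (norm (gradient (X n) x - du x))\<^sup>2) + 2 * ((X n x - u x)\<^sup>2 * (norm (gradient \<kappa> x))\<^sup>2)"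
          using norm_add_sq[of "\<kappa> x *\<^sub>R (gradient (X n) x - du x)" "(X n x - u x) *\<^sub>R gradient \<kappa> x"]
          by (simp add: power_mult_distrib)
        moreover have "(\<kappa> x * X n x - \<kappa> x * u x)\<^sup>2 = (\<kappa> x)\<^sup>2 * (X n x - u x)\<^sup>2"
          by (simp add: power2_eq_square algebra_simps)
        moreover have "(\<kappa> x)\<^sup>2 * (X n x - u x)\<^sup>2 \<le> B\<^sup>2 * (X n x - u x)\<^sup>2"
          "(\<kappa> x)\<^sup>2 * (norm (gradient (X n) x - du x))\<^sup>2 \<le> B\<^sup>2 * (norm (gradient (X n) x - du x))\<^sup>2"
          by (intro mult_right_mono k2 zero_le_power2)+
        moreover have "(X n x - u x)\<^sup>2 * (norm (gradient \<kappa> x))\<^sup>2 \<le> (X n x - u x)\<^sup>2 * B\<^sup>2"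
          by (intro mult_left_mono g2 zero_le_power2)
        moreover have "0 \<le> B\<^sup>2 * (norm (gradient (X n) x - du x))\<^sup>2" by simp
        ultimately have "?g n x \<le> 3 * (B\<^sup>2 * (X n x - u x)\<^sup>2) + 3 * (B\<^sup>2 * (norm (gradient (X n) x - du x))\<^sup>2)"
          by (simp only: mult.commute[of "(X n x - u x)\<^sup>2" "B\<^sup>2"])
        thus "?g n x \<le> 3 * B\<^sup>2 * ?f n x" by (simp add: algebra_simps)
      qed
    qed
    thus ?thesis by simp
  qed
  have "(\<lambda>n. 3 * B\<^sup>2 * (LINT x|lebesgue_on cell. ?f n x)) \<longlonglongrightarrow> 3 * B\<^sup>2 * 0"
    using c unfolding H1_converges_def by (intro tendsto_mult tendsto_const)
  hence lim: "(\<lambda>n. 3 * B\<^sup>2 * (LINT x|lebesgue_on cell. ?f n x)) \<longlonglongrightarrow> 0" by simp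
  show ?thesis unfolding H1_converges_def
    by (rule tendsto_sandwich[OF _ _ tendsto_const lim])
       (use le in \<open>auto intro!: always_eventually Bochner_Integration.integral_nonneg\<close>)
qed

lemma H10_mult:
  assumes k: "multiplier \<kappa>" and H: "H10 u du"
  shows "H10 (\<lambda>x. \<kappa> x * u x) (\<lambda>x. \<kappa> x *\<^sub>R du x + u x *\<^sub>R gradient \<kappa> x)"
proof -
  obtain X where X: "\<forall>n. test_fun (X n)" "H1_converges X u du" and H1: "H1 u du" using H by (auto simp: H10_def)
  have s: "smooth_on M (X n)" for n
    by (rule smooth_on_subset[of UNIV]) (use X(1) in \<open>auto simp: test_fun_def\<close>)
  show ?thesis unfolding H10_def
    using H1_mult[OF k H1] H1_converges_mult[OF k H1 s X(2)] X(1) test_fun_mult[OF k]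
    by (intro conjI exI[of _ "\<lambda>n x. \<kappa> x * X n x"]) auto
qed

text \<open>Both \<open>H10\<close> and the functions with a trace that vanishes on the end \<open>t = 0\<close> satisfy this.\<close>

definition null_at_0 :: "('m::finite pt \<Rightarrow> real) \<Rightarrow> ('m pt \<Rightarrow> 'm covec) \<Rightarrow> bool" where
  "null_at_0 u du \<longleftrightarrow> H1 u du \<and> (\<exists>X. (\<forall>k. periodic (X k) \<and> smooth_on M (X k)) \<and> H1_converges X u du \<and>
     (\<lambda>k. integral torus_cell (\<lambda>y. (X k (0, y))\<^sup>2)) \<longlonglongrightarrow> 0)"

lemma H10_imp_null_at_0:
  assumes "H10 u du" shows "null_at_0 u du"
proof -
  obtain X where X: "\<And>k. test_fun (X k)" "H1_converges X u du" and H: "H1 u du" using assms by (auto simp: H10_def)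
  have "X k (0, y) = 0" for k y using X(1)[of k] by (force simp: test_fun_def)
  moreover have "periodic (X k) \<and> smooth_on M (X k)" for k
    using X(1)[of k] smooth_on_subset[of UNIV "X k" M] by (simp add: test_fun_def)
  ultimately show ?thesis unfolding null_at_0_def using H X(2) by (intro conjI exI[of _ X]) auto
qed

section \<open>Pairing the field with the differential of a product of Sobolev functions\<close>

lemma mult_le_weighted_squares:
  fixes a b s :: real
  assumes "0 < s" shows "\<bar>a\<bar> * \<bar>b\<bar> \<le> a\<^sup>2 / s + s * b\<^sup>2"
proof -
  have "0 \<le> (\<bar>a\<bar> / sqrt s - sqrt s * \<bar>b\<bar>)\<^sup>2" by simp
  also have "\<dots> = a\<^sup>2 / s + s * b\<^sup>2 - 2 * (\<bar>a\<bar> * \<bar>b\<bar>)"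
    using assms by (simp add: power2_diff power_mult_distrib power_divide)
  finally have "2 * (\<bar>a\<bar> * \<bar>b\<bar>) \<le> a\<^sup>2 / s + s * b\<^sup>2" by simp
  thus ?thesis using mult_nonneg_nonneg[OF abs_ge_zero[of a] abs_ge_zero[of b]] by linarith
qed

context flux_field begin

text \<open>The integrand is V applied to the product rule for u v. A product of H^1 functions need
  not be in H^1, so the identity is passed to the limit from products of smooth approximations;
  their boundary term at t = 0 tends to 0 because both restrictions do so in L^2.\<close>

lemma null_pairing:
  assumes u: "null_at_0 u du" and v: "null_at_0 v dv"
  shows "integrable (lebesgue_on cell) (\<lambda>x. V x \<bullet> (u x *\<^sub>R dv x + v x *\<^sub>R du x))"
    and "(LINT x|lebesgue_on cell. V x \<bullet> (u x *\<^sub>R dv x + v x *\<^sub>R du x)) = 0"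
proof -
  obtain X where X: "\<And>k. periodic (X k)" "\<And>k. smooth_on M (X k)" "H1_converges X u du"
    "(\<lambda>k. integral torus_cell (\<lambda>y. (X k (0, y))\<^sup>2)) \<longlonglongrightarrow> 0" and Hu: "H1 u du" using u by (auto simp: null_at_0_def)
  obtain Y where Y: "\<And>k. periodic (Y k)" "\<And>k. smooth_on M (Y k)" "H1_converges Y v dv"
    "(\<lambda>k. integral torus_cell (\<lambda>y. (Y k (0, y))\<^sup>2)) \<longlonglongrightarrow> 0" and Hv: "H1 v dv" using v by (auto simp: null_at_0_def)
  obtain B where B: "0 \<le> B" "\<And>x. x \<in> cell \<Longrightarrow> norm (V x) \<le> B" using V_bounded by blast
  have L: "L2 u" "L2 du" "L2 v" "L2 dv" using Hu Hv by (auto simp: H1_def)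
  have meas: "u \<in> borel_measurable (lebesgue_on cell)" "du \<in> borel_measurable (lebesgue_on cell)"
    "v \<in> borel_measurable (lebesgue_on cell)" "dv \<in> borel_measurable (lebesgue_on cell)"
    using L by (auto simp: L2_def)
  have Vm: "V \<in> borel_measurable (lebesgue_on cell)" by (rule borel_measurable_cell_continuous[OF V_continuous])
  let ?I = "\<lambda>x. V x \<bullet> (u x *\<^sub>R dv x + v x *\<^sub>R du x)"
  define P where "P x = (u x)\<^sup>2 + (norm (du x))\<^sup>2 + ((v x)\<^sup>2 + (norm (dv x))\<^sup>2)" for x
  have Pint: "integrable (lebesgue_on cell) P" using L unfolding P_def by (simp add: L2_def)
  have Im: "?I \<in> borel_measurable (lebesgue_on cell)" using meas Vm by measurable
  show Iint: "integrable (lebesgue_on cell) ?I"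
  proof (rule Bochner_Integration.integrable_bound)
    show "integrable (lebesgue_on cell) (\<lambda>x. B * P x)" using Pint by (rule integrable_mult_right)
    have "norm (?I x) \<le> norm (B * P x)" if "x \<in> cell" for x
    proof -
      have "norm (?I x) \<le> norm (V x) * norm (u x *\<^sub>R dv x + v x *\<^sub>R du x)" by (simp add: Cauchy_Schwarz_ineq2)
      also have "\<dots> \<le> B * (\<bar>u x\<bar> * norm (dv x) + \<bar>v x\<bar> * norm (du x))"
        using B(2)[OF that] B(1) norm_triangle_ineq[of "u x *\<^sub>R dv x" "v x *\<^sub>R du x"] by (intro mult_mono) auto
      also have "\<dots> \<le> B * P x"
        using mult_le_weighted_squares[of 1 "u x" "norm (dv x)"] mult_le_weighted_squares[of 1 "v x" "norm (du x)"]
        by (intro mult_left_mono B(1)) (simp add: P_def)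
      finally show ?thesis by simp
    qed
    thus "AE x in lebesgue_on cell. norm (?I x) \<le> norm (B * P x)" by (intro AE_I2) simp
  qed (rule Im)
  define p where "p k x = (X k x - u x)\<^sup>2 + (norm (gradient (X k) x - du x))\<^sup>2" for k x
  define q where "q k x = (Y k x - v x)\<^sup>2 + (norm (gradient (Y k) x - dv x))\<^sup>2" for k x
  have pint: "integrable (lebesgue_on cell) (p k)" for k
    unfolding p_def by (rule H1_diff_integrable(2)[OF X(2) L(1,2)])
  have qint: "integrable (lebesgue_on cell) (q k)" for k
    unfolding q_def by (rule H1_diff_integrable(2)[OF Y(2) L(3,4)])
  have pl: "(\<lambda>k. LINT x|lebesgue_on cell. p k x) \<longlonglongrightarrow> 0" using X(3) by (simp add: H1_converges_def p_def)
  have ql: "(\<lambda>k. LINT x|lebesgue_on cell. q k x) \<longlonglongrightarrow> 0" using Y(3) by (simp add: H1_converges_def q_def)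
  let ?Z = "\<lambda>k x. X k x * Y k x"
  have Zs: "smooth_on M (?Z k)" for k by (intro smooth_on_mult X Y)
  have Zp: "periodic (?Z k)" for k using X(1)[of k] Y(1)[of k] by (simp add: periodic_def)
  let ?J = "\<lambda>k. LINT x|lebesgue_on cell. V x \<bullet> gradient (?Z k) x"
  have Jint: "integrable (lebesgue_on cell) (\<lambda>x. V x \<bullet> gradient (?Z k) x)" for k
    by (rule flux_integrable[OF Zs Zp])
  have J0: "?J \<longlonglongrightarrow> 0"
  proof -
    let ?x = "\<lambda>k. integral torus_cell (\<lambda>y. (X k (0, y))\<^sup>2)" and ?y = "\<lambda>k. integral torus_cell (\<lambda>y. (Y k (0, y))\<^sup>2)"
    have c0: "continuous_on torus_cell (\<lambda>y. W (0, y))" if "smooth_on M W" for W :: "'m pt \<Rightarrow> real"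
      by (rule continuous_on_compose2[OF smooth_on_imp_continuous_on[OF that]]) (auto intro!: continuous_intros simp: M_def)
    have ii: "f integrable_on torus_cell" if "continuous_on torus_cell f" for f :: "real ^ 'm \<Rightarrow> real"
      using that unfolding torus_cell_def by (rule integrable_continuous)
    have Vc: "continuous_on torus_cell (\<lambda>y. V (0, y) $ None)"
      by (rule continuous_on_compose2[OF smooth_on_UNIV_D(3)[OF V_smooth, of UNIV None]]) (auto intro!: continuous_intros)
    have "norm (?J k) \<le> B * (?x k + ?y k)" for k
    proof -
      have "norm (?J k) = norm (integral torus_cell (\<lambda>y. ?Z k (0, y) * V (0, y) $ None))"
        unfolding flux_identity[OF Zs Zp] by simp
      also have "\<dots> \<le> integral torus_cell (\<lambda>y. B * ((X k (0, y))\<^sup>2 + (Y k (0, y))\<^sup>2))"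
      proof (rule integral_norm_bound_integral)
        show "(\<lambda>y. ?Z k (0, y) * V (0, y) $ None) integrable_on torus_cell"
          by (intro ii continuous_on_mult c0 X Y Vc)
        show "(\<lambda>y. B * ((X k (0, y))\<^sup>2 + (Y k (0, y))\<^sup>2)) integrable_on torus_cell"
          by (intro ii continuous_intros c0 X Y)
        fix y :: "real ^ 'm" assume y: "y \<in> torus_cell"
        have "norm (?Z k (0, y) * V (0, y) $ None) = \<bar>V (0, y) $ None\<bar> * (\<bar>X k (0, y)\<bar> * \<bar>Y k (0, y)\<bar>)"
          by (simp add: abs_mult mult.commute)
        also have "\<dots> \<le> B * ((X k (0, y))\<^sup>2 + (Y k (0, y))\<^sup>2)"
        proof (intro mult_mono B(1))
          have "(0, y) \<in> cell" using y by (simp add: cell_def)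
          thus "\<bar>V (0, y) $ None\<bar> \<le> B" using B(2) component_le_norm_cart[of "V (0, y)" None] by force
          show "\<bar>X k (0, y)\<bar> * \<bar>Y k (0, y)\<bar> \<le> (X k (0, y))\<^sup>2 + (Y k (0, y))\<^sup>2"
            using mult_le_weighted_squares[of 1 "X k (0, y)" "Y k (0, y)"] by simp
        qed simp
        finally show "norm (?Z k (0, y) * V (0, y) $ None) \<le> B * ((X k (0, y))\<^sup>2 + (Y k (0, y))\<^sup>2)" .
      qed
      also have "\<dots> = B * (?x k + ?y k)"
      proof -
        have "(\<lambda>y. (X k (0, y))\<^sup>2) integrable_on torus_cell" "(\<lambda>y. (Y k (0, y))\<^sup>2) integrable_on torus_cell"
          by (intro ii continuous_on_power c0 X Y)+
        from integral_add[OF this] show ?thesis by simp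
      qed
      finally show ?thesis .
    qed
    moreover have "(\<lambda>k. B * (?x k + ?y k)) \<longlonglongrightarrow> B * (0 + 0)" by (intro tendsto_intros X Y)
    ultimately show ?thesis by (intro Lim_null_comparison[of ?J "\<lambda>k. B * (?x k + ?y k)"]) simp_all
  qed
  \<comment> \<open>Mixed terms such as (X - u) dv are split with weights 1/s and s: the part with
    1/s tends to 0 with k, and the part with s multiplies a fixed integral. First k tends to
    infinity, then s becomes small.\<close>
  have key: "\<bar>(LINT x|lebesgue_on cell. ?I x)\<bar> \<le> s * (B * (2 * (LINT x|lebesgue_on cell. P x)))" if s: "0 < s" for s
  proof -
    have diff: "\<bar>?J k - (LINT x|lebesgue_on cell. ?I x)\<bar> \<le>
        B * ((2 + 1 / s) * ((LINT x|lebesgue_on cell. p k x) + (LINT x|lebesgue_on cell. q k x)) + 2 * s * (LINT x|lebesgue_on cell. P x))" for k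
    proof -
      let ?R = "\<lambda>x. B * ((2 + 1 / s) * (p k x + q k x) + 2 * s * P x)"
      have Rint: "integrable (lebesgue_on cell) ?R"
        by (intro integrable_mult_right Bochner_Integration.integrable_add pint qint Pint)
      have "\<bar>?J k - (LINT x|lebesgue_on cell. ?I x)\<bar> = norm (LINT x|lebesgue_on cell. V x \<bullet> gradient (?Z k) x - ?I x)"
        by (simp add: Bochner_Integration.integral_diff[OF Jint Iint])
      also have "\<dots> \<le> (LINT x|lebesgue_on cell. norm (V x \<bullet> gradient (?Z k) x - ?I x))" by (rule integral_norm_bound)
      also have "\<dots> \<le> (LINT x|lebesgue_on cell. ?R x)"
      proof (rule integral_mono_AE)
        show "AE x in lebesgue_on cell. norm (V x \<bullet> gradient (?Z k) x - ?I x) \<le> ?R x"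
          using AE_cell_open_cyl AE_space
        proof eventually_elim
          fix x :: "'m pt" assume x0: "x \<in> open_cyl" "x \<in> space (lebesgue_on cell)"
          hence x: "x \<in> cell" by simp
          define a where "a = X k x - u x"
          define b where "b = Y k x - v x"
          define da where "da = gradient (X k) x - du x"
          define db where "db = gradient (Y k) x - dv x"
          have "gradient (?Z k) x = X k x *\<^sub>R gradient (Y k) x + Y k x *\<^sub>R gradient (X k) x"
            by (rule gradient_mult[OF smooth_on_M_gradient(2)[OF X(2) x0(1)] smooth_on_M_gradient(2)[OF Y(2) x0(1)]])
          hence "gradient (?Z k) x - (u x *\<^sub>R dv x + v x *\<^sub>R du x)
             = (a *\<^sub>R db + a *\<^sub>R dv x + u x *\<^sub>R db) + (b *\<^sub>R da + b *\<^sub>R du x + v x *\<^sub>R da)"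
            by (simp add: a_def b_def da_def db_def algebra_simps)
          hence "norm (V x \<bullet> gradient (?Z k) x - ?I x) =
              \<bar>V x \<bullet> ((a *\<^sub>R db + a *\<^sub>R dv x + u x *\<^sub>R db) + (b *\<^sub>R da + b *\<^sub>R du x + v x *\<^sub>R da))\<bar>"
            by (simp add: inner_diff_right[symmetric])
          also have "\<dots> \<le> norm (V x) * norm ((a *\<^sub>R db + a *\<^sub>R dv x + u x *\<^sub>R db) + (b *\<^sub>R da + b *\<^sub>R du x + v x *\<^sub>R da))"
            by (rule Cauchy_Schwarz_ineq2)
          also have "\<dots> \<le> B * ((2 + 1 / s) * (p k x + q k x) + 2 * s * P x)"
          proof (intro mult_mono B(1) B(2)[OF x])
            have "norm ((a *\<^sub>R db + a *\<^sub>R dv x + u x *\<^sub>R db) + (b *\<^sub>R da + b *\<^sub>R du x + v x *\<^sub>R da)) \<le>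
              \<bar>a\<bar> * norm db + \<bar>a\<bar> * norm (dv x) + \<bar>u x\<bar> * norm db + (\<bar>b\<bar> * norm da + \<bar>b\<bar> * norm (du x) + \<bar>v x\<bar> * norm da)"
              by (intro norm_triangle_le add_mono) simp_all
            moreover have "\<bar>a\<bar> * norm db \<le> a\<^sup>2 + (norm db)\<^sup>2" "\<bar>b\<bar> * norm da \<le> b\<^sup>2 + (norm da)\<^sup>2"
              using mult_le_weighted_squares[of 1 a "norm db"] mult_le_weighted_squares[of 1 b "norm da"] by simp_all
            moreover have "\<bar>a\<bar> * norm (dv x) \<le> a\<^sup>2 / s + s * (norm (dv x))\<^sup>2" "\<bar>b\<bar> * norm (du x) \<le> b\<^sup>2 / s + s * (norm (du x))\<^sup>2"
              using mult_le_weighted_squares[OF s, of a "norm (dv x)"] mult_le_weighted_squares[OF s, of b "norm (du x)"] by simp_all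
            moreover have "\<bar>u x\<bar> * norm db \<le> (norm db)\<^sup>2 / s + s * (u x)\<^sup>2" "\<bar>v x\<bar> * norm da \<le> (norm da)\<^sup>2 / s + s * (v x)\<^sup>2"
              using mult_le_weighted_squares[OF s, of "norm db" "u x"] mult_le_weighted_squares[OF s, of "norm da" "v x"]
              by (simp_all add: mult.commute)
            moreover have "a\<^sup>2 + (norm db)\<^sup>2 + (b\<^sup>2 + (norm da)\<^sup>2) + (a\<^sup>2 / s + s * (norm (dv x))\<^sup>2) + (b\<^sup>2 / s + s * (norm (du x))\<^sup>2)
                + ((norm db)\<^sup>2 / s + s * (u x)\<^sup>2) + ((norm da)\<^sup>2 / s + s * (v x)\<^sup>2)
                = (1 + 1 / s) * (p k x + q k x) + s * P x"
              by (simp add: p_def q_def P_def a_def[symmetric] b_def[symmetric] da_def[symmetric] db_def[symmetric] algebra_simps)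
            moreover have "0 \<le> p k x + q k x" "0 \<le> s * P x" using s by (auto simp: p_def q_def P_def)
            moreover have "(2 + 1 / s) * (p k x + q k x) = (1 + 1 / s) * (p k x + q k x) + (p k x + q k x)"
              by (simp add: algebra_simps)
            ultimately show "norm ((a *\<^sub>R db + a *\<^sub>R dv x + u x *\<^sub>R db) + (b *\<^sub>R da + b *\<^sub>R du x + v x *\<^sub>R da))
              \<le> (2 + 1 / s) * (p k x + q k x) + 2 * s * P x" by linarith
          qed simp
          finally show "norm (V x \<bullet> gradient (?Z k) x - ?I x) \<le> ?R x" .
        qed
      qed (intro integrable_norm Bochner_Integration.integrable_diff Jint Iint Rint)+
      also have "\<dots> = B * ((2 + 1 / s) * ((LINT x|lebesgue_on cell. p k x) + (LINT x|lebesgue_on cell. q k x)) + 2 * s * (LINT x|lebesgue_on cell. P x))"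
        using pint[of k] qint[of k] Pint by simp
      finally show ?thesis .
    qed
    have "(\<lambda>k. \<bar>?J k - (LINT x|lebesgue_on cell. ?I x)\<bar>) \<longlonglongrightarrow> \<bar>0 - (LINT x|lebesgue_on cell. ?I x)\<bar>"
      by (intro tendsto_intros J0)
    moreover have "(\<lambda>k. B * ((2 + 1 / s) * ((LINT x|lebesgue_on cell. p k x) + (LINT x|lebesgue_on cell. q k x)) + 2 * s * (LINT x|lebesgue_on cell. P x)))
       \<longlonglongrightarrow> B * ((2 + 1 / s) * (0 + 0) + 2 * s * (LINT x|lebesgue_on cell. P x))"
      by (intro tendsto_intros pl ql)
    ultimately have "\<bar>0 - (LINT x|lebesgue_on cell. ?I x)\<bar> \<le> B * ((2 + 1 / s) * (0 + 0) + 2 * s * (LINT x|lebesgue_on cell. P x))"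
      by (rule LIMSEQ_le) (use diff in blast)
    thus ?thesis by (simp add: algebra_simps)
  qed
  show "(LINT x|lebesgue_on cell. ?I x) = 0"
  proof (rule ccontr)
    assume n: "(LINT x|lebesgue_on cell. ?I x) \<noteq> 0"
    define K where "K = B * (2 * (LINT x|lebesgue_on cell. P x))"
    have K: "0 \<le> K" unfolding K_def using B(1)
      by (intro mult_nonneg_nonneg Bochner_Integration.integral_nonneg) (auto simp: P_def)
    define I where "I = \<bar>LINT x|lebesgue_on cell. ?I x\<bar>"
    have I: "0 < I" using n by (simp add: I_def)
    \<comment> \<open>This choice of s makes the bound at most I/2, which contradicts I > 0; K + 1
      avoids a division by 0.\<close>
    have "I \<le> (I / (2 * (K + 1))) * K" using key[of "I / (2 * (K + 1))"] I K by (simp add: I_def K_def)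
    also have "\<dots> \<le> I / 2" using I K by (simp add: field_simps)
    finally show False using I by simp
  qed
qed

end

subsection \<open>Traces\<close>

lemma torus_cell_lebesgue: "torus_cell \<in> sets lebesgue" by (simp add: torus_cell_def)

lemma finite_measure_torus_cell: "finite_measure (lebesgue_on torus_cell)"
  by (rule finite_measure_lebesgue_on) (simp add: torus_cell_def)

lemma pair_sigma_finite_face:
  "pair_sigma_finite (count_space {0, 1 :: real}) (lebesgue_on (torus_cell :: (real ^ 'm::finite) set))"
  using finite_measure.axioms(1)[OF finite_measure_torus_cell] sigma_finite_measure_count_space_finite[of "{0, 1::real}"]
  by (simp add: pair_sigma_finite_def)

lemma sigma_finite_lebesgue: "sigma_finite_measure (lebesgue :: 'a::euclidean_space measure)"
proof -
  obtain A :: "'a set set" where "countable A" "A \<subseteq> sets lborel" "\<Union> A = space lborel" "\<forall>a\<in>A. emeasure lborel a \<noteq> \<infinity>"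
    using lborel.sigma_finite_countable by blast
  thus ?thesis by (intro sigma_finite_measure.intro exI[of _ A]) auto
qed

lemma face_integral:
  fixes f :: "'m::finite pt \<Rightarrow> real"
  assumes "\<And>t. t \<in> {0, 1} \<Longrightarrow> integrable (lebesgue_on torus_cell) (\<lambda>y. f (t, y))"
  shows "(LINT z|face_measure torus_cell. f z) =
    (LINT y|lebesgue_on torus_cell. f (0, y)) + (LINT y|lebesgue_on torus_cell. f (1, y))"
proof -
  interpret pair_sigma_finite "count_space {0, 1 :: real}" "lebesgue_on (torus_cell :: (real ^ 'm) set)"
    by (rule pair_sigma_finite_face)
  have m: "f \<in> borel_measurable (count_space {0, 1} \<Otimes>\<^sub>M lebesgue_on torus_cell)"
    by (rule measurable_pair_measure_countable1) (use assms in auto)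
  have "integrable (count_space {0, 1} \<Otimes>\<^sub>M lebesgue_on torus_cell) f"
    by (rule Fubini_integrable[OF m]) (use assms in \<open>auto simp: AE_count_space integrable_count_space\<close>)
  from integral_fst'[OF this] show ?thesis
    by (simp add: face_measure_def lebesgue_integral_count_space_finite)
qed

lemma L2_boundary_sections:
  fixes \<psi> :: "'m::finite pt \<Rightarrow> real"
  assumes "L2_boundary \<psi>" "t \<in> {0, 1}"
  shows "(\<lambda>y. \<psi> (t, y)) \<in> borel_measurable (lebesgue_on torus_cell)"
    "integrable (lebesgue_on torus_cell) (\<lambda>y. (\<psi> (t, y))\<^sup>2)"
proof -
  interpret pair_sigma_finite "count_space {0, 1 :: real}" "lebesgue_on (torus_cell :: (real ^ 'm) set)"
    by (rule pair_sigma_finite_face)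
  have m: "\<psi> \<in> borel_measurable (count_space {0, 1} \<Otimes>\<^sub>M lebesgue_on torus_cell)"
    and i: "integrable (count_space {0, 1} \<Otimes>\<^sub>M lebesgue_on torus_cell) (\<lambda>z. (\<psi> z)\<^sup>2)"
    using assms(1) by (simp_all add: L2_boundary_def face_measure_def)
  show "(\<lambda>y. \<psi> (t, y)) \<in> borel_measurable (lebesgue_on torus_cell)"
    by (rule measurable_compose[OF measurable_Pair1' m]) (use assms(2) in simp)
  show "integrable (lebesgue_on torus_cell) (\<lambda>y. (\<psi> (t, y))\<^sup>2)"
    using AE_integrable_fst'[OF i] assms(2) unfolding AE_count_space by (rule bspec)
qed

text \<open>Every point of the face t = 0 has a neighbourhood on which \<psi> vanishes almost
  everywhere. By the Lindeloef property countably many of them cover the face, and a countable union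
  of null sets is null.\<close>

lemma boundary_supp_Gamma1:
  fixes \<psi> :: "'m::finite pt \<Rightarrow> real"
  assumes "boundary_supp \<psi> \<subseteq> Gamma1"
  shows "AE y in lebesgue_on torus_cell. \<psi> (0, y) = 0"
proof -
  let ?F = "face_measure UNIV :: 'm pt measure"
  define \<U> where "\<U> = {U. open U \<and> (AE z in ?F. z \<in> U \<longrightarrow> \<psi> z = 0)}"
  obtain \<V> where V: "\<V> \<subseteq> \<U>" "countable \<V>" "\<Union>\<V> = \<Union>\<U>"
    using Lindelof[of \<U>] unfolding \<U>_def by blast
  have cov: "(0, y) \<in> \<Union>\<V>" for y :: "real ^ 'm"
  proof -
    have "(0, y) \<in> boundary_M" "(0, y) \<notin> Gamma1" by (auto simp: boundary_M_def Gamma1_def)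
    hence "(0, y) \<notin> boundary_supp \<psi>" using assms by blast
    hence "\<exists>U. open U \<and> (0, y) \<in> U \<and> (AE z in ?F. z \<in> U \<longrightarrow> \<psi> z = 0)"
      using \<open>(0, y) \<in> boundary_M\<close> unfolding boundary_supp_def by blast
    thus ?thesis unfolding V(3) \<U>_def by blast
  qed
  have "AE z in ?F. \<forall>U\<in>\<V>. z \<in> U \<longrightarrow> \<psi> z = 0"
    using V(1) by (subst AE_ball_countable[OF V(2)]) (auto simp: \<U>_def)
  hence "AE z in ?F. fst z = 0 \<longrightarrow> \<psi> z = 0"
  proof eventually_elim
    fix z :: "'m pt" assume z: "\<forall>U\<in>\<V>. z \<in> U \<longrightarrow> \<psi> z = 0"
    obtain t y where "z = (t, y)" by (cases z)
    thus "fst z = 0 \<longrightarrow> \<psi> z = 0" using z cov[of y] by auto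
  qed
  moreover have "pair_sigma_finite (count_space {0, 1 :: real}) (lebesgue_on (UNIV :: (real ^ 'm) set))"
    using sigma_finite_measure_restrict_space[OF sigma_finite_lebesgue, of "UNIV :: (real ^ 'm) set"]
      sigma_finite_measure_count_space_finite[of "{0, 1::real}"]
    by (simp add: pair_sigma_finite_def)
  ultimately have "AE t in count_space {0, 1 :: real}. AE y in lebesgue_on (UNIV :: (real ^ 'm) set). fst (t, y) = 0 \<longrightarrow> \<psi> (t, y) = 0"
    unfolding face_measure_def by (intro pair_sigma_finite.AE_pair)
  hence "AE y in lebesgue_on (UNIV :: (real ^ 'm) set). fst (0 :: real, y) = 0 \<longrightarrow> \<psi> (0, y) = 0"
    unfolding AE_count_space by (rule bspec) simp
  hence "AE y in lebesgue_on (UNIV :: (real ^ 'm) set). \<psi> (0, y) = 0" by simp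
  hence "AE y in (lebesgue :: (real ^ 'm) measure). \<psi> (0, y) = 0" by (subst (asm) AE_restrict_space_iff) auto
  hence "AE y in (lebesgue :: (real ^ 'm) measure). y \<in> torus_cell \<longrightarrow> \<psi> (0, y) = 0" by (rule eventually_mono) simp
  thus ?thesis using torus_cell_lebesgue by (subst AE_restrict_space_iff) auto
qed

lemma section_integrable:
  fixes X \<psi> :: "'m::finite pt \<Rightarrow> real"
  assumes X: "smooth_on M X" and \<psi>: "L2_boundary \<psi>" and t: "t \<in> {0, 1}"
  shows "integrable (lebesgue_on torus_cell) (\<lambda>y. (X (t, y) - \<psi> (t, y))\<^sup>2)"
    "integrable (lebesgue_on torus_cell) (\<lambda>y. (X (t, y))\<^sup>2)"
    "(\<lambda>y. X (t, y)) \<in> borel_measurable (lebesgue_on torus_cell)"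
proof -
  interpret finite_measure "lebesgue_on (torus_cell :: (real ^ 'm) set)" by (rule finite_measure_torus_cell)
  have c: "continuous_on torus_cell (\<lambda>y. X (t, y))"
    by (rule continuous_on_compose2[OF smooth_on_imp_continuous_on[OF X]])
       (use t in \<open>auto intro!: continuous_intros simp: M_def\<close>)
  show m: "(\<lambda>y. X (t, y)) \<in> borel_measurable (lebesgue_on torus_cell)"
    by (rule continuous_imp_measurable_on_sets_lebesgue[OF c torus_cell_lebesgue])
  have "compact ((\<lambda>y. X (t, y)) ` torus_cell)"
    by (rule compact_continuous_image[OF c]) (simp add: torus_cell_def compact_cbox)
  from compact_imp_bounded[OF this]
  obtain B where B: "\<forall>y\<in>torus_cell. norm (X (t, y)) \<le> B" by (auto simp: bounded_iff)
  have B2: "(X (t, y))\<^sup>2 \<le> B\<^sup>2" if "y \<in> torus_cell" for y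
    using power_mono[of "\<bar>X (t, y)\<bar>" B 2] B that by simp
  show i: "integrable (lebesgue_on torus_cell) (\<lambda>y. (X (t, y))\<^sup>2)"
    by (rule integrable_const_bound[of _ "B\<^sup>2"]) (use m B2 in \<open>auto intro!: AE_I2\<close>)
  note ps = L2_boundary_sections[OF \<psi> t]
  have i2: "integrable (lebesgue_on torus_cell) (\<lambda>y. 2 * (X (t, y))\<^sup>2 + 2 * (\<psi> (t, y))\<^sup>2)" using i ps(2) by simp
  show "integrable (lebesgue_on torus_cell) (\<lambda>y. (X (t, y) - \<psi> (t, y))\<^sup>2)"
  proof (rule Bochner_Integration.integrable_bound[OF i2])
    show "(\<lambda>y. (X (t, y) - \<psi> (t, y))\<^sup>2) \<in> borel_measurable (lebesgue_on torus_cell)" using m ps(1) by measurable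
    have "(a - b)\<^sup>2 \<le> 2 * a\<^sup>2 + 2 * b\<^sup>2" for a b :: real using norm_add_sq[of a "-b"] by simp
    thus "AE y in lebesgue_on torus_cell. norm ((X (t, y) - \<psi> (t, y))\<^sup>2) \<le> norm (2 * (X (t, y))\<^sup>2 + 2 * (\<psi> (t, y))\<^sup>2)"
      by (intro AE_I2) simp
  qed
qed

lemma trace_integral_0:
  fixes X \<psi> :: "'m::finite pt \<Rightarrow> real"
  assumes X: "smooth_on M X" and \<psi>: "L2_boundary \<psi>" and z: "AE y in lebesgue_on torus_cell. \<psi> (0, y) = 0"
  shows "(LINT y|lebesgue_on torus_cell. (X (0, y) - \<psi> (0, y))\<^sup>2) = (LINT y|lebesgue_on torus_cell. (X (0, y))\<^sup>2)"
  by (rule integral_cong_AE)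
     (use z section_integrable[OF X \<psi>, of 0] L2_boundary_sections[OF \<psi>, of 0] in \<open>auto elim: eventually_mono\<close>)

lemma has_traceD:
  assumes "has_trace u du \<psi>"
  shows "H1 u du" "L2_boundary \<psi>" "\<exists>X. (\<forall>k. periodic (X k) \<and> smooth_on M (X k)) \<and> H1_converges X u du \<and>
     (\<lambda>k. LINT z|face_measure torus_cell. (X k z - \<psi> z)\<^sup>2) \<longlonglongrightarrow> 0"
  using assms[unfolded has_trace_def] by (rule conjunct1, rule conjunct2[THEN conjunct1], rule conjunct2[THEN conjunct2])

text \<open>The integral over both faces dominates the one over t = 0, where the datum is zero, so
  the approximating functions tend to 0 there.\<close>

lemma has_trace_imp_null_at_0:
  assumes T: "has_trace u du \<psi>" and z: "AE y in lebesgue_on torus_cell. \<psi> (0, y) = 0"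
  shows "null_at_0 u du"
proof -
  note H = has_traceD(1)[OF T] and \<psi> = has_traceD(2)[OF T]
  from has_traceD(3)[OF T] obtain X where
    X0: "(\<forall>k. periodic (X k) \<and> smooth_on M (X k)) \<and> H1_converges X u du \<and>
      (\<lambda>k. LINT z|face_measure torus_cell. (X k z - \<psi> z)\<^sup>2) \<longlonglongrightarrow> 0" by (rule exE)
  note X = X0[THEN conjunct1, THEN spec, THEN conjunct1] X0[THEN conjunct1, THEN spec, THEN conjunct2]
    X0[THEN conjunct2, THEN conjunct1] X0[THEN conjunct2, THEN conjunct2]
  have "integral torus_cell (\<lambda>y. (X k (0, y))\<^sup>2) \<le> (LINT z|face_measure torus_cell. (X k z - \<psi> z)\<^sup>2)" for k
  proof -
    have "integral torus_cell (\<lambda>y. (X k (0, y))\<^sup>2) = (LINT y|lebesgue_on torus_cell. (X k (0, y))\<^sup>2)"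
      by (rule lebesgue_integral_eq_integral[symmetric, OF section_integrable(2)[OF X(2) \<psi>] torus_cell_lebesgue]) simp
    moreover have "(LINT z|face_measure torus_cell. (X k z - \<psi> z)\<^sup>2) =
        (LINT y|lebesgue_on torus_cell. (X k (0, y) - \<psi> (0, y))\<^sup>2) + (LINT y|lebesgue_on torus_cell. (X k (1, y) - \<psi> (1, y))\<^sup>2)"
      by (rule face_integral) (rule section_integrable(1)[OF X(2) \<psi>])
    moreover have "0 \<le> (LINT y|lebesgue_on torus_cell. (X k (1, y) - \<psi> (1, y))\<^sup>2)" by simp
    ultimately show ?thesis using trace_integral_0[OF X(2) \<psi> z] by simp
  qed
  moreover have "0 \<le> integral torus_cell (\<lambda>y. (X k (0, y))\<^sup>2)" for k
    by (rule Henstock_Kurzweil_Integration.integral_nonneg)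
       (use integrable_on_lebesgue_on[OF section_integrable(2)[OF X(2) \<psi>] torus_cell_lebesgue] in auto)
  ultimately have "(\<lambda>k. integral torus_cell (\<lambda>y. (X k (0, y))\<^sup>2)) \<longlonglongrightarrow> 0"
    by (intro tendsto_sandwich[OF _ _ tendsto_const X(4)]) (auto intro!: always_eventually)
  thus ?thesis unfolding null_at_0_def using H X(1-3) by (intro conjI exI[of _ X]) simp_all
qed

text \<open>On t = 1 the multiplier is 1 and on t = 0 the datum is 0 almost everywhere, so
  multiplication changes neither part of the datum.\<close>

lemma has_trace_mult:
  assumes k: "multiplier \<kappa>" "\<And>y. \<kappa> (1, y) = 1" and T: "has_trace u du \<psi>"
    and z: "AE y in lebesgue_on torus_cell. \<psi> (0, y) = 0"
  shows "has_trace (\<lambda>x. \<kappa> x * u x) (\<lambda>x. \<kappa> x *\<^sub>R du x + u x *\<^sub>R gradient \<kappa> x) \<psi>"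
proof -
  note H = has_traceD(1)[OF T] and \<psi> = has_traceD(2)[OF T]
  from has_traceD(3)[OF T] obtain X where
    X0: "(\<forall>k. periodic (X k) \<and> smooth_on M (X k)) \<and> H1_converges X u du \<and>
      (\<lambda>k. LINT z|face_measure torus_cell. (X k z - \<psi> z)\<^sup>2) \<longlonglongrightarrow> 0" by (rule exE)
  note X = X0[THEN conjunct1, THEN spec, THEN conjunct1] X0[THEN conjunct1, THEN spec, THEN conjunct2]
    X0[THEN conjunct2, THEN conjunct1] X0[THEN conjunct2, THEN conjunct2]
  obtain B where B: "1 \<le> B" "\<And>x. x \<in> cell \<Longrightarrow> \<bar>\<kappa> x\<bar> \<le> B" "\<And>x. x \<in> cell \<Longrightarrow> norm (gradient \<kappa> x) \<le> B"
    using multiplier_bound[OF k(1)] by blast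
  let ?Y = "\<lambda>n x. \<kappa> x * X n x"
  have Ys: "smooth_on M (?Y n)" for n
    by (intro smooth_on_mult X smooth_on_subset[OF multiplier_smooth[OF k(1)]]) simp
  have Yp: "periodic (?Y n)" for n using X(1)[of n] multiplier_periodic[OF k(1)] by (simp add: periodic_def)
  have face: "(LINT z|face_measure torus_cell. (W z - \<psi> z)\<^sup>2) =
        (LINT y|lebesgue_on torus_cell. (W (0, y))\<^sup>2) + (LINT y|lebesgue_on torus_cell. (W (1, y) - \<psi> (1, y))\<^sup>2)"
    if W: "smooth_on M W" for W
    unfolding trace_integral_0[OF W \<psi> z, symmetric] by (rule face_integral) (rule section_integrable(1)[OF W \<psi>])
  have le: "(LINT z|face_measure torus_cell. (?Y n z - \<psi> z)\<^sup>2) \<le> B\<^sup>2 * (LINT z|face_measure torus_cell. (X n z - \<psi> z)\<^sup>2)" for n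
  proof -
    have "(LINT y|lebesgue_on torus_cell. (?Y n (0, y))\<^sup>2) \<le> (LINT y|lebesgue_on torus_cell. B\<^sup>2 * (X n (0, y))\<^sup>2)"
    proof (rule integral_mono_AE)
      show "integrable (lebesgue_on torus_cell) (\<lambda>y. (?Y n (0, y))\<^sup>2)" by (rule section_integrable(2)[OF Ys \<psi>]) simp
      show "integrable (lebesgue_on torus_cell) (\<lambda>y. B\<^sup>2 * (X n (0, y))\<^sup>2)"
        by (intro integrable_mult_right section_integrable(2)[OF X(2) \<psi>]) simp
      have "(?Y n (0, y))\<^sup>2 \<le> B\<^sup>2 * (X n (0, y))\<^sup>2" if "y \<in> torus_cell" for y
      proof -
        have "(0, y) \<in> cell" using that by (simp add: cell_def)
        hence "(\<kappa> (0, y))\<^sup>2 \<le> B\<^sup>2" using power_mono[OF B(2), of "(0, y)" 2] by simp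
        thus ?thesis by (simp add: power_mult_distrib mult_right_mono)
      qed
      thus "AE y in lebesgue_on torus_cell. (?Y n (0, y))\<^sup>2 \<le> B\<^sup>2 * (X n (0, y))\<^sup>2" by (intro AE_I2) simp
    qed
    \<comment> \<open>Nothing changes on this face; as B is at least 1, the same factor serves for
      both faces.\<close>
    moreover have "1 * (LINT y|lebesgue_on torus_cell. (X n (1, y) - \<psi> (1, y))\<^sup>2) \<le> B\<^sup>2 * (LINT y|lebesgue_on torus_cell. (X n (1, y) - \<psi> (1, y))\<^sup>2)"
      using B(1) by (intro mult_right_mono Bochner_Integration.integral_nonneg) (auto simp: one_le_power)
    ultimately show ?thesis unfolding face[OF Ys] face[OF X(2)] by (simp add: k(2) distrib_left)
  qed
  have "(\<lambda>n. B\<^sup>2 * (LINT z|face_measure torus_cell. (X n z - \<psi> z)\<^sup>2)) \<longlonglongrightarrow> B\<^sup>2 * 0" by (intro tendsto_intros X)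
  hence l: "(\<lambda>n. B\<^sup>2 * (LINT z|face_measure torus_cell. (X n z - \<psi> z)\<^sup>2)) \<longlonglongrightarrow> 0" by (simp only: mult_zero_right)
  have "(\<lambda>n. LINT z|face_measure torus_cell. (?Y n z - \<psi> z)\<^sup>2) \<longlonglongrightarrow> 0"
  proof (rule tendsto_sandwich[OF _ _ tendsto_const l])
    show "\<forall>\<^sub>F n in sequentially. 0 \<le> (LINT z|face_measure torus_cell. (?Y n z - \<psi> z)\<^sup>2)"
      by (rule always_eventually, rule allI, rule Bochner_Integration.integral_nonneg, rule zero_le_power2)
    show "\<forall>\<^sub>F n in sequentially. (LINT z|face_measure torus_cell. (?Y n z - \<psi> z)\<^sup>2) \<le> B\<^sup>2 * (LINT z|face_measure torus_cell. (X n z - \<psi> z)\<^sup>2)"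
      by (rule always_eventually, rule allI, rule le)
  qed
  thus ?thesis unfolding has_trace_def
    by (intro conjI exI[of _ ?Y] allI H1_mult[OF k(1) H] \<psi> Ys Yp H1_converges_mult[OF k(1) H X(2,3)])
qed

subsection \<open>The gauge argument\<close>

text \<open>\<open>w\<close> is harmonic for \<open>g\<close> with vanishing Cauchy data (up to the constant 1) on \<open>\<Gamma>\<^sub>1\<close>, and
  \<open>A\<close> is \<open>sqrt |g| g^-1\<close>; then \<open>u \<mapsto> u / w\<close> maps solutions for \<open>g\<close> to solutions for \<open>g'\<close>.\<close>

locale gauge = flux_field V for V :: "'m::finite pt \<Rightarrow> 'm covec" +
  fixes w :: "'m pt \<Rightarrow> real" and A :: "'m metric" and g g' :: "'m metric"
  assumes w: "multiplier w" and w_pos: "\<And>x. 0 < w x" and w_end: "\<And>y. w (1, y) = 1"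
    and A_sym: "\<And>x a b. x \<in> M \<Longrightarrow> a \<bullet> (A x *v b) = b \<bullet> (A x *v a)"
    and V_eq: "\<And>x. x \<in> M \<Longrightarrow> V x = A x *v gradient w x"
    and g_A: "\<And>x a b. x \<in> M \<Longrightarrow> (a \<bullet> (matrix_inv (g x) *v b)) * sqrt (det (g x)) = a \<bullet> (A x *v b)"
    and g'_A: "\<And>x a b. x \<in> M \<Longrightarrow> (a \<bullet> (matrix_inv (g' x) *v b)) * sqrt (det (g' x)) = (w x)\<^sup>2 * (a \<bullet> (A x *v b))"
begin

text \<open>The power -1 stands for 1 / w, so that smoothness follows from
  \<open>smooth_on_powr\<close>.\<close>

definition "iw x = w x powr (- 1)"

lemma iw_eq: "iw x = 1 / w x"
  using w_pos[of x] by (simp add: iw_def powr_minus divide_inverse)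

lemma iw: "multiplier iw"
  unfolding multiplier_def iw_def
  by (intro conjI smooth_on_powr multiplier_smooth[OF w] w_pos) (use w in \<open>simp add: multiplier_def\<close>)

text \<open>The weak differential that \<open>H1_mult\<close> gives to \<kappa> u.\<close>

definition Tw where "Tw \<kappa> u du = (\<lambda>x. \<kappa> x *\<^sub>R du x + u x *\<^sub>R gradient \<kappa> x)" for \<kappa> u :: "'m pt \<Rightarrow> real"

lemma gradient_iw: "w x *\<^sub>R gradient iw x + iw x *\<^sub>R gradient w x = 0"
proof -
  have "gradient (\<lambda>x. w x * iw x) x = w x *\<^sub>R gradient iw x + iw x *\<^sub>R gradient w x"
    by (rule gradient_mult) (intro smooth_on_UNIV_D(1) multiplier_smooth w iw)+
  moreover have "(\<lambda>x. w x * iw x) = (\<lambda>x. 1)" using w_pos by (auto simp: iw_eq less_imp_neq[symmetric])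
  ultimately show ?thesis by (simp add: gradient_def zero_vec_def)
qed

lemma w_iw: "w x * (iw x * c) = c" "iw x * (w x * c) = c"
  using w_pos[of x] by (auto simp: iw_eq)

lemma Tw_inverse:
  "Tw w (\<lambda>x. iw x * u x) (Tw iw u du) = du" "Tw iw (\<lambda>x. w x * u x) (Tw w u du) = du"
proof -
  have "Tw w (\<lambda>x. iw x * u x) (Tw iw u du) x = (w x * iw x) *\<^sub>R du x + u x *\<^sub>R (w x *\<^sub>R gradient iw x + iw x *\<^sub>R gradient w x)" for x
    by (simp add: Tw_def algebra_simps)
  thus "Tw w (\<lambda>x. iw x * u x) (Tw iw u du) = du" using w_iw[of _ 1] by (auto simp: gradient_iw)
  have "Tw iw (\<lambda>x. w x * u x) (Tw w u du) x = (iw x * w x) *\<^sub>R du x + u x *\<^sub>R (w x *\<^sub>R gradient iw x + iw x *\<^sub>R gradient w x)" for x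
    by (simp add: Tw_def algebra_simps)
  thus "Tw iw (\<lambda>x. w x * u x) (Tw w u du) = du" using w_iw[of _ 1] by (auto simp: gradient_iw)
qed

lemma null_at_0_Tw:
  assumes "null_at_0 u du" "multiplier \<kappa>"
  shows "null_at_0 (\<lambda>x. \<kappa> x * u x) (Tw \<kappa> u du)"
proof -
  obtain X where X: "\<And>k. periodic (X k)" "\<And>k. smooth_on M (X k)" "H1_converges X u du"
    "(\<lambda>k. integral torus_cell (\<lambda>y. (X k (0, y))\<^sup>2)) \<longlonglongrightarrow> 0" and H: "H1 u du" using assms(1) by (auto simp: null_at_0_def)
  obtain B where B: "1 \<le> B" "\<And>x. x \<in> cell \<Longrightarrow> \<bar>\<kappa> x\<bar> \<le> B" "\<And>x. x \<in> cell \<Longrightarrow> norm (gradient \<kappa> x) \<le> B"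
    using multiplier_bound[OF assms(2)] by blast
  let ?Y = "\<lambda>n x. \<kappa> x * X n x"
  have Ys: "smooth_on M (?Y n)" for n
    by (intro smooth_on_mult X smooth_on_subset[OF multiplier_smooth[OF assms(2)]]) simp
  have Yp: "periodic (?Y n)" for n using X(1)[of n] multiplier_periodic[OF assms(2)] by (simp add: periodic_def)
  have ii: "(\<lambda>y. (W (0, y))\<^sup>2) integrable_on torus_cell" if "smooth_on M W" for W :: "'m pt \<Rightarrow> real"
    unfolding torus_cell_def
    by (intro integrable_continuous continuous_on_power continuous_on_compose2[OF smooth_on_imp_continuous_on[OF that]])
       (auto intro!: continuous_intros simp: M_def)
  have le: "integral torus_cell (\<lambda>y. (?Y n (0, y))\<^sup>2) \<le> B\<^sup>2 * integral torus_cell (\<lambda>y. (X n (0, y))\<^sup>2)" for n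
  proof -
    have "(?Y n (0, y))\<^sup>2 \<le> B\<^sup>2 * (X n (0, y))\<^sup>2" if "y \<in> torus_cell" for y
    proof -
      have "(0, y) \<in> cell" using that by (simp add: cell_def)
      hence "(\<kappa> (0, y))\<^sup>2 \<le> B\<^sup>2" using power_mono[OF B(2), of "(0, y)" 2] by simp
      thus ?thesis by (simp add: power_mult_distrib mult_right_mono)
    qed
    hence "integral torus_cell (\<lambda>y. (?Y n (0, y))\<^sup>2) \<le> integral torus_cell (\<lambda>y. B\<^sup>2 * (X n (0, y))\<^sup>2)"
      by (intro integral_le ii Ys integrable_on_mult_right X) auto
    thus ?thesis by simp
  qed
  have ge: "0 \<le> integral torus_cell (\<lambda>y. (?Y n (0, y))\<^sup>2)" for n
    by (rule Henstock_Kurzweil_Integration.integral_nonneg[OF ii[OF Ys]]) simp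
  have l: "(\<lambda>n. B\<^sup>2 * integral torus_cell (\<lambda>y. (X n (0, y))\<^sup>2)) \<longlonglongrightarrow> 0"
    using tendsto_mult[OF tendsto_const[of "B\<^sup>2"] X(4)] by simp
  have "(\<lambda>n. integral torus_cell (\<lambda>y. (?Y n (0, y))\<^sup>2)) \<longlonglongrightarrow> 0"
    by (rule tendsto_sandwich[OF always_eventually always_eventually tendsto_const l]) (rule allI, rule ge le)+
  thus ?thesis unfolding null_at_0_def Tw_def
    by (intro conjI exI[of _ ?Y] allI H1_mult[OF assms(2) H] Ys Yp H1_converges_mult[OF assms(2) H X(2,3)])
qed

lemma energy_gauge:
  assumes u: "null_at_0 u du" and v: "null_at_0 v dv"
  shows "energy g' (Tw iw u du) (Tw iw v dv) = energy g du dv"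
proof -
  let ?v = "\<lambda>x. iw x * v x" and ?dv = "Tw iw v dv"
  let ?P = "\<lambda>x. V x \<bullet> (u x *\<^sub>R ?dv x + ?v x *\<^sub>R du x)"
  let ?f = "\<lambda>x. du x \<bullet> (A x *v dv x)"
  note P = null_pairing[OF u null_at_0_Tw[OF v iw]]
  \<comment> \<open>Here w \<nabla>(u/w) = \<nabla>u - (u/w) \<nabla>w. When the bilinear form is
    expanded, the three terms with \<nabla>w are those of V applied to the differential of u v /
    w.\<close>
  have eq: "(w x)\<^sup>2 * (Tw iw u du x \<bullet> (A x *v ?dv x)) = ?f x - ?P x" if x: "x \<in> M" for x
  proof -
    define i where "i = iw x"
    define G where "G = gradient w x"
    have wi: "w x * i = 1" using w_iw(1)[of x 1] by (simp add: i_def)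
    have gi: "w x *\<^sub>R gradient iw x = - (i *\<^sub>R G)"
      using gradient_iw[of x] by (simp add: i_def G_def eq_neg_iff_add_eq_0)
    have T: "w x *\<^sub>R Tw iw f df x = df x - (f x * i) *\<^sub>R G" for f df
    proof -
      have "w x *\<^sub>R Tw iw f df x = (w x * i) *\<^sub>R df x + f x *\<^sub>R (w x *\<^sub>R gradient iw x)"
        by (simp add: Tw_def i_def algebra_simps)
      thus ?thesis by (simp add: wi gi)
    qed
    let ?b = "\<lambda>a b. a \<bullet> (A x *v b)"
    have lin: "?b (a - c) b = ?b a b - ?b c b" "?b a (b - c) = ?b a b - ?b a c" "?b (r *\<^sub>R a) b = r * ?b a b"
        "?b a (r *\<^sub>R b) = r * ?b a b" for a b c r
      by (simp_all add: inner_diff_left inner_diff_right matrix_vector_mult_diff_distrib matrix_vector_mult_scaleR)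
    have "(w x)\<^sup>2 * ?b (Tw iw u du x) (?dv x) = ?b (w x *\<^sub>R Tw iw u du x) (w x *\<^sub>R ?dv x)"
      by (simp add: lin power2_eq_square)
    also have "\<dots> = ?b (du x) (dv x) - v x * i * ?b (du x) G - u x * i * ?b G (dv x) + u x * i * (v x * i) * ?b G G"
      unfolding T by (simp add: lin algebra_simps)
    also have "?b (du x) G = ?b G (du x)" by (rule A_sym[OF x])
    finally have 1: "(w x)\<^sup>2 * ?b (Tw iw u du x) (?dv x) =
        ?f x - v x * i * ?b G (du x) - u x * i * ?b G (dv x) + u x * i * (v x * i) * ?b G G" .
    have "?dv x = i *\<^sub>R (w x *\<^sub>R ?dv x)" using wi by (simp add: mult.commute)
    also have "\<dots> = i *\<^sub>R (dv x - (v x * i) *\<^sub>R G)" unfolding T ..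
    finally have dv: "?dv x = i *\<^sub>R (dv x - (v x * i) *\<^sub>R G)" .
    have "V x \<bullet> a = ?b G a" for a
      using A_sym[OF x, of a G] by (simp add: V_eq[OF x] G_def inner_commute)
    hence "?P x = ?b G (u x *\<^sub>R ?dv x + (i * v x) *\<^sub>R du x)" by (simp add: i_def)
    also have "\<dots> = u x * i * ?b G (dv x) - u x * i * (v x * i) * ?b G G + v x * i * ?b G (du x)"
      unfolding dv by (simp add: matrix_vector_right_distrib inner_add_right lin algebra_simps)
    finally show ?thesis using 1 by simp
  qed
  have "energy g' (Tw iw u du) ?dv = (LINT x|lebesgue_on cell. ?f x - ?P x)"
    unfolding energy_def
    by (rule Bochner_Integration.integral_cong) (use cell_subset_M in \<open>auto simp: g'_A eq[symmetric]\<close>)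
  also have "\<dots> = (LINT x|lebesgue_on cell. ?f x)"
  \<comment> \<open>\<open>A\<close> carries no bound in this locale, so the energy density may fail
    to be integrable; then both densities fail to be, and both integrals have the default value
    0.\<close>
  proof (cases "integrable (lebesgue_on cell) ?f")
    case True
    thus ?thesis using P by (simp add: Bochner_Integration.integral_diff)
  next
    case False
    have "\<not> integrable (lebesgue_on cell) (\<lambda>x. ?f x - ?P x)"
    proof
      assume "integrable (lebesgue_on cell) (\<lambda>x. ?f x - ?P x)"
      from Bochner_Integration.integrable_add[OF this P(1)] show False using False by simp
    qed
    thus ?thesis using False by (simp add: not_integrable_integral_eq)
  qed
  also have "\<dots> = energy g du dv"
    unfolding energy_def
    by (rule Bochner_Integration.integral_cong) (use cell_subset_M in \<open>auto simp: g_A\<close>)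
  finally show ?thesis .
qed

text \<open>The descriptions under \<open>THE\<close> are shown to hold for the same numbers, so the
  two maps agree whatever \<open>THE\<close> returns. Division and multiplication by w are inverse
  to each other on solutions, on extensions of the data and on test functions, which gives both
  directions.\<close>

theorem DN_map_eq: "DN_map g' Gamma1 = DN_map g Gamma1"
proof -
  have "(\<exists>u du v dv. weak_solution g' \<psi> u du \<and> has_trace v dv \<phi> \<and> a = energy g' du dv) \<longleftrightarrow>
        (\<exists>u du v dv. weak_solution g \<psi> u du \<and> has_trace v dv \<phi> \<and> a = energy g du dv)"
    (is "?L \<longleftrightarrow> ?R") if "\<psi> \<in> H_half_co Gamma1" "\<phi> \<in> H_half_co Gamma1" for \<psi> \<phi> a
  proof -
    have z: "AE y in lebesgue_on torus_cell. \<psi> (0, y) = 0" "AE y in lebesgue_on torus_cell. \<phi> (0, y) = 0"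
      using that boundary_supp_Gamma1 by (auto simp: H_half_co_def)
    have iw_end: "iw (1, y) = 1" for y by (simp add: iw_eq w_end)
    have H10T: "H10 (\<lambda>x. \<kappa> x * u x) (Tw \<kappa> u du)" if "multiplier \<kappa>" "H10 u du" for \<kappa> u du
      unfolding Tw_def by (rule H10_mult[OF that])
    have trT: "has_trace (\<lambda>x. \<kappa> x * u x) (Tw \<kappa> u du) \<theta>"
      if "multiplier \<kappa>" "\<And>y. \<kappa> (1, y) = 1" "has_trace u du \<theta>" "AE y in lebesgue_on torus_cell. \<theta> (0, y) = 0" for \<kappa> u du \<theta>
      unfolding Tw_def by (rule has_trace_mult[OF that])
    have tH: "H1 u du" if "has_trace u du \<theta>" for u and du :: "'m pt \<Rightarrow> 'm covec" and \<theta> using that by (simp add: has_trace_def)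
    show ?thesis
    proof
      assume ?R
      then obtain u du v dv where s: "weak_solution g \<psi> u du" and t: "has_trace v dv \<phi>" and a: "a = energy g du dv" by blast
      have tu: "has_trace u du \<psi>" using s by (simp add: weak_solution_def)
      note n = has_trace_imp_null_at_0[OF tu z(1)] has_trace_imp_null_at_0[OF t z(2)]
      have t': "has_trace (\<lambda>x. iw x * u x) (Tw iw u du) \<psi>" by (rule trT[OF iw iw_end tu z(1)])
      have "energy g' (Tw iw u du) d\<eta> = 0" if "H10 \<eta> d\<eta>" for \<eta> d\<eta>
      proof -
        \<comment> \<open>A test function for g' is written as the quotient by w of a test function
          for g.\<close>
        have "energy g' (Tw iw u du) (Tw iw (\<lambda>x. w x * \<eta> x) (Tw w \<eta> d\<eta>)) = energy g du (Tw w \<eta> d\<eta>)"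
          by (rule energy_gauge[OF n(1) H10_imp_null_at_0[OF H10T[OF w that]]])
        also have "\<dots> = 0" using s H10T[OF w that] by (simp add: weak_solution_def)
        finally show ?thesis by (simp add: Tw_inverse)
      qed
      hence "weak_solution g' \<psi> (\<lambda>x. iw x * u x) (Tw iw u du)" unfolding weak_solution_def using t' tH[OF t'] by simp
      moreover have "has_trace (\<lambda>x. iw x * v x) (Tw iw v dv) \<phi>" by (rule trT[OF iw iw_end t z(2)])
      moreover have "a = energy g' (Tw iw u du) (Tw iw v dv)" using a energy_gauge[OF n] by simp
      ultimately show ?L by blast
    next
      assume ?L
      then obtain u du v dv where s: "weak_solution g' \<psi> u du" and t: "has_trace v dv \<phi>" and a: "a = energy g' du dv" by blast
      have tu: "has_trace u du \<psi>" using s by (simp add: weak_solution_def)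
      have t': "has_trace (\<lambda>x. w x * u x) (Tw w u du) \<psi>" by (rule trT[OF w w_end tu z(1)])
      have t2: "has_trace (\<lambda>x. w x * v x) (Tw w v dv) \<phi>" by (rule trT[OF w w_end t z(2)])
      note n = has_trace_imp_null_at_0[OF t' z(1)] has_trace_imp_null_at_0[OF t2 z(2)]
      have "energy g (Tw w u du) d\<eta> = 0" if "H10 \<eta> d\<eta>" for \<eta> d\<eta>
      proof -
        have "energy g' (Tw iw (\<lambda>x. w x * u x) (Tw w u du)) (Tw iw \<eta> d\<eta>) = energy g (Tw w u du) d\<eta>"
          by (rule energy_gauge[OF n(1) H10_imp_null_at_0[OF that]])
        moreover have "energy g' du (Tw iw \<eta> d\<eta>) = 0" using s H10T[OF iw that] by (simp add: weak_solution_def)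
        ultimately show ?thesis by (simp add: Tw_inverse)
      qed
      hence "weak_solution g \<psi> (\<lambda>x. w x * u x) (Tw w u du)" unfolding weak_solution_def using t' tH[OF t'] by simp
      moreover have "a = energy g (Tw w u du) (Tw w v dv)" using a energy_gauge[OF n] by (simp add: Tw_inverse)
      ultimately show ?R using t2 by blast
    qed
  qed
  thus ?thesis unfolding DN_map_def by (intro restrict_ext) simp
qed

end

subsection \<open>Modes of the Plis--Miller construction\<close>

locale step_profile =
  fixes S S1 S2 :: "real \<Rightarrow> real" and K :: real
  assumes S_tempered: "tempered (\<lambda>_. UNIV) (\<lambda>_. 1) (\<lambda>_. S)"
    "tempered (\<lambda>_. UNIV) (\<lambda>_. 1) (\<lambda>_. S1)" "tempered (\<lambda>_. UNIV) (\<lambda>_. 1) (\<lambda>_. S2)"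
    and S_deriv: "\<And>x. (S has_real_derivative S1 x) (at x)" "\<And>x. (S1 has_real_derivative S2 x) (at x)"
    and S_low: "\<And>x. x \<le> 0 \<Longrightarrow> S x = 0" and S_high: "\<And>x. 1 \<le> x \<Longrightarrow> S x = 1"
    and S_nonneg: "\<And>x. 0 \<le> S x" and S_le: "\<And>x. S x \<le> 1"
    and S1_zero: "\<And>x. x \<le> 0 \<or> 1 \<le> x \<Longrightarrow> S1 x = 0" and S2_zero: "\<And>x. x \<le> 0 \<or> 1 \<le> x \<Longrightarrow> S2 x = 0"
    and S1_le: "\<And>x. \<bar>S1 x\<bar> \<le> K" and S2_le: "\<And>x. \<bar>S2 x\<bar> \<le> K" and K: "1 \<le> K"

lemma ex_step_profile: "\<exists>S S1 S2 K. step_profile S S1 S2 K"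
proof -
  obtain S :: "real \<Rightarrow> real" where t: "tempered (\<lambda>_. UNIV) (\<lambda>_. 1) (\<lambda>_. S)" and lo: "\<forall>x\<le>0. S x = 0"
    and hi: "\<forall>x\<ge>1. S x = 1" and b: "\<forall>x. 0 \<le> S x" "\<forall>x. S x \<le> 1" using ex_smooth_step by blast
  have der: "(f has_real_derivative frechet_derivative f (at x) 1) (at x)"
    if "tempered (\<lambda>_. UNIV) (\<lambda>_. 1) (\<lambda>_. f)" for f :: "real \<Rightarrow> real" and x
  proof -
    have "f differentiable (at x)" by (rule temperedD(1)[OF that])
    then obtain d where "(f has_real_derivative d) (at x)" by (auto simp: real_differentiable_def)
    thus ?thesis using fd_real(1)[of f d x 1] by simp
  qed
  define S1 where "S1 x = frechet_derivative S (at x) 1" for x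
  define S2 where "S2 x = frechet_derivative S1 (at x) 1" for x
  have t1: "tempered (\<lambda>_. UNIV) (\<lambda>_. 1) (\<lambda>_. S1)" unfolding S1_def using temperedD(2)[OF t] .
  have t2: "tempered (\<lambda>_. UNIV) (\<lambda>_. 1) (\<lambda>_. S2)" unfolding S2_def using temperedD(2)[OF t1] .
  have d1: "(S has_real_derivative S1 x) (at x)" "(S1 has_real_derivative S2 x) (at x)" for x
    unfolding S1_def S2_def using der[OF t] der[OF t1] unfolding S1_def by blast+
  have bd: "\<exists>C. \<forall>x. \<bar>f x\<bar> \<le> C" if tf: "tempered (\<lambda>_. UNIV) (\<lambda>_. 1) (\<lambda>_. f)" for f :: "real \<Rightarrow> real"
  proof -
    obtain C N where "\<And>k x. \<bar>f x\<bar> \<le> C * (real k + 1) ^ N * 1"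
      using temperedD(3)[OF tf] unfolding poly_bounded_def by auto
    from this[where k=0] show ?thesis by auto
  qed
  obtain C1 C2 where C: "\<forall>x. \<bar>S1 x\<bar> \<le> C1" "\<forall>x. \<bar>S2 x\<bar> \<le> C2" using bd[OF t1] bd[OF t2] by blast
  have cont: "isCont S1 x" "isCont S2 x" for x
    using temperedD(1)[OF t1] temperedD(1)[OF t2] by (simp_all add: differentiable_imp_continuous_within)
  \<comment> \<open>Constancy determines the derivative only on the open outer intervals; at 0 and 1
    it follows by continuity from outside.\<close>
  have zero: "f' x = 0" if f: "\<And>x. (f has_real_derivative f' x) (at x)" "\<And>x. isCont f' x"
      and c: "(\<forall>x<0. f x = a) \<and> (\<forall>x>1. f x = e)" and x: "x \<le> 0 \<or> 1 \<le> x" for f f' :: "real \<Rightarrow> real" and a e x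
  proof -
    have 1: "f' y = 0" if y: "y < 0 \<or> 1 < y" for y
    proof -
      have "((\<lambda>x. if y < 0 then a else e) has_real_derivative f' y) (at y)"
        by (rule has_field_derivative_transform_within_open[OF f(1), where S="if y < 0 then {..<0} else {1<..}"])
           (use y c in \<open>auto split: if_splits\<close>)
      from DERIV_unique[OF this DERIV_const] show ?thesis .
    qed
    have "f' 0 = 0"
    proof -
      have "(f' \<longlongrightarrow> f' 0) (at_left 0)" using f(2)[of 0] by (simp add: isCont_def filterlim_at_split)
      moreover have "(f' \<longlongrightarrow> 0) (at_left 0)"
        by (rule Lim_transform_eventually[OF tendsto_const]) (use 1 in \<open>auto simp: eventually_at_left_field intro!: exI[of _ "-1"]\<close>)
      ultimately show ?thesis by (intro tendsto_unique[of "at_left 0"]) auto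
    qed
    moreover have "f' 1 = 0"
    proof -
      have "(f' \<longlongrightarrow> f' 1) (at_right 1)" using f(2)[of 1] by (simp add: isCont_def filterlim_at_split)
      moreover have "(f' \<longlongrightarrow> 0) (at_right 1)"
        by (rule Lim_transform_eventually[OF tendsto_const]) (use 1 in \<open>auto simp: eventually_at_right_field intro!: exI[of _ 2]\<close>)
      ultimately show ?thesis by (intro tendsto_unique[of "at_right 1"]) auto
    qed
    ultimately show ?thesis using 1 x by (cases "x = 0 \<or> x = 1") auto
  qed
  have z1: "S1 x = 0" if "x \<le> 0 \<or> 1 \<le> x" for x
    by (rule zero[OF d1(1) cont(1) _ that, of 0 1]) (use lo hi in auto)
  have z2: "S2 x = 0" if "x \<le> 0 \<or> 1 \<le> x" for x
    by (rule zero[OF d1(2) cont(2) _ that, of 0 0]) (use z1 in auto)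
  have "step_profile S S1 S2 (max 1 (max C1 C2))"
  proof
    show "\<bar>S1 x\<bar> \<le> max 1 (max C1 C2)" "\<bar>S2 x\<bar> \<le> max 1 (max C1 C2)" for x using C by (auto simp: le_max_iff_disj)
  qed (use t t1 t2 d1 lo hi b z1 z2 in auto)
  thus ?thesis by blast
qed

text \<open>For \<open>\<tau>\<close> in \<open>[0, 1]\<close>, the position within a strip, \<open>on\<close> rises on \<open>[1/4, 3/8]\<close> and \<open>off\<close> on
  \<open>[5/8, 3/4]\<close>, both while \<open>hump = 1\<close>; \<open>hump\<close> vanishes outside \<open>[1/8, 7/8]\<close>. Here and below, a suffix
  \<open>1\<close> or \<open>2\<close> denotes the first or second derivative.\<close>

context step_profile begin

definition "on \<tau> = S (8 * \<tau> - 2)"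
definition "on1 \<tau> = 8 * S1 (8 * \<tau> - 2)"
definition "on2 \<tau> = 64 * S2 (8 * \<tau> - 2)"
definition "off \<tau> = S (8 * \<tau> - 5)"
definition "off1 \<tau> = 8 * S1 (8 * \<tau> - 5)"
definition "off2 \<tau> = 64 * S2 (8 * \<tau> - 5)"
definition "hump \<tau> = S (8 * \<tau> - 1) * (1 - S (8 * \<tau> - 6))"
definition "hump1 \<tau> = 8 * S1 (8 * \<tau> - 1) * (1 - S (8 * \<tau> - 6)) - S (8 * \<tau> - 1) * (8 * S1 (8 * \<tau> - 6))"

lemma DERIV_affine:
  assumes "\<And>x. (f has_real_derivative f' x) (at x)"
  shows "((\<lambda>\<tau>. f (8 * \<tau> - d)) has_real_derivative 8 * f' (8 * \<tau> - d)) (at \<tau>)"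
proof -
  have "((\<lambda>\<tau>::real. 8 * \<tau> - d) has_real_derivative 8) (at \<tau>)" by (auto intro!: derivative_eq_intros)
  from DERIV_chain2[OF assms this] show ?thesis by (simp add: mult.commute)
qed

lemma profile_deriv:
  "(on has_real_derivative on1 \<tau>) (at \<tau>)" "(on1 has_real_derivative on2 \<tau>) (at \<tau>)"
  "(off has_real_derivative off1 \<tau>) (at \<tau>)" "(off1 has_real_derivative off2 \<tau>) (at \<tau>)"
  "(hump has_real_derivative hump1 \<tau>) (at \<tau>)"
  unfolding on_def[abs_def] on1_def[abs_def] on2_def off_def[abs_def] off1_def[abs_def] off2_def hump_def[abs_def] hump1_def
  by (auto intro!: derivative_eq_intros DERIV_affine[OF S_deriv(1)] DERIV_affine[OF S_deriv(2)])

lemma tempered_affine: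
  assumes "tempered (\<lambda>_. UNIV) (\<lambda>_. 1) (\<lambda>_. \<phi> :: real \<Rightarrow> real)"
  shows "tempered (\<lambda>_. UNIV) (\<lambda>_. 1) (\<lambda>_ \<tau>. \<phi> (8 * \<tau> - d))"
proof -
  have "poly_bounded (\<lambda>_. UNIV) (\<lambda>_. 1) (\<lambda>k (x::real). 8)" by (auto intro!: poly_boundedI[of 8 _ _ 0])
  from tempered_comp_real[OF assms this, where d="\<lambda>_. - d" and b=1] show ?thesis by simp
qed

lemma tempered_diff:
  assumes "tempered X (\<lambda>_. 1) F" "tempered X (\<lambda>_. 1) G"
  shows "tempered X (\<lambda>_. 1) (\<lambda>k x. F k x - G k x)"
  using tempered_add[OF _ assms(1) tempered_cmult[OF _ assms(2), of "-1"]] by simp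

lemma tempered_one: "tempered X (\<lambda>_. 1) (\<lambda>k x. c)"
  by (rule tempered_const) (auto intro!: poly_boundedI[of "\<bar>c\<bar>" _ _ 0])

lemma profile_tempered:
  "tempered (\<lambda>_. UNIV) (\<lambda>_. 1) (\<lambda>_. on)" "tempered (\<lambda>_. UNIV) (\<lambda>_. 1) (\<lambda>_. on1)" "tempered (\<lambda>_. UNIV) (\<lambda>_. 1) (\<lambda>_. on2)"
  "tempered (\<lambda>_. UNIV) (\<lambda>_. 1) (\<lambda>_. off)" "tempered (\<lambda>_. UNIV) (\<lambda>_. 1) (\<lambda>_. off1)" "tempered (\<lambda>_. UNIV) (\<lambda>_. 1) (\<lambda>_. off2)"
  "tempered (\<lambda>_. UNIV) (\<lambda>_. 1) (\<lambda>_. hump)" "tempered (\<lambda>_. UNIV) (\<lambda>_. 1) (\<lambda>_. hump1)"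
proof -
  note S = tempered_affine[OF S_tempered(1)] and S' = tempered_cmult[OF zero_le_one tempered_affine[OF S_tempered(2)]]
    and S'' = tempered_cmult[OF zero_le_one tempered_affine[OF S_tempered(3)]]
  note m = tempered_mult[OF zero_le_one]
  show "tempered (\<lambda>_. UNIV) (\<lambda>_. 1) (\<lambda>_. on)" "tempered (\<lambda>_. UNIV) (\<lambda>_. 1) (\<lambda>_. off)"
    unfolding on_def[abs_def] off_def[abs_def] by (rule S)+
  show "tempered (\<lambda>_. UNIV) (\<lambda>_. 1) (\<lambda>_. on1)" "tempered (\<lambda>_. UNIV) (\<lambda>_. 1) (\<lambda>_. off1)"
    unfolding on1_def[abs_def] off1_def[abs_def] by (rule S')+
  show "tempered (\<lambda>_. UNIV) (\<lambda>_. 1) (\<lambda>_. on2)" "tempered (\<lambda>_. UNIV) (\<lambda>_. 1) (\<lambda>_. off2)"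
    unfolding on2_def[abs_def] off2_def[abs_def] by (rule S'')+
  show "tempered (\<lambda>_. UNIV) (\<lambda>_. 1) (\<lambda>_. hump)"
    unfolding hump_def[abs_def] by (rule m[OF S tempered_diff[OF tempered_one S]])
  show "tempered (\<lambda>_. UNIV) (\<lambda>_. 1) (\<lambda>_. hump1)"
    unfolding hump1_def[abs_def] by (rule tempered_diff[OF m[OF S' tempered_diff[OF tempered_one S]] m[OF S S']])
qed

lemma profile_values:
  "\<tau> \<le> 1/4 \<Longrightarrow> on \<tau> = 0" "3/8 \<le> \<tau> \<Longrightarrow> on \<tau> = 1" "\<tau> \<le> 1/4 \<or> 3/8 \<le> \<tau> \<Longrightarrow> on1 \<tau> = 0" "\<tau> \<le> 1/4 \<or> 3/8 \<le> \<tau> \<Longrightarrow> on2 \<tau> = 0"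
  "\<tau> \<le> 5/8 \<Longrightarrow> off \<tau> = 0" "3/4 \<le> \<tau> \<Longrightarrow> off \<tau> = 1" "\<tau> \<le> 5/8 \<or> 3/4 \<le> \<tau> \<Longrightarrow> off1 \<tau> = 0" "\<tau> \<le> 5/8 \<or> 3/4 \<le> \<tau> \<Longrightarrow> off2 \<tau> = 0"
  "\<tau> \<le> 1/8 \<or> 7/8 \<le> \<tau> \<Longrightarrow> hump \<tau> = 0" "\<tau> \<le> 1/8 \<or> 7/8 \<le> \<tau> \<Longrightarrow> hump1 \<tau> = 0"
  "1/4 \<le> \<tau> \<Longrightarrow> \<tau> \<le> 3/4 \<Longrightarrow> hump \<tau> = 1"
  by (auto simp: on_def on1_def on2_def off_def off1_def off2_def hump_def hump1_def S_low S_high S1_zero S2_zero)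

lemma profile_bounds:
  "0 \<le> on \<tau>" "on \<tau> \<le> 1" "0 \<le> off \<tau>" "off \<tau> \<le> 1" "0 \<le> hump \<tau>" "hump \<tau> \<le> 1"
  "\<bar>on1 \<tau>\<bar> \<le> 8 * K" "\<bar>on2 \<tau>\<bar> \<le> 64 * K" "\<bar>off1 \<tau>\<bar> \<le> 8 * K" "\<bar>off2 \<tau>\<bar> \<le> 64 * K" "\<bar>hump1 \<tau>\<bar> \<le> 16 * K"
proof -
  show "0 \<le> on \<tau>" "on \<tau> \<le> 1" "0 \<le> off \<tau>" "off \<tau> \<le> 1" by (simp_all add: on_def off_def S_nonneg S_le)
  show "0 \<le> hump \<tau>" "hump \<tau> \<le> 1" by (simp_all add: hump_def S_nonneg S_le mult_le_one)
  show "\<bar>on1 \<tau>\<bar> \<le> 8 * K" "\<bar>on2 \<tau>\<bar> \<le> 64 * K" "\<bar>off1 \<tau>\<bar> \<le> 8 * K" "\<bar>off2 \<tau>\<bar> \<le> 64 * K"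
    by (simp_all add: on1_def on2_def off1_def off2_def abs_mult S1_le S2_le)
  have "\<bar>hump1 \<tau>\<bar> \<le> \<bar>8 * S1 (8 * \<tau> - 1)\<bar> * \<bar>1 - S (8 * \<tau> - 6)\<bar> + \<bar>S (8 * \<tau> - 1)\<bar> * \<bar>8 * S1 (8 * \<tau> - 6)\<bar>"
    unfolding hump1_def abs_mult[symmetric] by (rule abs_triangle_ineq4)
  also have "\<dots> \<le> (8 * K) * 1 + 1 * (8 * K)"
    using K S_nonneg S_le by (intro add_mono mult_mono) (simp_all add: abs_mult S1_le)
  finally show "\<bar>hump1 \<tau>\<bar> \<le> 16 * K" by simp
qed

lemma ex_hump_primitive: "\<exists>H. \<forall>\<tau>. (H has_real_derivative hump \<tau>) (at \<tau>)"
proof -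
  have "isCont hump x" for x using profile_deriv(5) by (rule DERIV_isCont)
  moreover have "hump x = 0" if "x \<le> 0" for x using that by (simp add: profile_values(9))
  ultimately show ?thesis using ex_antiderivative[of hump] by blast
qed

text \<open>Only differences of this primitive enter \<open>P\<close>, so any choice of it gives the
  same exponents.\<close>

definition "Hump = (SOME H. \<forall>\<tau>. (H has_real_derivative hump \<tau>) (at \<tau>))"

lemma Hump_deriv: "(Hump has_real_derivative hump \<tau>) (at \<tau>)"
  using someI_ex[OF ex_hump_primitive] by (simp add: Hump_def)

end

text \<open>Strip \<open>n\<close> is \<open>[T n, T (n + 1)]\<close>; since \<open>T 1 = 0\<close>, strip \<open>0\<close> lies outside the cylinder. Mode \<open>n\<close>
  is of size \<open>exp (- P n)\<close>; the slope of \<open>P n\<close> is \<open>lam n\<close> apart from a dip by the factor \<open>1 - c n\<close> in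
  strip \<open>n\<close>, during which mode \<open>n\<close> takes over from mode \<open>n - 1\<close>. The constants \<open>Mm\<close> normalise \<open>P n\<close> and
  \<open>P (n + 1)\<close> to agree at the midpoint of strip \<open>n + 1\<close>.\<close>

locale miller = step_profile S S1 S2 K for S S1 S2 :: "real \<Rightarrow> real" and K :: real +
  fixes T lam c :: "nat \<Rightarrow> real" and freq :: "nat \<Rightarrow> nat"
  assumes T_less: "\<And>n. T n < T (Suc n)" and T_1: "T 1 = 0" and T_lim: "T \<longlonglongrightarrow> 1"
    and lam_freq: "\<And>n. lam n = 2 * pi * real (freq n)" and freq_pos: "\<And>n. 0 < freq n"
    and c_pos: "\<And>n. 0 \<le> c n" and c_le: "\<And>n. c n \<le> 1"
    and lam_poly: "poly_bounded (\<lambda>_. UNIV :: real set) (\<lambda>_. 1) (\<lambda>n x. lam n)"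
    and L_poly: "poly_bounded (\<lambda>_. UNIV :: real set) (\<lambda>_. 1) (\<lambda>n x. 1 / (T (Suc n) - T n))"
    and growth: "\<And>n. 2 \<le> lam n * (T (Suc (Suc n)) - T (Suc n))"
    and gap: "\<And>n. 8 * (real n + 1) \<le> (lam n - lam (Suc n) * (1 - c (Suc n))) * (T (Suc (Suc n)) - T (Suc n))"
begin

definition "L n = T (Suc n) - T n"
definition "tau n t = (t - T n) / L n"
text \<open>The excess of the old decay rate over the rate of the new mode during its dip; it is
  positive because \<open>c\<close> exceeds the relative step of the frequencies.\<close>

definition "gam n = lam n - lam (Suc n) * (1 - c (Suc n))"
definition "mid n = (T n + T (Suc n)) / 2"
definition "rate n t = lam n * (1 - c n * hump (tau n t))"
definition "rate1 n t = - (lam n * c n * hump1 (tau n t) / L n)"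
definition "R n t = lam n * (t - c n * L n * Hump (tau n t))"
definition "Mm n = (\<Sum>k<n. R k (mid (Suc k)) - R k (mid k))"
definition "P n t = R n t - R n (mid n) + Mm n"

section \<open>Decay of the modes\<close>

lemma L_pos: "0 < L n" using T_less[of n] by (simp add: L_def)

lemma lam_ge: "1 \<le> lam n"
proof -
  have "1 * 1 \<le> (2 * pi) * real (freq n)" using freq_pos[of n] pi_gt3 by (intro mult_mono) auto
  thus ?thesis by (simp add: lam_freq)
qed

lemma lam_pos: "0 < lam n" using lam_ge[of n] by simp

lemma tau_deriv: "(tau n has_real_derivative 1 / L n) (at t)"
  unfolding tau_def[abs_def] using L_pos[of n] by (auto intro!: derivative_eq_intros)

lemma DERIV_tau: "(f has_real_derivative d) (at (tau n t)) \<Longrightarrow> ((\<lambda>t. f (tau n t)) has_real_derivative d / L n) (at t)"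
  using DERIV_chain2[OF _ tau_deriv] by simp

lemma rate_deriv: "(rate n has_real_derivative rate1 n t) (at t)"
  unfolding rate_def[abs_def] rate1_def
  by (auto intro!: derivative_eq_intros DERIV_tau[OF profile_deriv(5)])

lemma P_deriv: "(P n has_real_derivative rate n t) (at t)"
  unfolding P_def[abs_def] R_def[abs_def] rate_def using L_pos[of n]
  by (auto intro!: derivative_eq_intros DERIV_tau[OF Hump_deriv] simp: field_simps)

lemma rate_nonneg: "0 \<le> rate n t"
  using lam_pos[of n] mult_le_one[OF c_le[of n] profile_bounds(5) profile_bounds(6)] c_pos[of n]
  by (auto simp: rate_def intro!: mult_nonneg_nonneg)

lemma P_mono: "s \<le> t \<Longrightarrow> P n s \<le> P n t"
  by (rule DERIV_nonneg_imp_nondecreasing) (use P_deriv rate_nonneg in blast)+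

lemma T_mono: "m \<le> n \<Longrightarrow> T m \<le> T n"
  by (rule lift_Suc_mono_le[of T]) (use T_less in \<open>auto intro: less_imp_le\<close>)

lemma T_less_1: "T n < 1"
proof -
  have "T (Suc n) \<le> 1" by (rule LIMSEQ_le_const[OF T_lim]) (use T_mono in blast)
  thus ?thesis using T_less[of n] by simp
qed

lemma mid_bounds: "T n < mid n" "mid n < T (Suc n)" "mid n - T n = L n / 2" "T (Suc n) - mid n = L n / 2"
  using T_less[of n] by (auto simp: mid_def L_def field_simps)

lemma tau_Suc: "T (Suc n) \<le> t \<Longrightarrow> 1 \<le> tau n t"
  using L_pos[of n] by (auto simp: tau_def L_def field_simps)

lemma P_mid: "P n (mid n) = Mm n" "P n (mid (Suc n)) = Mm (Suc n)"
  by (simp_all add: P_def Mm_def)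

text \<open>Beyond strip n the dip of mode n is over, and its rate is the constant
  \<open>lam n\<close>.\<close>

lemma P_linear_old:
  assumes "T (Suc n) \<le> s" "s \<le> t" shows "P n t - P n s = lam n * (t - s)"
proof (cases "s = t")
  case False
  hence "s < t" using assms by simp
  from MVT2[OF this, of "P n" "rate n"] obtain z where z: "s < z" "z < t" "P n t - P n s = (t - s) * rate n z"
    using P_deriv by blast
  have "tau n z \<ge> 1" using tau_Suc[of n z] z(1) assms(1) by simp
  hence "rate n z = lam n" by (simp add: rate_def profile_values(9))
  thus ?thesis using z(3) by simp
qed simp

text \<open>Between consecutive midpoints the exponent gains at least \<open>lam n\<close> times
  half the width of strip n + 1, which is at least 1 by \<open>growth\<close>.\<close>

lemma Mm_ge: "real n \<le> Mm n"
proof (induction n)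
  case (Suc n)
  have "Mm (Suc n) - Mm n = P n (mid (Suc n)) - P n (mid n)" by (simp add: P_mid)
  moreover have "P n (mid n) \<le> P n (T (Suc n))" using mid_bounds(2)[of n] by (intro P_mono) simp
  moreover have "P n (mid (Suc n)) - P n (T (Suc n)) = lam n * (L (Suc n) / 2)"
    using P_linear_old[of n "T (Suc n)" "mid (Suc n)"] mid_bounds[of "Suc n"] by simp
  moreover have "lam n * (L (Suc n) / 2) \<ge> 1" using growth[of n] by (simp add: L_def)
  ultimately show ?case using Suc by simp
qed (simp add: Mm_def)

lemma gam: "8 * (real n + 1) \<le> gam n * L (Suc n)" "0 < gam n"
proof -
  show 1: "8 * (real n + 1) \<le> gam n * L (Suc n)" using gap[of n] by (simp add: gam_def L_def)
  have "0 < gam n * L (Suc n)" using 1 by (rule less_le_trans[rotated]) simp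
  thus "0 < gam n" using L_pos[of "Suc n"] zero_less_mult_pos2 by blast
qed

text \<open>On the middle half of strip \<open>n + 1\<close> the new mode decays more slowly than the old one, and the
  two modes are balanced at the midpoint.\<close>

lemma P_diff_linear:
  assumes "1/4 \<le> tau (Suc n) t" "tau (Suc n) t \<le> 3/4"
  shows "P n t - P (Suc n) t = gam n * (t - mid (Suc n))"
proof -
  have tz: "1/4 \<le> tau (Suc n) z \<and> tau (Suc n) z \<le> 3/4 \<and> T (Suc n) \<le> z"
    if "min t (mid (Suc n)) \<le> z" "z \<le> max t (mid (Suc n))" for z
  proof -
    have m: "tau (Suc n) (mid (Suc n)) = 1/2"
      using mid_bounds(3)[of "Suc n"] L_pos[of "Suc n"] by (simp add: tau_def)
    have mono: "tau (Suc n) a \<le> tau (Suc n) b" if "a \<le> b" for a b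
      using that L_pos[of "Suc n"] by (simp add: tau_def divide_right_mono)
    have "1/4 \<le> tau (Suc n) z" using mono[OF that(1)] m assms by (auto simp: min_def split: if_splits)
    moreover have "tau (Suc n) z \<le> 3/4" using mono[OF that(2)] m assms by (auto simp: max_def split: if_splits)
    moreover have "T (Suc n) \<le> z" using \<open>1/4 \<le> tau (Suc n) z\<close> L_pos[of "Suc n"] by (simp add: tau_def field_simps)
    ultimately show ?thesis by blast
  qed
  let ?F = "\<lambda>z. P n z - P (Suc n) z - gam n * z"
  have d: "(?F has_real_derivative 0) (at z)" if "min t (mid (Suc n)) \<le> z" "z \<le> max t (mid (Suc n))" for z
  proof -
    have "rate n z = lam n" using tau_Suc[of n z] tz[OF that] by (simp add: rate_def profile_values(9))
    moreover have "rate (Suc n) z = lam (Suc n) * (1 - c (Suc n))" using tz[OF that] by (simp add: rate_def profile_values(11))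
    ultimately have "rate n z - rate (Suc n) z - gam n = 0" by (simp add: gam_def)
    thus ?thesis using DERIV_diff[OF DERIV_diff[OF P_deriv[of n z] P_deriv[of "Suc n" z]] DERIV_cmult_Id[of "gam n"]] by simp
  qed
  have "?F t = ?F (mid (Suc n))"
  proof (cases t "mid (Suc n)" rule: linorder_cases)
    case less
    have "?F (mid (Suc n)) = ?F t"
      by (rule DERIV_isconst2[OF less]) (use d less in \<open>auto intro!: continuous_at_imp_continuous_on DERIV_isCont\<close>)
    thus ?thesis by simp
  next
    case greater
    show ?thesis
      by (rule DERIV_isconst2[OF greater]) (use d greater in \<open>auto intro!: continuous_at_imp_continuous_on DERIV_isCont\<close>)
  qed simp
  thus ?thesis by (simp add: P_mid algebra_simps)
qed

lemma tau_T: "tau n (T n + r * L n) = r" using L_pos[of n] by (simp add: tau_def)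

text \<open>At the quarter point of strip n, where it is switched on, mode n is still no larger than
  mode n - 1, which by then is at most exp (-(n - 1)). This costs the factor exp 1; mode 0 has no
  predecessor and is bounded by its value at T 0.\<close>

lemma exp_P_bound: "\<exists>C\<ge>0. \<forall>n t. T n + L n / 4 \<le> t \<longrightarrow> exp (- P n t) \<le> C * exp (- real n)"
proof -
  let ?C = "max (exp 1) (exp (- P 0 (T 0)))"
  have "exp (- P n t) \<le> ?C * exp (- real n)" if t: "T n + L n / 4 \<le> t" for n t
  proof (cases n)
    case 0
    have "P 0 (T 0) \<le> P 0 t" using t L_pos[of 0] 0 by (intro P_mono) simp
    thus ?thesis using 0 by (simp add: le_max_iff_disj)
  next
    case (Suc m)
    let ?s = "T n + L n / 4"
    have ts: "tau (Suc m) ?s = 1/4" using tau_T[of "Suc m" "1/4"] Suc by simp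
    have "Mm m = P m (mid m)" by (simp add: P_mid)
    also have "\<dots> \<le> P m ?s" using mid_bounds(2)[of m] L_pos[of n] Suc by (intro P_mono) simp
    also have "\<dots> \<le> P n ?s"
    proof -
      have "?s \<le> mid (Suc m)" using mid_bounds(3)[of "Suc m"] L_pos[of "Suc m"] Suc by simp
      hence "gam m * (?s - mid (Suc m)) \<le> 0" using gam(2)[of m] by (simp add: mult_nonneg_nonpos)
      thus ?thesis using P_diff_linear[of m ?s] ts Suc by simp
    qed
    also have "\<dots> \<le> P n t" by (rule P_mono[OF t])
    finally have "- P n t \<le> 1 + (- real n)" using Mm_ge[of m] Suc by simp
    hence "exp (- P n t) \<le> exp 1 * exp (- real n)" by (simp add: exp_add[symmetric])
    also have "\<dots> \<le> ?C * exp (- real n)" by (intro mult_right_mono) auto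
    finally show ?thesis .
  qed
  thus ?thesis by (intro exI[of _ ?C]) (auto simp: le_max_iff_disj)
qed

end

lemma fd_line:
  fixes F :: "'m::finite pt \<Rightarrow> real"
  assumes "F differentiable (at x)" "((\<lambda>s. F (x + s *\<^sub>R v)) has_real_derivative d) (at 0)"
  shows "frechet_derivative F (at x) v = d"
proof -
  have "((\<lambda>s. F (x + s *\<^sub>R v)) has_real_derivative frechet_derivative F (at (x + 0 *\<^sub>R v)) v) (at 0)"
    by (rule has_real_derivative_line) (use assms(1) in simp)
  from DERIV_unique[OF this assms(2)] show ?thesis by simp
qed

text \<open>Series of this kind dominate every tempered sequence with weight exp (-k).\<close>

lemma summable_poly_exp: "summable (\<lambda>k. (real k + 1) ^ N * exp (- real k))"
proof (rule summable_comparison_test_ev)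
  have "((\<lambda>x::real. (x + 1) ^ (N + 2) / exp (x + 1)) \<longlongrightarrow> 0) at_top"
    by (rule filterlim_compose[OF tendsto_power_div_exp_0])
       (rule filterlim_tendsto_add_at_top[OF tendsto_const filterlim_ident, of 1, simplified add.commute])
  from filterlim_compose[OF this filterlim_real_sequentially]
  have "(\<lambda>k. (real k + 1) ^ (N + 2) / exp (real k + 1)) \<longlonglongrightarrow> 0" .
  hence "\<forall>\<^sub>F k in sequentially. (real k + 1) ^ (N + 2) / exp (real k + 1) < 1" by (rule order_tendstoD) simp
  thus "\<forall>\<^sub>F k in sequentially. norm ((real k + 1) ^ N * exp (- real k)) \<le> exp 1 * inverse ((real (Suc k)) ^ 2)"
  proof eventually_elim
    case (elim k)
    have "(real k + 1) ^ N * (real k + 1) ^ 2 \<le> exp (real k + 1)"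
      using elim by (simp add: power_add[symmetric] field_simps)
    also have "\<dots> = exp 1 * exp (real k)" by (simp add: exp_add mult.commute)
    finally have "(real k + 1) ^ N * exp (- real k) \<le> exp 1 / (real k + 1) ^ 2"
      by (simp add: field_simps exp_minus)
    thus ?case by (simp add: divide_inverse add.commute)
  qed
  show "summable (\<lambda>k. exp 1 * inverse ((real (Suc k)) ^ 2))"
  proof (rule summable_mult)
    have "summable (\<lambda>k. inverse (real k ^ 2))" using inverse_power_summable[of 2, where ?'a=real] by simp
    thus "summable (\<lambda>k. inverse (real (Suc k) ^ 2))" by (subst summable_Suc_iff)
  qed
qed

text \<open>Mode \<open>n\<close> is switched on in strip \<open>n\<close> and off in strip \<open>n + 1\<close>. The terms \<open>fon\<close> and \<open>foff\<close> are
  the errors in the equation caused by the switching, and \<open>ron\<close> and \<open>roff\<close> their sizes relative to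
  \<open>exp (- P n)\<close>.\<close>

locale miller_dirs = miller S S1 S2 K T lam c freq
  for S S1 S2 :: "real \<Rightarrow> real" and K :: real and T lam c :: "nat \<Rightarrow> real" and freq :: "nat \<Rightarrow> nat" +
  fixes p q :: "'m::finite"
  assumes pq: "p \<noteq> q"
begin

definition "dir n = (if even n then p else q)" for n :: nat

lemma dir_Suc: "dir (Suc n) \<noteq> dir n" "dir (Suc (Suc n)) = dir n" using pq by (auto simp: dir_def)

definition "om n t = on (tau n t) * (1 - off (tau (Suc n) t))"
definition "om1 n t = on1 (tau n t) / L n - off1 (tau (Suc n) t) / L (Suc n)"
definition "om2 n t = on2 (tau n t) / (L n)\<^sup>2 - off2 (tau (Suc n) t) / (L (Suc n))\<^sup>2"
definition "E n t = exp (- P n t)"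
definition "U n t = om n t * E n t"
definition "U1 n t = (om1 n t - rate n t * om n t) * E n t"
definition "U2 n t = (om2 n t - rate1 n t * om n t - 2 * rate n t * om1 n t + (rate n t)\<^sup>2 * om n t) * E n t"
definition "ron n t = 2 * (on1 (tau n t) / L n) * rate n t - on2 (tau n t) / (L n)\<^sup>2"
definition "roff n t = off2 (tau (Suc n) t) / (L (Suc n))\<^sup>2 - 2 * (off1 (tau (Suc n) t) / L (Suc n)) * rate n t"
definition "fon n t = ron n t * E n t"
definition "foff n t = roff n t * E n t"
definition "G n t = ((rate n t)\<^sup>2 - rate1 n t) * om n t * E n t"

text \<open>\<open>G\<close> is the part of \<open>U2\<close> in which the cutoff is not
  differentiated; the flux in the direction of the mode compensates it. What remains are the terms
  with derivatives of \<open>on\<close> and of \<open>off\<close>, kept apart because they are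
  absorbed with the help of different partner modes.\<close>

lemma balance: "U2 n t - G n t + fon n t + foff n t = 0"
  by (simp add: U2_def G_def fon_def foff_def ron_def roff_def om1_def om2_def algebra_simps)

lemma tau_neg: "t \<le> T n \<Longrightarrow> tau n t \<le> 0"
  using L_pos[of n] by (simp add: tau_def divide_nonpos_pos)

text \<open>The two transition zones lie in different strips: where one factor varies the other is
  1, so the product rule yields a plain difference.\<close>

lemma om_deriv: "(om n has_real_derivative om1 n t) (at t)"
proof -
  have "(om n has_real_derivative on1 (tau n t) / L n * (1 - off (tau (Suc n) t)) + on (tau n t) * (0 - off1 (tau (Suc n) t) / L (Suc n))) (at t)"
    unfolding om_def[abs_def]
    by (auto intro!: derivative_eq_intros DERIV_tau[OF profile_deriv(1)] DERIV_tau[OF profile_deriv(3)])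
  moreover have "on1 (tau n t) / L n * (1 - off (tau (Suc n) t)) + on (tau n t) * (0 - off1 (tau (Suc n) t) / L (Suc n)) = om1 n t"
  proof (cases "t \<le> T (Suc n)")
    case True
    thus ?thesis using tau_neg[of t "Suc n"] by (simp add: om1_def profile_values)
  next
    case False
    thus ?thesis using tau_Suc[of n t] by (simp add: om1_def profile_values)
  qed
  ultimately show ?thesis by simp
qed

lemma om1_deriv: "(om1 n has_real_derivative om2 n t) (at t)"
  unfolding om1_def[abs_def] om2_def power2_eq_square divide_divide_eq_left[symmetric]
  by (intro DERIV_diff DERIV_cdivide DERIV_tau profile_deriv)

lemma E_deriv: "(E n has_real_derivative - rate n t * E n t) (at t)"
  unfolding E_def[abs_def] by (auto intro!: derivative_eq_intros P_deriv)

lemma U_deriv: "(U n has_real_derivative U1 n t) (at t)" "(U1 n has_real_derivative U2 n t) (at t)"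
  unfolding U_def[abs_def] U1_def[abs_def] U2_def
  by (auto intro!: derivative_eq_intros om_deriv om1_deriv E_deriv rate_deriv simp: algebra_simps power2_eq_square)

definition St :: "nat \<Rightarrow> 'm pt set" where
  "St n = {x. T n + L n / 4 \<le> fst x \<and> fst x \<le> T (Suc n) + 3 / 4 * L (Suc n)}"

lemma closed_St: "closed (St n)"
  unfolding St_def by (intro closed_Collect_conj closed_Collect_le continuous_intros)

lemma support:
  assumes "x \<notin> St n"
  shows "om n (fst x) = 0" "om1 n (fst x) = 0" "ron n (fst x) = 0" "roff n (fst x) = 0"
proof -
  consider "fst x < T n + L n / 4" | "T (Suc n) + 3 / 4 * L (Suc n) < fst x" using assms by (auto simp: St_def)
  hence "om n (fst x) = 0 \<and> om1 n (fst x) = 0 \<and> ron n (fst x) = 0 \<and> roff n (fst x) = 0"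
  proof cases
    case 1
    have "T n + L n / 4 \<le> T (Suc n)" 
    proof -
      have "a + (b - a) / 4 \<le> b" if "a < b" for a b :: real using that by (simp add: field_simps)
      from this[OF T_less[of n]] show ?thesis unfolding L_def .
    qed
    hence "tau n (fst x) \<le> 1/4" "tau (Suc n) (fst x) \<le> 0"
      using 1 L_pos[of n] tau_neg[of "fst x" "Suc n"] by (auto simp: tau_def field_simps)
    thus ?thesis by (simp add: om_def om1_def ron_def roff_def profile_values)
  next
    case 2
    have "tau n (fst x) \<ge> 1" using 2 L_pos[of "Suc n"] by (intro tau_Suc) simp
    moreover have "tau (Suc n) (fst x) \<ge> 3/4" using 2 L_pos[of "Suc n"] by (simp add: tau_def field_simps)
    ultimately show ?thesis by (simp add: om_def om1_def ron_def roff_def profile_values)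
  qed
  thus "om n (fst x) = 0" "om1 n (fst x) = 0" "ron n (fst x) = 0" "roff n (fst x) = 0" by auto
qed

section \<open>Tempered bounds for the modes\<close>

abbreviation "tmp \<equiv> tempered (\<lambda>_. UNIV :: 'm pt set) (\<lambda>_. 1)"
abbreviation "dec \<equiv> tempered (\<lambda>_. UNIV :: 'm pt set) (\<lambda>n. exp (- real n))"

lemma tmp_mult: "tmp F \<Longrightarrow> tmp F' \<Longrightarrow> tmp (\<lambda>n x. F n x * F' n x)" by (rule tempered_mult) simp_all
lemma tmp_add: "tmp F \<Longrightarrow> tmp F' \<Longrightarrow> tmp (\<lambda>n x. F n x + F' n x)" by (rule tempered_add) simp_all
lemma tmp_diff: "tmp F \<Longrightarrow> tmp F' \<Longrightarrow> tmp (\<lambda>n x. F n x - F' n x)" by (rule tempered_diff)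
lemma tmp_const: "tmp (\<lambda>n x. r)" by (rule tempered_one)
lemma dec_mult: "tmp F \<Longrightarrow> dec F' \<Longrightarrow> dec (\<lambda>n x. F n x * F' n x)" by (rule tempered_mult) simp_all
lemma dec_mult': "dec F \<Longrightarrow> tmp F' \<Longrightarrow> dec (\<lambda>n x. F n x * F' n x)" using dec_mult[of F' F] by (simp add: mult.commute)
lemma dec_add: "dec F \<Longrightarrow> dec F' \<Longrightarrow> dec (\<lambda>n x. F n x + F' n x)" by (rule tempered_add) simp_all
lemma tmp_shift: "tmp F \<Longrightarrow> tmp (\<lambda>n. F (Suc n))" using tempered_shift[of "\<lambda>_. UNIV" "\<lambda>_. 1" F] by simp

lemma tmp_seq:
  assumes "poly_bounded (\<lambda>_. UNIV :: real set) (\<lambda>_. 1) (\<lambda>n x. a n)" shows "tmp (\<lambda>n x. a n)"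
  by (rule tempered_const) (use assms in \<open>auto simp: poly_bounded_def\<close>)

lemma tmp_bounded_seq:
  assumes "\<And>n. \<bar>a n\<bar> \<le> B" shows "tmp (\<lambda>n x. a n)"
  by (rule tempered_const)
     (use assms order_trans[OF abs_ge_zero assms[of 0]] in \<open>auto intro!: poly_boundedI[of B _ _ 0]\<close>)

lemma tmp_lam: "tmp (\<lambda>n x. lam n)" by (rule tmp_seq[OF lam_poly])
lemma tmp_iL: "tmp (\<lambda>n x. 1 / L n)" by (rule tmp_seq[OF L_poly[folded L_def]])
lemma tmp_ilam: "tmp (\<lambda>n x. 1 / lam n)" 
  by (rule tmp_bounded_seq[of _ 1]) (simp add: abs_of_pos[OF lam_pos] divide_le_eq_1_pos[OF lam_pos] lam_ge)
lemma tmp_c: "tmp (\<lambda>n x. c n)" by (rule tmp_bounded_seq[of _ 1]) (use c_pos c_le in simp)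

lemma tmp_tau:
  assumes "tempered (\<lambda>_. UNIV) (\<lambda>_. 1) (\<lambda>_. \<phi>)" shows "tmp (\<lambda>n x. \<phi> (tau n (fst x)))"
proof -
  have "poly_bounded (\<lambda>_. UNIV :: 'm pt set) (\<lambda>_. 1) (\<lambda>n x. 1 / L n)" by (rule temperedD(3)[OF tmp_iL])
  from tempered_comp_real[OF assms this, where b="(1, 0)" and d="\<lambda>n. - (T n / L n)"]
  show ?thesis by (simp add: tau_def inner_prod_def diff_divide_distrib)
qed

lemma tmp_trig:
  assumes "tmp (\<lambda>n x. a n)"
  shows "tmp (\<lambda>n x. sin (a n * snd x $ i))" "tmp (\<lambda>n x. cos (a n * snd x $ i))"
proof -
  have e: "x \<bullet> (0, axis i 1) = snd x $ i" for x :: "'m pt" by (simp add: inner_prod_def inner_axis)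
  show "tmp (\<lambda>n x. sin (a n * snd x $ i))" "tmp (\<lambda>n x. cos (a n * snd x $ i))"
    using tempered_comp_real[OF tempered_sin_cos(1) temperedD(3)[OF assms], where b="(0, axis i 1)" and d="\<lambda>_. 0"]
      tempered_comp_real[OF tempered_sin_cos(2) temperedD(3)[OF assms], where b="(0, axis i 1)" and d="\<lambda>_. 0"]
    by (simp_all add: e)
qed

text \<open>The parity of n is expressed by bounded coefficients, so that closure under sums and
  products applies.\<close>

lemma tmp_choose:
  assumes "\<And>i. tmp (F i)" shows "tmp (\<lambda>n x. F (dir n) n x)"
proof -
  have "tmp (\<lambda>n x. of_bool (even n) * F p n x + of_bool (odd n) * F q n x)"
    by (intro tmp_add tmp_mult assms tmp_bounded_seq[of _ 1]) simp_all
  moreover have "(\<lambda>n x. of_bool (even n) * F p n x + of_bool (odd n) * F q n x) = (\<lambda>n x. F (dir n) n x)"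
    by (auto simp: dir_def fun_eq_iff)
  ultimately show ?thesis by simp
qed

definition "sn n x = sin (lam n * snd x $ dir n)" for x :: "'m pt"
definition "cs n x = cos (lam n * snd x $ dir n)" for x :: "'m pt"
text \<open>The factors of mode n - 1, since \<open>dir (Suc n)\<close> is the direction of that
  mode. For n = 0 there is no such mode and the truncated n - 1 is 0; the formulas still satisfy the
  identities of sine and cosine that \<open>div_Vn\<close> relies on, and the strip concerned lies
  outside the cylinder.\<close>

definition "snp n x = sin (lam (n - 1) * snd x $ dir (Suc n))" for x :: "'m pt"
definition "csp n x = cos (lam (n - 1) * snd x $ dir (Suc n))" for x :: "'m pt"

lemma snp_Suc: "snp (Suc n) = sn n" "csp (Suc n) = cs n"
  by (auto simp: snp_def sn_def csp_def cs_def dir_Suc)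

lemma tmp_pred:
  assumes "tmp (\<lambda>n x. a n)" shows "tmp (\<lambda>n x. a (n - 1))"
proof -
  have "poly_bounded (\<lambda>_. UNIV :: 'm pt set) (\<lambda>_. 1) (\<lambda>n x. a n)" by (rule temperedD(3)[OF assms])
  then obtain C N where C: "0 \<le> C" "\<And>k. \<bar>a k\<bar> \<le> C * (real k + 1) ^ N * 1" unfolding poly_bounded_def by auto
  have "\<bar>a (k - 1)\<bar> \<le> C * (real k + 1) ^ N * 1" for k
  proof -
    have "(real (k - 1) + 1) ^ N \<le> (real k + 1) ^ N" by (intro power_mono) auto
    hence "C * (real (k - 1) + 1) ^ N * 1 \<le> C * (real k + 1) ^ N * 1" using C(1) by (simp add: mult_left_mono)
    thus ?thesis using C(2)[of "k - 1"] by linarith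
  qed
  thus ?thesis using C(1) by (intro tempered_const poly_boundedI[of C _ _ N]) auto
qed

lemma tmp_trigs: "tmp sn" "tmp cs" "tmp snp" "tmp csp"
proof -
  show "tmp sn" "tmp cs" unfolding sn_def[abs_def] cs_def[abs_def]
    using tmp_choose[of "\<lambda>i n x. sin (lam n * snd x $ i)"] tmp_choose[of "\<lambda>i n x. cos (lam n * snd x $ i)"] tmp_trig[OF tmp_lam]
    by blast+
  have d: "dir (Suc n) = (if even n then q else p)" for n by (simp add: dir_def)
  have "tmp (\<lambda>n x. of_bool (even n) * sin (lam (n - 1) * snd x $ q) + of_bool (odd n) * sin (lam (n - 1) * snd x $ p))"
    "tmp (\<lambda>n x. of_bool (even n) * cos (lam (n - 1) * snd x $ q) + of_bool (odd n) * cos (lam (n - 1) * snd x $ p))"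
    by (intro tmp_add tmp_mult tmp_trig[OF tmp_pred[OF tmp_lam]] tmp_bounded_seq[of _ 1]; simp)+
  moreover have "(\<lambda>n x. of_bool (even n) * sin (lam (n - 1) * snd x $ q) + of_bool (odd n) * sin (lam (n - 1) * snd x $ p)) = snp"
    "(\<lambda>n x. of_bool (even n) * cos (lam (n - 1) * snd x $ q) + of_bool (odd n) * cos (lam (n - 1) * snd x $ p)) = csp"
    by (auto simp: snp_def csp_def d fun_eq_iff)
  ultimately show "tmp snp" "tmp csp" by simp_all
qed

lemma tmp_profiles:
  "tmp (\<lambda>n x. rate n (fst x))" "tmp (\<lambda>n x. rate1 n (fst x))"
  "tmp (\<lambda>n x. om n (fst x))" "tmp (\<lambda>n x. om1 n (fst x))" "tmp (\<lambda>n x. ron n (fst x))" "tmp (\<lambda>n x. roff n (fst x))"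
proof -
  note t = profile_tempered[THEN tmp_tau]
  note ts = t[THEN tmp_shift]
  note iLs = tmp_shift[OF tmp_iL]
  show r: "tmp (\<lambda>n x. rate n (fst x))" unfolding rate_def
    by (intro tmp_mult tmp_diff tmp_lam tmp_const tmp_c t)
  show "tmp (\<lambda>n x. rate1 n (fst x))"
    using tmp_mult[OF tmp_const[of "-1"] tmp_mult[OF tmp_mult[OF tmp_mult[OF tmp_lam tmp_c] t(8)] tmp_iL]] by (simp add: rate1_def)
  show "tmp (\<lambda>n x. om n (fst x))" unfolding om_def by (rule tmp_mult[OF t(1) tmp_diff[OF tmp_const ts(4)]])
  show "tmp (\<lambda>n x. om1 n (fst x))" unfolding om1_def
    using tmp_diff[OF tmp_mult[OF t(2) tmp_iL] tmp_mult[OF ts(5) iLs]] by simp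
  show "tmp (\<lambda>n x. ron n (fst x))" unfolding ron_def
    using tmp_diff[OF tmp_mult[OF tmp_mult[OF tmp_const[of 2] tmp_mult[OF t(2) tmp_iL]] r] tmp_mult[OF t(3) tmp_mult[OF tmp_iL tmp_iL]]]
    by (simp add: power2_eq_square)
  show "tmp (\<lambda>n x. roff n (fst x))" unfolding roff_def
    using tmp_diff[OF tmp_mult[OF ts(6) tmp_mult[OF iLs iLs]] tmp_mult[OF tmp_mult[OF tmp_const[of 2] tmp_mult[OF ts(5) iLs]] r]]
    by (simp add: power2_eq_square)
qed

text \<open>\<open>E\<close> alone grows without bound as t decreases. The factor \<open>F\<close>
  confines it to \<open>St n\<close>, where \<open>exp_P_bound\<close> provides the weight.\<close>

lemma dec_E:
  assumes F: "tmp F" and z: "\<And>n x. x \<notin> St n \<Longrightarrow> F n x = 0"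
  shows "dec (\<lambda>n x. F n x * E n (fst x))"
proof (rule tempered_support[OF _ closed_St])
  have dP: "((\<lambda>x. - P n (fst x)) has_derivative (\<lambda>v. fst v * - rate n (fst x))) (at x)" for n and x :: "'m pt"
  proof -
    have f: "(fst has_derivative fst) (at x)" by (rule bounded_linear_imp_has_derivative) (rule bounded_linear_fst)
    show ?thesis using fd_comp_real[OF DERIV_minus[OF P_deriv[of n "fst x"]] differentiableI[OF f]] unfolding fd_eq[OF f] .
  qed
  have "tempered St (\<lambda>n. exp (- real n)) (\<lambda>n x. exp (- P n (fst x)))"
  proof (rule tempered_exp)
    show "(\<lambda>x. - P n (fst x)) differentiable (at x)" for n and x :: "'m pt" by (rule differentiableI[OF dP])
    show "tempered St (\<lambda>_. 1) (\<lambda>n x. frechet_derivative (\<lambda>x. - P n (fst x)) (at x) v)" for v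
      unfolding fd_eq[OF dP]
    proof (rule tempered_mono)
      show "tmp (\<lambda>n x. fst v * - rate n (fst x))"
        using tmp_mult[OF tmp_const[of "fst v"] tmp_mult[OF tmp_const[of "-1"] tmp_profiles(1)]] by simp
    qed auto
    obtain C where "0 \<le> C" "\<And>n t. T n + L n / 4 \<le> t \<Longrightarrow> exp (- P n t) \<le> C * exp (- real n)" using exp_P_bound by blast
    thus "poly_bounded St (\<lambda>n. exp (- real n)) (\<lambda>n x. exp (- P n (fst x)))"
      by (intro poly_boundedI[of C _ _ 0]) (auto simp: St_def)
  qed simp
  hence "tempered St (\<lambda>n. exp (- real n)) (\<lambda>n x. E n (fst x))" unfolding E_def .
  thus "tempered St (\<lambda>n. exp (- real n)) (\<lambda>n x. F n x * E n (fst x))"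
    by (rule tempered_mult[rotated 2]) (use tempered_mono[OF F, of St] in auto)
qed (use z in auto)

lemma dec_modes:
  "dec (\<lambda>n x. U n (fst x))" "dec (\<lambda>n x. U1 n (fst x))" "dec (\<lambda>n x. G n (fst x))"
  "dec (\<lambda>n x. fon n (fst x))" "dec (\<lambda>n x. foff n (fst x))"
proof -
  note t = tmp_profiles
  show "dec (\<lambda>n x. U n (fst x))" unfolding U_def by (rule dec_E[OF t(3)]) (rule support)
  show "dec (\<lambda>n x. U1 n (fst x))" unfolding U1_def
    by (rule dec_E[OF tmp_diff[OF t(4) tmp_mult[OF t(1) t(3)]]]) (simp add: support)
  show "dec (\<lambda>n x. G n (fst x))" unfolding G_def power2_eq_square
    by (rule dec_E[OF tmp_mult[OF tmp_diff[OF tmp_mult[OF t(1) t(1)] t(2)] t(3)]]) (simp add: support)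
  show "dec (\<lambda>n x. fon n (fst x))" unfolding fon_def by (rule dec_E[OF t(5)]) (rule support)
  show "dec (\<lambda>n x. foff n (fst x))" unfolding foff_def by (rule dec_E[OF t(6)]) (rule support)
qed

text \<open>With \<open>A\<close> not yet defined, the components of its flux \<open>A \<nabla>u\<close> are written down directly, as
  products that are smooth up to \<open>t = 1\<close>.\<close>

definition "un n x = U n (fst x) * cs n x"

definition Va :: "nat \<Rightarrow> 'm pt \<Rightarrow> real" where
  "Va n x = - (1 / lam n) * (G n (fst x) * sn n x) + 2 * (1 / lam n) * (fon n (fst x) * (sn n x * (snp n x)\<^sup>2))
     + 2 * (1 / lam n) * (foff n (fst x) * (sn n x * (sn (Suc n) x)\<^sup>2))"

definition Vb :: "nat \<Rightarrow> 'm pt \<Rightarrow> real" where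
  "Vb n x = (1 / lam (n - 1)) * (fon n (fst x) * (cs n x * (csp n x * snp n x)))
     + (1 / lam (Suc n)) * (foff n (fst x) * (cs n x * (cs (Suc n) x * sn (Suc n) x)))"

definition Vn :: "nat \<Rightarrow> 'm option \<Rightarrow> 'm pt \<Rightarrow> real" where
  "Vn n i x = (case i of None \<Rightarrow> U1 n (fst x) * cs n x
     | Some j \<Rightarrow> if j = dir n then Va n x else if j = dir (Suc n) then Vb n x else 0)"

definition "u x = (\<Sum>n. un n x)"
definition "V x = (\<chi> i. \<Sum>n. Vn n i x)"

lemma dec_un: "dec un"
  unfolding un_def[abs_def] by (rule dec_mult'[OF dec_modes(1) tmp_trigs(2)])

lemma dec_Va: "dec Va" and dec_Vb: "dec Vb"
proof -
  note t = tmp_trigs and ts = tmp_trigs[THEN tmp_shift]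
  have 1: "dec (\<lambda>n x. (- 1) * (1 / lam n) * (G n (fst x) * sn n x) + 2 * (1 / lam n) * (fon n (fst x) * (sn n x * (snp n x * snp n x)))
     + 2 * (1 / lam n) * (foff n (fst x) * (sn n x * (sn (Suc n) x * sn (Suc n) x))))"
    by (intro dec_add dec_mult[OF tmp_mult[OF tmp_const tmp_ilam]] dec_mult'[OF dec_modes(3)] dec_mult'[OF dec_modes(4)]
        dec_mult'[OF dec_modes(5)] tmp_mult t ts)
  show "dec Va" using 1 by (simp add: Va_def[abs_def] power2_eq_square)
  show "dec Vb" unfolding Vb_def[abs_def]
    by (intro dec_add dec_mult[OF tmp_pred[OF tmp_ilam]] dec_mult[OF tmp_shift[OF tmp_ilam]] dec_mult'[OF dec_modes(4)]
        dec_mult'[OF dec_modes(5)] tmp_mult t ts)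
qed

lemma dec_Vn: "dec (\<lambda>n x. Vn n i x)"
proof (cases i)
  case None
  thus ?thesis using dec_mult'[OF dec_modes(2) tmp_trigs(2)] by (simp add: Vn_def)
next
  case (Some j)
  have "dec (\<lambda>n x. of_bool (j = dir n) * Va n x + of_bool (j = dir (Suc n)) * Vb n x)"
    by (intro dec_add dec_mult dec_Va dec_Vb tmp_bounded_seq[of _ 1]) simp_all
  moreover have "(\<lambda>n x. of_bool (j = dir n) * Va n x + of_bool (j = dir (Suc n)) * Vb n x) = (\<lambda>n x. Vn n i x)"
    using Some dir_Suc by (auto simp: Vn_def fun_eq_iff)
  ultimately show ?thesis by simp
qed

section \<open>The function u and its flux V as smooth series\<close>

lemma dec_series:
  assumes "dec F"
  shows "summable (\<lambda>n. F n x)"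
    "frechet_derivative (\<lambda>x. \<Sum>n. F n x) (at x) v = (\<Sum>n. frechet_derivative (F n) (at x) v)"
    "smooth_on UNIV (\<lambda>x. \<Sum>n. F n x)" "summable (\<lambda>n. frechet_derivative (F n) (at x) v)"
  by (fact tempered_series(1)[OF assms summable_poly_exp],
      simp only: fd_eq[OF tempered_series(2)[OF assms summable_poly_exp]],
      fact tempered_series_smooth[OF assms summable_poly_exp],
      fact tempered_series(1)[OF temperedD(2)[OF assms] summable_poly_exp])

lemma line_coords:
  "fst (x + s *\<^sub>R coord None) = fst x + s" "snd (x + s *\<^sub>R coord None) = snd x"
  "fst (x + s *\<^sub>R coord (Some j)) = fst x" "snd (x + s *\<^sub>R coord (Some j)) $ k = snd x $ k + (if k = j then s else 0)"
  for x :: "'m pt"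
  by (auto simp: coord_def axis_def)

lemma line_trig:
  "((\<lambda>s. sn n (x + s *\<^sub>R coord (Some (dir n)))) has_real_derivative lam n * cs n x) (at 0)"
  "((\<lambda>s. cs n (x + s *\<^sub>R coord (Some (dir n)))) has_real_derivative - (lam n * sn n x)) (at 0)"
  "((\<lambda>s. snp n (x + s *\<^sub>R coord (Some (dir (Suc n))))) has_real_derivative lam (n - 1) * csp n x) (at 0)"
  "((\<lambda>s. csp n (x + s *\<^sub>R coord (Some (dir (Suc n))))) has_real_derivative - (lam (n - 1) * snp n x)) (at 0)"
  by (simp_all only: sn_def cs_def snp_def csp_def line_coords refl if_True)
     (auto intro!: derivative_eq_intros)

lemma line_trig_const:
  "j \<noteq> dir n \<Longrightarrow> sn n (x + s *\<^sub>R coord (Some j)) = sn n x" "j \<noteq> dir n \<Longrightarrow> cs n (x + s *\<^sub>R coord (Some j)) = cs n x"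
  "snp n (x + s *\<^sub>R coord (Some (dir n))) = snp n x" "csp n (x + s *\<^sub>R coord (Some (dir n))) = csp n x"
  "cs n (x + s *\<^sub>R coord None) = cs n x"
  using dir_Suc(1)[of n] by (auto simp: sn_def cs_def snp_def csp_def line_coords simp del: snd_add)

lemma line_time:
  assumes "\<And>t. (f has_real_derivative f' t) (at t)"
  shows "((\<lambda>s. f (fst (x + s *\<^sub>R coord None :: 'm pt)) * a) has_real_derivative f' (fst x) * a) (at 0)"
proof -
  have "((\<lambda>s. f (fst x + s)) has_real_derivative f' (fst x)) (at 0)"
    using DERIV_shift[of f "f' (fst x)" 0 "fst x"] assms[of "fst x"] by (simp add: add.commute)
  from DERIV_cmult_right[OF this] show ?thesis by (simp only: line_coords)
qed

text \<open>For each of the two errors f, the flux in the direction of the mode contributes 2 f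
  sin^2 and the flux in the direction of the partner f (cos^2 - sin^2), with sine and cosine of the
  partner mode: together f. By \<open>balance\<close> the total is 0.\<close>

lemma div_Vn: "(\<Sum>i\<in>UNIV. frechet_derivative (Vn n i) (at x) (coord i)) = 0"
proof -
  let ?D = "\<lambda>i. frechet_derivative (Vn n i) (at x) (coord i)"
  have df: "Vn n i differentiable (at x)" for i using temperedD(1)[OF dec_Vn] .
  have l: "lam n \<noteq> 0" for n using lam_pos[of n] by simp
  have 0: "?D None = U2 n (fst x) * cs n x"
    by (rule fd_line[OF df]) (use line_time[OF U_deriv(2)] in \<open>simp add: Vn_def line_trig_const del: fst_add\<close>)
  have 1: "?D (Some (dir n)) = (- G n (fst x) + 2 * fon n (fst x) * (snp n x)\<^sup>2 + 2 * foff n (fst x) * (sn (Suc n) x)\<^sup>2) * cs n x"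
  proof (rule fd_line[OF df])
    let ?c = "\<lambda>s. x + s *\<^sub>R coord (Some (dir n))"
    have e: "Vn n (Some (dir n)) (?c s) = - (1 / lam n) * (G n (fst x) * sn n (?c s)) + 2 * (1 / lam n) * (fon n (fst x) * (sn n (?c s) * (snp n x)\<^sup>2))
     + 2 * (1 / lam n) * (foff n (fst x) * (sn n (?c s) * (sn (Suc n) x)\<^sup>2))" for s
      using line_trig_const(1)[OF dir_Suc(1)[symmetric], of n x s]
      by (simp only: Vn_def option.case refl if_True Va_def line_coords line_trig_const)
    have "((\<lambda>s. Vn n (Some (dir n)) (?c s)) has_real_derivative
      - (1 / lam n) * (G n (fst x) * (lam n * cs n x)) + 2 * (1 / lam n) * (fon n (fst x) * ((lam n * cs n x) * (snp n x)\<^sup>2))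
     + 2 * (1 / lam n) * (foff n (fst x) * ((lam n * cs n x) * (sn (Suc n) x)\<^sup>2))) (at 0)"
      unfolding e by (intro DERIV_add DERIV_cmult DERIV_cmult_right line_trig)
    thus "((\<lambda>s. Vn n (Some (dir n)) (?c s)) has_real_derivative
       (- G n (fst x) + 2 * fon n (fst x) * (snp n x)\<^sup>2 + 2 * foff n (fst x) * (sn (Suc n) x)\<^sup>2) * cs n x) (at 0)"
      by (rule DERIV_cong) (use l[of n] in \<open>simp add: field_simps\<close>)
  qed
  have 2: "?D (Some (dir (Suc n))) = cs n x * (fon n (fst x) * ((csp n x)\<^sup>2 - (snp n x)\<^sup>2) + foff n (fst x) * ((cs (Suc n) x)\<^sup>2 - (sn (Suc n) x)\<^sup>2))"
  proof (rule fd_line[OF df])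
    let ?c = "\<lambda>s. x + s *\<^sub>R coord (Some (dir (Suc n)))"
    have e: "Vn n (Some (dir (Suc n))) (?c s) = (1 / lam (n - 1)) * (fon n (fst x) * (cs n x * (csp n (?c s) * snp n (?c s))))
     + (1 / lam (Suc n)) * (foff n (fst x) * (cs n x * (cs (Suc n) (?c s) * sn (Suc n) (?c s))))" for s
      using line_trig_const(2)[OF dir_Suc(1), of n x s] dir_Suc(1)[of n]
      by (simp only: Vn_def option.case refl if_True if_False Vb_def line_coords line_trig_const)
    have "((\<lambda>s. Vn n (Some (dir (Suc n))) (?c s)) has_real_derivative
        (1 / lam (n - 1)) * (fon n (fst x) * (cs n x * (- (lam (n - 1) * snp n x) * snp n (?c 0) + (lam (n - 1) * csp n x) * csp n (?c 0))))
     + (1 / lam (Suc n)) * (foff n (fst x) * (cs n x * (- (lam (Suc n) * sn (Suc n) x) * sn (Suc n) (?c 0) + (lam (Suc n) * cs (Suc n) x) * cs (Suc n) (?c 0))))) (at 0)"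
      unfolding e by (intro DERIV_add DERIV_cmult DERIV_mult line_trig)
    thus "((\<lambda>s. Vn n (Some (dir (Suc n))) (?c s)) has_real_derivative cs n x * (fon n (fst x) * ((csp n x)\<^sup>2 - (snp n x)\<^sup>2) + foff n (fst x) * ((cs (Suc n) x)\<^sup>2 - (sn (Suc n) x)\<^sup>2))) (at 0)"
      by (rule DERIV_cong) (use l[of "n - 1"] l[of "Suc n"] in \<open>simp add: field_simps power2_eq_square\<close>)
  qed
  have 3: "?D (Some j) = 0" if "j \<noteq> dir n" "j \<noteq> dir (Suc n)" for j
    using that by (simp add: Vn_def[abs_def])
  have "(\<Sum>i\<in>UNIV. ?D i) = ?D None + (\<Sum>j\<in>UNIV. ?D (Some j))" by (simp add: UNIV_option_conv sum.reindex)
  also have "(\<Sum>j\<in>UNIV. ?D (Some j)) = (\<Sum>j\<in>{dir n, dir (Suc n)}. ?D (Some j))"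
    by (rule sum.mono_neutral_right) (use 3 in auto)
  also have "\<dots> = ?D (Some (dir n)) + ?D (Some (dir (Suc n)))" using dir_Suc(1)[of n] by (simp add: eq_commute)
  also have "?D None + (?D (Some (dir n)) + ?D (Some (dir (Suc n)))) =
      cs n x * (U2 n (fst x) - G n (fst x) + fon n (fst x) * ((csp n x)\<^sup>2 + (snp n x)\<^sup>2) + foff n (fst x) * ((cs (Suc n) x)\<^sup>2 + (sn (Suc n) x)\<^sup>2))"
    unfolding 0 1 2 by (simp add: algebra_simps)
  also have "\<dots> = 0" using balance[of n "fst x"] by (simp add: csp_def snp_def cs_def[of "Suc n"] sn_def)
  finally show ?thesis .
qed

text \<open>\<open>St n\<close> ends inside strip n + 1, hence before t = 1. Every single term
  vanishes at the end, so the sums have zero Cauchy data there although infinitely many strips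
  accumulate.\<close>

lemma beyond_end:
  assumes "1 \<le> fst x"
  shows "un n x = 0" "Vn n i x = 0" "U n (fst x) = 0" "U1 n (fst x) = 0"
proof -
  have "a + 3 / 4 * (b - a) < 1" if "a < b" "b < 1" for a b :: real using that by (simp add: field_simps)
  from this[OF T_less[of "Suc n"] T_less_1] have "T (Suc n) + 3 / 4 * L (Suc n) < 1" unfolding L_def .
  hence "x \<notin> St n" using assms by (simp add: St_def)
  note s = support[OF this]
  show "un n x = 0" "U n (fst x) = 0" "U1 n (fst x) = 0" using s by (simp_all add: un_def U_def U1_def)
  show "Vn n i x = 0" using s by (simp add: Vn_def Va_def Vb_def U1_def G_def fon_def foff_def split: option.split)
qed

lemma sin_cos_period: assumes "k \<in> lattice_pts"
  shows "sin (lam n * (y + k) $ i) = sin (lam n * y $ i)" "cos (lam n * (y + k) $ i) = cos (lam n * y $ i)"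
proof -
  obtain z :: int where z: "k $ i = of_int z" using assms by (auto simp: lattice_pts_def elim: Ints_cases)
  have "lam n * (y + k) $ i = lam n * y $ i + 2 * pi * of_int (int (freq n) * z)"
    by (simp add: z lam_freq algebra_simps)
  thus "sin (lam n * (y + k) $ i) = sin (lam n * y $ i)" "cos (lam n * (y + k) $ i) = cos (lam n * y $ i)"
    by (simp_all only: sin_add cos_add sin_int_2pin cos_int_2pin mult_1_right mult_zero_right add_0_right diff_0_right)
qed

lemma trig_period: assumes "k \<in> lattice_pts"
  shows "sn n (t, y + k) = sn n (t, y)" "cs n (t, y + k) = cs n (t, y)" "snp n (t, y + k) = snp n (t, y)" "csp n (t, y + k) = csp n (t, y)"
  by (simp_all only: sn_def cs_def snp_def csp_def snd_conv sin_cos_period[OF assms])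

lemma u_multiplier: "multiplier u"
  unfolding multiplier_def
proof (intro conjI allI ballI)
  show "smooth_on UNIV u" unfolding u_def[abs_def] by (rule dec_series(3)[OF dec_un])
  show "u (t, y + k) = u (t, y)" if "k \<in> lattice_pts" for t y k by (simp add: u_def un_def trig_period[OF that])
qed

lemma V_flux_field: "flux_field V"
proof
  have Vi: "(\<lambda>x. V x $ i) = (\<lambda>x. \<Sum>n. Vn n i x)" for i by (simp add: V_def)
  show "smooth_on UNIV (\<lambda>x. V x $ i)" for i unfolding Vi by (rule dec_series(3)[OF dec_Vn])
  have "Vn n i (t, y + k) = Vn n i (t, y)" if "k \<in> lattice_pts" for n i t y k
    by (simp add: Vn_def Va_def Vb_def trig_period[OF that] split: option.split)
  thus "periodic V" by (simp add: periodic_def V_def)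
  show "V (1, y) = 0" for y by (simp add: V_def beyond_end vec_eq_iff)
  show "(\<Sum>i\<in>UNIV. frechet_derivative (\<lambda>x. V x $ i) (at x) (coord i)) = 0" for x
  proof -
    have "(\<Sum>i\<in>UNIV. frechet_derivative (\<lambda>x. V x $ i) (at x) (coord i)) = (\<Sum>i\<in>UNIV. \<Sum>n. frechet_derivative (Vn n i) (at x) (coord i))"
      unfolding Vi dec_series(2)[OF dec_Vn] ..
    also have "\<dots> = (\<Sum>n. \<Sum>i\<in>UNIV. frechet_derivative (Vn n i) (at x) (coord i))"
      by (rule suminf_sum[symmetric]) (rule dec_series(4)[OF dec_Vn])
    also have "\<dots> = 0" by (simp add: div_Vn)
    finally show ?thesis .
  qed
qed

lemma gradient_u:
  "gradient u x $ None = (\<Sum>n. U1 n (fst x) * cs n x)"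
  "gradient u x $ Some j = (\<Sum>n. if j = dir n then - (lam n * U n (fst x) * sn n x) else 0)"
proof -
  have df: "un n differentiable (at x)" for n using temperedD(1)[OF dec_un] .
  have 0: "frechet_derivative (un n) (at x) (coord None) = U1 n (fst x) * cs n x" for n
    by (rule fd_line[OF df]) (use line_time[OF U_deriv(1)] in \<open>simp add: un_def line_trig_const del: fst_add\<close>)
  have 1: "frechet_derivative (un n) (at x) (coord (Some j)) = (if j = dir n then - (lam n * U n (fst x) * sn n x) else 0)" for n
  proof (rule fd_line[OF df])
    show "((\<lambda>s. un n (x + s *\<^sub>R coord (Some j))) has_real_derivative (if j = dir n then - (lam n * U n (fst x) * sn n x) else 0)) (at 0)"
    proof (cases "j = dir n")
      case True
      have "((\<lambda>s. U n (fst x) * cs n (x + s *\<^sub>R coord (Some (dir n)))) has_real_derivative U n (fst x) * - (lam n * sn n x)) (at 0)"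
        by (intro DERIV_cmult line_trig)
      thus ?thesis using True by (simp add: un_def line_coords algebra_simps del: fst_add)
    next
      case False
      thus ?thesis by (simp add: un_def line_coords line_trig_const del: fst_add)
    qed
  qed
  show "gradient u x $ None = (\<Sum>n. U1 n (fst x) * cs n x)"
    "gradient u x $ Some j = (\<Sum>n. if j = dir n then - (lam n * U n (fst x) * sn n x) else 0)"
    unfolding gradient_def u_def[abs_def] by (simp_all add: dec_series(2)[OF dec_un] 0 1)
qed

end

text \<open>Interpolation between a bound and a Lipschitz bound: for \<open>d\<close> below 1 the
  second one is stronger than needed, for larger \<open>d\<close> the first one suffices.\<close>

lemma min_powr_bound:
  fixes x a b d \<rho> :: real
  assumes "x \<le> a" "x \<le> b * d" "0 \<le> a" "0 \<le> b" "0 \<le> d" "0 < \<rho>" "\<rho> < 1"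
  shows "x \<le> (a + b) * d powr \<rho>"
proof (cases "1 \<le> d")
  case True
  hence "1 \<le> d powr \<rho>" using assms(6) by (simp add: ge_one_powr_ge_zero)
  hence "(a + b) * 1 \<le> (a + b) * d powr \<rho>" using assms(3,4) by (intro mult_left_mono) auto
  thus ?thesis using assms(1,4) by simp
next
  case False
  show ?thesis
  proof (cases "d = 0")
    case False
    have "d = d powr 1" using False assms(5) by simp
    also have "\<dots> \<le> d powr \<rho>" using \<open>\<not> 1 \<le> d\<close> assms by (intro powr_mono') auto
    finally have "b * d \<le> b * d powr \<rho>" using assms(4) by (intro mult_left_mono)
    moreover have "0 \<le> a * d powr \<rho>" using assms(3) by simp
    ultimately show ?thesis using assms(2) unfolding distrib_right by linarith
  qed (use assms in simp)
qed

lemma tempered_uniform_bound: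
  assumes "tempered (\<lambda>_. UNIV) W F" "\<And>N. summable (\<lambda>k. (real k + 1) ^ N * W k)"
  shows "\<exists>B\<ge>0. \<forall>n x. \<bar>F n x\<bar> \<le> B"
proof -
  obtain C N where C: "0 \<le> C" "\<And>k x. \<bar>F k x\<bar> \<le> C * (real k + 1) ^ N * W k"
    using temperedD(3)[OF assms(1)] unfolding poly_bounded_def by auto
  have "Bseq (\<lambda>k. (real k + 1) ^ N * W k)"
    using summable_LIMSEQ_zero[OF assms(2)] convergent_imp_Bseq by (auto simp: convergent_def)
  then obtain B where B: "0 < B" "\<And>k. norm ((real k + 1) ^ N * W k) \<le> B" by (auto simp: Bseq_def)
  have "\<bar>F k x\<bar> \<le> C * B" for k x
  proof -
    have "(real k + 1) ^ N * W k \<le> B" using B(2)[of k] by (simp add: abs_le_iff)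
    hence "C * ((real k + 1) ^ N * W k) \<le> C * B" using C(1) by (rule mult_left_mono)
    thus ?thesis using C(2)[of k x] by (simp add: mult.assoc)
  qed
  thus ?thesis using C(1) B(1) by (intro exI[of _ "C * B"]) auto
qed

lemma uniform_lipschitz:
  fixes F :: "nat \<Rightarrow> 'a::euclidean_space \<Rightarrow> real"
  assumes d: "\<And>n x. F n differentiable (at x)"
    and b: "\<And>v. \<exists>B\<ge>0. \<forall>n x. \<bar>frechet_derivative (F n) (at x) v\<bar> \<le> B"
  shows "\<exists>B\<ge>0. \<forall>n x z. \<bar>F n x - F n z\<bar> \<le> B * dist x z"
proof -
  obtain B where B: "\<And>v. 0 \<le> B v" "\<And>v n x. \<bar>frechet_derivative (F n) (at x) v\<bar> \<le> B v" using b by metis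
  define C where "C = (\<Sum>b\<in>Basis. B b)"
  have C: "0 \<le> C" unfolding C_def by (intro sum_nonneg B)
  have Cb: "norm (frechet_derivative (F k) (at x) h) \<le> C * norm h" for k x h
  proof -
    interpret linear "frechet_derivative (F k) (at x)" using d linear_frechet_derivative by blast
    have "frechet_derivative (F k) (at x) h = (\<Sum>b\<in>Basis. (h \<bullet> b) * frechet_derivative (F k) (at x) b)"
      by (subst (1) euclidean_representation[of h, symmetric]) (simp only: sum scale real_scaleR_def)
    also have "\<bar>\<dots>\<bar> \<le> (\<Sum>b\<in>Basis. norm h * B b)"
      by (rule order_trans[OF sum_abs sum_mono]) (auto simp: abs_mult intro!: mult_mono B Basis_le_norm)
    finally show ?thesis by (simp add: C_def sum_distrib_left mult.commute)
  qed
  have "\<bar>F n x - F n z\<bar> \<le> C * dist x z" for n x z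
  proof -
    have "norm (F n x - F n z) \<le> C * norm (x - z)"
    proof (rule differentiable_bound[of UNIV])
      show "(F n has_derivative frechet_derivative (F n) (at x)) (at x within UNIV)" for x
        using d by (simp add: frechet_derivative_works[symmetric])
      show "onorm (frechet_derivative (F n) (at x)) \<le> C" for x by (rule onorm_bound[OF C Cb])
    qed auto
    thus ?thesis by (simp add: dist_norm)
  qed
  thus ?thesis using C by blast
qed

subsection \<open>The conductivity of the Plis--Miller construction\<close>

text \<open>An error \<open>f cos(\<mu> z)\<close> is absorbed with the help of a mode \<open>a cos(\<lambda> x)\<close> in the other direction
  which is fully switched on wherever \<open>f\<close> is not zero: the off-diagonal entry is
  \<open>b_xz = - (2 f / (\<lambda> \<mu> a)) sin(\<mu> z) sin(\<lambda> x)\<close>, and a diagonal correction \<open>b_xx\<close> of order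
  \<open>f / (\<lambda>^2 a)\<close> removes the terms that \<open>b_xz\<close> itself creates. In \<open>aij\<close>, \<open>aii\<close>, \<open>bjj\<close>, \<open>i\<close> is the
  direction of the old and \<open>j\<close> that of the new mode. The term \<open>phi\<close> compensates that the new mode does
  not decay at the rate \<open>lam\<close> during the dip.\<close>

locale miller_metric = miller_dirs S S1 S2 K T lam c freq p q
  for S S1 S2 :: "real \<Rightarrow> real" and K :: real and T lam c :: "nat \<Rightarrow> real" and freq :: "nat \<Rightarrow> nat"
    and p q :: "'m::finite" +
  fixes \<rho> C\<rho> sh :: real
  assumes sh: "0 \<le> sh"
    and gap_sh: "\<And>n. 8 * (real n + 1 + sh) \<le> (lam n - lam (Suc n) * (1 - c (Suc n))) * (T (Suc (Suc n)) - T (Suc n))"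
    and rho: "0 < \<rho>" "\<rho> < 1" and C\<rho>: "0 \<le> C\<rho>" "\<And>n. c n \<le> C\<rho> * (T (Suc n) - T n) powr \<rho>"
    and lam_mono: "\<And>n. lam n \<le> lam (Suc n)"
    and small: "\<And>n. (64 * K / (T (Suc (Suc n)) - T (Suc n))\<^sup>2 + 16 * K * lam (Suc n) / (T (Suc (Suc n)) - T (Suc n)))
       * exp (- (real n + sh)) \<le> 1 / 32"
    and small_c: "\<And>n. c n * (3 + 16 * K) \<le> 1 / 8"
begin

text \<open>\<open>exp (Dn n t)\<close> is the ratio of mode n + 1 to mode n, cutoffs aside.
  \<open>eon\<close> and \<open>eoff\<close> are the switching errors divided by the amplitude of
  the partner mode; \<open>eon2\<close> and \<open>eoff2\<close> contain the ratio of the amplitudes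
  once more. As exponentials they are defined also where an amplitude vanishes.\<close>

definition "Dn n t = P n t - P (Suc n) t"
definition "eon n t = ron (Suc n) t * exp (Dn n t)"
definition "eon2 n t = (ron (Suc n) t * on (tau (Suc n) t)) * exp (2 * Dn n t)"
definition "eoff n t = roff n t * exp (- Dn n t)"
definition "eoff2 n t = (roff n t * (1 - off (tau (Suc n) t))) * exp (- 2 * Dn n t)"
definition "phi n t = ((rate (Suc n) t)\<^sup>2 - rate1 (Suc n) t) * ((1 / lam (Suc n)) * (1 / lam (Suc n))) - 1"

definition aij :: "nat \<Rightarrow> 'm pt \<Rightarrow> real" where
  "aij n x = (- 2 * ((1 / lam n) * (1 / lam (Suc n))) * (sn n x * sn (Suc n) x)) * (eon n (fst x) + eoff n (fst x))"
definition aii :: "nat \<Rightarrow> 'm pt \<Rightarrow> real" where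
  "aii n x = (- 1 * ((1 / lam n) * (1 / lam n)) * (cs (Suc n) x * cs n x)) * eon n (fst x)
     + (2 * ((1 / lam n) * (1 / lam n)) * (sn (Suc n) x * sn (Suc n) x)) * eon2 n (fst x)"
definition bjj :: "nat \<Rightarrow> 'm pt \<Rightarrow> real" where
  "bjj n x = (- 1 * ((1 / lam (Suc n)) * (1 / lam (Suc n))) * (cs n x * cs (Suc n) x)) * eoff n (fst x)
     + (2 * ((1 / lam (Suc n)) * (1 / lam (Suc n))) * (sn n x * sn n x)) * eoff2 n (fst x)"

text \<open>Term n acts in strip n + 1, on the block of the directions of modes n and n + 1; the t
  direction is left as in the identity matrix.\<close>

definition ent :: "nat \<Rightarrow> 'm option \<Rightarrow> 'm option \<Rightarrow> 'm pt \<Rightarrow> real" where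
  "ent n r s x = (if r = Some (dir n) \<and> s = Some (dir n) then aii n x
     else if r = Some (dir (Suc n)) \<and> s = Some (dir (Suc n)) then phi n (fst x) + bjj n x
     else if r = Some (dir n) \<and> s = Some (dir (Suc n)) \<or> r = Some (dir (Suc n)) \<and> s = Some (dir n) then aij n x
     else 0)"

definition A :: "'m metric" where
  "A x = (\<chi> r s. (if r = s then 1 else 0) + (\<Sum>n. ent n r s x))"

section \<open>Supports, smoothness and symmetry of the conductivity\<close>

lemma ron_support: "ron (Suc n) t \<noteq> 0 \<Longrightarrow> 1/4 < tau (Suc n) t \<and> tau (Suc n) t < 3/8"
  using profile_values(3,4)[of "tau (Suc n) t"] by (force simp: ron_def)

lemma roff_support: "roff n t \<noteq> 0 \<Longrightarrow> 5/8 < tau (Suc n) t \<and> tau (Suc n) t < 3/4"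
  using profile_values(7,8)[of "tau (Suc n) t"] by (force simp: roff_def)

lemma tau_interior:
  assumes "0 < tau n t" "tau n t < 1" shows "T n < t \<and> t < T (Suc n)"
  using assms L_pos[of n] by (auto simp: tau_def L_def field_simps)

lemma ent_support:
  assumes "\<not> (T (Suc n) < fst x \<and> fst x < T (Suc (Suc n)))"
  shows "ent n r s x = 0"
proof -
  have t: "\<not> (0 < tau (Suc n) (fst x) \<and> tau (Suc n) (fst x) < 1)" using tau_interior[of "Suc n" "fst x"] assms by blast
  have "ron (Suc n) (fst x) = 0" using ron_support[of n "fst x"] t by fastforce
  moreover have "roff n (fst x) = 0" using roff_support[of n "fst x"] t by fastforce
  moreover have "phi n (fst x) = 0"
    using t profile_values(9,10)[of "tau (Suc n) (fst x)"] lam_pos[of "Suc n"]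
    by (force simp: phi_def rate_def rate1_def power2_eq_square)
  ultimately show ?thesis by (simp add: ent_def aii_def aij_def bjj_def eon_def eon2_def eoff_def eoff2_def)
qed

lemma ent_unique:
  assumes "T (Suc n) \<le> fst x" "fst x \<le> T (Suc (Suc n))" "k \<noteq> n"
  shows "ent k r s x = 0"
proof (rule ent_support)
  show "\<not> (T (Suc k) < fst x \<and> fst x < T (Suc (Suc k)))"
  proof (cases "k < n")
    case True
    thus ?thesis using T_mono[of "Suc (Suc k)" "Suc n"] assms by auto
  next
    case False
    thus ?thesis using T_mono[of "Suc (Suc n)" "Suc k"] assms by auto
  qed
qed

lemma find_strip:
  assumes "0 \<le> t" "t < 1"
  obtains n where "T (Suc n) \<le> t" "t < T (Suc (Suc n))"
proof -
  have "\<forall>\<^sub>F n in sequentially. t < T n" using order_tendstoD(1)[OF T_lim assms(2)] .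
  then obtain m where m: "t < T m" by (auto simp: eventually_sequentially)
  define k where "k = (LEAST m. t < T m)"
  have k: "t < T k" unfolding k_def using m by (rule LeastI)
  have "1 < k"
  proof (rule ccontr)
    assume "\<not> 1 < k"
    hence "T k \<le> T 1" by (intro T_mono) simp
    thus False using k assms(1) T_1 by simp
  qed
  then obtain n where n: "k = Suc (Suc n)" by (cases k; cases "k - 1") auto
  have "\<not> t < T (Suc n)" using not_less_Least[of "Suc n" "\<lambda>m. t < T m"] n k_def by simp
  thus ?thesis using that[of n] k n by (simp only: not_less)
qed

lemma A_entry:
  assumes "T (Suc n) \<le> fst x" "fst x \<le> T (Suc (Suc n))"
  shows "A x $ r $ s = (if r = s then 1 else 0) + ent n r s x"
proof -
  have "(\<Sum>k. ent k r s x) = (\<Sum>k\<in>{n}. ent k r s x)"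
    by (rule suminf_finite) (use ent_unique[OF assms] in auto)
  thus ?thesis by (simp add: A_def)
qed

lemma A_outside:
  assumes "fst x \<le> 0 \<or> 1 \<le> fst x" shows "A x $ r $ s = (if r = s then 1 else 0)"
proof -
  have "ent k r s x = 0" for k
    by (rule ent_support) (use assms T_mono[of 1 "Suc k"] T_1 T_less_1[of "Suc (Suc k)"] in auto)
  thus ?thesis by (simp add: A_def)
qed

lemma A_cases:
  obtains n where "\<And>r s. A x $ r $ s = (if r = s then 1 else 0) + ent n r s x"
proof (cases "0 \<le> fst x \<and> fst x < 1")
  case True
  then obtain n where "T (Suc n) \<le> fst x" "fst x < T (Suc (Suc n))" using find_strip by blast
  hence "A x $ r $ s = (if r = s then 1 else 0) + ent n r s x" for r s by (intro A_entry) simp_all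
  thus ?thesis by (rule that)
next
  case False
  have "ent 0 r s x = 0" for r s
    by (rule ent_support) (use False T_mono[of 1 "Suc 0"] T_1 T_less_1[of "Suc (Suc 0)"] in auto)
  moreover have "A x $ r $ s = (if r = s then 1 else 0)" for r s by (rule A_outside) (use False in auto)
  ultimately have "A x $ r $ s = (if r = s then 1 else 0) + ent 0 r s x" for r s by simp
  thus ?thesis by (rule that)
qed

text \<open>The transition zones keep a distance of 1/8 strip from the midpoint, where the modes
  balance, and the exponents separate at the rate \<open>gam n\<close>: this is the origin of the 8
  in \<open>gap_sh\<close>. The shift \<open>sh\<close> makes the errors small in the first strips
  as well.\<close>

lemma expD_bound_sh:
  shows "1/4 \<le> tau (Suc n) t \<Longrightarrow> tau (Suc n) t \<le> 3/8 \<Longrightarrow> Dn n t \<le> - (real (Suc n) + sh)"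
    and "5/8 \<le> tau (Suc n) t \<Longrightarrow> tau (Suc n) t \<le> 3/4 \<Longrightarrow> real (Suc n) + sh \<le> Dn n t"
proof -
  have t: "t - mid (Suc n) = (tau (Suc n) t - 1/2) * L (Suc n)"
  proof -
    have "tau (Suc n) t * L (Suc n) = t - T (Suc n)" using L_pos[of "Suc n"] by (simp add: tau_def)
    thus ?thesis using mid_bounds(3)[of "Suc n"] by (simp add: left_diff_distrib)
  qed
  have gL: "8 * (real (Suc n) + sh) \<le> gam n * L (Suc n)" using gap_sh[of n] by (simp add: gam_def L_def algebra_simps)
  have D: "Dn n t = (tau (Suc n) t - 1/2) * (gam n * L (Suc n))" if "1/4 \<le> tau (Suc n) t" "tau (Suc n) t \<le> 3/4"
    using P_diff_linear[OF that] by (simp add: Dn_def t)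
  show "Dn n t \<le> - (real (Suc n) + sh)" if h: "1/4 \<le> tau (Suc n) t" "tau (Suc n) t \<le> 3/8"
  proof -
    have "Dn n t = (tau (Suc n) t - 1/2) * (gam n * L (Suc n))" using D h by simp
    also have "\<dots> \<le> (- 1/8) * (gam n * L (Suc n))" using h gL sh by (intro mult_right_mono) auto
    also have "\<dots> \<le> - (real (Suc n) + sh)" using gL by simp
    finally show ?thesis .
  qed
  show "real (Suc n) + sh \<le> Dn n t" if h: "5/8 \<le> tau (Suc n) t" "tau (Suc n) t \<le> 3/4"
  proof -
    have "real (Suc n) + sh \<le> (1/8) * (gam n * L (Suc n))" using gL by simp
    also have "\<dots> \<le> (tau (Suc n) t - 1/2) * (gam n * L (Suc n))" using h gL sh by (intro mult_right_mono) auto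
    also have "\<dots> = Dn n t" using D h by simp
    finally show ?thesis .
  qed
qed

lemma expD_bound:
  shows "1/4 \<le> tau (Suc n) t \<Longrightarrow> tau (Suc n) t \<le> 3/8 \<Longrightarrow> Dn n t \<le> - real (Suc n)"
    and "5/8 \<le> tau (Suc n) t \<Longrightarrow> tau (Suc n) t \<le> 3/4 \<Longrightarrow> real (Suc n) \<le> Dn n t"
  using expD_bound_sh[of n t] sh by simp_all

text \<open>The sign of \<open>r\<close> tells in which zone \<open>F\<close> lives: the new mode is
  the smaller one where it is switched on, the old one is where it is switched off. So r times
  \<open>Dn\<close> is at most -(n + 1) wherever \<open>F\<close> is not zero, for r = 1, 2, -1 and
  -2 alike.\<close>

lemma dec_expD:
  assumes F: "tmp F" and r: "1 \<le> \<bar>r\<bar>"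
    and z: "\<And>n x. F n x \<noteq> 0 \<Longrightarrow> (r < 0 \<longrightarrow> 5/8 \<le> tau (Suc n) (fst x) \<and> tau (Suc n) (fst x) \<le> 3/4) \<and>
        (0 < r \<longrightarrow> 1/4 \<le> tau (Suc n) (fst x) \<and> tau (Suc n) (fst x) \<le> 3/8)"
  shows "dec (\<lambda>n x. F n x * exp (r * Dn n (fst x)))"
proof -
  define lo where "lo = (if r < 0 then 5/8 else 1/4 :: real)"
  define hi where "hi = (if r < 0 then 3/4 else 3/8 :: real)"
  define X where "X n = {x :: 'm pt. lo \<le> tau (Suc n) (fst x) \<and> tau (Suc n) (fst x) \<le> hi}" for n
  have cl: "closed (X n)" for n
    unfolding X_def tau_def using L_pos[of "Suc n"]
    by (intro closed_Collect_conj closed_Collect_le continuous_intros) auto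
  have dD: "((\<lambda>x. r * Dn n (fst x)) has_derivative (\<lambda>v. fst v * (r * (rate n (fst x) - rate (Suc n) (fst x))))) (at x)" for n and x :: "'m pt"
  proof -
    have f: "(fst has_derivative fst) (at x)" by (rule bounded_linear_imp_has_derivative) (rule bounded_linear_fst)
    have "((\<lambda>t. r * Dn n t) has_real_derivative r * (rate n (fst x) - rate (Suc n) (fst x))) (at (fst x))"
      unfolding Dn_def by (intro DERIV_cmult DERIV_diff P_deriv)
    from fd_comp_real[OF this differentiableI[OF f]] show ?thesis unfolding fd_eq[OF f] .
  qed
  have "tempered X (\<lambda>n. exp (- real n)) (\<lambda>n x. exp (r * Dn n (fst x)))"
  proof (rule tempered_exp)
    show "(\<lambda>x. r * Dn n (fst x)) differentiable (at x)" for n and x :: "'m pt" by (rule differentiableI[OF dD])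
    show "tempered X (\<lambda>_. 1) (\<lambda>n x. frechet_derivative (\<lambda>x. r * Dn n (fst x)) (at x) v)" for v
      unfolding fd_eq[OF dD]
      by (rule tempered_mono[OF tmp_mult[OF tmp_const tmp_mult[OF tmp_const tmp_diff[OF tmp_profiles(1) tmp_shift[OF tmp_profiles(1)]]]]]) auto
    have "exp (r * Dn n (fst x)) \<le> exp (- real n)" if "x \<in> X n" for n x
    proof -
      have "r * Dn n (fst x) \<le> - real (Suc n)"
      proof (cases "r < 0")
        case True
        have d: "real (Suc n) \<le> Dn n (fst x)" using expD_bound(2) that True by (simp add: X_def lo_def hi_def)
        have "1 * real (Suc n) \<le> \<bar>r\<bar> * Dn n (fst x)"
          by (rule order_trans[OF mult_right_mono[OF r] mult_left_mono]) (use d in simp_all)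
        thus ?thesis using True by simp
      next
        case False
        have "Dn n (fst x) \<le> - real (Suc n)" using expD_bound(1) that False by (simp add: X_def lo_def hi_def)
        hence "r * Dn n (fst x) \<le> r * - real (Suc n)" using False by (intro mult_left_mono) auto
        also have "\<dots> \<le> - real (Suc n)" using mult_right_mono[of 1 r "real (Suc n)"] r False by simp
        finally show ?thesis .
      qed
      thus ?thesis by simp
    qed
    thus "poly_bounded X (\<lambda>n. exp (- real n)) (\<lambda>n x. exp (r * Dn n (fst x)))"
      by (intro poly_boundedI[of 1 _ _ 0]) auto
  qed simp
  hence "tempered X (\<lambda>n. exp (- real n)) (\<lambda>n x. F n x * exp (r * Dn n (fst x)))"
    by (rule tempered_mult[rotated 2]) (use tempered_mono[OF F, of X] in auto)
  thus ?thesis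
  proof (rule tempered_support[OF _ cl])
    show "F n x * exp (r * Dn n (fst x)) = 0" if "x \<notin> X n" for n x
      using that z[of n x] r by (cases "r < 0") (auto simp: X_def lo_def hi_def)
  qed simp
qed

lemma dec_e:
  "dec (\<lambda>n x. eon n (fst x))" "dec (\<lambda>n x. eon2 n (fst x))" "dec (\<lambda>n x. eoff n (fst x))" "dec (\<lambda>n x. eoff2 n (fst x))"
proof -
  note ron = tmp_shift[OF tmp_profiles(5)] and roff = tmp_profiles(6)
  note on = tmp_shift[OF tmp_tau[OF profile_tempered(1)]] and off = tmp_diff[OF tmp_const tmp_shift[OF tmp_tau[OF profile_tempered(4)]]]
  show "dec (\<lambda>n x. eon n (fst x))" unfolding eon_def
    using dec_expD[OF ron, of 1] ron_support by fastforce
  show "dec (\<lambda>n x. eon2 n (fst x))" unfolding eon2_def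
    by (rule dec_expD[OF tmp_mult[OF ron on]]) (use ron_support in \<open>force+\<close>)
  have "dec (\<lambda>n x. roff n (fst x) * exp (- 1 * Dn n (fst x)))"
    by (rule dec_expD[OF roff]) (use roff_support in \<open>force+\<close>)
  thus "dec (\<lambda>n x. eoff n (fst x))" unfolding eoff_def by simp
  show "dec (\<lambda>n x. eoff2 n (fst x))" unfolding eoff2_def
    by (rule dec_expD[OF tmp_mult[OF roff off]]) (use roff_support in \<open>force+\<close>)
qed

lemma dec_a: "dec aij" "dec aii" "dec bjj"
proof -
  note t = tmp_trigs and ts = tmp_trigs[THEN tmp_shift] and il = tmp_ilam tmp_shift[OF tmp_ilam]
  show "dec aij" unfolding aij_def[abs_def] by (intro dec_mult dec_add dec_e tmp_mult tmp_const t ts il)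
  show "dec aii" unfolding aii_def[abs_def] by (intro dec_add dec_mult dec_e tmp_mult tmp_const t ts il)
  show "dec bjj" unfolding bjj_def[abs_def] by (intro dec_add dec_mult dec_e tmp_mult tmp_const t ts il)
qed

lemma tmp_phi: "tmp (\<lambda>n x. phi n (fst x))"
  unfolding phi_def power2_eq_square
  by (intro tmp_diff tmp_mult tmp_const tmp_shift[OF tmp_profiles(1)] tmp_shift[OF tmp_profiles(2)] tmp_shift[OF tmp_ilam])

lemma ent_smooth: "smooth_on UNIV (ent n r s)"
proof -
  have "smooth_on UNIV (aii n)" "smooth_on UNIV (\<lambda>x. phi n (fst x) + bjj n x)" "smooth_on UNIV (aij n)"
    by (intro smooth_on_add tempered_imp_smooth[OF dec_a(1)] tempered_imp_smooth[OF dec_a(2)] tempered_imp_smooth[OF dec_a(3)]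
        tempered_imp_smooth[OF tmp_phi])+
  moreover have "ent n r s = (if r = Some (dir n) \<and> s = Some (dir n) then aii n
     else if r = Some (dir (Suc n)) \<and> s = Some (dir (Suc n)) then (\<lambda>x. phi n (fst x) + bjj n x)
     else if r = Some (dir n) \<and> s = Some (dir (Suc n)) \<or> r = Some (dir (Suc n)) \<and> s = Some (dir n) then aij n
     else (\<lambda>x. 0))"
    by (rule ext) (simp add: ent_def)
  ultimately show ?thesis by (simp split: if_split)
qed

text \<open>Below t = T m only finitely many terms are present, so near each point the series is a
  finite sum.\<close>

lemma A_smooth: "smooth_on ({0..<1} \<times> UNIV) (\<lambda>x. A x $ r $ s)"
  unfolding smooth_on_def
proof
  fix x :: "'m pt" assume "x \<in> {0..<1} \<times> UNIV"
  hence "fst x < 1" by auto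
  then obtain m where m: "fst x < T m"
    using order_tendstoD(1)[OF T_lim] by (auto simp: eventually_sequentially)
  let ?U = "{z :: 'm pt. fst z < T m}" and ?F = "\<lambda>z. (if r = s then 1 else 0) + (\<Sum>n<m. ent n r s z)"
  have "open ?U" by (intro open_Collect_less continuous_intros)
  moreover have "Ck_on k ?U ?F" for k
  proof -
    have "smooth_on UNIV ?F" by (intro smooth_on_add smooth_on_const smooth_on_sum ent_smooth)
    thus ?thesis unfolding smooth_on_UNIV_iff using Ck_on_subset by blast
  qed
  moreover have "?F z = A z $ r $ s" if "z \<in> ?U" for z
  proof -
    have "ent n r s z = 0" if "n \<notin> {..<m}" for n
      by (rule ent_support) (use that \<open>z \<in> ?U\<close> T_mono[of m "Suc n"] in auto)
    hence "(\<Sum>n. ent n r s z) = (\<Sum>n<m. ent n r s z)" by (intro suminf_finite) auto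
    thus ?thesis by (simp add: A_def)
  qed
  ultimately show "\<exists>U F. open U \<and> x \<in> U \<and> (\<forall>k. Ck_on k U F) \<and> (\<forall>y\<in>U \<inter> {0..<1} \<times> UNIV. F y = A y $ r $ s)"
    using m by (intro exI[of _ ?U] exI[of _ ?F]) auto
qed

lemma A_period: assumes "k \<in> lattice_pts" shows "A (t, y + k) = A (t, y)"
proof -
  have e: "ent n r s (t, y + k) = ent n r s (t, y)" for n r s
    unfolding ent_def aij_def aii_def bjj_def trig_period[OF assms] fst_conv ..
  show ?thesis unfolding A_def e ..
qed

lemma ent_sym: "ent n r s x = ent n s r x"
proof (cases "r = s")
  case False
  have "ent n r s x = (if r = Some (dir n) \<and> s = Some (dir (Suc n)) \<or> r = Some (dir (Suc n)) \<and> s = Some (dir n) then aij n x else 0)"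
    if "r \<noteq> s" for r s
  proof -
    have "\<not> (r = Some (dir n) \<and> s = Some (dir n))" "\<not> (r = Some (dir (Suc n)) \<and> s = Some (dir (Suc n)))"
      using that by blast+
    thus ?thesis unfolding ent_def by (simp only: if_False)
  qed
  from this[OF False] this[OF False[symmetric]] show ?thesis by (simp only: disj_commute conj_commute)
qed simp

lemma A_sym: "A x $ r $ s = A x $ s $ r"
  unfolding A_def vec_lambda_beta
  by (rule arg_cong2[where f="(+)"], simp add: eq_commute, rule suminf_cong, rule ent_sym)

end

text \<open>An estimate for all lifts of z passes to the infimum over the lifts after raising both
  sides to the power 1/\<rho>, since the infimum stands inside \<open>powr\<close>. Using C + 1
  avoids a division by 0.\<close>

lemma holder_on_M_of_dist:
  fixes f :: "'m::finite pt \<Rightarrow> real"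
  assumes h: "\<And>x z. \<bar>f x - f z\<bar> \<le> C * dist x z powr \<rho>" and C: "0 \<le> C" and r: "0 < \<rho>"
    and per: "\<And>t y k. k \<in> lattice_pts \<Longrightarrow> f (t, y + k) = f (t, y)"
  shows "holder_on_M \<rho> f"
  unfolding holder_on_M_def
proof (intro exI ballI)
  fix x z :: "'m pt"
  let ?d = "\<lambda>k. dist x (fst z, snd z + k)"
  let ?v = "\<bar>f x - f z\<bar>"
  have b: "?v \<le> (C + 1) * ?d k powr \<rho>" if "k \<in> lattice_pts" for k
  proof -
    have "?v \<le> C * ?d k powr \<rho>" using h[of x "(fst z, snd z + k)"] per[OF that, of "fst z" "snd z"] by simp
    also have "\<dots> \<le> (C + 1) * ?d k powr \<rho>" by (intro mult_right_mono) auto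
    finally show ?thesis .
  qed
  have "(?v / (C + 1)) powr (1 / \<rho>) \<le> mdist x z"
    unfolding mdist_def
  proof (rule cINF_greatest)
    show "lattice_pts \<noteq> ({} :: (real ^ 'm) set)" using lattice_axis by blast
    fix k :: "real ^ 'm" assume k: "k \<in> lattice_pts"
    have "?v / (C + 1) \<le> ?d k powr \<rho>" using b[OF k] C by (simp add: field_simps)
    hence "(?v / (C + 1)) powr (1 / \<rho>) \<le> (?d k powr \<rho>) powr (1 / \<rho>)" using C r by (intro powr_mono2) auto
    also have "\<dots> = ?d k" using r by (simp add: powr_powr)
    finally show "(?v / (C + 1)) powr (1 / \<rho>) \<le> ?d k" .
  qed
  hence "((?v / (C + 1)) powr (1 / \<rho>)) powr \<rho> \<le> mdist x z powr \<rho>" using r by (intro powr_mono2) auto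
  hence "?v / (C + 1) \<le> mdist x z powr \<rho>" using r C by (simp add: powr_powr)
  thus "?v \<le> (C + 1) * mdist x z powr \<rho>" using C by (simp add: field_simps)
qed

context miller_metric begin

section \<open>The flux of u is V\<close>

lemma U_outside: "fst x \<notin> {T n<..<T (Suc (Suc n))} \<Longrightarrow> x \<notin> St n"
proof -
  have "a + 3 / 4 * (b - a) < b" if "a < b" for a b :: real using that by (simp add: field_simps)
  from this[OF T_less[of "Suc n"]] have "T (Suc n) + 3 / 4 * L (Suc n) < T (Suc (Suc n))" by (simp add: L_def)
  thus "fst x \<notin> {T n<..<T (Suc (Suc n))} \<Longrightarrow> x \<notin> St n" using L_pos[of n] by (auto simp: St_def)
qed

lemma suminf_two:
  fixes f :: "nat \<Rightarrow> real"
  assumes "T (Suc n) \<le> fst x" "fst x < T (Suc (Suc n))" "\<And>k. x \<notin> St k \<Longrightarrow> f k = 0"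
  shows "(\<Sum>k. f k) = f n + f (Suc n)"
proof -
  have "f k = 0" if "k \<notin> {n, Suc n}" for k
  proof (rule assms(3), rule U_outside)
    show "fst x \<notin> {T k<..<T (Suc (Suc k))}"
    proof (cases "k < n")
      case True
      thus ?thesis using T_mono[of "Suc (Suc k)" "Suc n"] assms by auto
    next
      case False
      thus ?thesis using that T_mono[of "Suc (Suc n)" k] assms by auto
    qed
  qed
  hence "(\<Sum>k. f k) = (\<Sum>k\<in>{n, Suc n}. f k)" by (intro suminf_finite) auto
  thus ?thesis by simp
qed

lemma strip_values:
  assumes "T (Suc n) \<le> t" "t < T (Suc (Suc n))"
  shows "om n t = 1 - off (tau (Suc n) t)" "om (Suc n) t = on (tau (Suc n) t)" "rate n t = lam n" "rate1 n t = 0"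
    "ron n t = 0" "roff (Suc n) t = 0"
proof -
  have 1: "1 \<le> tau n t" by (rule tau_Suc[OF assms(1)])
  have 2: "tau (Suc (Suc n)) t \<le> 0" using assms(2) by (intro tau_neg) simp
  show "om n t = 1 - off (tau (Suc n) t)" "om (Suc n) t = on (tau (Suc n) t)" "rate n t = lam n" "rate1 n t = 0"
    "ron n t = 0" "roff (Suc n) t = 0"
    using 1 2 by (simp_all add: om_def rate_def rate1_def ron_def roff_def profile_values)
qed

text \<open>Where a switching error is not zero the partner mode is fully on, so its amplitude is
  exactly \<open>E\<close> and the quotient of the two modes is an exponential of \<open>Dn\<close>,
  up to the cutoff of the other mode.\<close>

lemma correction_identities:
  assumes "T (Suc n) \<le> t" "t < T (Suc (Suc n))"
  shows "fon (Suc n) t = eon n t * U n t" "eon2 n t * U n t = eon n t * U (Suc n) t"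
    "foff n t = eoff n t * U (Suc n) t" "eoff2 n t * U (Suc n) t = eoff n t * U n t"
    "G n t = (lam n)\<^sup>2 * U n t" "G (Suc n) t = (1 + phi n t) * ((lam (Suc n))\<^sup>2 * U (Suc n) t)"
proof -
  note s = strip_values[OF assms]
  have e: "exp (Dn n t) * E n t = E (Suc n) t" "exp (- Dn n t) * E (Suc n) t = E n t"
    by (simp_all add: E_def Dn_def exp_add[symmetric])
  have e2: "exp (2 * Dn n t) = exp (Dn n t) * exp (Dn n t)" "exp (- 2 * Dn n t) = exp (- Dn n t) * exp (- Dn n t)"
    by (simp_all add: exp_add[symmetric])
  have U0: "U n t = E n t" if "ron (Suc n) t \<noteq> 0"
    using ron_support[OF that] s(1) by (simp add: U_def profile_values)
  have U1: "U (Suc n) t = E (Suc n) t" if "roff n t \<noteq> 0"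
    using roff_support[OF that] s(2) by (simp add: U_def profile_values)
  show "fon (Suc n) t = eon n t * U n t"
    using U0 e by (cases "ron (Suc n) t = 0") (simp_all add: fon_def eon_def mult.assoc)
  show "foff n t = eoff n t * U (Suc n) t"
    using U1 e by (cases "roff n t = 0") (simp_all add: foff_def eoff_def mult.assoc)
  show "eon2 n t * U n t = eon n t * U (Suc n) t"
  proof (cases "ron (Suc n) t = 0")
    case False
    have "eon2 n t * U n t = ron (Suc n) t * on (tau (Suc n) t) * exp (Dn n t) * (exp (Dn n t) * E n t)"
      using U0[OF False] by (simp add: eon2_def e2)
    thus ?thesis unfolding e by (simp add: eon_def U_def s)
  qed (simp add: eon2_def eon_def)
  show "eoff2 n t * U (Suc n) t = eoff n t * U n t"
  proof (cases "roff n t = 0")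
    case False
    have "eoff2 n t * U (Suc n) t = roff n t * (1 - off (tau (Suc n) t)) * exp (- Dn n t) * (exp (- Dn n t) * E (Suc n) t)"
      using U1[OF False] unfolding eoff2_def e2 by simp
    thus ?thesis unfolding e by (simp add: eoff_def U_def s)
  qed (simp add: eoff2_def eoff_def)
  show "G n t = (lam n)\<^sup>2 * U n t" by (simp add: G_def U_def s)
  have "lam (Suc n) * (1 / lam (Suc n)) = 1" using lam_pos[of "Suc n"] by simp
  hence "(1 / lam (Suc n)) * (1 / lam (Suc n)) * (lam (Suc n))\<^sup>2 = 1" by (simp add: power2_eq_square)
  hence h: "(1 + phi n t) * (lam (Suc n))\<^sup>2 = (rate (Suc n) t)\<^sup>2 - rate1 (Suc n) t"
    unfolding phi_def by (simp add: mult.assoc)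
  show "G (Suc n) t = (1 + phi n t) * ((lam (Suc n))\<^sup>2 * U (Suc n) t)"
    unfolding G_def U_def h[symmetric] by (simp only: mult.assoc)
qed

lemma V_eq_A_gradient:
  assumes "x \<in> M" shows "V x = A x *v gradient u x"
proof (cases "fst x = 1")
  case True
  \<comment> \<open>All terms of both series vanish at the end, so both sides of the equation are
    0.\<close>
  have z: "U n (fst x) = 0" "U1 n (fst x) = 0" for n by (rule beyond_end; simp add: True)+
  have "gradient u x $ i = 0" for i by (cases i) (simp_all add: gradient_u z cong: if_cong)
  hence g: "gradient u x = 0" by (simp add: vec_eq_iff)
  show ?thesis unfolding g using True by (simp add: V_def vec_eq_iff beyond_end(2))
next
  case False
  have "0 \<le> fst x" "fst x < 1" using assms False by (auto simp: M_def)
  then obtain n where n: "T (Suc n) \<le> fst x" "fst x < T (Suc (Suc n))" using find_strip by blast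
  define t where "t = fst x"
  note nt = n[folded t_def]
  note ci = correction_identities[OF nt]
  define i where "i = dir n"
  define j where "j = dir (Suc n)"
  have ij: "i \<noteq> j" "dir (Suc (Suc n)) = i" using dir_Suc[of n] by (auto simp: i_def j_def)
  have l: "lam n \<noteq> 0" "lam (Suc n) \<noteq> 0" using lam_pos[of n] lam_pos[of "Suc n"] by auto
  have Uz: "U k (fst x) = 0" "U1 k (fst x) = 0" "Vn k r x = 0" if "x \<notin> St k" for k r
  proof -
    note s = support[OF that]
    show "U k (fst x) = 0" "U1 k (fst x) = 0" using s by (simp_all add: U_def U1_def)
    show "Vn k r x = 0" using s by (simp add: Vn_def Va_def Vb_def U1_def G_def fon_def foff_def split: option.split)
  qed
  let ?g = "gradient u x"
  have g0: "?g $ None = U1 n t * cs n x + U1 (Suc n) t * cs (Suc n) x"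
    unfolding gradient_u t_def by (rule suminf_two[OF n]) (simp add: Uz)
  have gS: "?g $ Some k = (if k = i then - (lam n * U n t * sn n x) else 0) + (if k = j then - (lam (Suc n) * U (Suc n) t * sn (Suc n) x) else 0)" for k
    unfolding gradient_u t_def i_def j_def by (rule suminf_two[OF n]) (simp add: Uz)
  have Vs: "V x $ r = Vn n r x + Vn (Suc n) r x" for r
    unfolding V_def vec_lambda_beta by (rule suminf_two[OF n]) (simp add: Uz)
  have Ar: "(A x *v ?g) $ r = ?g $ r + ent n r (Some i) x * ?g $ Some i + ent n r (Some j) x * ?g $ Some j" for r
  proof -
    have "(A x *v ?g) $ r = (\<Sum>s\<in>UNIV. ((if r = s then 1 else 0) + ent n r s x) * ?g $ s)"
      unfolding matrix_vector_mult_def vec_lambda_beta by (rule sum.cong) (use n A_entry[of n x] in auto)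
    also have "\<dots> = (\<Sum>s\<in>UNIV. (if r = s then ?g $ s else 0)) + (\<Sum>s\<in>UNIV. ent n r s x * ?g $ s)"
      by (simp add: distrib_right sum.distrib if_distrib[of "\<lambda>a. a * _"] cong: if_cong)
    also have "(\<Sum>s\<in>UNIV. ent n r s x * ?g $ s) = (\<Sum>s\<in>{Some i, Some j}. ent n r s x * ?g $ s)"
      by (rule sum.mono_neutral_right) (auto simp: ent_def i_def j_def)
    finally show ?thesis using ij by simp
  qed
  have z: "fon n t = 0" "foff (Suc n) t = 0" using strip_values[OF nt] by (simp_all add: fon_def foff_def)
  show ?thesis
  proof (subst vec_eq_iff, rule allI)
    fix r
    consider "r = None" | "r = Some i" | "r = Some j" | k where "r = Some k" "k \<noteq> i" "k \<noteq> j" by (cases r) auto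
    thus "V x $ r = (A x *v ?g) $ r"
    proof cases
      case 1
      thus ?thesis unfolding Vs Ar by (simp add: g0 Vn_def ent_def t_def)
    next
      \<comment> \<open>Row of the old mode. The \<open>eon\<close> part of the off-diagonal entry
        creates a flux that \<open>V\<close> does not contain; the \<open>eon2\<close> part of
        \<open>aii\<close> cancels it by \<open>ci(2)\<close>.\<close>
      case 2
      have gi: "?g $ Some i = - (lam n * U n t * sn n x)" "?g $ Some j = - (lam (Suc n) * U (Suc n) t * sn (Suc n) x)"
        using ij by (simp_all add: gS)
      have e: "ent n (Some i) (Some i) x = aii n x" "ent n (Some i) (Some j) x = aij n x"
        using ij by (auto simp: ent_def i_def j_def)
      have v: "Vn n (Some i) x = Va n x" "Vn (Suc n) (Some i) x = Vb (Suc n) x"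
        using ij by (auto simp: Vn_def i_def j_def)
      have "Va n x = - (lam n * U n t * sn n x) + 2 / lam n * (eoff n t * U (Suc n) t * (sn n x * (sn (Suc n) x)\<^sup>2))"
        using l by (simp add: Va_def t_def[symmetric] z ci power2_eq_square)
      moreover have "Vb (Suc n) x = 1 / lam n * (eon n t * U n t * (cs (Suc n) x * (cs n x * sn n x)))"
        by (simp add: Vb_def t_def[symmetric] z ci snp_Suc)
      moreover have "aii n x * - (lam n * U n t * sn n x) =
          1 / lam n * (eon n t * U n t * (cs (Suc n) x * (cs n x * sn n x))) - 2 / lam n * ((eon2 n t * U n t) * (sn n x * (sn (Suc n) x)\<^sup>2))"
        using l by (simp add: aii_def t_def[symmetric] field_simps power2_eq_square)
      moreover have "aij n x * - (lam (Suc n) * U (Suc n) t * sn (Suc n) x) =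
          2 / lam n * ((eon n t * U (Suc n) t + eoff n t * U (Suc n) t) * (sn n x * (sn (Suc n) x)\<^sup>2))"
        using l by (simp add: aij_def t_def[symmetric] field_simps power2_eq_square)
      ultimately show ?thesis unfolding 2 Vs Ar e v gi ci(2) by (simp add: algebra_simps)
    next
      \<comment> \<open>Row of the new mode: \<open>eon\<close> and \<open>eoff\<close> exchange
        their roles, and the factor 1 + \<open>phi\<close> turns \<lambda>^2 U into
        \<open>G\<close>.\<close>
      case 3
      have gi: "?g $ Some i = - (lam n * U n t * sn n x)" "?g $ Some j = - (lam (Suc n) * U (Suc n) t * sn (Suc n) x)"
        using ij by (simp_all add: gS)
      have e: "ent n (Some j) (Some j) x = phi n t + bjj n x" "ent n (Some j) (Some i) x = aij n x"
        using ij by (auto simp: ent_def i_def j_def t_def)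
      have v: "Vn n (Some j) x = Vb n x" "Vn (Suc n) (Some j) x = Va (Suc n) x"
        using ij by (auto simp: Vn_def i_def j_def)
      have "Va (Suc n) x = - ((1 + phi n t) * (lam (Suc n) * U (Suc n) t * sn (Suc n) x))
          + 2 / lam (Suc n) * (eon n t * U n t * (sn (Suc n) x * (sn n x)\<^sup>2))"
        using l by (simp add: Va_def t_def[symmetric] z ci snp_Suc power2_eq_square)
      moreover have "Vb n x = 1 / lam (Suc n) * (eoff n t * U (Suc n) t * (cs n x * (cs (Suc n) x * sn (Suc n) x)))"
        by (simp add: Vb_def t_def[symmetric] z ci)
      moreover have "bjj n x * - (lam (Suc n) * U (Suc n) t * sn (Suc n) x) =
          1 / lam (Suc n) * (eoff n t * U (Suc n) t * (cs n x * (cs (Suc n) x * sn (Suc n) x)))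
          - 2 / lam (Suc n) * ((eoff2 n t * U (Suc n) t) * (sn (Suc n) x * (sn n x)\<^sup>2))"
        using l by (simp add: bjj_def t_def[symmetric] field_simps power2_eq_square)
      moreover have "aij n x * - (lam n * U n t * sn n x) =
          2 / lam (Suc n) * ((eon n t * U n t + eoff n t * U n t) * (sn (Suc n) x * (sn n x)\<^sup>2))"
        using l by (simp add: aij_def t_def[symmetric] field_simps power2_eq_square)
      ultimately show ?thesis unfolding 3 Vs Ar e v gi ci(4) by (simp add: algebra_simps)
    next
      case 4
      thus ?thesis unfolding Vs Ar using ij by (auto simp: gS Vn_def ent_def i_def j_def)
    qed
  qed
qed

text \<open>Strip 0 ends at t = 0: there mode 0 is completely switched on and no other mode has
  started.\<close>

lemma u_nonzero: "u (0, 0) \<noteq> 0"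
proof -
  have z: "un k (0, 0) = 0" if "k \<notin> {0}" for k
  proof -
    have "tau k 0 \<le> 0" using T_mono[of 1 k] T_1 that by (intro tau_neg) auto
    thus ?thesis by (simp add: un_def U_def om_def profile_values)
  qed
  have "u (0, 0) = (\<Sum>k\<in>{0}. un k (0, 0))" unfolding u_def by (rule suminf_finite) (use z in auto)
  also have "\<dots> = U 0 0" by (simp add: un_def cs_def)
  also have "U 0 0 = E 0 0"
  proof -
    have "1 \<le> tau 0 0" using T_1 by (intro tau_Suc) simp
    moreover have "tau (Suc 0) 0 \<le> 0" using T_1 by (intro tau_neg) simp
    ultimately show ?thesis by (simp add: U_def om_def profile_values)
  qed
  finally show ?thesis by (simp add: E_def)
qed

lemma u_bounded: "\<exists>B\<ge>0. \<forall>x. \<bar>u x\<bar> \<le> B"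
proof -
  obtain C N where C: "0 \<le> C" "\<And>k x. \<bar>un k x\<bar> \<le> C * (real k + 1) ^ N * exp (- real k)"
    using temperedD(3)[OF dec_un] unfolding poly_bounded_def by auto
  let ?b = "\<lambda>k. C * ((real k + 1) ^ N * exp (- real k))"
  have s: "summable ?b" by (rule summable_mult[OF summable_poly_exp])
  have "\<bar>u x\<bar> \<le> suminf ?b" for x
  proof -
    have "norm (un k x) \<le> ?b k" for k using C(2)[of k x] by (simp add: mult.assoc)
    hence n: "\<bar>un k x\<bar> \<le> ?b k" for k by simp
    have sa: "summable (\<lambda>k. \<bar>un k x\<bar>)" by (rule summable_comparison_test'[OF s, of 0]) (use n in simp)
    have "\<bar>\<Sum>k. un k x\<bar> \<le> (\<Sum>k. \<bar>un k x\<bar>)" by (rule summable_rabs[OF sa])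
    also have "\<dots> \<le> suminf ?b" by (rule suminf_le[OF n sa s])
    finally show ?thesis by (simp add: u_def)
  qed
  moreover have "0 \<le> suminf ?b" by (rule suminf_nonneg[OF s]) (use C(1) in simp)
  ultimately show ?thesis by blast
qed

lemma u_end: "u (1, y) = 0" by (simp add: u_def beyond_end)

section \<open>Smallness of the perturbation and ellipticity\<close>

lemma rate_le: "\<bar>rate n t\<bar> \<le> lam n"
proof -
  have "0 \<le> c n * hump (tau n t)" using c_pos profile_bounds(5) by simp
  hence "rate n t \<le> lam n * 1" unfolding rate_def using lam_pos[of n] by (intro mult_left_mono) auto
  thus ?thesis using rate_nonneg[of n t] by simp
qed

lemma small': "(64 * K / (L (Suc n))\<^sup>2 + 16 * K * lam (Suc n) / L (Suc n)) * exp (- (real n + sh)) \<le> 1 / 32"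
  using small[of n] by (simp add: L_def)

text \<open>Both errors are brought to the form that \<open>small\<close> controls; by
  \<open>lam_mono\<close> the larger frequency serves for the old mode too.\<close>

lemma r_bound:
  "\<bar>ron (Suc n) t\<bar> \<le> 64 * K / (L (Suc n))\<^sup>2 + 16 * K * lam (Suc n) / L (Suc n)"
  "\<bar>roff n t\<bar> \<le> 64 * K / (L (Suc n))\<^sup>2 + 16 * K * lam (Suc n) / L (Suc n)"
proof -
  have Lp: "0 < L (Suc n)" by (rule L_pos)
  have 1: "\<bar>2 * (w1 / L (Suc n)) * r\<bar> \<le> 16 * K * lam (Suc n) / L (Suc n)" if "\<bar>w1\<bar> \<le> 8 * K" "\<bar>r\<bar> \<le> lam (Suc n)" for w1 r
  proof -
    have "\<bar>2 * (w1 / L (Suc n)) * r\<bar> = 2 * (\<bar>w1\<bar> * \<bar>r\<bar>) / L (Suc n)" using Lp by (simp add: abs_mult)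
    also have "\<dots> \<le> 2 * ((8 * K) * lam (Suc n)) / L (Suc n)"
      using that Lp K by (intro divide_right_mono mult_left_mono mult_mono) auto
    finally show ?thesis by simp
  qed
  have 2: "\<bar>w2 / (L (Suc n))\<^sup>2\<bar> \<le> 64 * K / (L (Suc n))\<^sup>2" if "\<bar>w2\<bar> \<le> 64 * K" for w2
    using that by (simp add: divide_right_mono)
  show "\<bar>ron (Suc n) t\<bar> \<le> 64 * K / (L (Suc n))\<^sup>2 + 16 * K * lam (Suc n) / L (Suc n)"
    using 1[OF profile_bounds(7) rate_le, of "tau (Suc n) t" t] 2[OF profile_bounds(8), of "tau (Suc n) t"]
      abs_triangle_ineq4[of "2 * (on1 (tau (Suc n) t) / L (Suc n)) * rate (Suc n) t" "on2 (tau (Suc n) t) / (L (Suc n))\<^sup>2"]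
    by (simp add: ron_def)
  show "\<bar>roff n t\<bar> \<le> 64 * K / (L (Suc n))\<^sup>2 + 16 * K * lam (Suc n) / L (Suc n)"
    using 1[OF profile_bounds(9) order_trans[OF rate_le lam_mono], of "tau (Suc n) t" t] 2[OF profile_bounds(10), of "tau (Suc n) t"]
      abs_triangle_ineq4[of "off2 (tau (Suc n) t) / (L (Suc n))\<^sup>2" "2 * (off1 (tau (Suc n) t) / L (Suc n)) * rate n t"]
    by (simp add: roff_def)
qed

text \<open>With 1/32, \<open>aij\<close> is at most 1/8 and \<open>aii\<close> and
  \<open>bjj\<close> are at most 3/32; as \<open>phi\<close> is at most 1/8, every entry of the
  perturbation stays below 1/4.\<close>

lemma e_bound: "\<bar>eon n t\<bar> \<le> 1/32" "\<bar>eon2 n t\<bar> \<le> 1/32" "\<bar>eoff n t\<bar> \<le> 1/32" "\<bar>eoff2 n t\<bar> \<le> 1/32"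
proof -
  let ?Q = "64 * K / (L (Suc n))\<^sup>2 + 16 * K * lam (Suc n) / L (Suc n)"
  have Q: "0 \<le> ?Q" using K lam_pos[of "Suc n"] L_pos[of "Suc n"] by simp
  have gen: "\<bar>a * w * exp s\<bar> \<le> 1/32" if "\<bar>a\<bar> \<le> ?Q" "\<bar>w\<bar> \<le> 1" "a \<noteq> 0 \<Longrightarrow> s \<le> - (real n + sh)" for a w s
  proof (cases "a = 0")
    case False
    have "\<bar>a * w * exp s\<bar> = \<bar>a\<bar> * \<bar>w\<bar> * exp s" by (simp add: abs_mult)
    also have "\<dots> \<le> ?Q * 1 * exp (- (real n + sh))"
      using that False Q by (intro mult_mono) auto
    finally show ?thesis using small'[of n] by simp
  qed simp
  have on: "ron (Suc n) t \<noteq> 0 \<Longrightarrow> Dn n t \<le> - (real (Suc n) + sh)" using ron_support expD_bound_sh(1) less_imp_le by blast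
  have off: "roff n t \<noteq> 0 \<Longrightarrow> real (Suc n) + sh \<le> Dn n t" using roff_support expD_bound_sh(2) less_imp_le by blast
  have "\<bar>ron (Suc n) t * 1 * exp (Dn n t)\<bar> \<le> 1/32" by (rule gen[OF r_bound(1)]) (use on in auto)
  thus "\<bar>eon n t\<bar> \<le> 1/32" by (simp add: eon_def)
  show "\<bar>eon2 n t\<bar> \<le> 1/32" unfolding eon2_def
    by (rule gen[OF r_bound(1)]) (use on sh profile_bounds in auto)
  have "\<bar>roff n t * 1 * exp (- Dn n t)\<bar> \<le> 1/32" by (rule gen[OF r_bound(2)]) (use off in auto)
  thus "\<bar>eoff n t\<bar> \<le> 1/32" by (simp add: eoff_def)
  show "\<bar>eoff2 n t\<bar> \<le> 1/32" unfolding eoff2_def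
    by (rule gen[OF r_bound(2)]) (use off sh profile_bounds in auto)
qed

text \<open>In this form both the size and the variation of \<open>phi\<close> are seen to be of
  order c: the last factor is at most 1.\<close>

lemma phi_eq:
  "phi n t = (1 - c (Suc n) * hump (tau (Suc n) t))\<^sup>2 - 1 + c (Suc n) * hump1 (tau (Suc n) t) * (1 / (L (Suc n) * lam (Suc n)))"
proof -
  have "lam (Suc n) \<noteq> 0" using lam_pos[of "Suc n"] by simp
  thus ?thesis by (simp add: phi_def rate_def rate1_def field_simps power2_eq_square)
qed

lemma iLlam: "0 \<le> 1 / (L (Suc n) * lam (Suc n))" "1 / (L (Suc n) * lam (Suc n)) \<le> 1"
proof -
  have "lam n * L (Suc n) \<le> lam (Suc n) * L (Suc n)" using lam_mono L_pos[of "Suc n"] by (intro mult_right_mono) auto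
  hence "1 \<le> L (Suc n) * lam (Suc n)" using growth[of n] by (simp add: L_def mult.commute)
  thus "0 \<le> 1 / (L (Suc n) * lam (Suc n))" "1 / (L (Suc n) * lam (Suc n)) \<le> 1" by auto
qed

lemma phi_bound: "\<bar>phi n t\<bar> \<le> c (Suc n) * (3 + 16 * K)"
proof -
  let ?c = "c (Suc n)" and ?h = "hump (tau (Suc n) t)" and ?h1 = "hump1 (tau (Suc n) t)"
  have b: "0 \<le> ?c" "?c \<le> 1" "0 \<le> ?h" "?h \<le> 1" "\<bar>?h1\<bar> \<le> 16 * K" using c_pos c_le profile_bounds by auto
  have ch: "0 \<le> ?c * ?h" "?c * ?h \<le> ?c" "?c * ?h \<le> 1" using b by (auto intro: mult_left_le mult_le_one)
  have "(1 - ?c * ?h)\<^sup>2 - 1 = (?c * ?h) * (?c * ?h - 2)" by (simp add: power2_eq_square algebra_simps)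
  also have "\<bar>\<dots>\<bar> \<le> ?c * 3"
  proof -
    have "\<bar>?c * ?h\<bar> \<le> ?c" unfolding abs_of_nonneg[OF ch(1)] by (rule ch(2))
    moreover have "\<bar>y - 2\<bar> \<le> 3" if "0 \<le> y" "y \<le> 1" for y :: real using that by simp
    hence "\<bar>?c * ?h - 2\<bar> \<le> 3" using ch(1,3) by blast
    ultimately show ?thesis unfolding abs_mult[of "?c * ?h"] using b(1) by (intro mult_mono) simp_all
  qed
  finally have 1: "\<bar>(1 - ?c * ?h)\<^sup>2 - 1\<bar> \<le> ?c * 3" .
  have "\<bar>?c * ?h1 * (1 / (L (Suc n) * lam (Suc n)))\<bar> = ?c * \<bar>?h1\<bar> * (1 / (L (Suc n) * lam (Suc n)))"
    by (simp only: abs_mult[of "?c * ?h1"] abs_mult[of ?c] abs_of_nonneg[OF b(1)] abs_of_nonneg[OF iLlam(1)])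
  also have "\<dots> \<le> ?c * (16 * K) * 1" using b iLlam[of n] K by (intro mult_mono) auto
  finally have "\<bar>?c * ?h1 * (1 / (L (Suc n) * lam (Suc n)))\<bar> \<le> ?c * (16 * K)" by simp
  thus ?thesis unfolding phi_eq using 1 abs_triangle_ineq[of "(1 - ?c * ?h)\<^sup>2 - 1" "?c * ?h1 * (1 / (L (Suc n) * lam (Suc n)))"]
    by (simp add: distrib_left)
qed

lemma ent_bound: "\<bar>ent n r s x\<bar> \<le> 1/4"
proof -
  have il: "\<bar>1 / lam k\<bar> \<le> 1" for k using lam_ge[of k] lam_pos[of k] by (simp add: abs_of_pos)
  have tr: "\<bar>sn k x\<bar> \<le> 1" "\<bar>cs k x\<bar> \<le> 1" for k by (simp_all add: sn_def cs_def)
  have pr: "\<bar>a * b\<bar> \<le> A' * B'" if "\<bar>a\<bar> \<le> A'" "\<bar>b\<bar> \<le> B'" for a b A' B' :: real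
    unfolding abs_mult using that by (intro mult_mono) auto
  have 1: "\<bar>r * ((1 / lam k) * (1 / lam l)) * (a * b) * e\<bar> \<le> \<bar>r\<bar> * (1 * 1) * (1 * 1) * f"
    if "\<bar>a\<bar> \<le> 1" "\<bar>b\<bar> \<le> 1" "\<bar>e\<bar> \<le> f" for r a b e f k l
    by (intro pr that il order_refl)
  note e = e_bound[of n "fst x"]
  have "\<bar>eon n (fst x) + eoff n (fst x)\<bar> \<le> 1/16"
    using e(1,3) abs_triangle_ineq[of "eon n (fst x)" "eoff n (fst x)"] by simp
  from 1[OF tr(1) tr(1) this, of "-2" n "Suc n" n "Suc n"] have "\<bar>aij n x\<bar> \<le> 1/8" by (simp add: aij_def)
  note aij = this
  have add3: "\<bar>a + b\<bar> \<le> 3/32"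
    if "\<bar>a\<bar> \<le> \<bar>- 1\<bar> * (1 * 1) * (1 * 1) * (1/32)" "\<bar>b\<bar> \<le> \<bar>2\<bar> * (1 * 1) * (1 * 1) * (1/32)" for a b :: real
    using abs_triangle_ineq[of a b] that by simp
  note aij
  moreover have "\<bar>aii n x\<bar> \<le> 3/32" unfolding aii_def by (rule add3[OF 1[OF tr(2) tr(2) e(1)] 1[OF tr(1) tr(1) e(2)]])
  moreover have "\<bar>bjj n x\<bar> \<le> 3/32" unfolding bjj_def by (rule add3[OF 1[OF tr(2) tr(2) e(3)] 1[OF tr(1) tr(1) e(4)]])
  moreover have "\<bar>phi n (fst x) + bjj n x\<bar> \<le> 1/8 + 3/32"
    by (rule order_trans[OF abs_triangle_ineq add_mono[OF order_trans[OF phi_bound small_c] \<open>\<bar>bjj n x\<bar> \<le> 3/32\<close>]])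
  ultimately show ?thesis unfolding ent_def by auto
qed

text \<open>The perturbation affects a 2 by 2 block with entries at most 1/4, so it takes away at
  most (|a| + |b|)^2 / 4, hence at most (a^2 + b^2) / 2.\<close>

lemma A_elliptic: "(1/2) * (norm \<xi>)\<^sup>2 \<le> \<xi> \<bullet> (A x *v \<xi>)"
proof -
  obtain n where n: "\<And>r s. A x $ r $ s = (if r = s then 1 else 0) + ent n r s x" using A_cases[of x] by blast
  define i where "i = Some (dir n)"
  define j where "j = Some (dir (Suc n))"
  have ij: "i \<noteq> j" using dir_Suc(1)[of n] by (auto simp: i_def j_def)
  have "\<xi> \<bullet> (A x *v \<xi>) = (\<Sum>r\<in>UNIV. \<Sum>s\<in>UNIV. \<xi> $ r * ((if r = s then 1 else 0) + ent n r s x) * \<xi> $ s)"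
    by (simp add: inner_vec_def matrix_vector_mult_def n sum_distrib_left mult.assoc)
  also have "\<dots> = (\<Sum>r\<in>UNIV. \<Sum>s\<in>UNIV. (if r = s then \<xi> $ r * \<xi> $ s else 0)) + (\<Sum>r\<in>UNIV. \<Sum>s\<in>UNIV. \<xi> $ r * ent n r s x * \<xi> $ s)"
    unfolding sum.distrib[symmetric] by (intro sum.cong refl) (simp add: distrib_left distrib_right)
  also have "(\<Sum>r\<in>UNIV. \<Sum>s\<in>UNIV. (if r = s then \<xi> $ r * \<xi> $ s else 0)) = (norm \<xi>)\<^sup>2"
    by (simp add: power2_norm_eq_inner inner_vec_def)
  also have "(\<Sum>r\<in>UNIV. \<Sum>s\<in>UNIV. \<xi> $ r * ent n r s x * \<xi> $ s) = (\<Sum>r\<in>{i, j}. \<Sum>s\<in>{i, j}. \<xi> $ r * ent n r s x * \<xi> $ s)"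
  proof -
    have z: "ent n r s x = 0" if "r \<notin> {i, j} \<or> s \<notin> {i, j}" for r s using that by (auto simp: ent_def i_def j_def)
    have "(\<Sum>r\<in>UNIV. \<Sum>s\<in>UNIV. \<xi> $ r * ent n r s x * \<xi> $ s) = (\<Sum>r\<in>{i, j}. \<Sum>s\<in>UNIV. \<xi> $ r * ent n r s x * \<xi> $ s)"
      by (rule sum.mono_neutral_right) (use z in auto)
    also have "\<dots> = (\<Sum>r\<in>{i, j}. \<Sum>s\<in>{i, j}. \<xi> $ r * ent n r s x * \<xi> $ s)"
      by (intro sum.cong refl sum.mono_neutral_right) (use z in auto)
    finally show ?thesis .
  qed
  finally have eq: "\<xi> \<bullet> (A x *v \<xi>) = (norm \<xi>)\<^sup>2 + (\<Sum>r\<in>{i, j}. \<Sum>s\<in>{i, j}. \<xi> $ r * ent n r s x * \<xi> $ s)" .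
  have "- (1/4) * (\<bar>\<xi> $ i\<bar> + \<bar>\<xi> $ j\<bar>)\<^sup>2 \<le> (\<Sum>r\<in>{i, j}. \<Sum>s\<in>{i, j}. \<xi> $ r * ent n r s x * \<xi> $ s)"
  proof -
    have b: "- (1/4) * (\<bar>\<xi> $ r\<bar> * \<bar>\<xi> $ s\<bar>) \<le> \<xi> $ r * ent n r s x * \<xi> $ s" for r s
    proof -
      have "\<bar>\<xi> $ r * ent n r s x * \<xi> $ s\<bar> = \<bar>ent n r s x\<bar> * (\<bar>\<xi> $ r\<bar> * \<bar>\<xi> $ s\<bar>)" by (simp add: abs_mult)
      also have "\<dots> \<le> (1/4) * (\<bar>\<xi> $ r\<bar> * \<bar>\<xi> $ s\<bar>)" by (intro mult_right_mono ent_bound) simp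
      finally show ?thesis by (simp add: abs_le_iff)
    qed
    show ?thesis using b[of i i] b[of i j] b[of j i] b[of j j] ij by (simp add: power2_eq_square algebra_simps)
  qed
  hence 1: "(norm \<xi>)\<^sup>2 - (1/4) * (\<bar>\<xi> $ i\<bar> + \<bar>\<xi> $ j\<bar>)\<^sup>2 \<le> \<xi> \<bullet> (A x *v \<xi>)"
    unfolding eq by simp
  have "(\<xi> $ i)\<^sup>2 + (\<xi> $ j)\<^sup>2 \<le> (norm \<xi>)\<^sup>2"
  proof -
    have "(\<Sum>r\<in>{i, j}. (\<xi> $ r)\<^sup>2) \<le> (\<Sum>r\<in>UNIV. (\<xi> $ r)\<^sup>2)" by (rule sum_mono2) auto
    moreover have "(norm \<xi>)\<^sup>2 = (\<Sum>r\<in>UNIV. (\<xi> $ r)\<^sup>2)"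
      unfolding power2_norm_eq_inner inner_vec_def inner_real_def by (simp only: power2_eq_square)
    ultimately show ?thesis using ij by simp
  qed
  moreover have "(\<bar>\<xi> $ i\<bar> + \<bar>\<xi> $ j\<bar>)\<^sup>2 \<le> 2 * ((\<xi> $ i)\<^sup>2 + (\<xi> $ j)\<^sup>2)"
    using zero_le_power2[of "\<bar>\<xi> $ i\<bar> - \<bar>\<xi> $ j\<bar>"] by (simp add: power2_sum power2_diff)
  ultimately show ?thesis using 1 by simp
qed

lemma A_bound: "\<bar>A x $ r $ s\<bar> \<le> 2"
proof -
  obtain n where n: "\<And>r s. A x $ r $ s = (if r = s then 1 else 0) + ent n r s x" using A_cases[of x] by blast
  show ?thesis unfolding n using ent_bound[of n r s x] by auto
qed

section \<open>Hoelder continuity up to the end\<close>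

lemma dec_holder:
  assumes "dec F" shows "\<exists>B\<ge>0. \<forall>n x z. \<bar>F n x - F n z\<bar> \<le> B * dist x z powr \<rho>"
proof -
  obtain B0 where B0: "0 \<le> B0" "\<And>n x. \<bar>F n x\<bar> \<le> B0" using tempered_uniform_bound[OF assms summable_poly_exp] by blast
  have "\<exists>B\<ge>0. \<forall>n x z. \<bar>F n x - F n z\<bar> \<le> B * dist x z"
    by (rule uniform_lipschitz[OF temperedD(1)[OF assms] tempered_uniform_bound[OF temperedD(2)[OF assms] summable_poly_exp]])
  then obtain B1 where B1: "0 \<le> B1" "\<And>n x z. \<bar>F n x - F n z\<bar> \<le> B1 * dist x z" by blast
  have "\<bar>F n x - F n z\<bar> \<le> (2 * B0 + B1) * dist x z powr \<rho>" for n x z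
  proof (rule min_powr_bound[OF _ B1(2)])
    show "\<bar>F n x - F n z\<bar> \<le> 2 * B0" using abs_triangle_ineq4[of "F n x" "F n z"] B0(2)[of n x] B0(2)[of n z] by linarith
  qed (use B0 B1 rho in auto)
  thus ?thesis using B0 B1 by (intro exI[of _ "2 * B0 + B1"]) auto
qed

lemma profile_lipschitz:
  fixes \<phi> :: "real \<Rightarrow> real"
  assumes "tempered (\<lambda>_. UNIV) (\<lambda>_. 1) (\<lambda>_. \<phi>)" shows "\<exists>B\<ge>0. \<forall>x z. \<bar>\<phi> x - \<phi> z\<bar> \<le> B * \<bar>x - z\<bar>"
proof -
  have "\<exists>B\<ge>0. \<forall>n x. \<bar>frechet_derivative \<phi> (at x) v\<bar> \<le> B" for v
  proof -
    obtain C N where C: "0 \<le> C" "\<And>k x. \<bar>frechet_derivative \<phi> (at x) v\<bar> \<le> C * (real k + 1) ^ N * 1"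
      using temperedD(3)[OF temperedD(2)[OF assms, of v]] unfolding poly_bounded_def by auto
    from C(2)[where k=0] show ?thesis using C(1) by (intro exI[of _ C]) auto
  qed
  from uniform_lipschitz[OF temperedD(1)[OF assms] this] show ?thesis by (auto simp: dist_real_def)
qed

text \<open>In terms of the position in the strip, \<open>phi\<close> is c times a bounded Lipschitz
  function, so it varies by at most a multiple of c (|t - t'| / L)^\<rho>. The bound of c by a
  multiple of L^\<rho> cancels the width, and the constant is the same for all strips.\<close>

lemma phi_holder: "\<exists>B\<ge>0. \<forall>n t t'. \<bar>phi n t - phi n t'\<bar> \<le> B * \<bar>t - t'\<bar> powr \<rho>"
proof -
  obtain B1 where B1: "0 \<le> B1" "\<And>x z. \<bar>hump x - hump z\<bar> \<le> B1 * \<bar>x - z\<bar>" using profile_lipschitz[OF profile_tempered(7)] by blast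
  obtain B2 where B2: "0 \<le> B2" "\<And>x z. \<bar>hump1 x - hump1 z\<bar> \<le> B2 * \<bar>x - z\<bar>" using profile_lipschitz[OF profile_tempered(8)] by blast
  let ?a = "2 * (3 + 16 * K)" and ?b = "4 * B1 + B2"
  have "\<bar>phi n t - phi n t'\<bar> \<le> (C\<rho> * (?a + ?b)) * \<bar>t - t'\<bar> powr \<rho>" for n t t'
  proof -
    let ?c = "c (Suc n)" and ?h = "hump (tau (Suc n) t)" and ?h' = "hump (tau (Suc n) t')"
      and ?k = "hump1 (tau (Suc n) t)" and ?k' = "hump1 (tau (Suc n) t')" and ?i = "1 / (L (Suc n) * lam (Suc n))"
    let ?d = "\<bar>tau (Suc n) t - tau (Suc n) t'\<bar>"
    have b: "0 \<le> ?c" "?c \<le> 1" "0 \<le> ?h" "?h \<le> 1" "0 \<le> ?h'" "?h' \<le> 1" using c_pos c_le profile_bounds by auto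
    have dd: "?d = \<bar>t - t'\<bar> / L (Suc n)"
      using L_pos[of "Suc n"] by (simp add: tau_def diff_divide_distrib[symmetric])
    have "\<bar>phi n t - phi n t'\<bar> \<le> (?c * ?a + ?c * ?b) * ?d powr \<rho>"
    proof (rule min_powr_bound)
      show "\<bar>phi n t - phi n t'\<bar> \<le> ?c * ?a"
        using abs_triangle_ineq4[of "phi n t" "phi n t'"] phi_bound[of n t] phi_bound[of n t']
        by (simp add: algebra_simps)
      have "phi n t - phi n t' = ?c * ((?h - ?h') * (?c * (?h + ?h') - 2)) + ?c * ((?k - ?k') * ?i)"
        unfolding phi_eq by (simp add: power2_eq_square algebra_simps)
      hence "\<bar>phi n t - phi n t'\<bar> \<le> \<bar>?c * ((?h - ?h') * (?c * (?h + ?h') - 2))\<bar> + \<bar>?c * ((?k - ?k') * ?i)\<bar>"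
        by (simp only: abs_triangle_ineq)
      also have "\<bar>?c * ((?h - ?h') * (?c * (?h + ?h') - 2))\<bar> \<le> ?c * ((B1 * ?d) * 4)"
      proof -
        have ch: "?c * (?h + ?h') \<le> 1 * (1 + 1)" "0 \<le> ?c * (?h + ?h')" using b by (intro mult_mono add_mono mult_nonneg_nonneg; simp)+
        hence "\<bar>?c * (?h + ?h') - 2\<bar> \<le> 4" by (simp add: abs_le_iff)
        thus ?thesis unfolding abs_mult[of ?c] abs_mult[of "?h - ?h'"] using b B1 by (intro mult_mono) auto
      qed
      also have "\<bar>?c * ((?k - ?k') * ?i)\<bar> \<le> ?c * ((B2 * ?d) * 1)"
        unfolding abs_mult[of ?c] abs_mult[of "?k - ?k'"] using b B2 iLlam[of n] by (intro mult_mono) auto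
      finally show "\<bar>phi n t - phi n t'\<bar> \<le> ?c * ?b * ?d" by (simp add: algebra_simps)
    qed (use b K B1 B2 rho in auto)
    also have "\<dots> = ?c * (?a + ?b) * (\<bar>t - t'\<bar> powr \<rho> / L (Suc n) powr \<rho>)"
      unfolding dd using L_pos[of "Suc n"] by (simp add: powr_divide distrib_left)
    also have "\<dots> \<le> (C\<rho> * L (Suc n) powr \<rho>) * (?a + ?b) * (\<bar>t - t'\<bar> powr \<rho> / L (Suc n) powr \<rho>)"
      using C\<rho>(2)[of "Suc n"] K B1 B2 by (intro mult_right_mono) (auto simp: L_def)
    also have "\<dots> = (C\<rho> * (?a + ?b)) * \<bar>t - t'\<bar> powr \<rho>" using L_pos[of "Suc n"] by simp
    finally show ?thesis .
  qed
  moreover have "0 \<le> C\<rho> * (?a + ?b)" using C\<rho>(1) K B1 B2 by simp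
  ultimately show ?thesis by blast
qed

lemma ent_holder: "\<exists>B\<ge>0. \<forall>n r s x z. \<bar>ent n r s x - ent n r s z\<bar> \<le> B * dist x z powr \<rho>"
proof -
  obtain B1 where B1: "0 \<le> B1" "\<And>n x z. \<bar>aii n x - aii n z\<bar> \<le> B1 * dist x z powr \<rho>" using dec_holder[OF dec_a(2)] by blast
  obtain B2 where B2: "0 \<le> B2" "\<And>n x z. \<bar>aij n x - aij n z\<bar> \<le> B2 * dist x z powr \<rho>" using dec_holder[OF dec_a(1)] by blast
  obtain B3 where B3: "0 \<le> B3" "\<And>n x z. \<bar>bjj n x - bjj n z\<bar> \<le> B3 * dist x z powr \<rho>" using dec_holder[OF dec_a(3)] by blast
  obtain B4 where B4: "0 \<le> B4" "\<And>n t t'. \<bar>phi n t - phi n t'\<bar> \<le> B4 * \<bar>t - t'\<bar> powr \<rho>" using phi_holder by blast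
  let ?B = "B1 + B2 + B3 + B4"
  have "\<bar>ent n r s x - ent n r s z\<bar> \<le> ?B * dist x z powr \<rho>" for n r s x z
  proof -
    let ?p = "dist x z powr \<rho>"
    have "\<bar>fst x - fst z\<bar> powr \<rho> \<le> ?p"
      using dist_fst_le[of x z] rho by (intro powr_mono2) (auto simp: dist_real_def)
    hence "B4 * \<bar>fst x - fst z\<bar> powr \<rho> \<le> B4 * ?p" using B4(1) by (rule mult_left_mono)
    hence p: "\<bar>phi n (fst x) - phi n (fst z)\<bar> \<le> B4 * ?p" using B4(2)[of n "fst x" "fst z"] by linarith
    have nn: "0 \<le> B1 * ?p" "0 \<le> B2 * ?p" "0 \<le> B3 * ?p" "0 \<le> B4 * ?p" using B1 B2 B3 B4 by auto
    have "\<bar>(phi n (fst x) + bjj n x) - (phi n (fst z) + bjj n z)\<bar> \<le> B4 * ?p + B3 * ?p"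
      using p B3(2)[of n x z] by linarith
    moreover have "?B * ?p = B1 * ?p + B2 * ?p + B3 * ?p + B4 * ?p" by (simp add: algebra_simps)
    ultimately have 1: "\<bar>aii n x - aii n z\<bar> \<le> ?B * ?p" "\<bar>aij n x - aij n z\<bar> \<le> ?B * ?p"
        "\<bar>(phi n (fst x) + bjj n x) - (phi n (fst z) + bjj n z)\<bar> \<le> ?B * ?p" "\<bar>0 - 0\<bar> \<le> ?B * ?p"
      using nn B1(2)[of n x z] B2(2)[of n x z] by simp_all
    have "\<bar>(if a then x1 else if b then x2 else if d then x3 else 0) - (if a then y1 else if b then y2 else if d then y3 else 0)\<bar> \<le> N"
      if "\<bar>x1 - y1\<bar> \<le> N" "\<bar>x3 - y3\<bar> \<le> N" "\<bar>x2 - y2\<bar> \<le> N" "\<bar>0 - 0\<bar> \<le> N"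
      for a b d and x1 x2 x3 y1 y2 y3 N :: real using that by simp
    from this[OF 1] show ?thesis unfolding ent_def .
  qed
  thus ?thesis using B1 B2 B3 B4 by (intro exI[of _ ?B]) auto
qed

lemma ent_index: "\<exists>n. \<forall>k r s. k \<noteq> n \<longrightarrow> ent k r s x = 0"
proof (cases "0 \<le> fst x \<and> fst x < 1")
  case True
  then obtain n where n: "T (Suc n) \<le> fst x" "fst x < T (Suc (Suc n))" using find_strip by blast
  have "ent k r s x = 0" if "k \<noteq> n" for k r s by (rule ent_unique[OF n(1) less_imp_le[OF n(2)] that])
  thus ?thesis by blast
next
  case False
  have "ent k r s x = 0" for k r s
    by (rule ent_support) (use False T_mono[of 1 "Suc k"] T_1 T_less_1[of "Suc (Suc k)"] in auto)
  thus ?thesis by blast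
qed

text \<open>Only one term is present at each point. If the terms at x and z have different indices,
  each vanishes at the other point and is bounded by its own difference; hence the factor 2.\<close>

lemma A_holder: "holder_on_M \<rho> (\<lambda>x. A x $ r $ s)"
proof -
  obtain B where B: "0 \<le> B" "\<And>n r s x z. \<bar>ent n r s x - ent n r s z\<bar> \<le> B * dist x z powr \<rho>" using ent_holder by blast
  show ?thesis
  proof (rule holder_on_M_of_dist[where C="2 * B"])
    fix x z :: "'m pt"
    obtain n where n: "\<And>k. k \<noteq> n \<Longrightarrow> ent k r s x = 0" using ent_index[of x] by blast
    obtain m where m: "\<And>k. k \<noteq> m \<Longrightarrow> ent k r s z = 0" using ent_index[of z] by blast
    have sx: "(\<Sum>k. ent k r s x) = ent n r s x"
      using suminf_finite[of "{n}" "\<lambda>k. ent k r s x"] n by auto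
    have sz: "(\<Sum>k. ent k r s z) = ent m r s z"
      using suminf_finite[of "{m}" "\<lambda>k. ent k r s z"] m by auto
    have "\<bar>ent n r s x - ent m r s z\<bar> \<le> 2 * (B * dist x z powr \<rho>)"
    proof (cases "n = m")
      case True
      thus ?thesis using B(2)[of n r s x z] B(1) by (auto intro: order_trans)
    next
      case False
      thus ?thesis using B(2)[of n r s x z] B(2)[of m r s x z] n[of m] m[of n] by auto
    qed
    thus "\<bar>A x $ r $ s - A z $ r $ s\<bar> \<le> 2 * B * dist x z powr \<rho>" by (simp add: A_def sx sz)
  qed (use B rho A_period in auto)
qed

end

subsection \<open>Choice of the parameters\<close>

text \<open>With \<open>r = 1 / \<rho> - 1\<close> the strips have width of order \<open>n powr (- 1 / \<rho>)\<close>, so the variation \<open>c n\<close>,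
  of order \<open>1 / n\<close>, of the coefficients over one strip is just admissible for the exponent \<open>\<rho>\<close>.\<close>

locale powers = step_profile S S1 S2 K for S S1 S2 K +
  fixes r \<rho> :: real and e N :: nat
  assumes rho: "0 < \<rho>" "\<rho> < 1" and r: "r = 1 / \<rho> - 1" and e: "r + 1 \<le> real e"
    and N2: "2 \<le> N" and N_gap: "8 * 2 ^ e \<le> r * real N" and N_c: "16 * (real e + 3) * (3 + 16 * K) \<le> real N"
    and N_small: "\<And>x. N \<le> x \<Longrightarrow> (64 * K / r\<^sup>2 + 32 * pi * K / r) * (real x + 2) ^ (2 * e + 3) * exp (- real x) \<le> 1 / 32"
begin

text \<open>Counting from N makes the smallness conditions hold from the first strip on.\<close>

definition "x n = real n + real N"
text \<open>The widths are at least of order x^(-e). With the exponent e + 3 the gap between the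
  rates is of order x^(e + 2), and its product with the width, of order x^2, exceeds the required
  multiple of n + 1 + N.\<close>

definition "lam n = 2 * pi * x n ^ (e + 3)"
definition "freq n = (n + N) ^ (e + 3)"
text \<open>Normalised by x 1 = N + 1, so that T 1 = 0.\<close>

definition "T n = 1 - ((real N + 1) / x n) powr r"
text \<open>Twice the relative step (e + 3) / x of the frequencies: one half pays for the step, the
  other half is the gap between the rates.\<close>

definition "c n = 2 * (real e + 3) / x n"

lemma r_pos: "0 < r" using rho by (simp add: r)

lemma x_ge: "2 \<le> x n" "0 < x n" "real N \<le> x n" "x (Suc n) = x n + 1" using N2 by (auto simp: x_def)

text \<open>Mean value theorem for the power -r. The resulting exponent -(r + 1) is -1/\<rho>, and
  the factor (N + 1)^r is at least 1.\<close>

lemma L_lower: "r * (x n + 1) powr - (r + 1) \<le> T (Suc n) - T n"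
proof -
  have xp: "0 < x n" by (rule x_ge)
  have T: "T k = 1 - (real N + 1) powr r * x k powr - r" for k
  proof -
    have "((real N + 1) / x k) powr r = (real N + 1) powr r / x k powr r"
      by (rule powr_divide)
    thus ?thesis by (simp only: T_def powr_minus divide_inverse)
  qed
  have "\<exists>z. x n < z \<and> z < x n + 1 \<and> (x n + 1) powr - r - x n powr - r = (x n + 1 - x n) * (- r * z powr (- r - 1))"
    using xp by (intro MVT2) (auto intro!: derivative_eq_intros)
  then obtain z where z: "x n < z" "z < x n + 1" "(x n + 1) powr - r - x n powr - r = - (r * z powr (- r - 1))" by auto
  have "T (Suc n) - T n = (real N + 1) powr r * (r * z powr (- r - 1))"
    using z(3) by (simp add: T x_ge(4) right_diff_distrib[symmetric])
  moreover have "(x n + 1) powr (- (r + 1)) \<le> z powr (- r - 1)"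
    using z xp r_pos by (simp add: powr_mono2')
  hence "1 * (r * (x n + 1) powr (- (r + 1))) \<le> (real N + 1) powr r * (r * z powr (- r - 1))"
    using r_pos by (intro mult_mono mult_left_mono) (auto intro: ge_one_powr_ge_zero)
  ultimately show ?thesis by simp
qed

lemma L_lower': "r / (x n + 1) ^ e \<le> T (Suc n) - T n"
proof -
  have "(x n + 1) powr - real e \<le> (x n + 1) powr - (r + 1)" using e x_ge[of n] by (intro powr_mono) auto
  hence "r * (x n + 1) powr - real e \<le> r * (x n + 1) powr - (r + 1)" using r_pos by (intro mult_left_mono) auto
  moreover have "(x n + 1) powr - real e = 1 / (x n + 1) ^ e"
    using x_ge[of n] by (simp add: powr_minus powr_realpow divide_inverse)
  ultimately show ?thesis using L_lower[of n] by simp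
qed

lemma L_pos: "0 < T (Suc n) - T n"
  by (rule less_le_trans[OF _ L_lower']) (use r_pos x_ge[of n] in simp)

lemma inv_L: "1 / (T (Suc n) - T n) \<le> (x n + 1) ^ e / r"
proof -
  have "0 < r / (x n + 1) ^ e" using r_pos x_ge[of n] by simp
  from le_imp_inverse_le[OF L_lower' this] show ?thesis by (simp add: divide_inverse mult.commute)
qed

lemma x_le: "x n + 1 \<le> (real N + 1) * (real n + 1)" by (simp add: x_def algebra_simps)

lemma lam_step: "(lam n - lam (Suc n) * (1 - c (Suc n))) \<ge> (x n + 1) ^ (e + 2)"
proof -
  let ?y = "x n + 1" and ?m = "real e + 3"
  have y: "0 < ?y" using x_ge[of n] by simp
  have xy: "x n = ?y * (1 + - 1 / ?y)" using y by (simp add: field_simps)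
  \<comment> \<open>Bernoulli's inequality bounds the relative step of the frequencies by (e + 3) /
    (x + 1), half of the dip.\<close>
  have "1 + real (e + 3) * (- 1 / ?y) \<le> (1 + - 1 / ?y) ^ (e + 3)"
    using y x_ge[of n] by (intro Bernoulli_inequality) (simp add: field_simps)
  hence "?y ^ (e + 3) * (1 - ?m / ?y) \<le> ?y ^ (e + 3) * (1 + - 1 / ?y) ^ (e + 3)"
    using y by (intro mult_left_mono) auto
  also have "\<dots> = x n ^ (e + 3)" by (subst xy) (simp only: power_mult_distrib)
  finally have 1: "?y ^ (e + 3) * (1 - ?m / ?y) \<le> x n ^ (e + 3)" .
  have "lam n - lam (Suc n) * (1 - c (Suc n)) = 2 * pi * (x n ^ (e + 3) - ?y ^ (e + 3) * (1 - 2 * ?m / ?y))"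
    by (simp add: lam_def c_def x_ge(4) right_diff_distrib)
  also have "\<dots> \<ge> 2 * pi * (?y ^ (e + 3) * (1 - ?m / ?y) - ?y ^ (e + 3) * (1 - 2 * ?m / ?y))"
    using 1 by (intro mult_left_mono) auto
  also have "2 * pi * (?y ^ (e + 3) * (1 - ?m / ?y) - ?y ^ (e + 3) * (1 - 2 * ?m / ?y)) = (2 * pi * ?m) * ?y ^ (e + 2)"
  proof -
    have y3: "?y ^ (e + 3) = ?y ^ (e + 2) * ?y" by (simp add: eval_nat_numeral)
    have "a * (1 - b / d) - a * (1 - 2 * b / d) = a * (b / d)" for a b d :: real by (simp add: algebra_simps)
    hence "?y ^ (e + 3) * (1 - ?m / ?y) - ?y ^ (e + 3) * (1 - 2 * ?m / ?y) = ?y ^ (e + 3) * (?m / ?y)" .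
    also have "\<dots> = ?m * ?y ^ (e + 2)" unfolding y3 using y by simp
    finally show ?thesis by (simp only: mult.assoc)
  qed
  finally have "(2 * pi * ?m) * ?y ^ (e + 2) \<le> lam n - lam (Suc n) * (1 - c (Suc n))" .
  moreover have "1 * 1 \<le> (2 * pi) * ?m" using pi_gt3 by (intro mult_mono) auto
  hence "1 * ?y ^ (e + 2) \<le> (2 * pi * ?m) * ?y ^ (e + 2)" using y by (intro mult_right_mono) auto
  ultimately show ?thesis by simp
qed

text \<open>As x is at least 2, x + 2 is at most 2 x; \<open>N_gap\<close> makes up for the
  resulting factor 2^e.\<close>

lemma power_ratio: "r / 2 ^ e * (x n) ^ k \<le> x n ^ (e + k) * (r / (x n + 2) ^ e)"
proof -
  have "(x n + 2) ^ e \<le> (2 * x n) ^ e" using x_ge[of n] by (intro power_mono) auto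
  hence "r / (2 * x n) ^ e \<le> r / (x n + 2) ^ e" using r_pos x_ge[of n] by (intro divide_left_mono) auto
  hence "x n ^ (e + k) * (r / (2 * x n) ^ e) \<le> x n ^ (e + k) * (r / (x n + 2) ^ e)"
    using x_ge[of n] by (intro mult_left_mono) auto
  moreover have "x n ^ (e + k) * (r / (2 * x n) ^ e) = r / 2 ^ e * (x n) ^ k"
    using x_ge[of n] by (simp add: power_add power_mult_distrib)
  ultimately show ?thesis by simp
qed

lemma rx_ge: "8 \<le> r / 2 ^ e * x n"
proof -
  have "8 * 2 ^ e \<le> r * x n" by (rule order_trans[OF N_gap mult_left_mono[OF x_ge(3)]]) (use r_pos in simp)
  thus ?thesis by (simp add: field_simps)
qed

lemma growth: "2 \<le> lam n * (T (Suc (Suc n)) - T (Suc n))"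
proof -
  have "2 \<le> 8 * 1 * (1::real)" by simp
  also have "\<dots> \<le> (r / 2 ^ e * x n) * x n ^ 2 * (2 * pi)"
    using rx_ge[of n] x_ge[of n] pi_gt3 r_pos by (intro mult_mono) (auto intro: one_le_power)
  also have "\<dots> = 2 * pi * (r / 2 ^ e * x n ^ 3)" by (simp add: eval_nat_numeral)
  also have "\<dots> \<le> 2 * pi * (x n ^ (e + 3) * (r / (x n + 2) ^ e))" by (intro mult_left_mono power_ratio) simp
  also have "\<dots> \<le> lam n * (T (Suc (Suc n)) - T (Suc n))"
  proof -
    have "r / (x n + 2) ^ e \<le> T (Suc (Suc n)) - T (Suc n)" using L_lower'[of "Suc n"] by (simp add: x_ge(4) add.commute)
    from mult_left_mono[OF this, of "lam n"] show ?thesis using x_ge[of n] by (simp add: lam_def mult.assoc)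
  qed
  finally show ?thesis .
qed

lemma gap: "8 * (real n + 1 + real N) \<le> (lam n - lam (Suc n) * (1 - c (Suc n))) * (T (Suc (Suc n)) - T (Suc n))"
proof -
  let ?y = "x n + 1"
  have "8 * (real n + 1 + real N) = 8 * ?y" by (simp add: x_def)
  also have "\<dots> \<le> (r / 2 ^ e * x (Suc n)) * ?y" using rx_ge[of "Suc n"] x_ge[of n] by (intro mult_right_mono) auto
  also have "\<dots> = r / 2 ^ e * (x (Suc n)) ^ 2" by (simp add: x_ge(4) power2_eq_square)
  also have "\<dots> \<le> x (Suc n) ^ (e + 2) * (r / (x (Suc n) + 2) ^ e)" by (rule power_ratio)
  also have "\<dots> \<le> ?y ^ (e + 2) * (r / (x n + 2) ^ e)"
    unfolding x_ge(4) using r_pos x_ge[of n] by (intro mult_left_mono divide_left_mono power_mono) auto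
  also have "\<dots> \<le> (lam n - lam (Suc n) * (1 - c (Suc n))) * (T (Suc (Suc n)) - T (Suc n))"
  proof (rule mult_mono[OF lam_step])
    show "r / (x n + 2) ^ e \<le> T (Suc (Suc n)) - T (Suc n)" using L_lower'[of "Suc n"] by (simp add: x_ge(4) add.commute)
    show "0 \<le> lam n - lam (Suc n) * (1 - c (Suc n))" by (rule order_trans[OF _ lam_step]) (use x_ge[of n] in simp)
  qed (use r_pos x_ge[of n] in simp)
  finally show ?thesis .
qed

lemma small_n: "(64 * K / (T (Suc (Suc n)) - T (Suc n))\<^sup>2 + 16 * K * lam (Suc n) / (T (Suc (Suc n)) - T (Suc n)))
       * exp (- (real n + real N)) \<le> 1 / 32"
proof -
  let ?L = "T (Suc (Suc n)) - T (Suc n)" and ?z = "x n + 2"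
  have z: "1 \<le> ?z" using x_ge[of n] by simp
  have iL: "0 < 1 / ?L" "1 / ?L \<le> ?z ^ e / r" using L_pos[of "Suc n"] inv_L[of "Suc n"] by (simp_all add: x_ge(4) add.commute)
  have "64 * K / ?L\<^sup>2 = 64 * K * (1 / ?L)\<^sup>2" by (simp add: power_divide)
  also have "\<dots> \<le> 64 * K * (?z ^ e / r)\<^sup>2" using iL K by (intro mult_left_mono power_mono) auto
  also have "\<dots> = 64 * K / r\<^sup>2 * ?z ^ (2 * e)" by (simp add: power_divide power_mult[symmetric] mult.commute)
  also have "\<dots> \<le> 64 * K / r\<^sup>2 * ?z ^ (2 * e + 3)" using K z by (intro mult_left_mono power_increasing) auto
  finally have 1: "64 * K / ?L\<^sup>2 \<le> 64 * K / r\<^sup>2 * ?z ^ (2 * e + 3)" .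
  have "16 * K * lam (Suc n) / ?L = 16 * K * lam (Suc n) * (1 / ?L)" by simp
  also have "\<dots> \<le> 16 * K * (2 * pi * ?z ^ (e + 3)) * (?z ^ e / r)"
    using iL K x_ge[of n] unfolding lam_def x_ge(4) by (intro mult_mono mult_left_mono power_mono) auto
  also have "\<dots> = 32 * pi * K / r * ?z ^ (2 * e + 3)"
  proof -
    have "(e + 3) + e = 2 * e + 3" by simp
    hence p: "?z ^ (2 * e + 3) = ?z ^ (e + 3) * ?z ^ e" using power_add[of ?z "e + 3" e] by simp
    show ?thesis unfolding p by simp
  qed
  finally have 2: "16 * K * lam (Suc n) / ?L \<le> 32 * pi * K / r * ?z ^ (2 * e + 3)" .
  have "(64 * K / ?L\<^sup>2 + 16 * K * lam (Suc n) / ?L) * exp (- (real n + real N))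
      \<le> (64 * K / r\<^sup>2 * ?z ^ (2 * e + 3) + 32 * pi * K / r * ?z ^ (2 * e + 3)) * exp (- (real n + real N))"
    using 1 2 by (intro mult_right_mono add_mono) auto
  also have "\<dots> = (64 * K / r\<^sup>2 + 32 * pi * K / r) * (real (n + N) + 2) ^ (2 * e + 3) * exp (- real (n + N))"
    by (simp add: x_def distrib_right)
  also have "\<dots> \<le> 1 / 32" by (rule N_small) simp
  finally show ?thesis .
qed

lemma c_small: "c n * (3 + 16 * K) \<le> 1 / 8"
proof -
  have "16 * (real e + 3) * (3 + 16 * K) \<le> x n" using N_c x_ge(3)[of n] by simp
  thus ?thesis using x_ge[of n] by (simp add: c_def field_simps)
qed

text \<open>The choice of r gives -(r + 1) \<rho> = -1: the power \<rho> of a width is at least of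
  order 1 / x, the order of c.\<close>

lemma c_holder: "c n \<le> (4 * (real e + 3) / r powr \<rho>) * (T (Suc n) - T n) powr \<rho>"
proof -
  have "(r * (x n + 1) powr - (r + 1)) powr \<rho> \<le> (T (Suc n) - T n) powr \<rho>"
    using L_lower[of n] rho r_pos by (intro powr_mono2) auto
  moreover have "(r * (x n + 1) powr - (r + 1)) powr \<rho> = r powr \<rho> / (x n + 1)"
  proof -
    have "- (r + 1) * \<rho> = - 1" using rho by (simp add: r field_simps)
    hence "((x n + 1) powr - (r + 1)) powr \<rho> = (x n + 1) powr - 1" by (simp only: powr_powr)
    thus ?thesis using r_pos x_ge[of n] by (simp add: powr_mult powr_minus divide_inverse)
  qed
  ultimately have 1: "r powr \<rho> / (x n + 1) \<le> (T (Suc n) - T n) powr \<rho>" by simp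
  have "c n = 2 * (real e + 3) / x n" by (simp add: c_def)
  also have "\<dots> \<le> 4 * (real e + 3) / (x n + 1)"
  proof -
    have "1 / x n \<le> 2 / (x n + 1)" using x_ge[of n] by (simp add: field_simps)
    from mult_left_mono[OF this, of "2 * (real e + 3)"] show ?thesis by simp
  qed
  also have "\<dots> = (4 * (real e + 3) / r powr \<rho>) * (r powr \<rho> / (x n + 1))" using r_pos by simp
  also have "\<dots> \<le> (4 * (real e + 3) / r powr \<rho>) * (T (Suc n) - T n) powr \<rho>" using 1 by (intro mult_left_mono) auto
  finally show ?thesis .
qed

lemma T_tendsto: "T \<longlonglongrightarrow> 1"
proof -
  have "filterlim (\<lambda>n. x n) at_top sequentially"
    unfolding x_def by (rule filterlim_tendsto_add_at_top[OF tendsto_const filterlim_real_sequentially, of "real N", simplified add.commute])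
  hence "(\<lambda>n. (real N + 1) / x n) \<longlonglongrightarrow> 0"
    by (intro tendsto_divide_0[OF tendsto_const] filterlim_at_top_imp_at_infinity)
  hence "(\<lambda>n. ((real N + 1) / x n) powr r) \<longlonglongrightarrow> 0 powr r"
    using r_pos x_ge by (intro tendsto_powr') (auto intro!: always_eventually divide_nonneg_nonneg order_trans[OF _ x_ge(1)])
  from tendsto_diff[OF tendsto_const[of 1] this] show ?thesis using r_pos unfolding T_def by simp
qed

lemma miller_metric:
  assumes "p \<noteq> (q :: 'm::finite)"
  shows "miller_metric S S1 S2 K T lam c freq p q \<rho> (4 * (real e + 3) / r powr \<rho>) (real N)"
proof
  show "T n < T (Suc n)" for n using L_pos[of n] by simp
  show "T 1 = 0" by (simp add: T_def x_def add.commute)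
  show "T \<longlonglongrightarrow> 1" by (rule T_tendsto)
  show "lam n = 2 * pi * real (freq n)" "0 < freq n" for n using N2 by (simp_all add: lam_def freq_def x_def)
  show "0 \<le> c n" for n using x_ge[of n] by (simp add: c_def)
  show "c n \<le> 1" for n
  proof -
    have "c n * 1 \<le> c n * (3 + 16 * K)" using K x_ge[of n] by (intro mult_left_mono) (auto simp: c_def)
    thus ?thesis using c_small[of n] by simp
  qed
  show "poly_bounded (\<lambda>_. UNIV) (\<lambda>_. 1) (\<lambda>n x. lam n)"
  proof (rule poly_boundedI[of "2 * pi * (real N + 1) ^ (e + 3)" _ _ "e + 3"])
    fix n
    have "x n ^ (e + 3) \<le> ((real N + 1) * (real n + 1)) ^ (e + 3)" using x_le[of n] x_ge[of n] by (intro power_mono) auto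
    hence "2 * pi * x n ^ (e + 3) \<le> 2 * pi * ((real N + 1) * (real n + 1)) ^ (e + 3)" by (intro mult_left_mono) auto
    moreover have "0 \<le> x n ^ (e + 3)" using x_ge[of n] by simp
    ultimately show "\<bar>lam n\<bar> \<le> 2 * pi * (real N + 1) ^ (e + 3) * (real n + 1) ^ (e + 3) * 1"
      by (simp add: lam_def abs_mult power_mult_distrib mult.assoc)
  qed simp
  show "poly_bounded (\<lambda>_. UNIV) (\<lambda>_. 1) (\<lambda>n x. 1 / (T (Suc n) - T n))"
  proof (rule poly_boundedI[of "(real N + 1) ^ e / r" _ _ e])
    fix n
    have "(x n + 1) ^ e / r \<le> ((real N + 1) * (real n + 1)) ^ e / r"
      using x_le[of n] x_ge[of n] r_pos by (intro divide_right_mono power_mono) auto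
    hence "1 / (T (Suc n) - T n) \<le> ((real N + 1) * (real n + 1)) ^ e / r" using inv_L[of n] by linarith
    thus "\<bar>1 / (T (Suc n) - T n)\<bar> \<le> (real N + 1) ^ e / r * (real n + 1) ^ e * 1"
      using L_pos[of n] by (simp add: power_mult_distrib)
  qed (use r_pos in simp)
  show "2 \<le> lam n * (T (Suc (Suc n)) - T (Suc n))" for n by (rule growth)
  show g: "8 * (real n + 1 + real N) \<le> (lam n - lam (Suc n) * (1 - c (Suc n))) * (T (Suc (Suc n)) - T (Suc n))" for n by (rule gap)
  show "8 * (real n + 1) \<le> (lam n - lam (Suc n) * (1 - c (Suc n))) * (T (Suc (Suc n)) - T (Suc n))" for n
    by (rule order_trans[OF _ g]) simp
  show "p \<noteq> q" by fact
  show "0 < \<rho>" "\<rho> < 1" by (rule rho)+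
  show "c n \<le> 4 * (real e + 3) / r powr \<rho> * (T (Suc n) - T n) powr \<rho>" for n by (rule c_holder)
  show "lam n \<le> lam (Suc n)" for n
    using x_ge[of n] unfolding lam_def x_ge(4) by (intro mult_left_mono power_mono) auto
  show "(64 * K / (T (Suc (Suc n)) - T (Suc n))\<^sup>2 + 16 * K * lam (Suc n) / (T (Suc (Suc n)) - T (Suc n)))
       * exp (- (real n + real N)) \<le> 1 / 32" for n by (rule small_n)
  show "c n * (3 + 16 * K) \<le> 1 / 8" for n by (rule c_small)
qed simp_all

end

lemma ex_powers:
  assumes "step_profile S S1 S2 K" "0 < \<rho>" "\<rho> < 1"
  shows "\<exists>e N. powers S S1 S2 K (1 / \<rho> - 1) \<rho> e N"
proof -
  let ?r = "1 / \<rho> - 1"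
  have r: "0 < ?r" using assms by simp
  obtain e :: nat where e: "?r + 1 \<le> real e" using real_arch_simple by blast
  let ?C = "64 * K / ?r\<^sup>2 + 32 * pi * K / ?r"
  have lim: "(\<lambda>x. ?C * (real x + 2) ^ (2 * e + 3) * exp (- real x)) \<longlonglongrightarrow> 0"
  proof -
    have "((\<lambda>x::real. (x + 2) ^ (2 * e + 3) / exp (x + 2)) \<longlongrightarrow> 0) at_top"
      by (rule filterlim_compose[OF tendsto_power_div_exp_0])
         (rule filterlim_tendsto_add_at_top[OF tendsto_const filterlim_ident, of 2, simplified add.commute])
    from filterlim_compose[OF this filterlim_real_sequentially]
    have "(\<lambda>k. (?C * exp 2) * ((real k + 2) ^ (2 * e + 3) / exp (real k + 2))) \<longlonglongrightarrow> (?C * exp 2) * 0" by (intro tendsto_intros)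
    moreover have "(C * exp 2) * (a / exp (k + 2)) = C * a * exp (- k)" for C a k :: real
      by (simp add: exp_add exp_minus divide_inverse)
    ultimately show ?thesis by (simp only: mult_zero_right)
  qed
  have "\<forall>\<^sub>F x in sequentially. ?C * (real x + 2) ^ (2 * e + 3) * exp (- real x) < 1 / 32"
    by (rule order_tendstoD(2)[OF lim]) simp
  then obtain N1 where N1: "\<And>x. N1 \<le> x \<Longrightarrow> ?C * (real x + 2) ^ (2 * e + 3) * exp (- real x) < 1 / 32"
    by (auto simp: eventually_sequentially)
  obtain N2 :: nat where N2: "8 * 2 ^ e / ?r \<le> real N2" using real_arch_simple by blast
  obtain N3 :: nat where N3: "16 * (real e + 3) * (3 + 16 * K) \<le> real N3" using real_arch_simple by blast
  \<comment> \<open>Each requirement persists for larger N, so the sum of the thresholds meets all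
    of them.\<close>
  define N where "N = N1 + N2 + N3 + 2"
  have "powers S S1 S2 K ?r \<rho> e N"
  proof (intro powers.intro powers_axioms.intro)
    show "step_profile S S1 S2 K" "0 < \<rho>" "\<rho> < 1" "?r = 1 / \<rho> - 1" "?r + 1 \<le> real e" by (fact assms refl e)+
    show "2 \<le> N" by (simp add: N_def)
    have "8 * 2 ^ e / ?r \<le> real N" using N2 by (simp add: N_def)
    thus "8 * 2 ^ e \<le> ?r * real N" using r by (simp add: pos_divide_le_eq mult.commute)
    show "16 * (real e + 3) * (3 + 16 * K) \<le> real N" using N3 by (simp add: N_def)
    show "?C * (real x + 2) ^ (2 * e + 3) * exp (- real x) \<le> 1 / 32" if "N \<le> x" for x
      using N1[of x] that by (simp add: N_def)
  qed
  thus ?thesis by blast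
qed

theorem ex_miller_metric:
  fixes p q :: "'m::finite"
  assumes "0 < \<rho>" "\<rho> < 1" "p \<noteq> q"
  obtains A :: "'m metric" and V u where
    "flux_field V" "multiplier u" "\<exists>B\<ge>0. \<forall>x. \<bar>u x\<bar> \<le> B" "\<And>y. u (1, y) = 0" "u (0, 0) \<noteq> 0"
    "\<And>x. x \<in> M \<Longrightarrow> V x = A x *v gradient u x"
    "\<And>t y k. k \<in> lattice_pts \<Longrightarrow> A (t, y + k) = A (t, y)"
    "\<And>x i j. A x $ i $ j = A x $ j $ i"
    "\<And>x \<xi>. (1/2) * (norm \<xi>)\<^sup>2 \<le> \<xi> \<bullet> (A x *v \<xi>)" "\<And>x i j. \<bar>A x $ i $ j\<bar> \<le> 2"
    "\<And>i j. smooth_on ({0..<1} \<times> UNIV) (\<lambda>x. A x $ i $ j)"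
    "\<And>i j. holder_on_M \<rho> (\<lambda>x. A x $ i $ j)"
proof -
  obtain S S1 S2 K where S: "step_profile S S1 S2 K" using ex_step_profile by blast
  obtain e N where "powers S S1 S2 K (1 / \<rho> - 1) \<rho> e N" using ex_powers[OF S assms(1,2)] by blast
  then interpret powers S S1 S2 K "1 / \<rho> - 1" \<rho> e N .
  interpret m: miller_metric S S1 S2 K T lam c freq p q \<rho> "4 * (real e + 3) / (1 / \<rho> - 1) powr \<rho>" "real N"
    by (rule miller_metric[OF assms(3)])
  show ?thesis
    by (rule that[OF m.V_flux_field m.u_multiplier m.u_bounded m.u_end m.u_nonzero m.V_eq_A_gradient m.A_period m.A_sym m.A_elliptic
          m.A_bound m.A_smooth m.A_holder])
qed

subsection \<open>From conductivities to metrics\<close>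

lemma matrix_inv_unique:
  fixes A B :: "real ^ 'n ^ 'n::finite"
  assumes "A ** B = mat 1"
  shows "matrix_inv A = B"
proof -
  have BA: "B ** A = mat 1" using matrix_left_right_inverse assms by blast
  have C: "A ** matrix_inv A = mat 1 \<and> matrix_inv A ** A = mat 1"
    unfolding matrix_inv_def by (rule someI[of _ B]) (use assms BA in simp)
  have "matrix_inv A = matrix_inv A ** (A ** B)" using assms by simp
  also have "\<dots> = (matrix_inv A ** A) ** B" by (simp add: matrix_mul_assoc)
  finally show ?thesis using C by simp
qed

lemma matrix_inv_mult:
  fixes A :: "real ^ 'n ^ 'n::finite"
  assumes "det A \<noteq> 0"
  shows "A ** matrix_inv A = mat 1" "matrix_inv A ** A = mat 1"
proof -
  obtain B where B: "A ** B = mat 1" "B ** A = mat 1"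
    using assms invertible_det_nz[of A] unfolding invertible_def by blast
  show "A ** matrix_inv A = mat 1" "matrix_inv A ** A = mat 1"
    using B matrix_inv_unique[OF B(1)] by auto
qed

lemma det_nonzero_of_positive:
  fixes A :: "real ^ 'n ^ 'n::finite"
  assumes "\<And>\<xi>. \<xi> \<noteq> 0 \<Longrightarrow> 0 < \<xi> \<bullet> (A *v \<xi>)"
  shows "det A \<noteq> 0"
proof -
  have "\<forall>x. A *v x = 0 \<longrightarrow> x = 0"
  proof (intro allI impI)
    fix x assume "A *v x = 0"
    thus "x = 0" using assms[of x] by (cases "x = 0") auto
  qed
  hence "\<exists>B. B ** A = mat 1" using matrix_left_invertible_ker[of A] by simp
  thus ?thesis using invertible_det_nz[of A] invertible_left_inverse[of A] by simp
qed

text \<open>The segment from the identity to A consists of matrices with positive quadratic form,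
  hence of invertible ones, so the determinant cannot change sign along it.\<close>

lemma det_pos_of_positive:
  fixes A :: "real ^ 'n ^ 'n::finite"
  assumes pos: "\<And>\<xi>. \<xi> \<noteq> 0 \<Longrightarrow> 0 < \<xi> \<bullet> (A *v \<xi>)"
  shows "0 < det A"
proof (rule ccontr)
  let ?P = "\<lambda>t. t *\<^sub>R A + (1 - t) *\<^sub>R mat 1"
  assume "\<not> 0 < det A"
  hence "det (?P 1) \<le> 0" "0 \<le> det (?P 0)" by simp_all
  moreover have "continuous_on {0..1} (\<lambda>t. det (?P t))"
    unfolding det_def by (intro continuous_intros)
  ultimately obtain t where t: "0 \<le> t" "t \<le> 1" "det (?P t) = 0"
    using IVT2'[of "\<lambda>t. det (?P t)" 1 0 0] by auto
  have "0 < \<xi> \<bullet> (?P t *v \<xi>)" if "\<xi> \<noteq> 0" for \<xi>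
  proof -
    have e: "\<xi> \<bullet> (?P t *v \<xi>) = t * (\<xi> \<bullet> (A *v \<xi>)) + (1 - t) * (\<xi> \<bullet> \<xi>)"
      by (simp add: matrix_vector_mult_add_rdistrib inner_add_right scaleR_matrix_vector_assoc[symmetric])
    have "0 < \<xi> \<bullet> (A *v \<xi>)" "0 < \<xi> \<bullet> \<xi>" using pos[OF that] that by simp_all
    thus ?thesis unfolding e using t(1,2)
      by (cases "t = 0") (auto intro!: add_pos_nonneg)
  qed
  from det_nonzero_of_positive[OF this] t(3) show False by simp
qed

lemma det_scaleR:
  fixes A :: "real ^ 'n ^ 'n::finite"
  shows "det (c *\<^sub>R A) = c ^ CARD('n) * det A"
proof -
  have "c *\<^sub>R A = (\<chi> i. c *s A $ i)" by (simp add: vec_eq_iff)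
  thus ?thesis using det_rows_mul[of "\<lambda>_. c" "\<lambda>i. A $ i"] by (simp add: vec_lambda_eta)
qed

lemma matrix_inv_scaleR_inv:
  fixes A :: "real ^ 'n ^ 'n::finite"
  assumes "det A \<noteq> 0" "c \<noteq> 0"
  shows "matrix_inv (c *\<^sub>R matrix_inv A) = (1 / c) *\<^sub>R A"
  by (rule matrix_inv_unique)
    (use assms in \<open>simp add: matrix_inv_mult matrix_scalar_ac scalar_matrix_assoc[symmetric]\<close>)

text \<open>This is where \<open>n \<ge> 3\<close> enters: a conformal factor \<open>t ^ 4\<close> multiplies the conductivity
  \<open>sqrt (det g) g^(ij)\<close> by \<open>t ^ (2 n - 4)\<close>.\<close>

lemma conformal_density:
  fixes A :: "real ^ 'n ^ 'n::finite"
  assumes n: "2 \<le> CARD('n)" and t: "0 < t" and s: "0 < s" and d: "det A = s ^ (CARD('n) - 2)"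
  defines "G \<equiv> t ^ 4 *\<^sub>R (s *\<^sub>R matrix_inv A)"
  shows "(a \<bullet> (matrix_inv G *v b)) * sqrt (det G) = (t ^ (CARD('n) - 2))\<^sup>2 * (a \<bullet> (A *v b))"
proof -
  obtain m where m: "CARD('n) = m + 2" using n by (metis add.commute le_Suc_ex)
  have d0: "det A \<noteq> 0" using d s by simp
  have G: "G = (t ^ 4 * s) *\<^sub>R matrix_inv A" by (simp add: G_def)
  have i: "matrix_inv G = (1 / (t ^ 4 * s)) *\<^sub>R A"
    unfolding G by (rule matrix_inv_scaleR_inv[OF d0]) (use t s in simp)
  have "det (A ** matrix_inv A) = 1" using matrix_inv_mult(1)[OF d0] by simp
  hence "det (matrix_inv A) = 1 / s ^ m" using d s by (simp add: det_mul m field_simps)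
  hence "det G = (t ^ 4 * s) ^ (m + 2) / s ^ m" unfolding G det_scaleR m by simp
  \<comment> \<open>Written as a square, so that the root in the volume density can be taken
    exactly.\<close>
  also have "\<dots> = (t ^ (2 * m + 4) * s)\<^sup>2"
  proof -
    have t4: "(t ^ 4) ^ (m + 2) = (t ^ (2 * m + 4))\<^sup>2"
      unfolding power_mult[symmetric] by (rule arg_cong[where f="power t"]) simp
    show ?thesis unfolding power_mult_distrib t4 power_add[of s] using s by simp
  qed
  finally have "sqrt (det G) = t ^ (2 * m + 4) * s" using t s by simp
  hence "(a \<bullet> (matrix_inv G *v b)) * sqrt (det G) = (a \<bullet> (A *v b)) / (t ^ 4 * s) * (t ^ (2 * m + 4) * s)"
    unfolding i by (simp add: scaleR_matrix_vector_assoc[symmetric])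
  also have "\<dots> = (t ^ m)\<^sup>2 * (a \<bullet> (A *v b))"
    using t s by (simp add: power_add field_simps flip: power_mult)
  finally show ?thesis by (simp add: m)
qed

text \<open>Cramer's rule writes an entry of the inverse as a polynomial in the entries of A times a
  power of the determinant, a form to which closure under sums, products and powers applies.\<close>

lemma matrix_inv_cramer:
  fixes A :: "real ^ 'n ^ 'n::finite"
  assumes "0 < det A"
  shows "matrix_inv A $ k $ l = det (\<chi> i j. if j = k then axis l 1 $ i else A $ i $ j) * det A powr - 1"
proof -
  have d: "det A \<noteq> 0" using assms by simp
  have "A *v (matrix_inv A *v axis l 1) = axis l 1"
    by (simp add: matrix_vector_mul_assoc matrix_inv_mult(1)[OF d])
  hence "matrix_inv A *v axis l 1 = (\<chi> k. det (\<chi> i j. if j = k then axis l 1 $ i else A $ i $ j) / det A)"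
    using cramer[OF d] by blast
  hence "(matrix_inv A *v axis l 1) $ k = det (\<chi> i j. if j = k then axis l 1 $ i else A $ i $ j) / det A"
    by simp
  thus ?thesis using assms by (simp add: matrix_vector_mult_basis column_def powr_minus_divide)
qed

lemma abs_det_le:
  fixes A :: "real ^ 'n ^ 'n::finite"
  assumes "\<And>i j. \<bar>A $ i $ j\<bar> \<le> C"
  shows "\<bar>det A\<bar> \<le> real (card {p. p permutes (UNIV :: 'n set)}) * C ^ CARD('n)"
proof -
  have "\<bar>of_int (sign p) * (\<Prod>i\<in>UNIV. A $ i $ p i)\<bar> \<le> C ^ CARD('n)" for p
  proof -
    have "\<bar>of_int (sign p) * (\<Prod>i\<in>UNIV. A $ i $ p i)\<bar> = (\<Prod>i\<in>UNIV. \<bar>A $ i $ p i\<bar>)"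
      by (simp add: abs_mult sign_def abs_prod)
    also have "\<dots> \<le> (\<Prod>i\<in>(UNIV :: 'n set). C)" by (rule prod_mono) (use assms in auto)
    finally show ?thesis by simp
  qed
  hence "\<bar>det A\<bar> \<le> (\<Sum>p\<in>{p. p permutes (UNIV :: 'n set)}. C ^ CARD('n))"
    unfolding det_def by (intro order_trans[OF sum_abs] sum_mono)
  thus ?thesis by simp
qed

section \<open>The algebra of bounded Hoelder coefficients\<close>

definition holder_coeff :: "real \<Rightarrow> ('m::finite pt \<Rightarrow> real) \<Rightarrow> bool" where
  "holder_coeff \<rho> f \<longleftrightarrow> smooth_on ({0..<1} \<times> UNIV) f \<and> holder_on_M \<rho> f \<and> (\<exists>C. \<forall>x\<in>M. \<bar>f x\<bar> \<le> C)"

lemma holder_coeffE: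
  assumes "holder_coeff \<rho> (f :: 'm::finite pt \<Rightarrow> real)"
  obtains B H where "0 \<le> B" "0 \<le> H" "\<And>x. x \<in> M \<Longrightarrow> \<bar>f x\<bar> \<le> B"
    "\<And>x z. x \<in> M \<Longrightarrow> z \<in> M \<Longrightarrow> \<bar>f x - f z\<bar> \<le> H * mdist x z powr \<rho>"
proof -
  obtain B where B: "\<forall>x\<in>M. \<bar>f x\<bar> \<le> B" using assms unfolding holder_coeff_def by blast
  obtain H where H: "\<forall>x\<in>M. \<forall>z\<in>M. \<bar>f x - f z\<bar> \<le> H * mdist x z powr \<rho>"
    using assms unfolding holder_coeff_def holder_on_M_def by blast
  show thesis
  proof (rule that[of "\<bar>B\<bar>" "\<bar>H\<bar>"])
    show "\<bar>f x\<bar> \<le> \<bar>B\<bar>" if "x \<in> M" for x using B that by force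
    show "\<bar>f x - f z\<bar> \<le> \<bar>H\<bar> * mdist x z powr \<rho>" if "x \<in> M" "z \<in> M" for x z
      by (rule order_trans[OF H[rule_format, OF that]]) (simp add: mult_right_mono)
  qed simp_all
qed

lemma holder_coeffI:
  assumes "smooth_on ({0..<1} \<times> UNIV) f" "\<And>x. x \<in> M \<Longrightarrow> \<bar>f x\<bar> \<le> B"
    "\<And>x z. x \<in> M \<Longrightarrow> z \<in> M \<Longrightarrow> \<bar>f x - f z\<bar> \<le> H * mdist x z powr \<rho>"
  shows "holder_coeff \<rho> f"
  unfolding holder_coeff_def holder_on_M_def using assms by blast

lemma holder_coeff_const: "holder_coeff \<rho> (\<lambda>x. c)"
  by (rule holder_coeffI[where B="\<bar>c\<bar>" and H=0]) simp_all

lemma holder_coeff_add: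
  assumes "holder_coeff \<rho> f" "holder_coeff \<rho> g"
  shows "holder_coeff \<rho> (\<lambda>x. f x + g x)"
proof -
  obtain B H where f: "0 \<le> B" "0 \<le> H" "\<And>x. x \<in> M \<Longrightarrow> \<bar>f x\<bar> \<le> B"
    "\<And>x z. x \<in> M \<Longrightarrow> z \<in> M \<Longrightarrow> \<bar>f x - f z\<bar> \<le> H * mdist x z powr \<rho>"
    by (rule holder_coeffE[OF assms(1)]) blast
  obtain B' H' where g: "0 \<le> B'" "0 \<le> H'" "\<And>x. x \<in> M \<Longrightarrow> \<bar>g x\<bar> \<le> B'"
    "\<And>x z. x \<in> M \<Longrightarrow> z \<in> M \<Longrightarrow> \<bar>g x - g z\<bar> \<le> H' * mdist x z powr \<rho>"
    by (rule holder_coeffE[OF assms(2)]) blast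
  show ?thesis
  proof (rule holder_coeffI[where B="B + B'" and H="H + H'"])
    show "smooth_on ({0..<1} \<times> UNIV) (\<lambda>x. f x + g x)"
      using assms by (intro smooth_on_add) (simp_all add: holder_coeff_def)
    show "\<bar>f x + g x\<bar> \<le> B + B'" if "x \<in> M" for x using f(3)[OF that] g(3)[OF that] by linarith
    show "\<bar>f x + g x - (f z + g z)\<bar> \<le> (H + H') * mdist x z powr \<rho>" if "x \<in> M" "z \<in> M" for x z
      using f(4)[OF that] g(4)[OF that] unfolding distrib_right by linarith
  qed
qed

text \<open>The Hoelder constant of a product involves bounds of both factors, which is why
  \<open>holder_coeff\<close> includes a bound.\<close>

lemma holder_coeff_mult:
  assumes "holder_coeff \<rho> f" "holder_coeff \<rho> g"
  shows "holder_coeff \<rho> (\<lambda>x. f x * g x)"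
proof -
  obtain B H where f: "0 \<le> B" "0 \<le> H" "\<And>x. x \<in> M \<Longrightarrow> \<bar>f x\<bar> \<le> B"
    "\<And>x z. x \<in> M \<Longrightarrow> z \<in> M \<Longrightarrow> \<bar>f x - f z\<bar> \<le> H * mdist x z powr \<rho>"
    by (rule holder_coeffE[OF assms(1)]) blast
  obtain B' H' where g: "0 \<le> B'" "0 \<le> H'" "\<And>x. x \<in> M \<Longrightarrow> \<bar>g x\<bar> \<le> B'"
    "\<And>x z. x \<in> M \<Longrightarrow> z \<in> M \<Longrightarrow> \<bar>g x - g z\<bar> \<le> H' * mdist x z powr \<rho>"
    by (rule holder_coeffE[OF assms(2)]) blast
  show ?thesis
  proof (rule holder_coeffI[where B="B * B'" and H="B * H' + B' * H"])
    show "smooth_on ({0..<1} \<times> UNIV) (\<lambda>x. f x * g x)"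
      using assms by (intro smooth_on_mult) (simp_all add: holder_coeff_def)
    show "\<bar>f x * g x\<bar> \<le> B * B'" if "x \<in> M" for x
      unfolding abs_mult using f(1) f(3)[OF that] g(3)[OF that] by (intro mult_mono) simp_all
    show "\<bar>f x * g x - f z * g z\<bar> \<le> (B * H' + B' * H) * mdist x z powr \<rho>" if "x \<in> M" "z \<in> M" for x z
    proof -
      have "f x * g x - f z * g z = f x * (g x - g z) + g z * (f x - f z)" by (simp add: algebra_simps)
      hence "\<bar>f x * g x - f z * g z\<bar> \<le> \<bar>f x\<bar> * \<bar>g x - g z\<bar> + \<bar>g z\<bar> * \<bar>f x - f z\<bar>"
        using abs_triangle_ineq[of "f x * (g x - g z)" "g z * (f x - f z)"] by (simp add: abs_mult)
      also have "\<dots> \<le> B * (H' * mdist x z powr \<rho>) + B' * (H * mdist x z powr \<rho>)"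
        by (intro add_mono mult_mono f g that abs_ge_zero)
      finally show ?thesis by (simp add: algebra_simps)
    qed
  qed
qed

lemma holder_coeff_sum: "(\<And>i. i \<in> I \<Longrightarrow> holder_coeff \<rho> (f i)) \<Longrightarrow> holder_coeff \<rho> (\<lambda>x. \<Sum>i\<in>I. f i x)"
  by (induction I rule: infinite_finite_induct) (simp_all add: holder_coeff_const holder_coeff_add)

lemma holder_coeff_prod: "(\<And>i. i \<in> I \<Longrightarrow> holder_coeff \<rho> (f i)) \<Longrightarrow> holder_coeff \<rho> (\<lambda>x. \<Prod>i\<in>I. f i x)"
  by (induction I rule: infinite_finite_induct) (simp_all add: holder_coeff_const holder_coeff_mult)

lemma powr_lipschitz_on_interval:
  fixes a b r :: real
  assumes "0 < a"
  obtains L where "0 \<le> L" "\<And>x y. x \<in> {a..b} \<Longrightarrow> y \<in> {a..b} \<Longrightarrow> \<bar>x powr r - y powr r\<bar> \<le> L * \<bar>x - y\<bar>"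
proof -
  have "continuous_on {a..b} (\<lambda>x. r * x powr (r - 1))"
    using assms by (intro continuous_intros) auto
  hence "bounded ((\<lambda>x. r * x powr (r - 1)) ` {a..b})"
    by (intro compact_imp_bounded compact_continuous_image compact_Icc)
  then obtain L where L: "0 < L" "\<forall>x\<in>{a..b}. norm (r * x powr (r - 1)) \<le> L"
    unfolding bounded_pos by auto
  show thesis
  proof (rule that[of L])
    fix x y assume xy: "x \<in> {a..b}" "y \<in> {a..b}"
    have "norm (x powr r - y powr r) \<le> L * norm (x - y)"
    proof (rule field_differentiable_bound[where f'="\<lambda>z. r * z powr (r - 1)", OF convex_real_interval(5)[of a b]])
      fix z assume "z \<in> {a..b}"
      hence "0 < z" using assms by auto
      thus "((\<lambda>x. x powr r) has_field_derivative r * z powr (r - 1)) (at z within {a..b})"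
        by (auto intro!: derivative_eq_intros simp: powr_diff)
    qed (use L xy in auto)
    thus "\<bar>x powr r - y powr r\<bar> \<le> L * \<bar>x - y\<bar>" by simp
  qed (use L in simp)
qed

text \<open>The values lie in a compact interval away from 0, on which the power is
  Lipschitz.\<close>

lemma holder_coeff_powr:
  assumes f: "holder_coeff \<rho> f" and d: "0 < \<delta>" "\<And>x. x \<in> M \<Longrightarrow> \<delta> \<le> f x"
  shows "holder_coeff \<rho> (\<lambda>x. f x powr r)"
proof -
  obtain B H where f': "0 \<le> B" "0 \<le> H" "\<And>x. x \<in> M \<Longrightarrow> \<bar>f x\<bar> \<le> B"
    "\<And>x z. x \<in> M \<Longrightarrow> z \<in> M \<Longrightarrow> \<bar>f x - f z\<bar> \<le> H * mdist x z powr \<rho>"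
    by (rule holder_coeffE[OF f]) blast
  obtain L where L: "0 \<le> L" "\<And>x y. x \<in> {\<delta>..B} \<Longrightarrow> y \<in> {\<delta>..B} \<Longrightarrow> \<bar>x powr r - y powr r\<bar> \<le> L * \<bar>x - y\<bar>"
    by (rule powr_lipschitz_on_interval[OF d(1)]) blast
  have r: "f x \<in> {\<delta>..B}" if "x \<in> M" for x using f'(3)[OF that] d(2)[OF that] by simp
  show ?thesis
  proof (rule holder_coeffI[where B="L * (B - \<delta>) + \<delta> powr r" and H="L * H"])
    show "smooth_on ({0..<1} \<times> UNIV) (\<lambda>x. f x powr r)"
    proof (rule smooth_on_powr)
      show "smooth_on ({0..<1} \<times> UNIV) f" using f by (simp add: holder_coeff_def)
      show "0 < f x" if "x \<in> {0..<1} \<times> UNIV" for x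
        using d(1) d(2)[of x] that by (auto simp: M_def)
    qed
    show "\<bar>f x powr r\<bar> \<le> L * (B - \<delta>) + \<delta> powr r" if "x \<in> M" for x
    proof -
      have "\<bar>f x powr r - \<delta> powr r\<bar> \<le> L * \<bar>f x - \<delta>\<bar>" using r[OF that] by (intro L(2)) auto
      also have "\<dots> \<le> L * (B - \<delta>)" using r[OF that] L(1) by (intro mult_left_mono) auto
      finally show ?thesis by simp
    qed
    show "\<bar>f x powr r - f z powr r\<bar> \<le> L * H * mdist x z powr \<rho>" if "x \<in> M" "z \<in> M" for x z
      using order_trans[OF L(2)[OF r[OF that(1)] r[OF that(2)]] mult_left_mono[OF f'(4)[OF that] L(1)]]
      by (simp add: mult.assoc)
  qed
qed

lemma holder_coeff_det:
  assumes "\<And>i j. holder_coeff \<rho> (\<lambda>x. A x $ i $ j)"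
  shows "holder_coeff \<rho> (\<lambda>x. det (A x))"
  unfolding det_def by (intro holder_coeff_sum holder_coeff_mult holder_coeff_const holder_coeff_prod assms)

text \<open>Smoothness covers t < 1 only. Continuity up to the end, from which measurability on
  \<open>M\<close> follows, comes from the Hoelder bound, as \<open>mdist\<close> is at most the
  distance of two lifts.\<close>

lemma holder_coeff_continuous:
  assumes "holder_coeff \<rho> (f :: 'm::finite pt \<Rightarrow> real)" and r: "0 < \<rho>"
  shows "continuous_on M f"
  unfolding continuous_on_iff
proof (intro ballI allI impI)
  obtain H where H: "0 \<le> H" "\<And>x z. x \<in> M \<Longrightarrow> z \<in> M \<Longrightarrow> \<bar>f x - f z\<bar> \<le> H * mdist x z powr \<rho>"
    by (rule holder_coeffE[OF assms(1)]) blast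
  fix x :: "'m pt" and e :: real assume x: "x \<in> M" and e: "0 < e"
  let ?d = "(e / (H + 1)) powr (1 / \<rho>)"
  have "dist (f z) (f x) < e" if z: "z \<in> M" "dist z x < ?d" for z
  proof -
    have m: "0 \<le> mdist z x \<and> mdist z x \<le> dist z x"
    proof
      have "(0 :: real ^ 'm) \<in> lattice_pts" by (simp add: lattice_pts_def)
      hence "(INF k\<in>lattice_pts. dist z (fst x, snd x + k)) \<le> dist z (fst x, snd x + 0)"
        by (intro cINF_lower bdd_belowI2[where m=0]) simp_all
      thus "mdist z x \<le> dist z x" by (simp add: mdist_def)
      show "0 \<le> mdist z x" unfolding mdist_def
        by (rule cINF_greatest) (auto simp: lattice_pts_def intro: exI[of _ 0])
    qed
    hence "mdist z x powr \<rho> < ?d powr \<rho>" using z(2) r by (intro powr_less_mono2) auto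
    hence "mdist z x powr \<rho> < e / (H + 1)" using e H(1) r by (simp add: powr_powr)
    hence "(H + 1) * mdist z x powr \<rho> < e" using H(1) by (simp add: field_simps)
    moreover have "H * mdist z x powr \<rho> \<le> (H + 1) * mdist z x powr \<rho>" by (simp add: mult_right_mono)
    ultimately show ?thesis using H(2)[OF z(1) x] by (simp add: dist_real_def)
  qed
  moreover have "0 < ?d" using e H(1) by simp
  ultimately show "\<exists>d>0. \<forall>x'\<in>M. dist x' x < d \<longrightarrow> dist (f x') (f x) < e" by blast
qed

lemma holder_coeff_measurable:
  assumes "holder_coeff \<rho> (f :: 'm::finite pt \<Rightarrow> real)" "0 < \<rho>"
  shows "f \<in> borel_measurable (lebesgue_on M)"
proof (rule continuous_imp_measurable_on_sets_lebesgue[OF holder_coeff_continuous[OF assms]])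
  have "closed (M :: 'm pt set)" unfolding M_def by (intro closed_Times) simp_all
  thus "(M :: 'm pt set) \<in> sets lebesgue" by (simp add: borel_closed)
qed

section \<open>The metric with a given conductivity\<close>

locale conductivity =
  fixes A :: "'m::finite metric" and \<rho> :: real
  assumes dim: "3 \<le> CARD('m option)" and rho: "0 < \<rho>"
    and A_periodic: "\<And>t y k. k \<in> lattice_pts \<Longrightarrow> A (t, y + k) = A (t, y)"
    and A_sym: "\<And>x i j. A x $ i $ j = A x $ j $ i"
    and A_elliptic: "\<And>x \<xi>. (1/2) * (norm \<xi>)\<^sup>2 \<le> \<xi> \<bullet> (A x *v \<xi>)"
    and A_holder: "\<And>i j. holder_coeff \<rho> (\<lambda>x. A x $ i $ j)"
begin

definition metric_scale :: "'m pt \<Rightarrow> real" where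
  "metric_scale x = det (A x) powr (1 / real (CARD('m option) - 2))"

text \<open>The exponent in \<open>metric_scale\<close> is chosen so that \<open>sqrt (det g) g^(ij)\<close> is \<open>A\<close>.\<close>

definition metric :: "'m metric" where
  "metric x = metric_scale x *\<^sub>R matrix_inv (A x)"

lemma A_pos: "\<xi> \<noteq> 0 \<Longrightarrow> 0 < \<xi> \<bullet> (A x *v \<xi>)"
  by (rule less_le_trans[OF _ A_elliptic]) simp

lemma A_self_adjoint: "a \<bullet> (A x *v b) = b \<bullet> (A x *v a)"
proof -
  have "transpose (A x) = A x" by (simp add: transpose_def vec_eq_iff A_sym)
  thus ?thesis by (metis dot_lmul_matrix inner_commute transpose_matrix_vector)
qed

lemma det_A_pos: "0 < det (A x)" by (rule det_pos_of_positive[OF A_pos])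

lemma det_A_nonzero: "det (A x) \<noteq> 0" using det_A_pos[of x] by simp

lemma metric_scale_pos: "0 < metric_scale x" using det_A_nonzero by (simp add: metric_scale_def)

lemma det_A: "det (A x) = metric_scale x ^ (CARD('m option) - 2)"
proof -
  have "0 < CARD('m option) - 2" using dim by simp
  thus ?thesis using det_A_pos[of x]
    by (simp add: metric_scale_def powr_realpow[symmetric] powr_powr det_A_nonzero)
qed

lemma A_inv: "A x *v (matrix_inv (A x) *v \<xi>) = \<xi>"
  by (simp add: matrix_vector_mul_assoc matrix_inv_mult(1)[OF det_A_nonzero])

text \<open>Ellipticity applied to \<eta> = A^(-1) \<xi> bounds the square of the norm of \<eta> by
  2 \<eta> \<bullet> \<xi>.\<close>

lemma norm_inv_le: "norm (matrix_inv (A x) *v \<xi>) \<le> 2 * norm \<xi>"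
proof -
  let ?\<eta> = "matrix_inv (A x) *v \<xi>"
  have "(1/2) * (norm ?\<eta>)\<^sup>2 \<le> ?\<eta> \<bullet> \<xi>" using A_elliptic[of ?\<eta> x] by (simp add: A_inv)
  also have "\<dots> \<le> norm ?\<eta> * norm \<xi>" by (rule norm_cauchy_schwarz)
  finally have "norm ?\<eta> * norm ?\<eta> \<le> norm ?\<eta> * (2 * norm \<xi>)" by (simp add: power2_eq_square)
  thus ?thesis by (cases "norm ?\<eta> = 0") simp_all
qed

lemma inv_entry_le: "\<bar>matrix_inv (A x) $ i $ j\<bar> \<le> 2"
proof -
  have "\<bar>(matrix_inv (A x) *v axis j 1) $ i\<bar> \<le> norm (matrix_inv (A x) *v axis j 1)" by (rule component_le_norm_cart)
  also have "\<dots> \<le> 2" using norm_inv_le[of x "axis j 1"] by simp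
  finally show ?thesis by (simp add: matrix_vector_mult_basis column_def)
qed

text \<open>The entries of the inverse are at most 2, which bounds its determinant from above, and
  det A is the reciprocal of that determinant.\<close>

lemma det_A_bounded_below: "\<exists>\<delta>>0. \<forall>x. \<delta> \<le> det (A x)"
proof -
  let ?D = "real (card {p. p permutes (UNIV :: 'm option set)}) * 2 ^ CARD('m option)"
  have D: "1 \<le> det (A x) * ?D" for x
  proof -
    have "det (A x ** matrix_inv (A x)) = 1" by (simp add: matrix_inv_mult(1)[OF det_A_nonzero])
    hence "1 = det (A x) * det (matrix_inv (A x))" by (simp add: det_mul)
    also have "\<dots> \<le> det (A x) * ?D"
      using abs_det_le[of "matrix_inv (A x)" 2, OF inv_entry_le] det_A_pos[of x]
      by (intro mult_left_mono) (auto simp: abs_le_iff)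
    finally show ?thesis .
  qed
  have "?D \<noteq> 0"
  proof
    assume "?D = 0"
    thus False using D[of "(0, 0)"] unfolding \<open>?D = 0\<close> by simp
  qed
  moreover have "0 \<le> ?D" by simp
  ultimately have p: "0 < ?D" by linarith
  have "1 / ?D \<le> det (A x)" for x using D[of x] p by (simp add: field_simps)
  moreover have "0 < 1 / ?D" using p by simp
  ultimately show ?thesis by blast
qed

lemma metric_scale_holder: "holder_coeff \<rho> metric_scale"
  and metric_holder: "holder_coeff \<rho> (\<lambda>x. metric x $ i $ j)"
proof -
  obtain \<delta> where d: "\<delta> > 0" "\<forall>x. \<delta> \<le> det (A x)" using det_A_bounded_below by blast
  have p: "holder_coeff \<rho> (\<lambda>x. det (A x) powr r)" for r
    by (rule holder_coeff_powr[OF holder_coeff_det[OF A_holder] d(1) d(2)[rule_format]])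
  show s: "holder_coeff \<rho> metric_scale" using p[of "1 / real (CARD('m option) - 2)"]
    unfolding metric_scale_def[abs_def] .
  have "holder_coeff \<rho> (\<lambda>x. (\<chi> i' j'. if j' = i then axis j 1 $ i' else A x $ i' $ j') $ i' $ j')" for i' j'
    by (cases "j' = i") (simp_all add: holder_coeff_const A_holder)
  from holder_coeff_mult[OF s holder_coeff_mult[OF holder_coeff_det[OF this] p[of "- 1"]]]
  show "holder_coeff \<rho> (\<lambda>x. metric x $ i $ j)"
    unfolding metric_def by (simp add: matrix_inv_cramer[OF det_A_pos])
qed

lemma matrix_inv_metric: "matrix_inv (metric x) = (1 / metric_scale x) *\<^sub>R A x"
  unfolding metric_def using metric_scale_pos[of x] by (intro matrix_inv_scaleR_inv[OF det_A_nonzero]) simp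

lemma riemannian_metric: "riemannian_metric metric"
  unfolding riemannian_metric_def
proof (intro conjI ballI allI impI)
  show "periodic metric" by (simp add: periodic_def metric_def metric_scale_def A_periodic)
  fix x :: "'m pt"
  have "transpose (A x) = A x" by (simp add: transpose_def vec_eq_iff A_sym)
  hence "transpose (matrix_inv (A x)) ** A x = transpose (A x ** matrix_inv (A x))"
    by (simp add: matrix_transpose_mul)
  also have "\<dots> = mat 1" by (simp add: matrix_inv_mult(1)[OF det_A_nonzero])
  finally have "A x ** transpose (matrix_inv (A x)) = mat 1" using matrix_left_right_inverse by blast
  from matrix_inv_unique[OF this] show "transpose (metric x) = metric x"
    by (simp add: metric_def transpose_scalar)
  fix \<xi> :: "'m covec" assume "\<xi> \<noteq> 0"
  let ?\<eta> = "matrix_inv (A x) *v \<xi>"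
  have "?\<eta> \<noteq> 0" using \<open>\<xi> \<noteq> 0\<close> A_inv[of x \<xi>] by auto
  from A_pos[OF this, of x] have "0 < \<xi> \<bullet> ?\<eta>" by (simp add: A_inv inner_commute)
  thus "0 < \<xi> \<bullet> (metric x *v \<xi>)"
    using metric_scale_pos[of x] by (simp add: metric_def scaleR_matrix_vector_assoc[symmetric])
next
  show "(\<lambda>x. metric x $ i $ j) \<in> borel_measurable (lebesgue_on M)" for i j
    by (rule holder_coeff_measurable[OF metric_holder rho])
  have "\<exists>C. \<forall>x\<in>M. \<bar>metric x $ i $ j\<bar> \<le> C" for i j
    using metric_holder[of i j] by (simp add: holder_coeff_def)
  then obtain C where C: "\<And>i j x. x \<in> M \<Longrightarrow> \<bar>metric x $ i $ j\<bar> \<le> C i j" by metis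
  have "\<bar>metric x $ i $ j\<bar> \<le> (\<Sum>i\<in>UNIV. \<Sum>j\<in>UNIV. \<bar>C i j\<bar>)" if "x \<in> M" for x i j
  proof -
    have "\<bar>metric x $ i $ j\<bar> \<le> \<bar>C i j\<bar>" using C[OF that, of i j] by linarith
    also have "\<dots> \<le> (\<Sum>j\<in>UNIV. \<bar>C i j\<bar>)" by (rule member_le_sum) simp_all
    also have "\<dots> \<le> (\<Sum>i\<in>UNIV. \<Sum>j\<in>UNIV. \<bar>C i j\<bar>)"
      by (rule member_le_sum[where f="\<lambda>i. \<Sum>j\<in>UNIV. \<bar>C i j\<bar>"]) (simp_all add: sum_nonneg)
    finally show ?thesis .
  qed
  thus "\<exists>C. \<forall>x\<in>M. \<forall>i j. \<bar>metric x $ i $ j\<bar> \<le> C" by blast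
  \<comment> \<open>The inverse of the metric is A divided by \<open>metric_scale\<close>, so an
    upper bound of the scale yields the ellipticity constant.\<close>
  obtain S where S: "0 \<le> S" "\<And>x. x \<in> M \<Longrightarrow> \<bar>metric_scale x\<bar> \<le> S"
    by (rule holder_coeffE[OF metric_scale_holder]) blast
  have "1 / (2 * (S + 1)) * (norm \<xi>)\<^sup>2 \<le> \<xi> \<bullet> (matrix_inv (metric x) *v \<xi>)" if "x \<in> M" for x \<xi>
  proof -
    have "1 / (2 * (S + 1)) * (norm \<xi>)\<^sup>2 = (1 / (S + 1)) * ((1/2) * (norm \<xi>)\<^sup>2)" by simp
    also have "\<dots> \<le> (1 / metric_scale x) * (\<xi> \<bullet> (A x *v \<xi>))"
      using S(2)[OF that] metric_scale_pos[of x]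
      by (intro mult_mono A_elliptic frac_le) (auto intro: order_trans[OF _ A_elliptic])
    finally show ?thesis by (simp add: matrix_inv_metric scaleR_matrix_vector_assoc[symmetric])
  qed
  hence "AE x in lebesgue_on M. \<forall>\<xi>. 1 / (2 * (S + 1)) * (norm \<xi>)\<^sup>2 \<le> \<xi> \<bullet> (matrix_inv (metric x) *v \<xi>)"
    by (intro AE_I2) simp
  moreover have "0 < 1 / (2 * (S + 1))" using S(1) by simp
  ultimately show "\<exists>\<kappa>>0. AE x in lebesgue_on M. \<forall>\<xi>. \<kappa> * (norm \<xi>)\<^sup>2 \<le> \<xi> \<bullet> (matrix_inv (metric x) *v \<xi>)"
    by blast
qed

lemma DN_map_conformal:
  assumes V: "flux_field V" and w: "multiplier w" "\<And>x. 0 < w x" "\<And>y. w (1, y) = 1"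
    and V_eq: "\<And>x. x \<in> M \<Longrightarrow> V x = A x *v gradient w x"
    and c: "\<And>x. x \<in> M \<Longrightarrow> c x = w x powr (1 / real (CARD('m option) - 2))"
  shows "DN_map (conformal c metric) Gamma1 = DN_map metric Gamma1"
proof -
  have n: "2 \<le> CARD('m option)" "0 < CARD('m option) - 2" using dim by simp_all
  have "gauge V w A metric (conformal c metric)"
  proof (rule gauge.intro[OF V gauge_axioms.intro[OF w]])
    fix x :: "'m pt" and a b :: "'m covec" assume x: "x \<in> M"
    show "V x = A x *v gradient w x" by (rule V_eq[OF x])
    show "a \<bullet> (A x *v b) = b \<bullet> (A x *v a)" by (rule A_self_adjoint)
    \<comment> \<open>The metric itself is the case of the conformal factor 1.\<close>
    show "a \<bullet> (matrix_inv (metric x) *v b) * sqrt (det (metric x)) = a \<bullet> (A x *v b)"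
      using conformal_density[OF n(1) zero_less_one metric_scale_pos det_A, of a x b]
      by (simp add: metric_def)
    have cp: "0 < c x" using w(2)[of x] by (simp add: c[OF x])
    have "c x ^ (CARD('m option) - 2) = w x"
      using n(2) w(2)[of x] by (simp add: c[OF x] powr_realpow[symmetric] powr_powr less_imp_neq[symmetric])
    thus "a \<bullet> (matrix_inv (conformal c metric x) *v b) * sqrt (det (conformal c metric x)) =
        (w x)\<^sup>2 * (a \<bullet> (A x *v b))"
      using conformal_density[OF n(1) cp metric_scale_pos det_A, of a x b]
      by (simp only: conformal_def metric_def)
  qed
  thus ?thesis by (rule gauge.DN_map_eq)
qed

end

section \<open>A family of conformal factors for one metric\<close>

lemma flux_field_scale:
  assumes "flux_field V" shows "flux_field (\<lambda>x. e *\<^sub>R V x)"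
proof -
  interpret flux_field V by fact
  show ?thesis
  proof
    show "smooth_on UNIV (\<lambda>x. (e *\<^sub>R V x) $ i)" for i
      using smooth_on_mult[OF smooth_on_const V_smooth] by simp
    show "periodic (\<lambda>x. e *\<^sub>R V x)" using V_periodic by (simp add: periodic_def)
    show "e *\<^sub>R V (1, y) = 0" for y by (simp add: V_end)
    fix x
    have "frechet_derivative (\<lambda>x. (e *\<^sub>R V x) $ i) (at x) (coord i) =
        e * frechet_derivative (\<lambda>x. V x $ i) (at x) (coord i)" for i
      by (simp add: fd_mult[OF differentiable_const smooth_on_UNIV_D(1)[OF V_smooth]])
    thus "(\<Sum>i\<in>UNIV. frechet_derivative (\<lambda>x. (e *\<^sub>R V x) $ i) (at x) (coord i)) = 0"
      by (simp add: V_div flip: sum_distrib_left)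
  qed
qed

text \<open>The constant 1 has no gradient, so the flux of 1 + e u is e times that of u: one
  conductivity serves all conformal factors.\<close>

lemma multiplier_perturbation:
  assumes u: "multiplier u"
  shows "multiplier (\<lambda>x. 1 + e * u x)" "gradient (\<lambda>x. 1 + e * u x) x = e *\<^sub>R gradient u x"
proof -
  have "smooth_on UNIV (\<lambda>x. 1 + e * u x)"
    by (intro smooth_on_add smooth_on_mult smooth_on_const multiplier_smooth[OF u])
  thus "multiplier (\<lambda>x. 1 + e * u x)" using u by (simp add: multiplier_def)
  have d: "u differentiable (at x)" "(\<lambda>x. e * u x) differentiable (at x)"
    by (intro smooth_on_UNIV_D(1) smooth_on_mult smooth_on_const multiplier_smooth[OF u])+
  show "gradient (\<lambda>x. 1 + e * u x) x = e *\<^sub>R gradient u x"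
    unfolding gradient_def using fd_add[OF differentiable_const d(2)] fd_mult[OF differentiable_const d(1)]
    by (simp add: vec_eq_iff)
qed

theorem theorem1p1:
  assumes "3 \<le> CARD('m::finite option)"
  shows "\<forall>\<rho>::real. 0 < \<rho> \<and> \<rho> < 1 \<longrightarrow>
    (\<exists>g :: 'm metric.
       riemannian_metric g \<and>
       (\<forall>i j. smooth_on ({0..<1} \<times> UNIV) (\<lambda>x. g x $ i $ j)) \<and>
       (\<forall>i j. holder_on_M \<rho> (\<lambda>x. g x $ i $ j)) \<and>
       infinite {c \<in> extensional M. periodic c \<and> smooth_on M c \<and> (\<forall>x\<in>M. 0 < c x) \<and>
         \<not> (\<forall>x\<in>M. c x = 1) \<and>
         DN_map (conformal c g) Gamma1 = DN_map g Gamma1})"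
proof (intro allI impI)
  fix \<rho> :: real assume r: "0 < \<rho> \<and> \<rho> < 1"
  have "2 \<le> CARD('m)" using assms by simp
  then obtain p q :: 'm where pq: "p \<noteq> q" by (metis card_2_iff' ex_card subset_UNIV)
  obtain A :: "'m metric" and V u where V: "flux_field V" and u: "multiplier u" "\<exists>B\<ge>0. \<forall>x. \<bar>u x\<bar> \<le> B"
    "\<And>y. u (1, y) = 0" "u (0, 0) \<noteq> 0" "\<And>x. x \<in> M \<Longrightarrow> V x = A x *v gradient u x"
    and A: "\<And>t y k. k \<in> lattice_pts \<Longrightarrow> A (t, y + k) = A (t, y)" "\<And>x i j. A x $ i $ j = A x $ j $ i"
    "\<And>x \<xi>. (1/2) * (norm \<xi>)\<^sup>2 \<le> \<xi> \<bullet> (A x *v \<xi>)" "\<And>x i j. \<bar>A x $ i $ j\<bar> \<le> 2"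
    "\<And>i j. smooth_on ({0..<1} \<times> UNIV) (\<lambda>x. A x $ i $ j)" "\<And>i j. holder_on_M \<rho> (\<lambda>x. A x $ i $ j)"
    by (rule ex_miller_metric[OF conjunct1[OF r] conjunct2[OF r] pq]) blast
  have "holder_coeff \<rho> (\<lambda>x. A x $ i $ j)" for i j
    unfolding holder_coeff_def using A(4-6) by blast
  then interpret conductivity A \<rho>
    using assms r A(1-3) by unfold_locales simp_all
  obtain B where B: "0 \<le> B" "\<And>x. \<bar>u x\<bar> \<le> B" using u(2) by blast
  let ?k = "1 / real (CARD('m option) - 2)"
  have k: "?k \<noteq> 0" using assms by simp
  define w where "w = (\<lambda>e x. 1 + e * u x)"
  \<comment> \<open>Restriction to \<open>M\<close> identifies functions that agree on
    \<open>M\<close>, so values outside \<open>M\<close> cannot inflate the set.\<close>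
  define c where "c = (\<lambda>e. restrict (\<lambda>x. w e x powr ?k) M)"
  \<comment> \<open>For these e the product e u stays below 1 in absolute value, so 1 + e u is
    positive; B + 1 keeps the interval well defined for B = 0.\<close>
  define I where "I = {0<..<1 / (B + 1)}"
  have w_pos: "0 < w e x" if "e \<in> I" for e x
  proof -
    have e: "0 < e" "e * (B + 1) < 1" using that B(1) by (auto simp: I_def field_simps)
    have "\<bar>e * u x\<bar> \<le> e * (B + 1)" unfolding abs_mult using e(1) B(2)[of x] by (intro mult_mono) auto
    thus ?thesis using e(2) unfolding w_def by linarith
  qed
  have cM: "c e x = w e x powr ?k" if "x \<in> M" for e x using that by (simp add: c_def)
  have M0: "(0, 0) \<in> (M :: 'm pt set)" by (simp add: M_def)
  have "inj_on c I"
  proof (rule inj_onI)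
    fix d e assume h: "d \<in> I" "e \<in> I" "c d = c e"
    \<comment> \<open>Different parameters are told apart at the origin, where u does not
      vanish.\<close>
    have "w d (0, 0) powr ?k = w e (0, 0) powr ?k" using fun_cong[OF h(3), of "(0, 0)"] by (simp only: cM[OF M0])
    hence "(w d (0, 0) powr ?k) powr (1 / ?k) = (w e (0, 0) powr ?k) powr (1 / ?k)" by (rule arg_cong)
    hence "w d (0, 0) = w e (0, 0)"
      unfolding powr_powr using k w_pos[OF h(1), of "(0, 0)"] w_pos[OF h(2), of "(0, 0)"] by simp
    thus "d = e" using u(4) by (simp add: w_def)
  qed
  moreover have "infinite I" unfolding I_def using B(1) by (intro infinite_Ioo) simp
  ultimately have inf: "infinite (c ` I)" by (simp add: finite_image_iff)
  have sub: "c ` I \<subseteq> {c \<in> extensional M. periodic c \<and> smooth_on M c \<and> (\<forall>x\<in>M. 0 < c x) \<and>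
      \<not> (\<forall>x\<in>M. c x = 1) \<and> DN_map (conformal c metric) Gamma1 = DN_map metric Gamma1}"
  proof (rule image_subsetI, rule CollectI, intro conjI ballI)
    fix e assume e: "e \<in> I"
    have w: "multiplier (w e)" unfolding w_def by (rule multiplier_perturbation(1)[OF u(1)])
    show "c e \<in> extensional M" by (simp add: c_def)
    show "periodic (c e)" using w by (simp add: c_def periodic_def multiplier_def M_def)
    show "smooth_on M (c e)"
      by (rule smooth_on_cong_subset[OF smooth_on_powr[OF multiplier_smooth[OF w] w_pos[OF e]] subset_UNIV cM[symmetric]])
    show "0 < c e x" if "x \<in> M" for x using w_pos[OF e, of x] by (simp add: cM[OF that])
    have "w e (0, 0) \<noteq> 1" using e u(4) by (simp add: w_def I_def)
    hence "c e (0, 0) \<noteq> 1" using w_pos[OF e, of "(0, 0)"] k by (simp add: cM[OF M0])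
    thus "\<not> (\<forall>x\<in>M. c e x = 1)" using M0 by blast
    show "DN_map (conformal (c e) metric) Gamma1 = DN_map metric Gamma1"
    proof (rule DN_map_conformal[OF flux_field_scale[OF V, of e] w w_pos[OF e] _ _ cM])
      show "w e (1, y) = 1" for y by (simp add: w_def u(3))
      show "e *\<^sub>R V x = A x *v gradient (w e) x" if "x \<in> M" for x
        unfolding w_def multiplier_perturbation(2)[OF u(1)] by (simp add: u(5)[OF that] matrix_vector_mult_scaleR)
    qed
  qed
  have s: "smooth_on ({0..<1} \<times> UNIV) (\<lambda>x. metric x $ i $ j)" "holder_on_M \<rho> (\<lambda>x. metric x $ i $ j)" for i j
    using metric_holder[of i j] by (simp_all add: holder_coeff_def)
  show "\<exists>g :: 'm metric. riemannian_metric g \<and>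
       (\<forall>i j. smooth_on ({0..<1} \<times> UNIV) (\<lambda>x. g x $ i $ j)) \<and>
       (\<forall>i j. holder_on_M \<rho> (\<lambda>x. g x $ i $ j)) \<and>
       infinite {c \<in> extensional M. periodic c \<and> smooth_on M c \<and> (\<forall>x\<in>M. 0 < c x) \<and>
         \<not> (\<forall>x\<in>M. c x = 1) \<and>
         DN_map (conformal c g) Gamma1 = DN_map g Gamma1}"
    by (rule exI[of _ metric], intro conjI allI riemannian_metric s infinite_super[OF sub inf])
qed

end
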